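(* Let $\Gamma\subset\mathbb{R}^2$ be a smooth closed curve of length $L$, and let $k$, $c_1$, $c_2$, $\kappa$, $\mathcal S,\mathcal D,\mathcal S',\mathcal D',\mathcal S''$ and the periodic surface Green's operator $\mathcal G$ be as in the context. Then the operator $$-\frac{c_1}{2}I+c_1\mathcal D-\frac1{c_1}\mathcal G\mathcal D+\mathcal G(\mathcal D'+\mathcal S'')+\Big(k^2-\frac{c_2}{c_1}\Big)\mathcal G\mathcal S+\mathcal G\Big(\kappa-\frac1{c_1}\Big)\mathcal S'$$ is Fredholm second-kind on $H^2(\Gamma)$, i.e. it is a nonzero scalar multiple of the identity plus a compact operator on $H^2(\Gamma)$.
   Context: $\Gamma$ is the (positively oriented) boundary of a region, with outward unit normal $n$ and curvature $\kappa=\nabla_\Gamma\cdot n$. $k>0$ is the wave number; $c_1,c_2\in\mathbb{C}$ with $c_1\ne0$; $k_\Gamma=\sqrt{(1+c_1c_2)/c_1^2}$ with the branch chosen so that $\Im k_\Gamma>0$ (it is assumed that $c_1,c_2$ are such that this strict inequality holds). With $G(x,y)=\frac i4H_0^{(1)}(k|x-y|)$, define for $x\in\Gamma$ $$\mathcal S[\sigma](x)=\int_\Gamma G(x,y)\sigma(y)\,ds(y),\quad \mathcal D[\sigma](x)=\int_\Gamma\partial_{n_y}G(x,y)\sigma(y)\,ds(y),$$ $$\mathcal S'[\sigma](x)=\int_\Gamma\partial_{n_x}G(x,y)\sigma(y)\,ds(y),\quad \mathcal D'[\sigma](x)=\int_\Gamma\partial_{n_x}\partial_{n_y}G(x,y)\sigma(y)\,ds(y),$$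 $$\mathcal S''[\sigma](x)=\int_\Gamma\partial_{n_x}^2G(x,y)\sigma(y)\,ds(y),$$ where $\partial_{n_x}^2$ is the second derivative in the fixed direction $n_x$ and the integrals for $\mathcal D'$ and $\mathcal S''$ are Hadamard finite part integrals. In $\mathcal G(\kappa-\frac{1}{c_1})\mathcal S'$, the factor $\kappa-\frac1{c_1}$ acts by multiplication. With $s,s'\in[0,L]$ arc length parameters on $\Gamma$, $\mathcal G$ is the periodic Green's operator of $\frac{d^2}{ds^2}+k_\Gamma^2$: $$\mathcal G[\sigma](s)=\int_0^L G_\Gamma(s,s')\sigma(s')\,ds',\qquad G_\Gamma(s,s')=\frac{1}{2ik_\Gamma}\sum_{\ell\in\mathbb Z}e^{ik_\Gamma|s-s'-\ell L|}.$$ *)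

theory Defs
  imports "HOL-Complex_Analysis.Complex_Analysis"
begin

text \<open>The plane \<open>\<real>\<^sup>2\<close> is identified with the type \<open>complex\<close>. A closed curve \<open>\<Gamma>\<close> of length \<open>L\<close> is given by an
  \<open>L\<close>-periodic arc length parametrization \<open>\<gamma> :: real \<Rightarrow> complex\<close>, and functions on \<open>\<Gamma>\<close> are given as
  \<open>L\<close>-periodic functions of the arc length parameter.\<close>


section \<open>Curves\<close>

definition vderiv :: "(real \<Rightarrow> complex) \<Rightarrow> real \<Rightarrow> complex" where
  "vderiv f t = vector_derivative f (at t)"

definition smooth :: "(real \<Rightarrow> complex) \<Rightarrow> bool" where
  "smooth f \<longleftrightarrow> (\<forall>n t. (vderiv ^^ n) f differentiable (at t))"

definition periodic :: "real \<Rightarrow> (real \<Rightarrow> complex) \<Rightarrow> bool" where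
  "periodic L f \<longleftrightarrow> (\<forall>t. f (t + L) = f t)"

text \<open>The region bounded by \<open>\<Gamma>\<close> is \<open>inside (\<gamma> ` {0..L})\<close>; positive orientation means winding number \<open>1\<close>
  about each of its points.\<close>

definition smooth_closed_curve :: "(real \<Rightarrow> complex) \<Rightarrow> real \<Rightarrow> bool" where
  "smooth_closed_curve \<gamma> L \<longleftrightarrow>
     0 < L \<and> smooth \<gamma> \<and> periodic L \<gamma> \<and> inj_on \<gamma> {0..<L} \<and> (\<forall>s. cmod (vderiv \<gamma> s) = 1) \<and>
     (\<forall>z \<in> inside (\<gamma> ` {0..L}). winding_number (\<lambda>t. \<gamma> (L * t)) z = 1)"

text \<open>For a positively oriented curve, the outward normal is the unit tangent turned clockwise by
  a right angle.\<close>

definition normal :: "(real \<Rightarrow> complex) \<Rightarrow> real \<Rightarrow> complex" where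
  "normal \<gamma> s = - \<i> * vderiv \<gamma> s"

text \<open>\<open>\<kappa> = \<nabla>\<^sub>\<Gamma> \<cdot> n\<close>: the surface divergence on a curve is the tangential component of the
  arc length derivative. It is positive on circles.\<close>

definition curvature :: "(real \<Rightarrow> complex) \<Rightarrow> real \<Rightarrow> real" where
  "curvature \<gamma> s = vderiv \<gamma> s \<bullet> vderiv (normal \<gamma>) s"


section \<open>The Helmholtz Green's function\<close>

text \<open>Power series of the Bessel functions of order zero, for \<open>x > 0\<close> (DLMF 10.2.2 and 10.8.2);
  note \<open>harm 0 = 0\<close>.\<close>

definition bessel_J0 :: "real \<Rightarrow> real" where
  "bessel_J0 x = (\<Sum>m. (- 1) ^ m / (fact m)\<^sup>2 * (x / 2) ^ (2 * m))"

definition bessel_Y0 :: "real \<Rightarrow> real" where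
  "bessel_Y0 x = 2 / pi * ((ln (x / 2) + euler_mascheroni) * bessel_J0 x
       + (\<Sum>m. (- 1) ^ (m + 1) * harm m / (fact m)\<^sup>2 * (x / 2) ^ (2 * m)))"

definition hankel_H0 :: "real \<Rightarrow> complex" where
  "hankel_H0 x = complex_of_real (bessel_J0 x) + \<i> * complex_of_real (bessel_Y0 x)"

definition green :: "real \<Rightarrow> complex \<Rightarrow> complex \<Rightarrow> complex" where
  "green k x y = \<i> / 4 * hankel_H0 (k * cmod (x - y))"

definition dir_deriv :: "complex \<Rightarrow> (complex \<Rightarrow> complex) \<Rightarrow> complex \<Rightarrow> complex" where
  "dir_deriv v F x = vector_derivative (\<lambda>t::real. F (x + t *\<^sub>R v)) (at 0)"


section \<open>Hadamard finite part\<close>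

text \<open>\<open>C\<close> is the finite part of \<open>I \<epsilon>\<close> as \<open>\<epsilon>\<close> decreases to \<open>0\<close> if it is the constant term of an expansion
  \<open>I \<epsilon> = a / \<epsilon> + b ln \<epsilon> + C + o(1)\<close>; the divergent terms are discarded. Such a \<open>C\<close> is unique.\<close>

definition has_finite_part :: "(real \<Rightarrow> complex) \<Rightarrow> complex \<Rightarrow> bool" where
  "has_finite_part I C \<longleftrightarrow> (\<exists>a b :: complex.
     ((\<lambda>\<epsilon>. I \<epsilon> - a / of_real \<epsilon> - b * of_real (ln \<epsilon>)) \<longlongrightarrow> C) (at_right 0))"

definition finite_part_integral ::
  "(real \<Rightarrow> complex) \<Rightarrow> real \<Rightarrow> real \<Rightarrow> (real \<Rightarrow> complex) \<Rightarrow> complex" where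
  "finite_part_integral \<gamma> L s h = (THE C. has_finite_part
     (\<lambda>\<epsilon>. LINT t | lebesgue_on {t \<in> {0..L}. \<epsilon> < dist (\<gamma> s) (\<gamma> t)}. h t) C)"


section \<open>Layer potential operators\<close>

definition layer_S ::
  "(real \<Rightarrow> complex) \<Rightarrow> real \<Rightarrow> real \<Rightarrow> (real \<Rightarrow> complex) \<Rightarrow> real \<Rightarrow> complex" where
  "layer_S \<gamma> L k \<sigma> s = (LINT t | lebesgue_on {0..L}. green k (\<gamma> s) (\<gamma> t) * \<sigma> t)"

definition layer_D ::
  "(real \<Rightarrow> complex) \<Rightarrow> real \<Rightarrow> real \<Rightarrow> (real \<Rightarrow> complex) \<Rightarrow> real \<Rightarrow> complex" where
  "layer_D \<gamma> L k \<sigma> s = (LINT t | lebesgue_on {0..L}.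
     dir_deriv (normal \<gamma> t) (\<lambda>y. green k (\<gamma> s) y) (\<gamma> t) * \<sigma> t)"

definition layer_S' ::
  "(real \<Rightarrow> complex) \<Rightarrow> real \<Rightarrow> real \<Rightarrow> (real \<Rightarrow> complex) \<Rightarrow> real \<Rightarrow> complex" where
  "layer_S' \<gamma> L k \<sigma> s = (LINT t | lebesgue_on {0..L}.
     dir_deriv (normal \<gamma> s) (\<lambda>x. green k x (\<gamma> t)) (\<gamma> s) * \<sigma> t)"

definition layer_D' ::
  "(real \<Rightarrow> complex) \<Rightarrow> real \<Rightarrow> real \<Rightarrow> (real \<Rightarrow> complex) \<Rightarrow> real \<Rightarrow> complex" where
  "layer_D' \<gamma> L k \<sigma> s = finite_part_integral \<gamma> L s (\<lambda>t.
     dir_deriv (normal \<gamma> s) (\<lambda>x. dir_deriv (normal \<gamma> t) (\<lambda>y. green k x y) (\<gamma> t)) (\<gamma> s) * \<sigma> t)"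

definition layer_S'' ::
  "(real \<Rightarrow> complex) \<Rightarrow> real \<Rightarrow> real \<Rightarrow> (real \<Rightarrow> complex) \<Rightarrow> real \<Rightarrow> complex" where
  "layer_S'' \<gamma> L k \<sigma> s = finite_part_integral \<gamma> L s (\<lambda>t.
     dir_deriv (normal \<gamma> s) (dir_deriv (normal \<gamma> s) (\<lambda>x. green k x (\<gamma> t))) (\<gamma> s) * \<sigma> t)"


section \<open>The periodic surface Green's operator\<close>

definition surface_green :: "real \<Rightarrow> complex \<Rightarrow> real \<Rightarrow> real \<Rightarrow> complex" where
  "surface_green L k\<Gamma> s t =
     1 / (2 * \<i> * k\<Gamma>) * (\<Sum>\<^sub>\<infinity>l::int. exp (\<i> * k\<Gamma> * complex_of_real \<bar>s - t - of_int l * L\<bar>))"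

definition surface_green_op ::
  "real \<Rightarrow> complex \<Rightarrow> (real \<Rightarrow> complex) \<Rightarrow> real \<Rightarrow> complex" where
  "surface_green_op L k\<Gamma> \<sigma> s = (LINT t | lebesgue_on {0..L}. surface_green L k\<Gamma> s t * \<sigma> t)"


section \<open>The Sobolev space \<open>H\<^sup>2(\<Gamma>)\<close>\<close>

definition square_integrable :: "real \<Rightarrow> (real \<Rightarrow> complex) \<Rightarrow> bool" where
  "square_integrable L f \<longleftrightarrow> f \<in> borel_measurable (lebesgue_on {0..L}) \<and>
     integrable (lebesgue_on {0..L}) (\<lambda>t. (cmod (f t))\<^sup>2)"

definition has_weak_deriv ::
  "real \<Rightarrow> nat \<Rightarrow> (real \<Rightarrow> complex) \<Rightarrow> (real \<Rightarrow> complex) \<Rightarrow> bool" where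
  "has_weak_deriv L m f g \<longleftrightarrow> square_integrable L g \<and>
     (\<forall>\<phi>. smooth \<phi> \<and> periodic L \<phi> \<longrightarrow>
        (LINT t | lebesgue_on {0..L}. f t * (vderiv ^^ m) \<phi> t) =
        (- 1) ^ m * (LINT t | lebesgue_on {0..L}. g t * \<phi> t))"

text \<open>Every class in \<open>H\<^sup>2(\<Gamma>)\<close> modulo null functions has exactly one continuous representative, and it is
  this function that is taken as the element of the space. The weak derivatives are determined
  only almost everywhere, which does not affect the norm.\<close>

definition H2 :: "real \<Rightarrow> (real \<Rightarrow> complex) set" where
  "H2 L = {f. periodic L f \<and> continuous_on UNIV f \<and> (\<forall>m\<le>2. \<exists>g. has_weak_deriv L m f g)}"

definition H2_norm :: "real \<Rightarrow> (real \<Rightarrow> complex) \<Rightarrow> real" where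
  "H2_norm L f = sqrt (\<Sum>m\<le>2. LINT t | lebesgue_on {0..L}.
     (cmod ((SOME g. has_weak_deriv L m f g) t))\<^sup>2)"


section \<open>Compact and second-kind operators on a normed function space \<open>(V, N)\<close>\<close>

definition linear_operator_on ::
  "('a \<Rightarrow> complex) set \<Rightarrow> (('a \<Rightarrow> complex) \<Rightarrow> 'a \<Rightarrow> complex) \<Rightarrow> bool" where
  "linear_operator_on V K \<longleftrightarrow> (\<forall>f\<in>V. K f \<in> V) \<and>
     (\<forall>f\<in>V. \<forall>g\<in>V. \<forall>a b. K (\<lambda>x. a * f x + b * g x) = (\<lambda>x. a * K f x + b * K g x))"

definition compact_operator_on ::
  "('a \<Rightarrow> complex) set \<Rightarrow> (('a \<Rightarrow> complex) \<Rightarrow> real) \<Rightarrow>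
   (('a \<Rightarrow> complex) \<Rightarrow> 'a \<Rightarrow> complex) \<Rightarrow> bool" where
  "compact_operator_on V N K \<longleftrightarrow> linear_operator_on V K \<and>
     (\<forall>f :: nat \<Rightarrow> 'a \<Rightarrow> complex. range f \<subseteq> V \<and> bounded (range (\<lambda>n. N (f n))) \<longrightarrow>
        (\<exists>g\<in>V. \<exists>r :: nat \<Rightarrow> nat. strict_mono r \<and>
           (\<lambda>n. N (\<lambda>x. K (f (r n)) x - g x)) \<longlonglongrightarrow> 0))"

definition fredholm_second_kind_on ::
  "('a \<Rightarrow> complex) set \<Rightarrow> (('a \<Rightarrow> complex) \<Rightarrow> real) \<Rightarrow>
   (('a \<Rightarrow> complex) \<Rightarrow> 'a \<Rightarrow> complex) \<Rightarrow> bool" where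
  "fredholm_second_kind_on V N A \<longleftrightarrow>
     (\<exists>\<mu> K. \<mu> \<noteq> 0 \<and> compact_operator_on V N K \<and> (\<forall>f\<in>V. A f = (\<lambda>x. \<mu> * f x + K f x)))"

end

theory Submission
  imports Defs "HOL-Real_Asymp.Real_Asymp"
begin

text \<open>The operator is \<open>- c\<^sub>1 / 2\<close> times the identity plus an operator \<open>K\<close> that is bounded from the continuous
  functions with the supremum norm to \<open>H\<^sup>2\<close>. Sequences bounded in \<open>H\<^sup>2\<close> have uniformly convergent
  subsequences by the Arzela-Ascoli theorem, so \<open>K\<close> is compact on \<open>H\<^sup>2\<close>.

  The surface Green's operator maps bounded functions to \<open>H\<^sup>2\<close>, so every term with \<open>\<G>\<close> only needs an
  operator that preserves boundedness: \<open>\<S>\<close> has a logarithmic kernel, \<open>\<D>\<close> and \<open>\<S>'\<close> have bounded kernels, and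
  in \<open>\<D>' + \<S>''\<close> the hypersingular parts of the two kernels cancel. The term \<open>c\<^sub>1 \<D>\<close> is smoothing of order
  two by itself: its kernel is the smooth Laplace double layer kernel plus a part whose second derivative
  has only a logarithmic singularity.\<close>

section \<open>Smooth periodic functions\<close>

text \<open>Compactness needs no sharp estimates, so singularities are measured crudely by powers of
  the chord length: a logarithm counts as the exponent \<open>-1/2\<close>, which is integrable
  along the curve, and kernel estimates become addition of exponents. Values on the diagonal are
  immaterial, since for fixed \<open>s\<close> it is a countable set of \<open>t\<close>. Two points
  resist this counting. The Laplace part of the double layer kernel is a quotient of two vanishing
  quantities, and orders alone do not control its derivatives; it is rewritten as the imaginary part
  of a smooth quotient. And \<open>layer_D'\<close> and \<open>layer_S''\<close> are separate finite
  parts, each chosen by \<open>THE\<close>, so the cancellation in their sum may be used only once a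
  finite part of one of them is known to exist. That existence draws on the regularity of a density
  in \<open>H2\<close>, whereas all other bounds use bounded densities only, and it has to cope with
  a cutoff by chord length instead of arc length. Derivatives are weak and test functions smooth and
  periodic, so differentiating a potential means integrating its kernel by parts in the first
  variable over one period.\<close>

lemma smooth_coinduct:
  assumes "f \<in> S" and S: "\<And>h. h \<in> S \<Longrightarrow> \<exists>h'\<in>S. \<forall>t. (h has_vector_derivative h' t) (at t)"
  shows "smooth f"
proof -
  \<comment> \<open>Derivatives are unique, so \<open>vderiv\<close> of a member equals the witness
    in \<open>S\<close>; the iterates never leave \<open>S\<close>.\<close>
  have "(vderiv ^^ n) f \<in> S" for n
  proof (induction n)
    case (Suc n)
    then obtain h' where h': "h' \<in> S" "\<And>t. ((vderiv ^^ n) f has_vector_derivative h' t) (at t)"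
      using S by blast
    then have "vderiv ((vderiv ^^ n) f) = h'"
      by (intro ext) (simp add: vderiv_def vector_derivative_at)
    with h' show ?case by simp
  qed (use assms in auto)
  then show ?thesis
    unfolding smooth_def using S by (meson differentiableI_vector)
qed

lemma smooth_vderiv: "smooth f \<Longrightarrow> smooth (vderiv f)"
  unfolding smooth_def by (metis funpow_Suc_right comp_apply)

lemma smooth_has_vderiv: "smooth f \<Longrightarrow> (f has_vector_derivative vderiv f t) (at t)"
  unfolding smooth_def vderiv_def by (metis funpow_0 vector_derivative_works)

lemma smooth_continuous_on: "smooth f \<Longrightarrow> continuous_on A f"
  by (meson smooth_has_vderiv continuous_at_imp_continuous_on has_vector_derivative_continuous)

lemma vderiv_eqI: "(\<And>t. (f has_vector_derivative f' t) (at t)) \<Longrightarrow> vderiv f = f'"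
  by (intro ext) (simp add: vderiv_def vector_derivative_at)

lemma smooth_antiderivative:
  assumes "smooth g" "\<And>t. (f has_vector_derivative g t) (at t)"
  shows "smooth f"
proof (rule smooth_coinduct[of _ "insert f {g. smooth g}"])
  fix h assume "h \<in> insert f {g. smooth g}"
  then consider "h = f" | "smooth h" by blast
  then show "\<exists>h'\<in>insert f {g. smooth g}. \<forall>t. (h has_vector_derivative h' t) (at t)"
  proof cases
    case 1
    then show ?thesis using assms by (intro bexI[of _ g]) auto
  next
    case 2
    then show ?thesis using smooth_vderiv[OF 2] smooth_has_vderiv[OF 2]
      by (intro bexI[of _ "vderiv h"]) auto
  qed
qed simp

lemma smooth_const: "smooth (\<lambda>t. c)"
  by (rule smooth_coinduct[of _ "range (\<lambda>c t. c)"]) (auto intro!: has_vector_derivative_const)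

lemma smooth_add:
  assumes "smooth f" "smooth g" shows "smooth (\<lambda>t. f t + g t)"
proof (rule smooth_coinduct[of _ "{\<lambda>t. f t + g t | f g. smooth f \<and> smooth g}"])
  fix h assume "h \<in> {\<lambda>t. f t + g t | f g. smooth f \<and> smooth g}"
  then obtain f g where h: "h = (\<lambda>t. f t + g t)" "smooth f" "smooth g" by blast
  then show "\<exists>h'\<in>{\<lambda>t. f t + g t | f g. smooth f \<and> smooth g}. \<forall>t. (h has_vector_derivative h' t) (at t)"
    by (intro bexI[of _ "\<lambda>t. vderiv f t + vderiv g t"])
       (auto intro!: has_vector_derivative_add smooth_has_vderiv intro: smooth_vderiv)
qed (use assms in auto)

text \<open>Products alone are not closed under differentiation because of the Leibniz rule. Closing
  them under sums yields a set to which \<open>smooth_coinduct\<close> applies.\<close>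

inductive_set product_sums :: "(real \<Rightarrow> complex) set" where
  prod: "smooth f \<Longrightarrow> smooth g \<Longrightarrow> (\<lambda>t. f t * g t) \<in> product_sums"
| add: "a \<in> product_sums \<Longrightarrow> b \<in> product_sums \<Longrightarrow> (\<lambda>t. a t + b t) \<in> product_sums"

lemma smooth_mult:
  assumes "smooth f" "smooth g" shows "smooth (\<lambda>t. f t * g t)"
proof (rule smooth_coinduct[of _ product_sums])
  fix h assume "h \<in> product_sums"
  then show "\<exists>h'\<in>product_sums. \<forall>t. (h has_vector_derivative h' t) (at t)"
  proof induction
    case (prod f g)
    then have "((\<lambda>t. f t * g t) has_vector_derivative f t * vderiv g t + vderiv f t * g t) (at t)" for t
      by (intro has_vector_derivative_mult smooth_has_vderiv)
    moreover have "(\<lambda>t. f t * vderiv g t + vderiv f t * g t) \<in> product_sums"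
      using prod by (intro product_sums.intros) (auto intro: smooth_vderiv)
    ultimately show ?case by (intro bexI[of _ "\<lambda>t. f t * vderiv g t + vderiv f t * g t"] allI)
  next
    case (add a b)
    then obtain a' b' where "a' \<in> product_sums" "b' \<in> product_sums"
      "\<And>t. (a has_vector_derivative a' t) (at t)" "\<And>t. (b has_vector_derivative b' t) (at t)"
      by blast
    then show ?case
      by (intro bexI[of _ "\<lambda>t. a' t + b' t"])
         (auto intro!: has_vector_derivative_add intro: product_sums.intros)
  qed
qed (use assms in \<open>auto intro: product_sums.intros\<close>)

lemma has_vector_derivative_exp_real:
  "((\<lambda>t. exp (a * complex_of_real t + b)) has_vector_derivative a * exp (a * complex_of_real t + b)) (at t)"
  by (rule has_vector_derivative_eq_rhs[OF has_vector_derivative_real_field])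
     (auto intro!: derivative_eq_intros)

lemma smooth_exp: "smooth (\<lambda>t. exp (a * complex_of_real t))"
proof (rule smooth_coinduct[of _ "range (\<lambda>c t. c * exp (a * complex_of_real t))"])
  show "(\<lambda>t. exp (a * complex_of_real t)) \<in> range (\<lambda>c t. c * exp (a * complex_of_real t))"
    by (rule range_eqI[of _ _ 1]) simp
  fix h assume "h \<in> range (\<lambda>c t. c * exp (a * complex_of_real t))"
  then obtain c where h: "h = (\<lambda>t. c * exp (a * complex_of_real t))" by blast
  have "(h has_vector_derivative (c * a) * exp (a * complex_of_real t)) (at t)" for t
    unfolding h using has_vector_derivative_mult_right[OF has_vector_derivative_exp_real[of a 0]]
    by (simp add: mult.assoc)
  then show "\<exists>h'\<in>range (\<lambda>c t. c * exp (a * complex_of_real t)). \<forall>t. (h has_vector_derivative h' t) (at t)"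
    by (intro bexI[of _ "\<lambda>t. (c * a) * exp (a * complex_of_real t)"] allI) auto
qed

lemma periodic_vderiv:
  assumes "smooth f" "periodic L f" shows "periodic L (vderiv f)"
  unfolding periodic_def
proof
  fix t
  have "(f \<circ> (\<lambda>t. t + L) has_vector_derivative 1 *\<^sub>R vderiv f (t + L)) (at t)"
    by (rule vector_diff_chain_at)
       (auto intro!: derivative_eq_intros smooth_has_vderiv assms)
  moreover have "f \<circ> (\<lambda>t. t + L) = f" using assms(2) by (auto simp: periodic_def)
  ultimately show "vderiv f (t + L) = vderiv f t"
    unfolding vderiv_def by (metis scaleR_one vector_derivative_at)
qed

lemma shift_of_int:
  assumes per: "\<And>t::real. f (t + L) = f t" shows "f (t + of_int n * L) = f t"
proof (induction n rule: int_induct[where k = 0])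
  case (step1 i)
  have "f (t + of_int (i + 1) * L) = f ((t + of_int i * L) + L)" by (simp add: algebra_simps)
  with step1 per show ?case by metis
next
  case (step2 i)
  have "f (t + of_int (i - 1) * L) = f (t + of_int (i - 1) * L + L)" using per by simp
  also have "t + of_int (i - 1) * L + L = t + of_int i * L" by (simp add: algebra_simps)
  finally show ?case using step2 by simp
qed simp

section \<open>The fundamental lemma of the calculus of variations on a circle\<close>

text \<open>A real polynomial restricted to the unit circle is a trigonometric polynomial in the
  angle. The base case is a real-linear functional, determined by its values at \<open>1\<close> and
  \<open>\<i>\<close>; cosine and sine are then written through exponentials.\<close>

lemma real_polynomial_smooth:
  assumes "real_polynomial_function p"
  shows "smooth (\<lambda>t. complex_of_real (p (exp (\<i> * of_real (w * t)))))"
  using assms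
proof induction
  case (linear h)
  have eq: "complex_of_real (h (exp (\<i> * of_real (w * t)))) =
    (of_real (h 1) / 2 + of_real (h \<i>) / (2 * \<i>)) * exp ((\<i> * of_real w) * of_real t)
     + (of_real (h 1) / 2 - of_real (h \<i>) / (2 * \<i>)) * exp ((- (\<i> * of_real w)) * of_real t)" for t
  proof -
    interpret h: bounded_linear h by fact
    let ?e = "exp (\<i> * of_real (w * t))"
    have "?e = Re ?e *\<^sub>R 1 + Im ?e *\<^sub>R \<i>" by (simp add: complex_eq_iff)
    then have "h ?e = h (Re ?e *\<^sub>R 1 + Im ?e *\<^sub>R \<i>)" by presburger
    also have "\<dots> = Re ?e * h 1 + Im ?e * h \<i>" by (simp add: h.add h.scaleR)
    finally have "h ?e = cos (w * t) * h 1 + sin (w * t) * h \<i>"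
      by (simp add: exp_eq_polar)
    moreover have "of_real (cos (w * t)) = (exp ((\<i> * of_real w) * of_real t) + exp ((- (\<i> * of_real w)) * of_real t)) / 2"
      using cos_exp_eq[of "of_real (w * t)"] by (subst cos_of_real[symmetric]) (simp add: mult.assoc)
    moreover have "of_real (sin (w * t)) = (exp ((\<i> * of_real w) * of_real t) - exp ((- (\<i> * of_real w)) * of_real t)) / (2 * \<i>)"
      using sin_exp_eq[of "of_real (w * t)"] by (subst sin_of_real[symmetric]) (simp add: mult.assoc)
    ultimately show ?thesis
      by (simp only: of_real_add of_real_mult) (simp add: field_simps)
  qed
  show ?case unfolding eq by (intro smooth_add smooth_mult smooth_const smooth_exp)
next
  case (const c)
  show ?case by (rule smooth_const)
next
  case (add f g)
  then show ?case by (simp add: smooth_add)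
next
  case (mult f g)
  then show ?case by (simp add: smooth_mult)
qed

text \<open>A continuous function with equal end values factors through the circle, where
  Stone-Weierstrass supplies polynomials; these pull back to trigonometric polynomials, so no
  mollification is involved.\<close>

lemma smooth_periodic_dense:
  fixes \<psi> :: "real \<Rightarrow> complex"
  assumes cont: "continuous_on {0..L} \<psi>" and L: "L > 0" and endp: "\<psi> 0 = \<psi> L" and e: "e > 0"
  obtains \<phi> where "smooth \<phi>" "periodic L \<phi>" "\<And>t. t \<in> {0..L} \<Longrightarrow> norm (\<psi> t - \<phi> t) < e"
proof -
  define w where "w = 2 * pi / L"
  define E where "E = (\<lambda>t::real. exp (\<i> * of_real (w * t)))"
  have w: "w > 0" "w * L = 2 * pi" using L by (auto simp: w_def)
  have E0L: "E 0 = E L" unfolding E_def w(2) by (simp add: exp_eq_polar)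
  have eq: "\<psi> t = \<psi> t'" if "t \<in> {0..L}" "t' \<in> {0..L}" "E t = E t'" for t t'
  proof -
    obtain n :: int where "\<i> * of_real (w * t) = \<i> * of_real (w * t') + of_int (2 * n) * pi * \<i>"
      using \<open>E t = E t'\<close> by (auto simp: E_def exp_eq)
    then have "\<i> * (of_real (w * t) :: complex) = \<i> * of_real (w * t' + 2 * n * pi)"
      by (simp add: algebra_simps)
    then have "w * t = w * t' + 2 * n * pi"
      by (metis complex_i_not_zero mult_left_cancel of_real_eq_iff)
    then have "w * t = w * (t' + n * L)" using w(2) by (simp add: algebra_simps)
    then have t: "t = t' + n * L" using w by simp
    \<comment> \<open>Both parameters lie in one closed period, so they differ by at most one
      period; \<open>endp\<close> settles the case of opposite ends.\<close>
    then have "\<bar>n * L\<bar> \<le> 1 * L" using that by (simp add: abs_le_iff)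
    then have "\<bar>n\<bar> \<le> 1" using L by (simp add: abs_mult)
    then consider "n = 0" | "n = 1" | "n = -1" by linarith
    then show ?thesis using t that endp by cases auto
  qed
  define S where "S = E ` {0..L}"
  define F where "F = (\<lambda>z. \<psi> (SOME t. t \<in> {0..L} \<and> E t = z))"
  have FE: "F (E t) = \<psi> t" if "t \<in> {0..L}" for t
  proof -
    have "(SOME t'. t' \<in> {0..L} \<and> E t' = E t) \<in> {0..L} \<and> E (SOME t'. t' \<in> {0..L} \<and> E t' = E t) = E t"
      by (rule someI[of _ t]) (use that in auto)
    then show ?thesis unfolding F_def using eq that by blast
  qed
  have contE: "continuous_on A E" for A unfolding E_def by (intro continuous_intros)
  have S: "compact S" unfolding S_def by (rule compact_continuous_image[OF contE compact_Icc])
  have "continuous_on S F"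
  \<comment> \<open>\<open>F\<close> is defined through a choice of preimage, but its graph is the
    image of \<open>{0..L}\<close> under a continuous map and hence compact.\<close>
  proof (rule continuous_from_closed_graph)
    show "compact (\<psi> ` {0..L})" using cont by (rule compact_continuous_image) auto
    show "F \<in> S \<rightarrow> \<psi> ` {0..L}" using FE by (auto simp: S_def)
    have "(\<lambda>z. (z, F z)) ` S = (\<lambda>t. (E t, \<psi> t)) ` {0..L}"
      unfolding S_def image_image using FE by (auto intro!: image_cong)
    moreover have "compact ((\<lambda>t. (E t, \<psi> t)) ` {0..L})"
      by (intro compact_continuous_image continuous_intros cont contE compact_Icc)
    ultimately show "closed ((\<lambda>z. (z, F z)) ` S)" by (simp add: compact_imp_closed)
  qed
  from Stone_Weierstrass_polynomial_function[OF S this e]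
  obtain g where g: "polynomial_function g" "\<And>z. z \<in> S \<Longrightarrow> norm (F z - g z) < e" by blast
  have g': "real_polynomial_function (\<lambda>z. Re (g z))" "real_polynomial_function (\<lambda>z. Im (g z))"
    using g(1) unfolding polynomial_function_def
    by (auto simp: o_def dest: spec[where x = Re] spec[where x = Im] intro: bounded_linear_Re bounded_linear_Im)
  define \<phi> where "\<phi> = (\<lambda>t. g (E t))"
  have \<phi>eq: "\<phi> = (\<lambda>t. of_real (Re (g (E t))) + \<i> * of_real (Im (g (E t))))"
    by (auto simp: \<phi>_def complex_eq_iff)
  have "smooth \<phi>" unfolding \<phi>eq E_def
    by (intro smooth_add smooth_mult smooth_const real_polynomial_smooth g')
  moreover have "periodic L \<phi>"
  proof -
    have "E (t + L) = E t" for t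
    proof -
      have "w * (t + L) = w * t + 2 * pi" using w(2) by (simp add: distrib_left)
      then show ?thesis by (simp only: E_def exp_eq_polar[of "\<i> * _"] cis_conv_exp[symmetric]) (simp add: cis_mult[symmetric] exp_eq_polar)
    qed
    then show ?thesis by (simp add: periodic_def \<phi>_def)
  qed
  moreover have "norm (\<psi> t - \<phi> t) < e" if "t \<in> {0..L}" for t
    using g(2)[of "E t"] FE[OF that] that by (auto simp: \<phi>_def S_def)
  ultimately show ?thesis using that by blast
qed

lemma finite_measure_Icc: "finite_measure (lebesgue_on {a..b::real})"
  by (rule finite_measure_lebesgue_on) simp

lemma integrable_mult_bounded:
  fixes f g :: "real \<Rightarrow> complex"
  assumes "integrable M f" "g \<in> borel_measurable M" "\<And>t. t \<in> space M \<Longrightarrow> norm (g t) \<le> C"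
  shows "integrable M (\<lambda>t. f t * g t)"
proof (rule Bochner_Integration.integrable_bound)
  show "integrable M (\<lambda>t. C * norm (f t))" using assms(1) by simp
  show "AE t in M. norm (f t * g t) \<le> norm (C * norm (f t))"
  proof (rule AE_I2)
    fix t assume "t \<in> space M"
    then have "norm (f t) * norm (g t) \<le> norm (f t) * C" by (intro mult_left_mono assms) auto
    also have "\<dots> \<le> norm (f t) * \<bar>C\<bar>" by (intro mult_left_mono) auto
    finally show "norm (f t * g t) \<le> norm (C * norm (f t))" by (simp add: norm_mult abs_mult mult.commute)
  qed
qed (use assms in \<open>auto intro!: borel_measurable_times\<close>)

lemma continuous_imp_measurable_lebesgue_on:
  fixes f :: "real \<Rightarrow> 'a::euclidean_space"
  shows "continuous_on {a..b} f \<Longrightarrow> f \<in> borel_measurable (lebesgue_on {a..b})"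
  by (rule continuous_imp_measurable_on_sets_lebesgue) auto

lemma continuous_imp_integrable_lebesgue_on:
  fixes f :: "real \<Rightarrow> 'a::euclidean_space"
  assumes "continuous_on {a..b} f" shows "integrable (lebesgue_on {a..b}) f"
  using absolutely_integrable_continuous_real[OF assms] by (rule absolutely_integrable_imp_integrable) auto

lemma continuous_bounded_Icc:
  fixes f :: "real \<Rightarrow> 'a::real_normed_vector"
  assumes "continuous_on {a..b} f"
  obtains C where "C > 0" "\<And>t. t \<in> {a..b} \<Longrightarrow> norm (f t) \<le> C"
  using compact_imp_bounded[OF compact_continuous_image[OF assms compact_Icc]]
  by (auto simp: bounded_pos)

text \<open>Uniform density of the smooth periodic functions extends the orthogonality from smooth
  to continuous test functions, because \<open>h\<close> is integrable.\<close>

lemma integral_continuous_zero: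
  fixes h \<psi> :: "real \<Rightarrow> complex"
  assumes L: "L > 0" and h: "integrable (lebesgue_on {0..L}) h"
    and z: "\<And>\<phi>. smooth \<phi> \<Longrightarrow> periodic L \<phi> \<Longrightarrow> (LINT t|lebesgue_on {0..L}. h t * \<phi> t) = 0"
    and cont: "continuous_on {0..L} \<psi>" and "\<psi> 0 = \<psi> L"
  shows "(LINT t|lebesgue_on {0..L}. h t * \<psi> t) = 0"
proof -
  let ?M = "lebesgue_on {0..L}"
  let ?C = "LINT t|?M. norm (h t)"
  have C: "?C \<ge> 0" by (intro Bochner_Integration.integral_nonneg) auto
  have "norm (LINT t|?M. h t * \<psi> t) \<le> 0 + e" if e: "e > 0" for e
  proof -
    \<comment> \<open>The summand \<open>1\<close> keeps the denominator positive even if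
      \<open>h\<close> vanishes almost everywhere.\<close>
    define d where "d = e / (?C + 1)"
    have d: "d > 0" unfolding d_def using C e by (intro divide_pos_pos) linarith+
    obtain \<phi> where \<phi>: "smooth \<phi>" "periodic L \<phi>" "\<And>t. t \<in> {0..L} \<Longrightarrow> norm (\<psi> t - \<phi> t) < d"
      using smooth_periodic_dense[OF cont L \<open>\<psi> 0 = \<psi> L\<close> d] by blast
    obtain B1 where B1: "\<And>t. t \<in> {0..L} \<Longrightarrow> norm (\<psi> t) \<le> B1" using continuous_bounded_Icc[OF cont] by metis
    obtain B2 where B2: "\<And>t. t \<in> {0..L} \<Longrightarrow> norm (\<phi> t) \<le> B2"
      using continuous_bounded_Icc[OF smooth_continuous_on[OF \<phi>(1)]] by metis
    have i1: "integrable ?M (\<lambda>t. h t * \<psi> t)"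
      by (rule integrable_mult_bounded[OF h _ B1]) (auto intro: continuous_imp_measurable_lebesgue_on cont)
    have i2: "integrable ?M (\<lambda>t. h t * \<phi> t)"
      by (rule integrable_mult_bounded[OF h _ B2]) (auto intro: continuous_imp_measurable_lebesgue_on smooth_continuous_on \<phi>)
    have "(LINT t|?M. h t * \<psi> t) = (LINT t|?M. h t * \<psi> t) - (LINT t|?M. h t * \<phi> t)" using z[OF \<phi>(1,2)] by simp
    also have "\<dots> = (LINT t|?M. h t * \<psi> t - h t * \<phi> t)" using i1 i2 by simp
    finally have "norm (LINT t|?M. h t * \<psi> t) \<le> (LINT t|?M. norm (h t * \<psi> t - h t * \<phi> t))" by simp
    also have "\<dots> \<le> (LINT t|?M. norm (h t) * d)"
    proof (rule Bochner_Integration.integral_mono)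
      fix t assume "t \<in> space ?M"
      then have "norm (\<psi> t - \<phi> t) \<le> d" using \<phi>(3) by (simp add: less_imp_le)
      then show "norm (h t * \<psi> t - h t * \<phi> t) \<le> norm (h t) * d"
        by (simp add: mult_left_mono norm_mult flip: right_diff_distrib)
    qed (use i1 i2 h in auto)
    also have "\<dots> = ?C * d" by simp
    also have "\<dots> \<le> (?C + 1) * d" using d by (intro mult_right_mono) auto
    also have "\<dots> = e"
    proof -
      have "?C + 1 \<noteq> 0" using C by linarith
      then show ?thesis by (simp add: d_def)
    qed
    finally show ?thesis by simp
  qed
  then have "norm (LINT t|?M. h t * \<psi> t) \<le> 0" by (rule field_le_epsilon)
  then show ?thesis by simp
qed

text \<open>Testing with the conjugate sign of \<open>h\<close> would give the integral of
  \<open>norm (h t)\<close> at once. The sign is only measurable, so it is replaced by continuous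
  functions converging to it almost everywhere, and dominated convergence finishes.\<close>

lemma fundamental_lemma:
  fixes h :: "real \<Rightarrow> complex"
  assumes L: "L > 0" and h: "integrable (lebesgue_on {0..L}) h"
    and z: "\<And>\<phi>. smooth \<phi> \<Longrightarrow> periodic L \<phi> \<Longrightarrow> (LINT t|lebesgue_on {0..L}. h t * \<phi> t) = 0"
  shows "AE t in lebesgue_on {0..L}. h t = 0"
proof -
  let ?M = "lebesgue_on {0..L}"
  have [measurable]: "h \<in> borel_measurable ?M" using h by simp
  have [measurable]: "cnj \<in> borel_measurable borel"
    by (intro borel_measurable_continuous_onI continuous_intros)
  have "(\<lambda>t. cnj (sgn (h t))) \<in> borel_measurable ?M"
    unfolding sgn_eq by measurable
  then have "(\<lambda>t. if t \<in> {0..L} then cnj (sgn (h t)) else 0) \<in> borel_measurable lebesgue"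
    by (rule borel_measurable_if_I) auto
  then have "(\<lambda>t. if t \<in> {0..L} then cnj (sgn (h t)) else 0) measurable_on UNIV"
    by (rule lebesgue_measurable_imp_measurable_on) simp
  then obtain N g where N: "negligible N" and g: "\<And>n. continuous_on UNIV (g n)"
    and lim: "\<And>t. t \<notin> N \<Longrightarrow> (\<lambda>n. g n t) \<longlonglongrightarrow> (if t \<in> {0..L} then cnj (sgn (h t)) else 0)"
    unfolding measurable_on_def by auto
  \<comment> \<open>The first factor vanishes at \<open>0\<close> and \<open>L\<close>, which makes
    the end values agree, and tends to \<open>1\<close> in between. The division truncates the
    approximants to norm at most \<open>1\<close>, as domination by \<open>norm (h t)\<close>
    requires.\<close>
  define \<psi> where "\<psi> = (\<lambda>n t. of_real (min 1 (real n * (t * (L - t)))) * (g n t / of_real (max 1 (norm (g n t)))))"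
  have cont: "continuous_on {0..L} (\<psi> n)" for n
    unfolding \<psi>_def by (intro continuous_intros continuous_on_subset[OF g]) auto
  have bnd: "norm (\<psi> n t) \<le> 1" if "t \<in> {0..L}" for n t
  proof -
    have "norm (g n t / of_real (max 1 (norm (g n t)))) \<le> 1" by (auto simp: norm_divide)
    moreover have "0 \<le> real n * (t * (L - t))" using that by simp
    ultimately show ?thesis unfolding \<psi>_def norm_mult
      by (intro mult_le_one) (auto simp: min_def)
  qed
  have "(\<lambda>n. LINT t|?M. h t * \<psi> n t) \<longlonglongrightarrow> (LINT t|?M. complex_of_real (norm (h t)))"
  proof (rule integral_dominated_convergence[where w = "\<lambda>t. norm (h t)"])
    show "(\<lambda>t. complex_of_real (norm (h t))) \<in> borel_measurable ?M" by measurable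
    show "(\<lambda>t. h t * \<psi> n t) \<in> borel_measurable ?M" for n
      using continuous_imp_measurable_lebesgue_on[OF cont[of n]] by measurable
    show "integrable ?M (\<lambda>t. norm (h t))" using h by simp
    show "AE t in ?M. norm (h t * \<psi> n t) \<le> norm (h t)" for n
    proof (rule AE_I2)
      fix t assume "t \<in> space ?M"
      then show "norm (h t * \<psi> n t) \<le> norm (h t)"
        using bnd[of t n] by (simp add: norm_mult mult_left_le)
    qed
    have "negligible (N \<union> {0, L})" using N by (simp add: negligible_insert)
    then have N': "N \<union> {0, L} \<in> null_sets lebesgue" using negligible_iff_null_sets by blast
    have "AE t in lebesgue. t \<notin> N \<union> {0, L}" using AE_not_in N' by blast
    then have "AE t in lebesgue. t \<in> {0..L} \<longrightarrow> (\<lambda>n. h t * \<psi> n t) \<longlonglongrightarrow> complex_of_real (norm (h t))"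
    proof (rule eventually_mono)
      fix t assume t: "t \<notin> N \<union> {0, L}"
      show "t \<in> {0..L} \<longrightarrow> (\<lambda>n. h t * \<psi> n t) \<longlonglongrightarrow> complex_of_real (norm (h t))"
      proof
        assume "t \<in> {0..L}"
        with t have p: "t * (L - t) > 0" by auto
        have "(\<lambda>n. g n t) \<longlonglongrightarrow> cnj (sgn (h t))" using lim[of t] t \<open>t \<in> {0..L}\<close> by simp
        moreover have "filterlim (\<lambda>n. real n * (t * (L - t))) at_top sequentially"
          using p by (intro filterlim_at_top_mult_tendsto_pos[OF tendsto_const] filterlim_real_sequentially)
        then have "eventually (\<lambda>n. real n * (t * (L - t)) \<ge> 1) sequentially"
          by (simp add: filterlim_at_top)
        then have "eventually (\<lambda>n. 1 = min 1 (real n * (t * (L - t)))) sequentially"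
          by (rule eventually_mono) simp
        then have "(\<lambda>n. min 1 (real n * (t * (L - t)))) \<longlonglongrightarrow> 1"
          by (rule Lim_transform_eventually[OF tendsto_const])
        ultimately have "(\<lambda>n. h t * \<psi> n t) \<longlonglongrightarrow> h t * (of_real 1 * (cnj (sgn (h t)) / of_real (max 1 (norm (cnj (sgn (h t)))))))"
          unfolding \<psi>_def by (intro tendsto_intros) auto
        moreover have "h t * (of_real 1 * (cnj (sgn (h t)) / of_real (max 1 (norm (cnj (sgn (h t))))))) = complex_of_real (norm (h t))"
        proof (cases "h t = 0")
          case False
          have "h t * cnj (h t) = complex_of_real (norm (h t)) * complex_of_real (norm (h t))"
            using complex_norm_square[of "h t"] by (simp add: power2_eq_square)
          moreover have "h t * cnj (sgn (h t)) = (h t * cnj (h t)) / complex_of_real (norm (h t))"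
            by (simp only: sgn_eq complex_cnj_divide complex_cnj_complex_of_real times_divide_eq_right)
          ultimately have "h t * cnj (sgn (h t)) = complex_of_real (norm (h t))"
            using False by (metis nonzero_mult_div_cancel_right norm_eq_zero of_real_eq_0_iff)
          moreover have "norm (cnj (sgn (h t))) = 1" using False by (simp add: norm_sgn)
          ultimately show ?thesis by simp
        qed simp
        ultimately show "(\<lambda>n. h t * \<psi> n t) \<longlonglongrightarrow> complex_of_real (norm (h t))" by simp
      qed
    qed
    then show "AE t in ?M. (\<lambda>n. h t * \<psi> n t) \<longlonglongrightarrow> complex_of_real (norm (h t))"
      by (subst AE_restrict_space_iff) auto
  qed
  moreover have "(LINT t|?M. h t * \<psi> n t) = 0" for n
    by (rule integral_continuous_zero[OF L h z cont]) (auto simp: \<psi>_def)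
  ultimately have "(\<lambda>n. 0) \<longlonglongrightarrow> (LINT t|?M. complex_of_real (norm (h t)))" by simp
  then have "(LINT t|?M. complex_of_real (norm (h t))) = 0" by (rule LIMSEQ_unique[OF _ tendsto_const])
  then have "(LINT t|?M. norm (h t)) = 0" by simp
  then have "AE t in ?M. norm (h t) = 0"
    using h by (subst (asm) integral_nonneg_eq_0_iff_AE) auto
  then show ?thesis by simp
qed

section \<open>The Sobolev space\<close>

text \<open>On finite measure spaces a uniform bound on the inner integrals of the norm already
  gives joint integrability. This is the form in which weakly singular kernels meet Fubini.\<close>

lemma fubini_bounded:
  fixes F :: "real \<Rightarrow> real \<Rightarrow> complex"
  assumes M1: "finite_measure M1" and M2: "finite_measure M2"
    and meas: "(\<lambda>(s, t). F s t) \<in> borel_measurable (M1 \<Otimes>\<^sub>M M2)"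
    and int: "\<And>s. s \<in> space M1 \<Longrightarrow> integrable M2 (F s)"
    and bnd: "\<And>s. s \<in> space M1 \<Longrightarrow> (LINT t|M2. norm (F s t)) \<le> C"
  shows "(LINT s|M1. LINT t|M2. F s t) = (LINT t|M2. LINT s|M1. F s t)"
    "integrable M2 (\<lambda>t. LINT s|M1. F s t)"
proof -
  interpret M1: finite_measure M1 by fact
  interpret M2: finite_measure M2 by fact
  interpret pair_sigma_finite M1 M2 ..
  have [measurable]: "(\<lambda>x. F (fst x) (snd x)) \<in> borel_measurable (M1 \<Otimes>\<^sub>M M2)"
    using meas by (simp add: case_prod_unfold)
  have "integrable M1 (\<lambda>s. LINT t|M2. norm (F s t))"
  proof (rule M1.integrable_const_bound[of _ C])
    show "AE s in M1. norm (LINT t|M2. norm (F s t)) \<le> C"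
    proof (rule AE_I2)
      fix s assume "s \<in> space M1"
      moreover have "(LINT t|M2. norm (F s t)) \<ge> 0" by (intro Bochner_Integration.integral_nonneg) auto
      ultimately show "norm (LINT t|M2. norm (F s t)) \<le> C" using bnd by simp
    qed
    show "(\<lambda>s. LINT t|M2. norm (F s t)) \<in> borel_measurable M1"
      by (rule M2.borel_measurable_lebesgue_integral) (simp add: case_prod_unfold)
  qed
  then have "integrable (M1 \<Otimes>\<^sub>M M2) (\<lambda>x. F (fst x) (snd x))"
    by (intro Fubini_integrable) (auto intro: int AE_I2)
  then have "integrable (M1 \<Otimes>\<^sub>M M2) (\<lambda>(x, y). F x y)" by (simp add: case_prod_unfold)
  from Fubini_integral[OF this] integrable_snd[OF this]
  show "(LINT s|M1. LINT t|M2. F s t) = (LINT t|M2. LINT s|M1. F s t)"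
    "integrable M2 (\<lambda>t. LINT s|M1. F s t)" by simp_all
qed

text \<open>Inside the interval the set of disagreement is open and negligible, hence empty; the end
  points follow by closure.\<close>

lemma AE_eq_continuous:
  fixes f g :: "real \<Rightarrow> complex"
  assumes ae: "AE t in lebesgue_on {a..b}. f t = g t" and ab: "a < b"
    and cont: "continuous_on {a..b} f" "continuous_on {a..b} g"
    and t: "t \<in> {a..b}"
  shows "f t = g t"
proof -
  have c: "continuous_on {a..b} (\<lambda>t. f t - g t)" by (intro continuous_intros cont)
  define S where "S = {t \<in> {a<..<b}. f t - g t \<in> - {0}}"
  have "open S"
  proof -
    have "continuous_on {a<..<b} (\<lambda>t. f t - g t)" by (rule continuous_on_subset[OF c]) auto
    then have "open ((\<lambda>t. f t - g t) -` (- {0}) \<inter> {a<..<b})"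
      by (subst (asm) continuous_on_open_vimage) auto
    also have "(\<lambda>t. f t - g t) -` (- {0}) \<inter> {a<..<b} = S" by (auto simp: S_def)
    finally show ?thesis .
  qed
  moreover have "negligible S"
  proof -
    have "AE t in lebesgue. t \<in> {a..b} \<longrightarrow> f t = g t"
      using ae by (subst (asm) AE_restrict_space_iff) auto
    then have "negligible {t. \<not> (t \<in> {a..b} \<longrightarrow> f t = g t)}"
      by (simp add: negligible_iff_null_sets eventually_ae_filter) (metis (no_types, lifting) null_sets_completion_subset)
    then show ?thesis by (rule negligible_subset) (auto simp: S_def)
  qed
  ultimately have "S = {}" using open_not_negligible by blast
  then have "\<And>x. x \<in> {a<..<b} \<Longrightarrow> f x - g x = 0" by (auto simp: S_def)
  moreover have "closure {a<..<b} = {a..b}" using ab by simp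
  ultimately have "f t - g t = 0"
    using continuous_constant_on_closure[of "{a<..<b}" "\<lambda>t. f t - g t" 0 t] c t by simp
  then show ?thesis by simp
qed

section \<open>Functions with an integrable weak derivative are antiderivatives of it\<close>

lemma integrable_on_subinterval_lebesgue:
  fixes f :: "real \<Rightarrow> complex"
  assumes "integrable (lebesgue_on {a..b}) f" "a \<le> c" "d \<le> b"
  shows "integrable (lebesgue_on {c..d}) f" "f integrable_on {c..d}"
    "(LINT t|lebesgue_on {c..d}. f t) = integral {c..d} f"
proof -
  show 1: "integrable (lebesgue_on {c..d}) f"
    by (rule integrable_subinterval[OF assms(1)]) (use assms in auto)
  show "f integrable_on {c..d}" by (rule integrable_on_lebesgue_on[OF 1]) auto
  show "(LINT t|lebesgue_on {c..d}. f t) = integral {c..d} f"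
    by (rule lebesgue_integral_eq_integral[OF 1]) auto
qed

lemma smooth_integral_vderiv:
  assumes "smooth \<phi>" "a \<le> b"
  shows "(LINT t|lebesgue_on {a..b}. vderiv \<phi> t) = \<phi> b - \<phi> a"
proof -
  have "(vderiv \<phi> has_integral (\<phi> b - \<phi> a)) {a..b}"
    using assms by (intro fundamental_theorem_of_calculus)
      (auto intro: has_vector_derivative_at_within smooth_has_vderiv)
  moreover have "integrable (lebesgue_on {a..b}) (vderiv \<phi>)"
    by (intro continuous_imp_integrable_lebesgue_on smooth_continuous_on smooth_vderiv assms)
  ultimately show ?thesis by (simp add: lebesgue_integral_eq_integral integral_unique)
qed

text \<open>The du Bois-Reymond argument on a circle: \<open>h\<close> minus the antiderivative of
  \<open>g\<close> is orthogonal to all derivatives of periodic functions, that is, to all functions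
  of mean zero, and is therefore constant almost everywhere.\<close>

lemma weak_deriv_imp_antiderivative:
  fixes h g :: "real \<Rightarrow> complex"
  assumes L: "L > 0" and h: "integrable (lebesgue_on {0..L}) h" and g: "integrable (lebesgue_on {0..L}) g"
    and weak: "\<And>\<phi>. smooth \<phi> \<Longrightarrow> periodic L \<phi> \<Longrightarrow>
      (LINT t|lebesgue_on {0..L}. h t * vderiv \<phi> t) = - (LINT t|lebesgue_on {0..L}. g t * \<phi> t)"
  obtains c where "AE t in lebesgue_on {0..L}. h t = c + integral {0..t} g"
    "integral {0..L} g = 0"
proof -
  let ?M = "lebesgue_on {0..L}"
  interpret finite_measure ?M by (rule finite_measure_Icc)
  define F where "F = (\<lambda>t. integral {0..t} g)"
  have gi: "g integrable_on {0..L}" by (rule integrable_on_subinterval_lebesgue(2)[OF g]) auto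
  have contF: "continuous_on {0..L} F"
    unfolding F_def by (rule indefinite_integral_continuous_1[OF gi])
  have vconst: "vderiv (\<lambda>t. c) = (\<lambda>t. 0)" for c :: complex by (rule vderiv_eqI) auto
  \<comment> \<open>The constant test function shows that \<open>g\<close> has mean zero, which
    makes its antiderivative periodic.\<close>
  have g0: "(LINT t|?M. g t) = 0"
    using weak[of "\<lambda>t. 1"] by (simp add: smooth_const periodic_def vconst)
  then have FL: "F L = 0" unfolding F_def
    using integrable_on_subinterval_lebesgue(3)[OF g, of 0 L] by simp
  \<comment> \<open>\<open>g\<close> is merely integrable, so integration by parts for
    \<open>F\<close> is carried out as Fubini on the triangle \<open>u \<le> t\<close>.\<close>
  have Fweak: "(LINT t|?M. F t * vderiv \<phi> t) = - (LINT t|?M. g t * \<phi> t)" if \<phi>: "smooth \<phi>" "periodic L \<phi>" for \<phi>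
  proof -
    obtain B where B: "B > 0" "\<And>t. t \<in> {0..L} \<Longrightarrow> norm (vderiv \<phi> t) \<le> B"
      using continuous_bounded_Icc[OF smooth_continuous_on[OF smooth_vderiv[OF \<phi>(1)]]] by metis
    have m1[measurable]: "vderiv \<phi> \<in> borel_measurable ?M" "\<phi> \<in> borel_measurable ?M" "g \<in> borel_measurable ?M"
      using g \<phi> by (auto intro!: continuous_imp_measurable_lebesgue_on smooth_continuous_on smooth_vderiv)
    have m2[measurable]: "(\<lambda>x. x) \<in> borel_measurable ?M" by (rule continuous_imp_measurable_lebesgue_on) auto
    have F: "F t = (LINT u|?M. indicator {..t} u *\<^sub>R g u)" if t: "t \<in> {0..L}" for t
    proof -
      have "(LINT u|?M. indicator {..t} u *\<^sub>R g u) = (LINT u|lebesgue. indicator {0..L} u *\<^sub>R (indicator {..t} u *\<^sub>R g u))"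
        by (rule integral_restrict_space) auto
      also have "\<dots> = (LINT u|lebesgue. indicator {0..t} u *\<^sub>R g u)"
        by (rule Bochner_Integration.integral_cong) (use t in \<open>auto simp: indicator_def\<close>)
      also have "\<dots> = (LINT u|lebesgue_on {0..t}. g u)"
        by (rule integral_restrict_space[symmetric]) auto
      also have "\<dots> = F t" unfolding F_def
        by (rule integrable_on_subinterval_lebesgue(3)[OF g]) (use t in auto)
      finally show ?thesis by simp
    qed
    have ind: "integrable ?M (\<lambda>u. indicator {..t} u *\<^sub>R g u)" for t
    proof (rule Bochner_Integration.integrable_bound[OF g])
      have "(\<lambda>u. indicat_real {..t} u *\<^sub>R g u) = (\<lambda>u. if u \<le> t then g u else 0)"
        by (auto simp: indicator_def)
      moreover have "(\<lambda>u. if u \<le> t then g u else 0) \<in> borel_measurable ?M" by measurable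
      ultimately show "(\<lambda>u. indicat_real {..t} u *\<^sub>R g u) \<in> borel_measurable ?M" by simp
    qed (auto simp: indicator_def)
    have "(LINT t|?M. F t * vderiv \<phi> t) = (LINT t|?M. LINT u|?M. (if u \<le> t then 1 else 0) * (g u * vderiv \<phi> t))"
    proof (rule Bochner_Integration.integral_cong[OF refl])
      fix t assume t: "t \<in> space ?M"
      have "F t * vderiv \<phi> t = (LINT u|?M. (indicator {..t} u *\<^sub>R g u) * vderiv \<phi> t)"
        using t F[of t] integral_mult_left_zero[of ?M "\<lambda>u. indicator {..t} u *\<^sub>R g u" "vderiv \<phi> t"] by simp
      also have "\<dots> = (LINT u|?M. (if u \<le> t then 1 else 0) * (g u * vderiv \<phi> t))"
        by (rule Bochner_Integration.integral_cong) (auto simp: indicator_def)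
      finally show "F t * vderiv \<phi> t = (LINT u|?M. (if u \<le> t then 1 else 0) * (g u * vderiv \<phi> t))" .
    qed
    also have "\<dots> = (LINT u|?M. LINT t|?M. (if u \<le> t then 1 else 0) * (g u * vderiv \<phi> t))"
    proof (rule fubini_bounded(1)[OF finite_measure_Icc finite_measure_Icc, where C = "B * (LINT u|?M. norm (g u))"])
      show "(\<lambda>(s, t). (if t \<le> s then 1 else 0) * (g t * vderiv \<phi> s)) \<in> borel_measurable (?M \<Otimes>\<^sub>M ?M)"
        by measurable
      fix t assume t: "t \<in> space ?M"
      have bd: "norm ((if u \<le> t then 1 else 0) * (g u * vderiv \<phi> t)) \<le> B * norm (g u)" for u
        using mult_left_mono[OF B(2)[of t], of "norm (g u)"] t \<open>B > 0\<close> by (auto simp: norm_mult mult.commute)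
      show i: "integrable ?M (\<lambda>u. (if u \<le> t then 1 else 0) * (g u * vderiv \<phi> t))"
      proof (rule Bochner_Integration.integrable_bound)
        show "integrable ?M (\<lambda>u. B * norm (g u))" using g by simp
        show "(\<lambda>u. (if u \<le> t then 1 else 0) * (g u * vderiv \<phi> t)) \<in> borel_measurable ?M" by measurable
        show "AE u in ?M. norm ((if u \<le> t then 1 else 0) * (g u * vderiv \<phi> t)) \<le> norm (B * norm (g u))"
          using bd \<open>B > 0\<close> by (intro AE_I2) (simp add: abs_mult)
      qed
      have "(LINT u|?M. norm ((if u \<le> t then 1 else 0) * (g u * vderiv \<phi> t))) \<le> (LINT u|?M. B * norm (g u))"
        by (rule Bochner_Integration.integral_mono) (use i g bd in auto)
      then show "(LINT u|?M. norm ((if u \<le> t then 1 else 0) * (g u * vderiv \<phi> t))) \<le> B * (LINT u|?M. norm (g u))"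
        by simp
    qed
    also have "\<dots> = (LINT u|?M. g u * (\<phi> L - \<phi> u))"
    proof (rule Bochner_Integration.integral_cong[OF refl])
      fix u assume u: "u \<in> space ?M"
      have "(LINT t|?M. (if u \<le> t then 1 else 0) * (g u * vderiv \<phi> t)) = g u * (LINT t|?M. (if u \<le> t then 1 else 0) * vderiv \<phi> t)"
        unfolding mult.left_commute[of _ "g u"] by (rule integral_mult_right_zero)
      also have "(LINT t|?M. (if u \<le> t then 1 else 0) * vderiv \<phi> t) = (LINT t|lebesgue. indicator {0..L} t *\<^sub>R ((if u \<le> t then 1 else 0) * vderiv \<phi> t))"
        by (rule integral_restrict_space) auto
      also have "\<dots> = (LINT t|lebesgue. indicator {u..L} t *\<^sub>R vderiv \<phi> t)"
        by (rule Bochner_Integration.integral_cong) (use u in \<open>auto simp: indicator_def\<close>)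
      also have "\<dots> = (LINT t|lebesgue_on {u..L}. vderiv \<phi> t)"
        by (rule integral_restrict_space[symmetric]) auto
      also have "\<dots> = \<phi> L - \<phi> u" using u by (intro smooth_integral_vderiv \<phi>) auto
      finally show "(LINT t|?M. (if u \<le> t then 1 else 0) * (g u * vderiv \<phi> t)) = g u * (\<phi> L - \<phi> u)" .
    qed
    also have "\<dots> = (LINT u|?M. g u * \<phi> L) - (LINT u|?M. g u * \<phi> u)"
    proof -
      obtain B' where B': "\<And>t. t \<in> {0..L} \<Longrightarrow> norm (\<phi> t) \<le> B'"
        using continuous_bounded_Icc[OF smooth_continuous_on[OF \<phi>(1)]] by metis
      have "integrable ?M (\<lambda>u. g u * \<phi> u)" by (rule integrable_mult_bounded[OF g _ B']) auto
      then show ?thesis using g by (simp add: right_diff_distrib)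
    qed
    finally show ?thesis using g g0 by simp
  qed
  define H where "H = (\<lambda>t. h t - F t)"
  have Fi: "integrable ?M F" by (rule continuous_imp_integrable_lebesgue_on[OF contF])
  have Hi: "integrable ?M H" unfolding H_def using h Fi by simp
  define c where "c = (LINT t|?M. H t) / L"
  have "AE t in ?M. H t - c = 0"
  proof (rule fundamental_lemma[OF L])
    show "integrable ?M (\<lambda>t. H t - c)" using Hi by simp
    fix \<psi> assume \<psi>: "smooth \<psi>" "periodic L \<psi>"
    have cont\<psi>: "continuous_on A \<psi>" for A by (rule smooth_continuous_on[OF \<psi>(1)])
    have psii: "integrable ?M \<psi>" by (rule continuous_imp_integrable_lebesgue_on[OF cont\<psi>])
    \<comment> \<open>An antiderivative of \<open>\<psi>\<close> is periodic only after the mean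
      \<open>m\<close> of \<open>\<psi>\<close> has been subtracted; this correction produces the
      constant \<open>c\<close>.\<close>
    define m where "m = (LINT t|?M. \<psi> t) / L"
    obtain P where P: "\<And>t. (P has_vector_derivative \<psi> t) (at t)"
    proof -
      have "\<exists>P. \<forall>t. (P has_vector_derivative \<psi> t) (at t)"
        using einterval_antiderivative[of "-\<infinity>" "\<infinity>" \<psi>] cont\<psi>[of UNIV]
        by (auto simp: continuous_on_eq_continuous_at einterval_def)
      then show ?thesis using that by blast
    qed
    have smP: "smooth P" using smooth_antiderivative[OF \<psi>(1) P] .
    have vP: "vderiv P = \<psi>" by (rule vderiv_eqI[OF P])
    define \<phi> where "\<phi> = (\<lambda>t. P t - m * t)"
    have d\<phi>: "(\<phi> has_vector_derivative \<psi> t - m) (at t)" for t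
      unfolding \<phi>_def by (auto intro!: derivative_eq_intros P)
    have v\<phi>: "vderiv \<phi> = (\<lambda>t. \<psi> t - m)" by (rule vderiv_eqI[OF d\<phi>])
    have "smooth (\<lambda>t. \<psi> t + (- m))" by (intro smooth_add \<psi> smooth_const)
    then have sm\<phi>: "smooth \<phi>" by (intro smooth_antiderivative[OF _ d\<phi>]) simp
    have per: "periodic L \<phi>" unfolding periodic_def
    proof
      fix t
      \<comment> \<open>\<open>Q\<close> has derivative zero, and its value at \<open>0\<close> is
        the integral of \<open>\<psi>\<close> minus \<open>L\<close> times its mean.\<close>
      define Q where "Q = (\<lambda>t. \<phi> (t + L) - \<phi> t)"
      have "(\<phi> \<circ> (\<lambda>t. t + L) has_vector_derivative 1 *\<^sub>R (\<psi> (t + L) - m)) (at t)" for t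
        by (rule vector_diff_chain_at) (auto intro!: derivative_eq_intros d\<phi>)
      then have "(Q has_vector_derivative 1 *\<^sub>R (\<psi> (t + L) - m) - (\<psi> t - m)) (at t)" for t
        unfolding Q_def o_def by (intro has_vector_derivative_diff d\<phi>)
      then have dQ: "(Q has_vector_derivative 0) (at t)" for t
        using \<psi>(2) by (simp add: periodic_def)
      have "Q t = Q 0"
      proof -
        have "\<exists>c. \<forall>x\<in>UNIV. Q x = c"
          by (rule has_vector_derivative_zero_constant[of UNIV Q]) (auto intro: dQ)
        then show ?thesis by (metis UNIV_I)
      qed
      also have "Q 0 = P L - P 0 - m * L" by (simp add: Q_def \<phi>_def)
      also have "P L - P 0 = (LINT t|?M. \<psi> t)"
        using smooth_integral_vderiv[OF smP, of 0 L] L by (simp add: vP)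
      also have "(LINT t|?M. \<psi> t) - m * L = 0" using L by (simp add: m_def)
      finally show "\<phi> (t + L) = \<phi> t" by (simp add: Q_def)
    qed
    have mb: "integrable ?M (\<lambda>t. f t * vderiv \<phi> t)" "integrable ?M (\<lambda>t. f t * \<psi> t)" if "integrable ?M f" for f
    proof -
      have cv: "continuous_on {0..L} (vderiv \<phi>)" by (intro smooth_continuous_on smooth_vderiv sm\<phi>)
      obtain B' where "\<And>t. t \<in> {0..L} \<Longrightarrow> norm (vderiv \<phi> t) \<le> B'" using continuous_bounded_Icc[OF cv] by metis
      then show "integrable ?M (\<lambda>t. f t * vderiv \<phi> t)"
        by (intro integrable_mult_bounded[OF that]) (auto intro!: continuous_imp_measurable_lebesgue_on cv)
      obtain B' where "\<And>t. t \<in> {0..L} \<Longrightarrow> norm (\<psi> t) \<le> B'" using continuous_bounded_Icc[OF cont\<psi>] by metis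
      then show "integrable ?M (\<lambda>t. f t * \<psi> t)"
        by (intro integrable_mult_bounded[OF that]) (auto intro!: continuous_imp_measurable_lebesgue_on cont\<psi>)
    qed
    have "(LINT t|?M. H t * vderiv \<phi> t) = (LINT t|?M. h t * vderiv \<phi> t) - (LINT t|?M. F t * vderiv \<phi> t)"
      unfolding H_def left_diff_distrib using mb(1)[OF h] mb(1)[OF Fi] by simp
    also have "\<dots> = 0" using weak[OF sm\<phi> per] Fweak[OF sm\<phi> per] by simp
    finally have "(LINT t|?M. H t * \<psi> t - H t * m) = 0" by (simp add: v\<phi> right_diff_distrib)
    then have "(LINT t|?M. H t * \<psi> t) = (LINT t|?M. H t) * m" using mb(2)[OF Hi] Hi by simp
    also have "\<dots> = c * (LINT t|?M. \<psi> t)" by (simp add: c_def m_def)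
    finally show "(LINT t|?M. (H t - c) * \<psi> t) = 0" using mb(2)[OF Hi] psii by (simp add: left_diff_distrib)
  qed
  then have "AE t in ?M. h t = c + integral {0..t} g"
    by (rule eventually_mono) (simp add: H_def F_def algebra_simps)
  then show ?thesis using that FL by (simp add: F_def)
qed

section \<open>Square integrability, weak derivatives and the \<open>H2\<close> norm\<close>

lemma L2_imp_L1:
  assumes "square_integrable L g" shows "integrable (lebesgue_on {0..L}) g"
proof (rule Bochner_Integration.integrable_bound)
  interpret finite_measure "lebesgue_on {0..L}" by (rule finite_measure_Icc)
  show "integrable (lebesgue_on {0..L}) (\<lambda>t. 1 + (cmod (g t))\<^sup>2)"
    using assms by (simp add: square_integrable_def)
  show "AE t in lebesgue_on {0..L}. norm (g t) \<le> norm (1 + (cmod (g t))\<^sup>2)"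
  proof (rule AE_I2)
    fix t
    have "0 \<le> (norm (g t) - 1)\<^sup>2" by simp
    then have "2 * norm (g t) \<le> 1 + (cmod (g t))\<^sup>2" by (simp add: power2_diff)
    moreover have "0 \<le> norm (g t)" by simp
    ultimately have "norm (g t) \<le> 1 + (cmod (g t))\<^sup>2" by linarith
    then show "norm (g t) \<le> norm (1 + (cmod (g t))\<^sup>2)" by simp
  qed
qed (use assms in \<open>simp add: square_integrable_def\<close>)

lemma continuous_imp_square_integrable:
  assumes "continuous_on {0..L} f" shows "square_integrable L f"
  unfolding square_integrable_def
  by (intro conjI continuous_imp_measurable_lebesgue_on continuous_imp_integrable_lebesgue_on continuous_intros assms)

lemma bounded_imp_square_integrable:
  assumes "f \<in> borel_measurable (lebesgue_on {0..L})" "\<And>t. t \<in> {0..L} \<Longrightarrow> norm (f t) \<le> B"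
  shows "square_integrable L f"
proof -
  interpret finite_measure "lebesgue_on {0..L}" by (rule finite_measure_Icc)
  have "integrable (lebesgue_on {0..L}) (\<lambda>t. (cmod (f t))\<^sup>2)"
    by (rule integrable_const_bound[of _ "B\<^sup>2"]) (use assms in \<open>auto intro!: AE_I2 power_mono\<close>)
  with assms(1) show ?thesis by (simp add: square_integrable_def)
qed

lemma integrable_mult_smooth:
  assumes "integrable (lebesgue_on {0..L}) f" "smooth \<phi>"
  shows "integrable (lebesgue_on {0..L}) (\<lambda>t. f t * \<phi> t)"
proof -
  obtain B where "\<And>t. t \<in> {0..L} \<Longrightarrow> norm (\<phi> t) \<le> B"
    using continuous_bounded_Icc[OF smooth_continuous_on[OF assms(2)]] by metis
  then show ?thesis
    by (intro integrable_mult_bounded[OF assms(1)])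
       (auto intro!: continuous_imp_measurable_lebesgue_on smooth_continuous_on assms)
qed

lemma has_weak_deriv_unique:
  assumes L: "L > 0" and g: "has_weak_deriv L m f g" and g': "has_weak_deriv L m f g'"
  shows "AE t in lebesgue_on {0..L}. g t = g' t"
proof -
  have i: "integrable (lebesgue_on {0..L}) g" "integrable (lebesgue_on {0..L}) g'"
    using g g' by (auto simp: has_weak_deriv_def intro: L2_imp_L1)
  have "AE t in lebesgue_on {0..L}. g t - g' t = 0"
  proof (rule fundamental_lemma[OF L])
    fix \<phi> assume \<phi>: "smooth \<phi>" "periodic L \<phi>"
    have "(- 1) ^ m * (LINT t|lebesgue_on {0..L}. g t * \<phi> t) = (- 1) ^ m * (LINT t|lebesgue_on {0..L}. g' t * \<phi> t)"
      using g g' \<phi> by (simp add: has_weak_deriv_def)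
    then have "(LINT t|lebesgue_on {0..L}. g t * \<phi> t) = (LINT t|lebesgue_on {0..L}. g' t * \<phi> t)" by simp
    then show "(LINT t|lebesgue_on {0..L}. (g t - g' t) * \<phi> t) = 0"
      using integrable_mult_smooth[OF i(1) \<phi>(1)] integrable_mult_smooth[OF i(2) \<phi>(1)]
      by (simp add: left_diff_distrib)
  qed (use i in simp)
  then show ?thesis by simp
qed

text \<open>Makes the \<open>SOME\<close> in \<open>H2_norm\<close> harmless: weak derivatives are
  unique almost everywhere, so any known one computes the norm.\<close>

lemma weak_deriv_norm:
  assumes L: "L > 0" and g: "has_weak_deriv L m f g"
  shows "(LINT t|lebesgue_on {0..L}. (cmod ((SOME g. has_weak_deriv L m f g) t))\<^sup>2)
    = (LINT t|lebesgue_on {0..L}. (cmod (g t))\<^sup>2)"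
proof (rule integral_cong_AE)
  have S: "has_weak_deriv L m f (SOME g. has_weak_deriv L m f g)" using g by (rule someI[where P = "\<lambda>g. has_weak_deriv L m f g"])
  then show "(\<lambda>t. (cmod ((SOME g. has_weak_deriv L m f g) t))\<^sup>2) \<in> borel_measurable (lebesgue_on {0..L})"
    by (auto simp: has_weak_deriv_def square_integrable_def)
  show "(\<lambda>t. (cmod (g t))\<^sup>2) \<in> borel_measurable (lebesgue_on {0..L})"
    using g by (auto simp: has_weak_deriv_def square_integrable_def)
  show "AE t in lebesgue_on {0..L}. (cmod ((SOME g. has_weak_deriv L m f g) t))\<^sup>2 = (cmod (g t))\<^sup>2"
    using has_weak_deriv_unique[OF L S g] by (rule eventually_mono) simp
qed

lemma has_weak_deriv_0: "continuous_on {0..L} f \<Longrightarrow> has_weak_deriv L 0 f f"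
  by (simp add: has_weak_deriv_def continuous_imp_square_integrable)

lemma H2_norm_eq:
  assumes L: "L > 0" and c: "continuous_on {0..L} f"
    and g: "has_weak_deriv L 1 f g1" "has_weak_deriv L 2 f g2"
  shows "H2_norm L f = sqrt ((LINT t|lebesgue_on {0..L}. (cmod (f t))\<^sup>2)
    + (LINT t|lebesgue_on {0..L}. (cmod (g1 t))\<^sup>2) + (LINT t|lebesgue_on {0..L}. (cmod (g2 t))\<^sup>2))"
  unfolding H2_norm_def
  using weak_deriv_norm[OF L has_weak_deriv_0[OF c]] weak_deriv_norm[OF L g(1)] weak_deriv_norm[OF L g(2)]
  by (simp add: atMost_Suc eval_nat_numeral add_ac)

text \<open>The gateway from pointwise bounds to the Sobolev norm. Each of the three terms under the
  root is at most \<open>L\<close> times the square of \<open>B\<close>, whence the factor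
  \<open>sqrt (3 * L)\<close>.\<close>

lemma H2I:
  assumes L: "L > 0" and f: "periodic L f" "continuous_on UNIV f"
    and g: "has_weak_deriv L 1 f g1" "has_weak_deriv L 2 f g2"
    and B: "\<And>t. t \<in> {0..L} \<Longrightarrow> norm (f t) \<le> B" "\<And>t. t \<in> {0..L} \<Longrightarrow> norm (g1 t) \<le> B"
      "\<And>t. t \<in> {0..L} \<Longrightarrow> norm (g2 t) \<le> B"
  shows "f \<in> H2 L" "H2_norm L f \<le> sqrt (3 * L) * B"
proof -
  have c: "continuous_on {0..L} f" using f(2) continuous_on_subset by blast
  have "m = 0 \<or> m = 1 \<or> m = 2" if "m \<le> 2" for m :: nat using that by linarith
  then have "\<exists>g. has_weak_deriv L m f g" if "m \<le> 2" for m
    using that g has_weak_deriv_0[OF c] by metis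
  then show "f \<in> H2 L" by (simp add: H2_def f)
  have B0: "B \<ge> 0" using B(1)[of 0] L norm_ge_zero[of "f 0"] by (smt (verit) atLeastAtMost_iff)
  have le: "(LINT t|lebesgue_on {0..L}. (cmod (h t))\<^sup>2) \<le> L * B\<^sup>2"
    if "square_integrable L h" "\<And>t. t \<in> {0..L} \<Longrightarrow> norm (h t) \<le> B" for h
  proof -
    interpret finite_measure "lebesgue_on {0..L}" by (rule finite_measure_Icc)
    have "(LINT t|lebesgue_on {0..L}. (cmod (h t))\<^sup>2) \<le> (LINT t|lebesgue_on {0..L}. B\<^sup>2)"
      by (rule Bochner_Integration.integral_mono) (use that in \<open>auto simp: square_integrable_def intro!: power_mono\<close>)
    also have "\<dots> = L * B\<^sup>2" using L by (simp add: measure_restrict_space)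
    finally show ?thesis .
  qed
  have "H2_norm L f \<le> sqrt (3 * L * B\<^sup>2)"
    unfolding H2_norm_eq[OF L c g]
    using le[OF continuous_imp_square_integrable[OF c] B(1)] le[of g1] le[of g2] g B
    by (simp add: has_weak_deriv_def)
  also have "\<dots> = sqrt (3 * L) * B" using B0 by (simp add: real_sqrt_mult)
  finally show "H2_norm L f \<le> sqrt (3 * L) * B" .
qed

lemma H2D:
  assumes "f \<in> H2 L"
  obtains g1 g2 where "has_weak_deriv L 1 f g1" "has_weak_deriv L 2 f g2"
    "continuous_on A f" "periodic L f"
proof -
  have "\<forall>m\<le>2. \<exists>g. has_weak_deriv L m f g" using assms by (simp add: H2_def)
  then obtain g1 g2 where "has_weak_deriv L 1 f g1" "has_weak_deriv L 2 f g2"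
    by (metis one_le_numeral order_refl)
  with assms that show ?thesis by (auto simp: H2_def intro: continuous_on_subset)
qed

lemma H2_antiderivative:
  assumes L: "L > 0" and f: "continuous_on {0..L} f" and g: "has_weak_deriv L 1 f g" and t: "t \<in> {0..L}"
  shows "f t = f 0 + integral {0..t} g"
proof -
  have gi: "integrable (lebesgue_on {0..L}) g"
    using g by (auto simp: has_weak_deriv_def intro: L2_imp_L1)
  obtain c where c: "AE t in lebesgue_on {0..L}. f t = c + integral {0..t} g"
    by (rule weak_deriv_imp_antiderivative[OF L continuous_imp_integrable_lebesgue_on[OF f] gi])
       (use g in \<open>auto simp: has_weak_deriv_def\<close>)
  have "continuous_on {0..L} (\<lambda>t. c + integral {0..t} g)"
    by (intro continuous_intros indefinite_integral_continuous_1 integrable_on_subinterval_lebesgue(2)[OF gi]) auto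
  from AE_eq_continuous[OF c L f this] have "\<And>t. t \<in> {0..L} \<Longrightarrow> f t = c + integral {0..t} g" .
  from this[OF t] this[of 0] L show ?thesis by simp
qed

text \<open>Instead of Cauchy-Schwarz, the weighted inequality
  \<open>|g| \<le> a/2 |g|^2 + 1/(2 a)\<close> is integrated with \<open>a = sqrt (y - x)\<close>.
  The price is the integral plus \<open>1\<close> in place of its square root.\<close>

lemma square_integrable_holder:
  assumes g: "square_integrable L g" and xy: "0 \<le> x" "x \<le> y" "y \<le> L"
  shows "norm (integral {x..y} g) \<le> ((LINT t|lebesgue_on {0..L}. (cmod (g t))\<^sup>2) + 1) * sqrt (y - x)"
proof (cases "x = y")
  case False
  let ?N = "lebesgue_on {x..y}" and ?B = "LINT t|lebesgue_on {0..L}. (cmod (g t))\<^sup>2"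
  interpret finite_measure ?N by (rule finite_measure_Icc)
  define a where "a = sqrt (y - x)"
  have a: "a > 0" "a\<^sup>2 = y - x" using False xy by (auto simp: a_def)
  have gi: "integrable (lebesgue_on {0..L}) g" by (rule L2_imp_L1[OF g])
  note gi' = integrable_on_subinterval_lebesgue[OF gi xy(1,3)]
  have g2: "integrable (lebesgue_on {0..L}) (\<lambda>t. (cmod (g t))\<^sup>2)" using g by (simp add: square_integrable_def)
  have g2': "integrable ?N (\<lambda>t. (cmod (g t))\<^sup>2)"
    by (rule integrable_subinterval[OF g2]) (use xy in auto)
  have le: "(LINT t|?N. (cmod (g t))\<^sup>2) \<le> ?B"
    by (rule integral_mono_lebesgue_on_AE[OF g2]) (use xy in auto)
  have "norm (integral {x..y} g) \<le> (LINT t|?N. norm (g t))"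
    unfolding gi'(3)[symmetric] by (rule integral_norm_bound)
  also have "\<dots> \<le> (LINT t|?N. a / 2 * (cmod (g t))\<^sup>2 + 1 / (2 * a))"
  proof (rule Bochner_Integration.integral_mono)
    fix t
    have "0 \<le> (a * norm (g t) - 1)\<^sup>2" by simp
    then have "2 * (a * norm (g t)) \<le> a\<^sup>2 * (norm (g t))\<^sup>2 + 1" by (simp add: power2_diff power_mult_distrib)
    then have "norm (g t) \<le> (a\<^sup>2 * (norm (g t))\<^sup>2 + 1) / (2 * a)" using a(1) by (simp add: field_simps)
    also have "\<dots> = a / 2 * (cmod (g t))\<^sup>2 + 1 / (2 * a)" using a(1) by (simp add: field_simps power2_eq_square)
    finally show "norm (g t) \<le> a / 2 * (cmod (g t))\<^sup>2 + 1 / (2 * a)" .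
  qed (use gi'(1) g2' in auto)
  also have "\<dots> = a / 2 * (LINT t|?N. (cmod (g t))\<^sup>2) + (y - x) / (2 * a)"
    using g2' xy by (simp add: measure_restrict_space)
  also have "\<dots> = a / 2 * (LINT t|?N. (cmod (g t))\<^sup>2) + a / 2"
    using a by (simp add: field_simps power2_eq_square flip: a(2))
  also have "\<dots> \<le> a / 2 * ?B + a / 2" using a le by (intro add_mono mult_left_mono) auto
  also have "\<dots> = (?B + 1) * a / 2" by (simp add: field_simps)
  also have "\<dots> \<le> (?B + 1) * a"
  proof -
    have "?B \<ge> 0" by (intro Bochner_Integration.integral_nonneg) auto
    then have "0 \<le> (?B + 1) * a" using a by (intro mult_nonneg_nonneg) linarith+
    then show ?thesis by linarith
  qed
  finally show ?thesis by (simp add: a_def)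
qed (use xy in simp)

lemma integral_diff_Icc:
  fixes g :: "real \<Rightarrow> complex"
  assumes "g integrable_on {0..L}" "0 \<le> x" "x \<le> y" "y \<le> L"
  shows "integral {0..y} g - integral {0..x} g = integral {x..y} g"
proof -
  have "g integrable_on {0..y}" by (rule integrable_on_subinterval[OF assms(1)]) (use assms in auto)
  from Henstock_Kurzweil_Integration.integral_combine[OF assms(2,3) this]
  show ?thesis by (simp add: algebra_simps)
qed

text \<open>The first bound is the uniform Hoelder estimate that supplies equicontinuity. The second
  turns a bound on the mean square of \<open>f\<close> into a pointwise one, since the Hoelder
  estimate limits the oscillation of \<open>f\<close>.\<close>

lemma H2_bounds:
  assumes L: "L > 0" and f: "f \<in> H2 L" and B: "H2_norm L f \<le> B"
  shows "\<And>x y. 0 \<le> x \<Longrightarrow> x \<le> y \<Longrightarrow> y \<le> L \<Longrightarrow> norm (f y - f x) \<le> (B\<^sup>2 + 1) * sqrt (y - x)"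
    and "\<And>x. x \<in> {0..L} \<Longrightarrow> (norm (f x))\<^sup>2 \<le> 2 * B\<^sup>2 / L + 2 * (B\<^sup>2 + 1)\<^sup>2 * L"
proof -
  let ?M = "lebesgue_on {0..L}"
  interpret finite_measure ?M by (rule finite_measure_Icc)
  obtain g1 g2 where g: "has_weak_deriv L 1 f g1" "has_weak_deriv L 2 f g2"
    and c: "continuous_on {0..L} f" "periodic L f" using H2D[OF f] by blast
  have si: "square_integrable L g1" using g by (simp add: has_weak_deriv_def)
  have gi: "g1 integrable_on {0..L}"
    by (rule integrable_on_subinterval_lebesgue(2)[OF L2_imp_L1[OF si]]) auto
  have nn: "(LINT t|?M. (cmod (h t))\<^sup>2) \<ge> 0" for h :: "real \<Rightarrow> complex"
    by (intro Bochner_Integration.integral_nonneg) auto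
  have N: "(LINT t|?M. (cmod (f t))\<^sup>2) + (LINT t|?M. (cmod (g1 t))\<^sup>2) + (LINT t|?M. (cmod (g2 t))\<^sup>2) = (H2_norm L f)\<^sup>2"
    unfolding H2_norm_eq[OF L c(1) g] using nn[of f] nn[of g1] nn[of g2] by (subst real_sqrt_pow2) auto
  have "(H2_norm L f)\<^sup>2 \<le> B\<^sup>2"
  proof (rule power_mono[OF B])
    show "0 \<le> H2_norm L f" unfolding H2_norm_eq[OF L c(1) g] using nn[of f] nn[of g1] nn[of g2] by simp
  qed
  with N nn[of f] nn[of g1] nn[of g2]
  have le: "(LINT t|?M. (cmod (f t))\<^sup>2) \<le> B\<^sup>2" "(LINT t|?M. (cmod (g1 t))\<^sup>2) \<le> B\<^sup>2" by linarith+
  show 1: "norm (f y - f x) \<le> (B\<^sup>2 + 1) * sqrt (y - x)" if xy: "0 \<le> x" "x \<le> y" "y \<le> L" for x y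
  proof -
    have "f y - f x = integral {0..y} g1 - integral {0..x} g1"
      using H2_antiderivative[OF L c(1) g(1), of y] H2_antiderivative[OF L c(1) g(1), of x] xy by simp
    also have "\<dots> = integral {x..y} g1" by (rule integral_diff_Icc[OF gi xy])
    finally have "norm (f y - f x) \<le> ((LINT t|?M. (cmod (g1 t))\<^sup>2) + 1) * sqrt (y - x)"
      using square_integrable_holder[OF si xy] by simp
    also have "\<dots> \<le> (B\<^sup>2 + 1) * sqrt (y - x)" using le xy by (intro mult_right_mono) auto
    finally show ?thesis .
  qed
  fix x assume x: "x \<in> {0..L}"
  \<comment> \<open>A comparison of the fixed value at \<open>x\<close> with the value at an
    arbitrary \<open>t\<close>; averaging over \<open>t\<close> brings in the norm.\<close>
  have "(norm (f x))\<^sup>2 \<le> 2 * (norm (f t))\<^sup>2 + 2 * (B\<^sup>2 + 1)\<^sup>2 * L" if t: "t \<in> {0..L}" for t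
  proof -
    have "norm (f x - f t) \<le> (B\<^sup>2 + 1) * sqrt \<bar>x - t\<bar>"
      using 1[of x t] 1[of t x] x t by (cases "x \<le> t") (auto simp: norm_minus_commute abs_if)
    also have "\<dots> \<le> (B\<^sup>2 + 1) * sqrt L" using x t by (intro mult_left_mono) auto
    finally have "(norm (f x - f t))\<^sup>2 \<le> ((B\<^sup>2 + 1) * sqrt L)\<^sup>2" by (intro power_mono) auto
    then have d: "(norm (f x - f t))\<^sup>2 \<le> (B\<^sup>2 + 1)\<^sup>2 * L" using L by (simp add: power_mult_distrib)
    have "norm (f x) \<le> norm (f t) + norm (f x - f t)" by (metis norm_triangle_sub add.commute)
    then have "(norm (f x))\<^sup>2 \<le> (norm (f t) + norm (f x - f t))\<^sup>2" by (intro power_mono) auto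
    also have "\<dots> \<le> 2 * (norm (f t))\<^sup>2 + 2 * (norm (f x - f t))\<^sup>2"
      using sum_squares_bound[of "norm (f t)" "norm (f x - f t)"] by (simp add: power2_sum)
    finally show ?thesis using d by linarith
  qed
  then have "(LINT t|?M. (norm (f x))\<^sup>2) \<le> (LINT t|?M. 2 * (norm (f t))\<^sup>2 + 2 * (B\<^sup>2 + 1)\<^sup>2 * L)"
    using continuous_imp_square_integrable[OF c(1)]
    by (intro Bochner_Integration.integral_mono) (auto simp: square_integrable_def)
  also have "\<dots> = 2 * (LINT t|?M. (norm (f t))\<^sup>2) + 2 * (B\<^sup>2 + 1)\<^sup>2 * L * L"
    using continuous_imp_square_integrable[OF c(1)] L
    by (simp add: square_integrable_def measure_restrict_space)
  also have "\<dots> \<le> 2 * B\<^sup>2 + 2 * (B\<^sup>2 + 1)\<^sup>2 * L * L" using le by simp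
  also have "\<dots> = L * (2 * B\<^sup>2 / L + 2 * (B\<^sup>2 + 1)\<^sup>2 * L)" using L by (simp add: distrib_left)
  finally have "L * (norm (f x))\<^sup>2 \<le> L * (2 * B\<^sup>2 / L + 2 * (B\<^sup>2 + 1)\<^sup>2 * L)"
    using L by (simp add: measure_restrict_space)
  then show "(norm (f x))\<^sup>2 \<le> 2 * B\<^sup>2 / L + 2 * (B\<^sup>2 + 1)\<^sup>2 * L" using L by simp
qed

lemma H2_compact:
  fixes f :: "nat \<Rightarrow> real \<Rightarrow> complex"
  assumes L: "L > 0" and f: "range f \<subseteq> H2 L" and bd: "bounded (range (\<lambda>n. H2_norm L (f n)))"
  obtains g :: "real \<Rightarrow> complex" and r :: "nat \<Rightarrow> nat" where "continuous_on {0..L} g" "strict_mono r"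
    "\<And>e. e > 0 \<Longrightarrow> \<exists>N. \<forall>n t. n \<ge> N \<and> t \<in> {0..L} \<longrightarrow> norm (f (r n) t - g t) < e"
proof -
  obtain B where B: "\<And>n. H2_norm L (f n) \<le> B" "B > 0"
    using bd unfolding bounded_pos by (metis abs_le_D1 rangeI real_norm_def)
  note H = H2_bounds[OF L _ B(1)]
  have fH: "f n \<in> H2 L" for n using f by auto
  define C where "C = sqrt (2 * B\<^sup>2 / L + 2 * (B\<^sup>2 + 1)\<^sup>2 * L)"
  show ?thesis
  proof (rule Arzela_Ascoli[of "{0..L}" f C])
    show "norm (f n x) \<le> C" if "x \<in> {0..L}" for n x
      unfolding C_def using H(2)[OF fH that] by (rule real_le_rsqrt)
    fix x e :: real assume x: "x \<in> {0..L}" and e: "0 < e"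
    \<comment> \<open>The solution of \<open>(B^2 + 1) * sqrt d = e\<close>, uniform over the
      sequence.\<close>
    define d where "d = (e / (B\<^sup>2 + 1))\<^sup>2"
    have p: "B\<^sup>2 + 1 > 0" by (smt (verit) zero_le_power2)
    have "norm (f n x - f n y) < e" if "y \<in> {0..L}" "norm (x - y) < d" for n y
    proof -
      have "norm (f n x - f n y) \<le> (B\<^sup>2 + 1) * sqrt \<bar>x - y\<bar>"
        using H(1)[OF fH, of x y n] H(1)[OF fH, of y x n] x that by (cases "x \<le> y") (auto simp: norm_minus_commute abs_if)
      also have "\<dots> < (B\<^sup>2 + 1) * sqrt d" using that p by (intro mult_strict_left_mono) auto
      also have "\<dots> = e" using p e by (simp add: d_def real_sqrt_abs)
      finally show ?thesis .
    qed
    moreover have "d > 0" using p e by (simp add: d_def)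
    ultimately show "\<exists>d>0. \<forall>n y. y \<in> {0..L} \<and> norm (x - y) < d \<longrightarrow> norm (f n x - f n y) < e" by blast
  qed (use that in auto)
qed

text \<open>The uniform limit of a bounded sequence in \<open>H2\<close> is known to be continuous
  only, so \<open>K\<close> has to be controlled on continuous functions. The image
  \<open>K g\<close> of the limit nevertheless lies in \<open>H2\<close> and serves as the limit of
  the images.\<close>

lemma compact_operator_onI:
  assumes L: "L > 0"
    and K: "\<And>f B. continuous_on {0..L} f \<Longrightarrow> (\<And>t. t \<in> {0..L} \<Longrightarrow> norm (f t) \<le> B) \<Longrightarrow>
      K f \<in> H2 L \<and> H2_norm L (K f) \<le> C * B"
    and lin: "\<And>f g a b. continuous_on {0..L} f \<Longrightarrow> continuous_on {0..L} g \<Longrightarrow>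
      K (\<lambda>x. a * f x + b * g x) = (\<lambda>x. a * K f x + b * K g x)"
  shows "compact_operator_on (H2 L) (H2_norm L) K"
proof -
  have c: "continuous_on {0..L} f" if "f \<in> H2 L" for f using H2D[OF that] by blast
  have "\<exists>g\<in>H2 L. \<exists>r. strict_mono r \<and> (\<lambda>n. H2_norm L (\<lambda>x. K (f (r n)) x - g x)) \<longlonglongrightarrow> 0"
    if f: "range f \<subseteq> H2 L" "bounded (range (\<lambda>n. H2_norm L (f n)))" for f :: "nat \<Rightarrow> real \<Rightarrow> complex"
  proof -
    obtain g r where g: "continuous_on {0..L} g" "strict_mono (r :: nat \<Rightarrow> nat)"
      "\<And>e. e > 0 \<Longrightarrow> \<exists>N. \<forall>n t. n \<ge> N \<and> t \<in> {0..L} \<longrightarrow> norm (f (r n) t - g t) < e"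
      using H2_compact[OF L f] by metis
    have fc: "continuous_on {0..L} (f n)" for n using f c by blast
    have eq: "(\<lambda>x. K (f n) x - K g x) = K (\<lambda>x. f n x - g x)" for n
      using lin[OF fc[of n] g(1), of 1 "-1"] by (simp add: algebra_simps)
    have dc: "continuous_on {0..L} (\<lambda>x. f n x - g x)" for n by (intro continuous_intros fc g)
    have "(\<lambda>n. H2_norm L (\<lambda>x. K (f (r n)) x - K g x)) \<longlonglongrightarrow> 0"
    proof (rule LIMSEQ_I)
      fix e :: real assume e: "e > 0"
      define d where "d = e / (\<bar>C\<bar> + 1)"
      have d: "d > 0" using e by (simp add: d_def)
      obtain N where N: "\<And>n t. n \<ge> N \<Longrightarrow> t \<in> {0..L} \<Longrightarrow> norm (f (r n) t - g t) < d" using g(3)[OF d] by blast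
      have "norm (H2_norm L (\<lambda>x. K (f (r n)) x - K g x) - 0) < e" if n: "n \<ge> N" for n
      proof -
        have "H2_norm L (K (\<lambda>x. f (r n) x - g x)) \<le> C * d"
          using K[OF dc, of "r n" d] N[OF n] by (simp add: less_imp_le)
        also have "\<dots> \<le> \<bar>C\<bar> * d" using d by (intro mult_right_mono) auto
        also have "\<dots> < (\<bar>C\<bar> + 1) * d" using d by (simp add: algebra_simps)
        also have "\<dots> = e" by (simp add: d_def)
        finally have "H2_norm L (K (\<lambda>x. f (r n) x - g x)) < e" .
        moreover have "H2_norm L h \<ge> 0" for h unfolding H2_norm_def
          by (intro real_sqrt_ge_zero sum_nonneg Bochner_Integration.integral_nonneg) auto
        ultimately show ?thesis by (simp add: eq)
      qed
      then show "\<exists>N. \<forall>n\<ge>N. norm (H2_norm L (\<lambda>x. K (f (r n)) x - K g x) - 0) < e" by blast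
    qed
    moreover have "K g \<in> H2 L"
    proof -
      obtain B where "\<And>t. t \<in> {0..L} \<Longrightarrow> norm (g t) \<le> B" using continuous_bounded_Icc[OF g(1)] by metis
      then show ?thesis using K[OF g(1)] by blast
    qed
    ultimately show ?thesis using g(2) by blast
  qed
  moreover have "K f \<in> H2 L" if fH: "f \<in> H2 L" for f
  proof -
    obtain B where "\<And>t. t \<in> {0..L} \<Longrightarrow> norm (f t) \<le> B" using continuous_bounded_Icc[OF c[OF fH]] by metis
    then show ?thesis using K[OF c[OF fH]] by blast
  qed
  ultimately show ?thesis
    unfolding compact_operator_on_def linear_operator_on_def using lin c by blast
qed

section \<open>Integrals of periodic functions\<close>

lemma integrable_lebesgue_on_iff_absolutely_integrable:
  fixes f :: "real \<Rightarrow> 'a::euclidean_space"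
  shows "integrable (lebesgue_on {a..b}) f \<longleftrightarrow> f absolutely_integrable_on {a..b}"
  unfolding set_integrable_def by (rule integrable_restrict_space) auto

lemma absolutely_integrable_combine_Icc:
  fixes f :: "real \<Rightarrow> 'a::euclidean_space"
  assumes "f absolutely_integrable_on {a..b}" "f absolutely_integrable_on {b..c}" "a \<le> b" "b \<le> c"
  shows "f absolutely_integrable_on {a..c}"
  using set_integrable_Un[OF assms(1,2)] assms(3,4) by (simp add: ivl_disj_un_two_touch)

lemma absolutely_integrable_shift_Icc:
  fixes f :: "real \<Rightarrow> 'a::euclidean_space"
  assumes "f absolutely_integrable_on {a..b}" "\<And>t. f (t + p) = f t"
  shows "f absolutely_integrable_on {a + p..b + p}" "integral {a + p..b + p} f = integral {a..b} f"
proof -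
  have "f \<circ> (+) p = f" "(\<lambda>t. norm (f t)) \<circ> (+) p = (\<lambda>t. norm (f t))"
    using assms(2) by (auto simp: fun_eq_iff add.commute)
  then show "f absolutely_integrable_on {a + p..b + p}" "integral {a + p..b + p} f = integral {a..b} f"
    using assms(1) integrable_on_shift_Icc_real[of f p a b] integrable_on_shift_Icc_real[of "\<lambda>t. norm (f t)" p a b]
      integral_shift_Icc_real[of a b f p] by (auto simp: absolutely_integrable_on_def)
qed

text \<open>Lets the window of integration start wherever a kernel is easiest to handle: at its
  jump, or half a period before its singularity.\<close>

lemma periodic_integral_shift:
  fixes f :: "real \<Rightarrow> 'a::euclidean_space"
  assumes L: "L > 0" and per: "\<And>t. f (t + L) = f t" and i: "integrable (lebesgue_on {a..a + L}) f"
  shows "integrable (lebesgue_on {b..b + L}) f"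
    "(LINT t|lebesgue_on {b..b + L}. f t) = (LINT t|lebesgue_on {a..a + L}. f t)"
proof -
  define n where "n = \<lfloor>(b - a) / L\<rfloor>"
  \<comment> \<open>\<open>c\<close> is the translate of \<open>b\<close> by whole periods that
    falls into the given window. The piece to the left of \<open>c\<close> is moved one period to
    the right.\<close>
  define c where "c = b - of_int n * L"
  have c: "a \<le> c" "c \<le> a + L"
  proof -
    have "of_int n \<le> (b - a) / L" "(b - a) / L < of_int n + 1"
      unfolding n_def using floor_correct[of "(b - a) / L"] by auto
    then have "of_int n * L \<le> b - a" "b - a < (of_int n + 1) * L"
      using L by (simp_all add: pos_le_divide_eq pos_divide_less_eq)
    then show "a \<le> c" "c \<le> a + L" by (auto simp: c_def algebra_simps)
  qed
  have pern: "f (t + of_int m * L) = f t" for t and m :: int by (rule shift_of_int[where f = f, OF per])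
  have A: "f absolutely_integrable_on {a..a + L}" using i integrable_lebesgue_on_iff_absolutely_integrable by blast
  have A1: "f absolutely_integrable_on {a..c}" and A2: "f absolutely_integrable_on {c..a + L}"
    by (rule absolutely_integrable_on_subinterval[OF A]; use c in auto)+
  note A3 = absolutely_integrable_shift_Icc[OF A1 per]
  have A4: "f absolutely_integrable_on {c..c + L}"
    by (rule absolutely_integrable_combine_Icc[OF A2 A3(1)]) (use c in auto)
  have "integral {c..c + L} f = integral {c..a + L} f + integral {a + L..c + L} f"
    by (rule Henstock_Kurzweil_Integration.integral_combine[symmetric])
       (use c A4 in \<open>auto simp: absolutely_integrable_on_def\<close>)
  also have "\<dots> = integral {a..c} f + integral {c..a + L} f" by (simp add: A3)
  also have "\<dots> = integral {a..a + L} f"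
    by (rule Henstock_Kurzweil_Integration.integral_combine)
       (use c A in \<open>auto simp: absolutely_integrable_on_def\<close>)
  finally have e: "integral {c..c + L} f = integral {a..a + L} f" .
  note A5 = absolutely_integrable_shift_Icc[OF A4 pern[of _ n]]
  have "c + of_int n * L = b" "c + L + of_int n * L = b + L" by (auto simp: c_def)
  with A5 have A6: "f absolutely_integrable_on {b..b + L}" "integral {b..b + L} f = integral {a..a + L} f"
    by (auto simp: e)
  then show 1: "integrable (lebesgue_on {b..b + L}) f" using integrable_lebesgue_on_iff_absolutely_integrable by blast
  show "(LINT t|lebesgue_on {b..b + L}. f t) = (LINT t|lebesgue_on {a..a + L}. f t)"
    using A6(2) lebesgue_integral_eq_integral[OF 1] lebesgue_integral_eq_integral[OF i] by simp
qed

lemma AE_lebesgue_on_notin_countable: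
  fixes S :: "real set"
  assumes "countable S" "A \<in> sets lebesgue" shows "AE t in lebesgue_on A. t \<notin> S"
proof -
  have "S \<in> null_sets lebesgue"
    by (intro null_sets_completionI countable_imp_null_set_lborel assms)
  then have "AE t in lebesgue. t \<notin> S" by (rule AE_not_in)
  then show ?thesis using assms(2) by (subst AE_restrict_space_iff) auto
qed

text \<open>\<open>F\<close> is the continuous extension of \<open>f\<close> to one closed period; its values at the two ends may differ.\<close>

lemma periodic_integration_by_parts:
  fixes f f' F :: "real \<Rightarrow> complex"
  assumes L: "L > 0" and per: "\<And>t. f (t + L) = f t" "\<And>t. f' (t + L) = f' t"
    and S: "finite S" and F: "continuous_on {a..a + L} F"
    and eq: "\<And>s. s \<in> {a<..<a + L} - S \<Longrightarrow> F s = f s"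
    and deriv: "\<And>s. s \<in> {a<..<a + L} - S \<Longrightarrow> (F has_vector_derivative f' s) (at s)"
    and mf: "f \<in> borel_measurable (lebesgue_on {a..a + L})"
    and i: "integrable (lebesgue_on {a..a + L}) f'" and \<phi>: "smooth \<phi>" "periodic L \<phi>"
  shows "(LINT s|lebesgue_on {0..L}. f s * vderiv \<phi> s) =
    (F (a + L) - F a) * \<phi> a - (LINT s|lebesgue_on {0..L}. f' s * \<phi> s)"
proof -
  let ?N = "lebesgue_on {a..a + L}"
  have cv: "continuous_on {a..a + L} (vderiv \<phi>)" and cp: "continuous_on {a..a + L} \<phi>"
    by (intro smooth_continuous_on smooth_vderiv \<phi>)+
  have iF: "integrable ?N (\<lambda>s. F s * vderiv \<phi> s)"
    by (intro continuous_imp_integrable_lebesgue_on continuous_intros F cv)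
  \<comment> \<open>\<open>F\<close> and \<open>f\<close> can disagree only on \<open>S\<close> and
    at the two ends, a null set.\<close>
  have ae: "AE s in ?N. F s * vderiv \<phi> s = f s * vderiv \<phi> s"
  proof -
    have "AE s in ?N. s \<notin> S \<union> {a, a + L}"
      by (rule AE_lebesgue_on_notin_countable) (use S in \<open>auto intro: countable_finite\<close>)
    moreover have "AE s in ?N. s \<in> space ?N" by (rule AE_space)
    ultimately show ?thesis by eventually_elim (use eq in auto)
  qed
  have m: "(\<lambda>s. f s * vderiv \<phi> s) \<in> borel_measurable ?N"
    by (intro borel_measurable_times mf continuous_imp_measurable_lebesgue_on cv)
  have if': "integrable ?N (\<lambda>s. f s * vderiv \<phi> s)"
    using iF integrable_cong_AE[OF borel_measurable_integrable[OF iF] m ae] by simp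
  have eq1: "(LINT s|?N. f s * vderiv \<phi> s) = (LINT s|?N. F s * vderiv \<phi> s)"
    by (rule integral_cong_AE[OF m borel_measurable_integrable[OF iF]]) (use ae in \<open>auto elim: eventually_mono\<close>)
  obtain B where "\<And>t. t \<in> {a..a + L} \<Longrightarrow> norm (\<phi> t) \<le> B" using continuous_bounded_Icc[OF cp] by metis
  then have i1: "integrable ?N (\<lambda>s. f' s * \<phi> s)"
    by (intro integrable_mult_bounded[OF i] continuous_imp_measurable_lebesgue_on[OF cp]) auto
  define y where "y = F (a + L) * \<phi> (a + L) - F a * \<phi> a - (LINT s|?N. F s * vderiv \<phi> s)"
  have "((\<lambda>s. f' s * \<phi> s) has_integral y) {a..a + L}"
  \<comment> \<open>The rule tolerates finitely many points at which the continuous \<open>F\<close>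
    has no derivative; the diagonal will be such a point.\<close>
  proof (rule integration_by_parts_interior_strong[OF bounded_bilinear_mult S])
    show "((\<lambda>x. F x * vderiv \<phi> x) has_integral F (a + L) * \<phi> (a + L) - F a * \<phi> a - y) {a..a + L}"
      using has_integral_integral_lebesgue_on[OF iF] by (simp add: y_def)
  qed (use L F cp deriv smooth_has_vderiv[OF \<phi>(1)] in auto)
  then have "(LINT s|?N. f' s * \<phi> s) = y"
    using lebesgue_integral_eq_integral[OF i1] by (simp add: integral_unique)
  moreover have "\<phi> (a + L) = \<phi> a" using \<phi>(2) by (simp add: periodic_def)
  ultimately have "(LINT s|?N. f s * vderiv \<phi> s) = (F (a + L) - F a) * \<phi> a - (LINT s|?N. f' s * \<phi> s)"
    using eq1 by (simp add: y_def algebra_simps)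
  moreover have "\<And>t. f (t + L) * vderiv \<phi> (t + L) = f t * vderiv \<phi> t" "\<And>t. f' (t + L) * \<phi> (t + L) = f' t * \<phi> t"
    using per periodic_vderiv[OF \<phi>] \<phi>(2) by (auto simp: periodic_def)
  ultimately show ?thesis
    using periodic_integral_shift(2)[OF L _ if', of 0] periodic_integral_shift(2)[OF L _ i1, of 0] by simp
qed

section \<open>Integral operators\<close>

definition integral_op :: "real \<Rightarrow> (real \<Rightarrow> real \<Rightarrow> complex) \<Rightarrow> (real \<Rightarrow> complex) \<Rightarrow> real \<Rightarrow> complex" where
  "integral_op L K \<sigma> s = (LINT t|lebesgue_on {0..L}. K s t * \<sigma> t)"

text \<open>Integrals of the norm in \<open>t\<close>, bounded uniformly in \<open>s\<close>, are
  what makes the operator bounded in the supremum norm. Joint Borel measurability is inherited from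
  the geometry by composition and passes to products of \<open>lebesgue_on\<close> spaces.\<close>

definition bounded_kernel :: "real \<Rightarrow> (real \<Rightarrow> real \<Rightarrow> complex) \<Rightarrow> real \<Rightarrow> bool" where
  "bounded_kernel L K C \<longleftrightarrow> (\<lambda>(s, t). K s t) \<in> borel_measurable (borel \<Otimes>\<^sub>M borel) \<and>
     (\<forall>s. integrable (lebesgue_on {0..L}) (K s) \<and> (LINT t|lebesgue_on {0..L}. norm (K s t)) \<le> C)"

definition bounded_density :: "real \<Rightarrow> (real \<Rightarrow> complex) \<Rightarrow> real \<Rightarrow> bool" where
  "bounded_density L \<sigma> B \<longleftrightarrow> \<sigma> \<in> borel_measurable (lebesgue_on {0..L}) \<and> (\<forall>t\<in>{0..L}. norm (\<sigma> t) \<le> B)"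

lemma bounded_kernelD:
  assumes "bounded_kernel L K C"
  shows "(\<lambda>x. K (fst x) (snd x)) \<in> borel_measurable (borel \<Otimes>\<^sub>M borel)"
    "integrable (lebesgue_on {0..L}) (K s)" "(LINT t|lebesgue_on {0..L}. norm (K s t)) \<le> C" "0 \<le> C"
proof -
  show "(\<lambda>x. K (fst x) (snd x)) \<in> borel_measurable (borel \<Otimes>\<^sub>M borel)"
    "integrable (lebesgue_on {0..L}) (K s)" and 1: "(LINT t|lebesgue_on {0..L}. norm (K s t)) \<le> C"
    using assms by (auto simp: bounded_kernel_def case_prod_unfold)
  have "0 \<le> (LINT t|lebesgue_on {0..L}. norm (K s t))" by (intro Bochner_Integration.integral_nonneg) auto
  with 1 show "0 \<le> C" by linarith
qed

lemma bounded_densityD: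
  assumes "bounded_density L \<sigma> B"
  shows "\<sigma> \<in> borel_measurable (lebesgue_on {0..L})" "\<And>t. t \<in> {0..L} \<Longrightarrow> norm (\<sigma> t) \<le> B"
  using assms by (auto simp: bounded_density_def)

lemma continuous_bounded_density:
  "continuous_on {0..L} \<sigma> \<Longrightarrow> (\<And>t. t \<in> {0..L} \<Longrightarrow> norm (\<sigma> t) \<le> B) \<Longrightarrow> bounded_density L \<sigma> B"
  by (simp add: bounded_density_def continuous_imp_measurable_lebesgue_on)

lemma integral_op_integrable:
  assumes "bounded_kernel L K C" "bounded_density L \<sigma> B"
  shows "integrable (lebesgue_on {0..L}) (\<lambda>t. K s t * \<sigma> t)"
  by (rule integrable_mult_bounded[OF bounded_kernelD(2)[OF assms(1)] bounded_densityD(1)[OF assms(2)], of B])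
     (use bounded_densityD(2)[OF assms(2)] in auto)

lemma integral_op_norm_le:
  assumes L: "L > 0" and K: "bounded_kernel L K C" and \<sigma>: "bounded_density L \<sigma> B"
  shows "norm (integral_op L K \<sigma> s) \<le> C * B" "(LINT t|lebesgue_on {0..L}. norm (K s t * \<sigma> t)) \<le> C * B"
proof -
  have B: "B \<ge> 0" using bounded_densityD(2)[OF \<sigma>, of 0] L norm_ge_zero[of "\<sigma> 0"] by (simp del: norm_ge_zero)
  have "(LINT t|lebesgue_on {0..L}. norm (K s t * \<sigma> t)) \<le> (LINT t|lebesgue_on {0..L}. norm (K s t) * B)"
  proof (rule Bochner_Integration.integral_mono)
    show "integrable (lebesgue_on {0..L}) (\<lambda>t. norm (K s t * \<sigma> t))"
      by (intro integrable_norm integral_op_integrable[OF K \<sigma>])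
    show "integrable (lebesgue_on {0..L}) (\<lambda>t. norm (K s t) * B)"
      by (intro integrable_mult_left integrable_norm bounded_kernelD(2)[OF K])
  qed (use bounded_densityD(2)[OF \<sigma>] in \<open>auto simp: norm_mult intro: mult_left_mono\<close>)
  also have "\<dots> \<le> C * B" using bounded_kernelD(3)[OF K] B by (simp add: mult_right_mono)
  finally show le: "(LINT t|lebesgue_on {0..L}. norm (K s t * \<sigma> t)) \<le> C * B" .
  show "norm (integral_op L K \<sigma> s) \<le> C * B" unfolding integral_op_def
    by (rule order_trans[OF integral_norm_bound le])
qed

lemma borel_measurable_lebesgue_on_borel:
  "f \<in> borel_measurable borel \<Longrightarrow> f \<in> borel_measurable (lebesgue_on A)"
  by (intro measurable_restrict_space1 measurable_completion) simp

lemma borel_kernel_measurable: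
  fixes K :: "real \<Rightarrow> real \<Rightarrow> complex"
  assumes "(\<lambda>x. K (fst x) (snd x)) \<in> borel_measurable (borel \<Otimes>\<^sub>M borel)"
  shows "(\<lambda>x. K (fst x) (snd x)) \<in> borel_measurable (lebesgue_on A \<Otimes>\<^sub>M lebesgue_on B)"
proof -
  have id: "(\<lambda>x. x) \<in> lebesgue_on A \<rightarrow>\<^sub>M borel" for A :: "real set"
    using id_borel_measurable_lebesgue_on[of A] by (simp add: id_def)
  have [measurable]: "fst \<in> lebesgue_on A \<Otimes>\<^sub>M lebesgue_on B \<rightarrow>\<^sub>M (borel :: real measure)"
    "snd \<in> lebesgue_on A \<Otimes>\<^sub>M lebesgue_on B \<rightarrow>\<^sub>M (borel :: real measure)"
    by (auto intro: measurable_compose[OF measurable_fst id] measurable_compose[OF measurable_snd id])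
  have "(\<lambda>x. (fst x, snd x)) \<in> lebesgue_on A \<Otimes>\<^sub>M lebesgue_on B \<rightarrow>\<^sub>M (borel :: real measure) \<Otimes>\<^sub>M (borel :: real measure)"
    by measurable
  from measurable_compose[OF this assms] show ?thesis by simp
qed

lemma integral_op_bounded_density:
  assumes L: "L > 0" and K: "bounded_kernel L K C" and \<sigma>: "bounded_density L \<sigma> B"
  shows "bounded_density L (integral_op L K \<sigma>) (C * B)"
proof -
  let ?M = "lebesgue_on {0..L}"
  interpret finite_measure ?M by (rule finite_measure_Icc)
  have [measurable]: "\<sigma> \<in> borel_measurable ?M" by (rule bounded_densityD(1)[OF \<sigma>])
  have [measurable]: "(\<lambda>x. K (fst x) (snd x)) \<in> borel_measurable (?M \<Otimes>\<^sub>M ?M)"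
    by (rule borel_kernel_measurable[OF bounded_kernelD(1)[OF K]])
  have "(\<lambda>s. LINT t|?M. K s t * \<sigma> t) \<in> borel_measurable ?M"
    by (rule borel_measurable_lebesgue_integral) (simp add: case_prod_unfold)
  then show ?thesis
    using integral_op_norm_le(1)[OF L K \<sigma>] by (simp add: bounded_density_def integral_op_def[abs_def])
qed

lemma smooth_bounded_density:
  assumes "smooth \<phi>" obtains B where "bounded_density L \<phi> B"
  using continuous_bounded_Icc[OF smooth_continuous_on[OF assms], of 0 L]
    continuous_bounded_density[OF smooth_continuous_on[OF assms]] by metis

lemma integral_op_fubini:
  assumes L: "L > 0" and K: "bounded_kernel L K C" and \<sigma>: "bounded_density L \<sigma> B" and \<phi>: "bounded_density L \<phi> B'"
  shows "(LINT s|lebesgue_on {0..L}. integral_op L K \<sigma> s * \<phi> s) =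
      (LINT t|lebesgue_on {0..L}. \<sigma> t * (LINT s|lebesgue_on {0..L}. K s t * \<phi> s))"
    "integrable (lebesgue_on {0..L}) (\<lambda>t. \<sigma> t * (LINT s|lebesgue_on {0..L}. K s t * \<phi> s))"
proof -
  let ?M = "lebesgue_on {0..L}"
  have [measurable]: "\<sigma> \<in> borel_measurable ?M" "\<phi> \<in> borel_measurable ?M"
    by (rule bounded_densityD(1)[OF \<sigma>] bounded_densityD(1)[OF \<phi>])+
  have [measurable]: "(\<lambda>x. K (fst x) (snd x)) \<in> borel_measurable (?M \<Otimes>\<^sub>M ?M)"
    by (rule borel_kernel_measurable[OF bounded_kernelD(1)[OF K]])
  have 1: "(LINT s|?M. integral_op L K \<sigma> s * \<phi> s) = (LINT s|?M. LINT t|?M. K s t * \<sigma> t * \<phi> s)"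
    unfolding integral_op_def by (intro Bochner_Integration.integral_cong refl integral_mult_left_zero[symmetric])
  have 2: "(LINT s|?M. K s t * \<sigma> t * \<phi> s) = \<sigma> t * (LINT s|?M. K s t * \<phi> s)" for t
    unfolding mult.commute[of "K _ _" "\<sigma> _"] mult.assoc by (rule integral_mult_right_zero)
  have m: "(\<lambda>(s, t). K s t * \<sigma> t * \<phi> s) \<in> borel_measurable (?M \<Otimes>\<^sub>M ?M)"
    unfolding case_prod_unfold by measurable
  have int: "integrable ?M (\<lambda>t. K s t * \<sigma> t * \<phi> s)" for s
    by (intro integrable_mult_left integral_op_integrable[OF K \<sigma>])
  have bd: "(LINT t|?M. norm (K s t * \<sigma> t * \<phi> s)) \<le> C * B * B'" if s: "s \<in> space ?M" for s
  proof -
    have "(LINT t|?M. norm (K s t * \<sigma> t * \<phi> s)) = (LINT t|?M. norm (K s t * \<sigma> t)) * norm (\<phi> s)"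
      unfolding norm_mult[of _ "\<phi> s"] by (rule integral_mult_left_zero)
    also have "\<dots> \<le> (C * B) * B'"
    proof (rule mult_mono)
      show "(LINT t|?M. norm (K s t * \<sigma> t)) \<le> C * B" by (rule integral_op_norm_le(2)[OF L K \<sigma>])
      then show "0 \<le> C * B" by (rule order_trans[rotated]) (intro Bochner_Integration.integral_nonneg, auto)
    qed (use s bounded_densityD(2)[OF \<phi>] in auto)
    finally show ?thesis .
  qed
  note fub = fubini_bounded[OF finite_measure_Icc finite_measure_Icc m int bd, unfolded 2]
  show "(LINT s|?M. integral_op L K \<sigma> s * \<phi> s) = (LINT t|?M. \<sigma> t * (LINT s|?M. K s t * \<phi> s))"
    using fub(1) 1 by simp
  show "integrable ?M (\<lambda>t. \<sigma> t * (LINT s|?M. K s t * \<phi> s))" by (rule fub(2))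
qed

lemma bounded_density_square_integrable: "bounded_density L f B \<Longrightarrow> square_integrable L f"
  by (rule bounded_imp_square_integrable) (auto simp: bounded_density_def)

text \<open>By Fubini a weak derivative of the potential reduces to one of the kernel in its first
  variable, for each fixed \<open>t\<close>.\<close>

lemma integral_op_weak_deriv:
  assumes L: "L > 0" and K: "bounded_kernel L K C" "bounded_kernel L K' C'" and \<sigma>: "bounded_density L \<sigma> B"
    and weak: "\<And>t \<phi>. t \<in> {0..L} \<Longrightarrow> smooth \<phi> \<Longrightarrow> periodic L \<phi> \<Longrightarrow>
      (LINT s|lebesgue_on {0..L}. K s t * (vderiv ^^ m) \<phi> s) = (- 1) ^ m * (LINT s|lebesgue_on {0..L}. K' s t * \<phi> s)"
  shows "has_weak_deriv L m (integral_op L K \<sigma>) (integral_op L K' \<sigma>)"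
  unfolding has_weak_deriv_def
proof (intro conjI allI impI)
  show "square_integrable L (integral_op L K' \<sigma>)"
    by (rule bounded_density_square_integrable[OF integral_op_bounded_density[OF L K(2) \<sigma>]])
  fix \<phi> assume \<phi>: "smooth \<phi> \<and> periodic L \<phi>"
  have "smooth ((vderiv ^^ m) \<phi>)" using \<phi> by (induction m) (auto intro: smooth_vderiv)
  then obtain B1 where B1: "bounded_density L ((vderiv ^^ m) \<phi>) B1" by (rule smooth_bounded_density)
  obtain B2 where B2: "bounded_density L \<phi> B2" using \<phi> smooth_bounded_density by blast
  have "(LINT t|lebesgue_on {0..L}. \<sigma> t * (LINT s|lebesgue_on {0..L}. K s t * (vderiv ^^ m) \<phi> s)) =
    (LINT t|lebesgue_on {0..L}. (- 1) ^ m * (\<sigma> t * (LINT s|lebesgue_on {0..L}. K' s t * \<phi> s)))"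
    by (rule Bochner_Integration.integral_cong) (use weak \<phi> in auto)
  then show "(LINT t|lebesgue_on {0..L}. integral_op L K \<sigma> t * (vderiv ^^ m) \<phi> t) =
    (- 1) ^ m * (LINT t|lebesgue_on {0..L}. integral_op L K' \<sigma> t * \<phi> t)"
    using integral_op_fubini(1)[OF L K(1) \<sigma> B1] integral_op_fubini(1)[OF L K(2) \<sigma> B2] by simp
qed

text \<open>Dominated convergence. The exceptional null set may depend on \<open>s\<close>, as it
  does for a kernel that jumps or is undefined on the diagonal.\<close>

lemma integral_op_continuous:
  assumes K: "bounded_kernel L K C" and \<sigma>: "bounded_density L \<sigma> B"
    and bd: "\<And>s. AE t in lebesgue_on {0..L}. norm (K s t) \<le> C'"
    and cont: "\<And>s. AE t in lebesgue_on {0..L}. isCont (\<lambda>s. K s t) s"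
  shows "continuous_on UNIV (integral_op L K \<sigma>)"
proof (rule continuous_at_imp_continuous_on, rule ballI)
  fix s :: real
  let ?M = "lebesgue_on {0..L}"
  interpret finite_measure ?M by (rule finite_measure_Icc)
  show "isCont (integral_op L K \<sigma>) s"
  proof (rule continuous_at_sequentiallyI)
    fix u assume u: "u \<longlonglongrightarrow> s"
    show "(\<lambda>n. integral_op L K \<sigma> (u n)) \<longlonglongrightarrow> integral_op L K \<sigma> s"
      unfolding integral_op_def
    proof (rule integral_dominated_convergence[where w = "\<lambda>t. C' * B"])
      show "(\<lambda>t. K s t * \<sigma> t) \<in> borel_measurable ?M" "(\<lambda>t. K (u n) t * \<sigma> t) \<in> borel_measurable ?M" for n
        using integral_op_integrable[OF K \<sigma>] by auto
      show "AE t in ?M. (\<lambda>n. K (u n) t * \<sigma> t) \<longlonglongrightarrow> K s t * \<sigma> t"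
        using cont[of s]
      proof eventually_elim
        case (elim t)
        then show ?case by (intro tendsto_mult tendsto_const isCont_tendsto_compose[OF _ u])
      qed
      show "AE t in ?M. norm (K (u n) t * \<sigma> t) \<le> C' * B" for n
        using bd[of "u n"] AE_space
      proof eventually_elim
        case (elim t)
        then have "0 \<le> C'" by (meson norm_ge_zero order_trans)
        with elim show ?case using bounded_densityD(2)[OF \<sigma>, of t] by (auto simp: norm_mult intro!: mult_mono)
      qed
    qed simp
  qed
qed

lemma bounded_kernel_mult:
  assumes K: "bounded_kernel L K C" and [measurable]: "a \<in> borel_measurable borel" and a: "\<And>s. norm (a s) \<le> D"
  shows "bounded_kernel L (\<lambda>s t. a s * K s t) (D * C)"
  unfolding bounded_kernel_def
proof (intro conjI allI)
  note [measurable] = bounded_kernelD(1)[OF K]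
  show "(\<lambda>(s, t). a s * K s t) \<in> borel_measurable (borel \<Otimes>\<^sub>M borel)" unfolding case_prod_unfold by measurable
  fix s
  show "integrable (lebesgue_on {0..L}) (\<lambda>t. a s * K s t)" using bounded_kernelD(2)[OF K] by simp
  have "D \<ge> 0" using a[of 0] norm_ge_zero order_trans by blast
  then show "(LINT t|lebesgue_on {0..L}. norm (a s * K s t)) \<le> D * C"
    using bounded_kernelD(3)[OF K, of s] a[of s]
    by (simp add: norm_mult mult_mono Bochner_Integration.integral_nonneg)
qed

section \<open>The periodic Green's operator\<close>

text \<open>Closed form of the series of images on one period: the two exponentials sum the images
  on either side, and the denominator comes from the two geometric series.\<close>

definition green_profile :: "real \<Rightarrow> complex \<Rightarrow> real \<Rightarrow> complex" where
  "green_profile L k x = (exp (\<i> * k * x) + exp (\<i> * k * (L - x))) / (2 * \<i> * k * (1 - exp (\<i> * k * L)))"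

definition green_profile' :: "real \<Rightarrow> complex \<Rightarrow> real \<Rightarrow> complex" where
  "green_profile' L k x = (exp (\<i> * k * x) - exp (\<i> * k * (L - x))) / (2 * (1 - exp (\<i> * k * L)))"

definition period_part :: "real \<Rightarrow> real \<Rightarrow> real" where
  "period_part L x = x - L * \<lfloor>x / L\<rfloor>"

lemma period_part:
  assumes "L > 0"
  shows "0 \<le> period_part L x" "period_part L x < L" "period_part L (x + L) = period_part L x"
    "0 \<le> x \<Longrightarrow> x < L \<Longrightarrow> period_part L x = x"
proof -
  define n where "n = \<lfloor>x / L\<rfloor>"
  have "of_int n \<le> x / L" "x / L < of_int n + 1" unfolding n_def using floor_correct[of "x / L"] by auto
  then have "of_int n * L \<le> x" "x < (of_int n + 1) * L"
    using assms by (simp_all add: pos_le_divide_eq pos_divide_less_eq)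
  then show "0 \<le> period_part L x" "period_part L x < L"
    by (auto simp: period_part_def n_def[symmetric] algebra_simps)
  have "(x + L) / L = x / L + 1" using assms by (simp add: add_divide_distrib)
  then show "period_part L (x + L) = period_part L x" by (simp add: period_part_def algebra_simps)
  assume "0 \<le> x" "x < L"
  then have "\<lfloor>x / L\<rfloor> = 0" using assms by (simp add: floor_eq_iff)
  then show "period_part L x = x" by (simp add: period_part_def)
qed

lemma exp_kL: assumes "L > 0" "Im k > 0" shows "norm (exp (\<i> * k * complex_of_real L)) < 1" "exp (\<i> * k * complex_of_real L) \<noteq> 1"
proof -
  show 1: "norm (exp (\<i> * k * complex_of_real L)) < 1" using assms by (simp add: norm_exp_eq_Re)
  then show "exp (\<i> * k * complex_of_real L) \<noteq> 1" by force
qed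

text \<open>For \<open>x\<close> in one period the absolute value resolves with one sign for
  \<open>l \<le> 0\<close> and the other for \<open>l \<ge> 1\<close>. Each half is a geometric
  series whose ratio has norm below \<open>1\<close> because \<open>Im k > 0\<close>.\<close>

lemma surface_green_eq:
  assumes L: "L > 0" and k: "Im k > 0"
  shows "surface_green L k s t = green_profile L k (period_part L (s - t))"
proof -
  define x where "x = period_part L (s - t)"
  define n where "n = \<lfloor>(s - t) / L\<rfloor>"
  have x: "0 \<le> x" "x < L" unfolding x_def by (rule period_part[OF L])+
  have st: "s - t = x + of_int n * L" by (simp add: x_def n_def period_part_def)
  define E where "E = exp (\<i> * k * complex_of_real L)"
  have E: "norm E < 1" "E \<noteq> 1" unfolding E_def using exp_kL[OF L k] .
  have geo: "((\<lambda>m. c * E ^ m) has_sum c / (1 - E)) UNIV" for c :: complex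
  proof (rule norm_summable_imp_has_sum)
    show "summable (\<lambda>m. norm (c * E ^ m))"
      unfolding norm_mult norm_power using E by (intro summable_mult summable_geometric) auto
    show "(\<lambda>m. c * E ^ m) sums (c / (1 - E))"
      using sums_mult[OF geometric_sums[OF E(1)], of c] by simp
  qed
  define f where "f = (\<lambda>l::int. exp (\<i> * k * complex_of_real \<bar>x - of_int l * L\<bar>))"
  have E_pow: "E ^ m = exp (\<i> * k * of_real (real m * L))" for m
    by (simp add: E_def flip: exp_of_nat_mult) (simp add: mult_ac)
  have "(f has_sum exp (\<i> * k * x) / (1 - E)) (range (\<lambda>m::nat. - int m))"
  proof (subst has_sum_reindex)
    have "f (- int m) = exp (\<i> * k * x) * E ^ m" for m
    proof -
      have "\<bar>x - of_int (- int m) * L\<bar> = x + real m * L" using x L by simp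
      then show ?thesis unfolding f_def E_pow by (simp add: distrib_left exp_add)
    qed
    then show "(f \<circ> (\<lambda>m. - int m) has_sum exp (\<i> * k * x) / (1 - E)) UNIV" using geo by (simp add: o_def)
  qed (auto simp: inj_def)
  moreover have "(f has_sum exp (\<i> * k * (L - x)) / (1 - E)) (range (\<lambda>m::nat. 1 + int m))"
  proof (subst has_sum_reindex)
    have "f (1 + int m) = exp (\<i> * k * (L - x)) * E ^ m" for m
    proof -
      have nn: "real m * L \<ge> 0" using L by simp
      have eq: "x - of_int (1 + int m) * L = - ((L - x) + real m * L)" by (simp add: algebra_simps)
      have "\<bar>x - of_int (1 + int m) * L\<bar> = (L - x) + real m * L"
        unfolding eq abs_minus_cancel using nn x by (intro abs_of_nonneg) linarith
      then show ?thesis unfolding f_def E_pow by (simp add: distrib_left exp_add)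
    qed
    then show "(f \<circ> (\<lambda>m. 1 + int m) has_sum exp (\<i> * k * (L - x)) / (1 - E)) UNIV" using geo by (simp add: o_def)
  qed (auto simp: inj_def)
  moreover have "range (\<lambda>m::nat. - int m) \<inter> range (\<lambda>m::nat. 1 + int m) = {}" by auto
  ultimately have "(f has_sum exp (\<i> * k * x) / (1 - E) + exp (\<i> * k * (L - x)) / (1 - E))
    (range (\<lambda>m::nat. - int m) \<union> range (\<lambda>m::nat. 1 + int m))" by (rule has_sum_Un_disjoint)
  moreover have "range (\<lambda>m::nat. - int m) \<union> range (\<lambda>m::nat. 1 + int m) = UNIV"
  proof -
    have "l \<in> range (\<lambda>m::nat. - int m) \<union> range (\<lambda>m::nat. 1 + int m)" for l :: int
    proof (cases "l \<le> 0")
      case True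
      then have "l = - int (nat (- l))" by simp
      then show ?thesis by blast
    next
      case False
      then have "l = 1 + int (nat (l - 1))" by simp
      then show ?thesis by blast
    qed
    then show ?thesis by blast
  qed
  ultimately have f: "infsum f UNIV = exp (\<i> * k * x) / (1 - E) + exp (\<i> * k * (L - x)) / (1 - E)"
    by (metis infsumI)
  \<comment> \<open>Shifting the summation index by the whole number of periods in
    \<open>s - t\<close> reduces to the fundamental period.\<close>
  have "(\<Sum>\<^sub>\<infinity>l::int. exp (\<i> * k * complex_of_real \<bar>s - t - of_int l * L\<bar>)) = (\<Sum>\<^sub>\<infinity>l. f (l - n))"
    unfolding f_def st by (simp add: algebra_simps)
  also have "\<dots> = infsum f UNIV"
    by (rule infsum_reindex_bij_betw) (rule bij_betwI[of _ _ _ "\<lambda>l. l + n"], auto)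
  finally show ?thesis
    unfolding surface_green_def f green_profile_def x_def[symmetric] E_def[symmetric]
    by (simp add: add_divide_distrib mult.commute)
qed

text \<open>The last two identities are the matching conditions at the diagonal: the profile closes
  up continuously, while its slope jumps by one. This jump is the source of the delta
  function.\<close>

lemma green_profile_deriv:
  assumes L: "L > 0" and k: "Im k > 0"
  shows "(green_profile L k has_vector_derivative green_profile' L k x) (at x)"
    "(green_profile' L k has_vector_derivative - k\<^sup>2 * green_profile L k x) (at x)"
    "green_profile L k L = green_profile L k 0" "green_profile' L k L - green_profile' L k 0 = - 1"
proof -
  have nz: "1 - exp (\<i> * k * L) \<noteq> 0" "k \<noteq> 0" using exp_kL(2)[OF L k] k by auto
  have d1: "((\<lambda>x. exp (\<i> * k * complex_of_real x)) has_vector_derivative \<i> * k * exp (\<i> * k * x)) (at x)"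
    using has_vector_derivative_exp_real[of "\<i> * k" 0] by simp
  have d2: "((\<lambda>x. exp (\<i> * k * (complex_of_real L - complex_of_real x))) has_vector_derivative - (\<i> * k) * exp (\<i> * k * (L - x))) (at x)"
    using has_vector_derivative_exp_real[of "- (\<i> * k)" "\<i> * k * L"] by (simp add: algebra_simps)
  have e: "complex_of_real (L - x) = complex_of_real L - complex_of_real x" for x by simp
  show "(green_profile L k has_vector_derivative green_profile' L k x) (at x)"
    unfolding green_profile_def[abs_def] e
    by (rule has_vector_derivative_eq_rhs[OF has_vector_derivative_divide[OF has_vector_derivative_add[OF d1 d2]]])
       (use nz in \<open>simp add: green_profile'_def field_simps\<close>)
  show "(green_profile' L k has_vector_derivative - k\<^sup>2 * green_profile L k x) (at x)"
    unfolding green_profile'_def[abs_def] e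
    by (rule has_vector_derivative_eq_rhs[OF has_vector_derivative_divide[OF has_vector_derivative_diff[OF d1 d2]]])
       (use nz in \<open>simp add: green_profile_def field_simps power2_eq_square\<close>)
  show "green_profile L k L = green_profile L k 0" by (simp add: green_profile_def add.commute)
  show "green_profile' L k L - green_profile' L k 0 = - 1" using nz
    by (simp add: green_profile'_def diff_divide_distrib[symmetric] field_simps)
qed

lemma periodic_kernel:
  assumes L: "L > 0" and P: "continuous_on UNIV P"
  shows "\<exists>C. bounded_kernel L (\<lambda>s t. P (period_part L (s - t)) :: complex) C \<and>
    (\<forall>s t. norm (P (period_part L (s - t))) \<le> C) \<and>
    (\<forall>s. AE t in lebesgue_on {0..L}. isCont (\<lambda>s. P (period_part L (s - t))) s)"
proof -
  interpret finite_measure "lebesgue_on {0..L}" by (rule finite_measure_Icc)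
  obtain C where C: "C > 0" "\<And>x. x \<in> {0..L} \<Longrightarrow> norm (P x) \<le> C"
    using continuous_bounded_Icc[OF continuous_on_subset[OF P subset_UNIV]] by metis
  have bd: "norm (P (period_part L (s - t))) \<le> C" for s t
    using period_part[OF L, of "s - t"] by (intro C) auto
  have [measurable]: "P \<in> borel_measurable borel" by (rule borel_measurable_continuous_onI[OF P])
  have [measurable]: "period_part L \<in> borel_measurable borel" unfolding period_part_def by measurable
  have m: "(\<lambda>(s, t). P (period_part L (s - t))) \<in> borel_measurable (borel \<Otimes>\<^sub>M borel)"
    unfolding case_prod_unfold by measurable
  have int: "integrable (lebesgue_on {0..L}) (\<lambda>t. P (period_part L (s - t)))" for s
  proof (rule integrable_const_bound[of _ C])
    have "(\<lambda>t. P (period_part L (s - t))) \<in> borel_measurable borel" by measurable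
    then show "(\<lambda>t. P (period_part L (s - t))) \<in> borel_measurable (lebesgue_on {0..L})"
      by (rule borel_measurable_lebesgue_on_borel)
  qed (use bd in auto)
  have "(LINT t|lebesgue_on {0..L}. norm (P (period_part L (s - t)))) \<le> C * L" for s
  proof -
    have "(LINT t|lebesgue_on {0..L}. norm (P (period_part L (s - t)))) \<le> (LINT t|lebesgue_on {0..L}. C)"
      using int bd by (intro Bochner_Integration.integral_mono) auto
    then show ?thesis using L by (simp add: measure_restrict_space mult.commute)
  qed
  \<comment> \<open>A single constant dominates both the integral bound \<open>C * L\<close> and the
    pointwise bound \<open>C\<close>.\<close>
  moreover have "C * L \<le> C * L + C" "C \<le> C * L + C" using C L by auto
  ultimately have le: "(LINT t|lebesgue_on {0..L}. norm (P (period_part L (s - t)))) \<le> C * L + C" for s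
    by (meson order_trans)
  have bk: "bounded_kernel L (\<lambda>s t. P (period_part L (s - t))) (C * L + C)"
    unfolding bounded_kernel_def using m int le by auto
  have cont: "AE t in lebesgue_on {0..L}. isCont (\<lambda>s. P (period_part L (s - t))) s" for s
  proof -
    \<comment> \<open>As a function of \<open>s\<close>, \<open>period_part L (s - t)\<close> jumps
      only where \<open>s - t\<close> is a multiple of \<open>L\<close>.\<close>
    have "countable (range (\<lambda>n::int. s - L * of_int n))" by simp
    then have "AE t in lebesgue_on {0..L}. t \<notin> range (\<lambda>n::int. s - L * of_int n)"
      by (rule AE_lebesgue_on_notin_countable) auto
    then show ?thesis
    proof eventually_elim
      case (elim t)
      have ni: "(s - t) / L \<notin> \<int>"
      proof
        assume "(s - t) / L \<in> \<int>"
        then obtain n :: int where "(s - t) / L = of_int n" by (auto elim: Ints_cases)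
        then have "t = s - L * of_int n" using L by (simp add: field_simps)
        with elim show False by blast
      qed
      have "isCont (real_of_int \<circ> floor) ((s - t) / L)" using continuous_floor[OF ni] .
      moreover have "isCont (\<lambda>s. (s - t) / L) s" by (intro continuous_intros) (use L in auto)
      ultimately have "isCont ((real_of_int \<circ> floor) \<circ> (\<lambda>s. (s - t) / L)) s" by (rule continuous_at_compose[rotated])
      then have "isCont (\<lambda>s. period_part L (s - t)) s"
        unfolding period_part_def o_def by (intro continuous_intros)
      then show ?case by (rule isCont_o2) (use P in \<open>simp add: continuous_on_eq_continuous_at\<close>)
    qed
  qed
  have "norm (P (period_part L (s - t))) \<le> C * L + C" for s t using bd[of s t] C L by (smt (verit) mult_pos_pos)
  with bk cont show ?thesis by blast
qed

text \<open>The window of integration starts at \<open>t\<close>, so the kernel is smooth inside it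
  and the diagonal contributes through the end terms: zero for the profile,
  \<open>- \<phi> t\<close> for its slope.\<close>

lemma surface_green_weak:
  assumes L: "L > 0" and k: "Im k > 0" and \<phi>: "smooth \<phi>" "periodic L \<phi>"
  shows "(LINT s|lebesgue_on {0..L}. green_profile L k (period_part L (s - t)) * vderiv \<phi> s) =
      - (LINT s|lebesgue_on {0..L}. green_profile' L k (period_part L (s - t)) * \<phi> s)"
    "(LINT s|lebesgue_on {0..L}. green_profile' L k (period_part L (s - t)) * vderiv \<phi> s) =
      - \<phi> t - (LINT s|lebesgue_on {0..L}. - k\<^sup>2 * green_profile L k (period_part L (s - t)) * \<phi> s)"
proof -
  note d = green_profile_deriv[OF L k]
  have c0: "continuous_on UNIV (green_profile L k)" and c1: "continuous_on UNIV (green_profile' L k)"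
    using d(1,2) by (auto intro!: continuous_at_imp_continuous_on has_vector_derivative_continuous)
  have per: "P (period_part L (s + L - t)) = P (period_part L (s - t))" for P :: "real \<Rightarrow> complex" and s
    using period_part(3)[OF L, of "s - t"] by (simp add: algebra_simps)
  have sh: "((\<lambda>s. P (s - t)) has_vector_derivative P' (s - t)) (at s)"
    if "\<And>x. (P has_vector_derivative P' x) (at x)" for P P' :: "real \<Rightarrow> complex" and s
  proof -
    have "(P \<circ> (\<lambda>s. s - t) has_vector_derivative 1 *\<^sub>R P' (s - t)) (at s)"
      by (rule vector_diff_chain_at) (auto intro!: derivative_eq_intros that)
    then show ?thesis by (simp add: o_def)
  qed
  have int: "integrable (lebesgue_on {t..t + L}) (\<lambda>s. P (period_part L (s - t)))" "(\<lambda>s. P (period_part L (s - t))) \<in> borel_measurable (lebesgue_on {t..t + L})"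
    if P: "continuous_on UNIV P" for P :: "real \<Rightarrow> complex"
  proof -
    interpret finite_measure "lebesgue_on {t..t + L}" by (rule finite_measure_Icc)
    have [measurable]: "P \<in> borel_measurable borel" by (rule borel_measurable_continuous_onI[OF P])
    have [measurable]: "period_part L \<in> borel_measurable borel" unfolding period_part_def by measurable
    have "(\<lambda>s. P (period_part L (s - t))) \<in> borel_measurable borel" by measurable
    then show m: "(\<lambda>s. P (period_part L (s - t))) \<in> borel_measurable (lebesgue_on {t..t + L})"
      by (rule borel_measurable_lebesgue_on_borel)
    obtain C where C: "C > 0" "\<And>x. x \<in> {0..L} \<Longrightarrow> norm (P x) \<le> C"
      using continuous_bounded_Icc[OF continuous_on_subset[OF P subset_UNIV]] by metis
    show "integrable (lebesgue_on {t..t + L}) (\<lambda>s. P (period_part L (s - t)))"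
      by (rule integrable_const_bound[of _ C, OF _ m])
         (use period_part(1,2)[OF L] in \<open>auto intro!: C AE_I2 simp: less_imp_le\<close>)
  qed
  have cs: "continuous_on {t..t + L} (\<lambda>s. P (s - t))" if "continuous_on UNIV P" for P :: "real \<Rightarrow> complex"
    by (rule continuous_on_compose2[OF that]) (auto intro!: continuous_intros)
  have eq: "period_part L (s - t) = s - t" if "s \<in> {t<..<t + L}" for s
    using that by (intro period_part(4)[OF L]) auto
  show "(LINT s|lebesgue_on {0..L}. green_profile L k (period_part L (s - t)) * vderiv \<phi> s) =
      - (LINT s|lebesgue_on {0..L}. green_profile' L k (period_part L (s - t)) * \<phi> s)"
    using periodic_integration_by_parts[where f = "\<lambda>s. green_profile L k (period_part L (s - t))"
        and f' = "\<lambda>s. green_profile' L k (period_part L (s - t))"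
        and F = "\<lambda>s. green_profile L k (s - t)" and a = t and S = "{}", OF L per per finite.emptyI _ _ _ _ _ \<phi>]
      int[OF c0] int[OF c1] sh[OF d(1)] d(3) \<phi> eq cs[OF c0] by auto
  have ck: "continuous_on UNIV (\<lambda>x. - k\<^sup>2 * green_profile L k x)" by (intro continuous_intros c0)
  show "(LINT s|lebesgue_on {0..L}. green_profile' L k (period_part L (s - t)) * vderiv \<phi> s) =
      - \<phi> t - (LINT s|lebesgue_on {0..L}. - k\<^sup>2 * green_profile L k (period_part L (s - t)) * \<phi> s)"
    using periodic_integration_by_parts[where f = "\<lambda>s. green_profile' L k (period_part L (s - t))"
        and f' = "\<lambda>s. - k\<^sup>2 * green_profile L k (period_part L (s - t))"
        and F = "\<lambda>s. green_profile' L k (s - t)" and a = t and S = "{}", OF L per per finite.emptyI _ _ _ _ _ \<phi>]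
      int[OF c1] int[OF ck] sh[OF d(2)] d(4) \<phi> eq cs[OF c1] by auto
qed

lemma surface_green_H2:
  assumes L: "L > 0" and k: "Im k > 0"
  obtains C where "C \<ge> 0" "\<And>\<tau> B. bounded_density L \<tau> B \<Longrightarrow>
    surface_green_op L k \<tau> \<in> H2 L \<and> H2_norm L (surface_green_op L k \<tau>) \<le> C * B"
proof -
  note d = green_profile_deriv[OF L k]
  have c0: "continuous_on UNIV (green_profile L k)" and c1: "continuous_on UNIV (green_profile' L k)"
    using d(1,2) by (auto intro!: continuous_at_imp_continuous_on has_vector_derivative_continuous)
  define K where "K = (\<lambda>s t. green_profile L k (period_part L (s - t)))"
  define K' where "K' = (\<lambda>s t. green_profile' L k (period_part L (s - t)))"
  obtain C0 where K: "bounded_kernel L K C0" "\<And>s t. norm (K s t) \<le> C0" "\<And>s. AE t in lebesgue_on {0..L}. isCont (\<lambda>s. K s t) s"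
    using periodic_kernel[OF L c0] unfolding K_def by blast
  obtain C1 where K': "bounded_kernel L K' C1" using periodic_kernel[OF L c1] unfolding K'_def by blast
  define C where "C = C0 + C1 + 1 + (norm k)\<^sup>2 * C0"
  have C0: "C0 \<ge> 0" "C1 \<ge> 0" using bounded_kernelD(4)[OF K(1)] bounded_kernelD(4)[OF K'] by auto
  have "surface_green_op L k \<tau> \<in> H2 L \<and> H2_norm L (surface_green_op L k \<tau>) \<le> sqrt (3 * L) * C * B"
    if \<tau>: "bounded_density L \<tau> B" for \<tau> B
  proof -
    have G: "surface_green_op L k \<tau> = integral_op L K \<tau>"
      unfolding surface_green_op_def[abs_def] integral_op_def[abs_def] K_def surface_green_eq[OF L k] ..
    have B: "B \<ge> 0" using bounded_densityD(2)[OF \<tau>, of 0] L norm_ge_zero[of "\<tau> 0"] by (simp del: norm_ge_zero)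
    \<comment> \<open>The differential equation \<open>u'' + k^2 u = \<tau>\<close>, solved for the
      second derivative. No third kernel is estimated.\<close>
    define g2 where "g2 = (\<lambda>t. \<tau> t - k\<^sup>2 * integral_op L K \<tau> t)"
    have g2b: "bounded_density L g2 (C * B)"
      unfolding bounded_density_def
    proof (intro conjI ballI)
      note [measurable] = bounded_densityD(1)[OF \<tau>] bounded_densityD(1)[OF integral_op_bounded_density[OF L K(1) \<tau>]]
      show "g2 \<in> borel_measurable (lebesgue_on {0..L})" unfolding g2_def by measurable
      fix t assume t: "t \<in> {0..L}"
      have "norm (g2 t) \<le> norm (\<tau> t) + norm (k\<^sup>2 * integral_op L K \<tau> t)" unfolding g2_def by (rule norm_triangle_ineq4)
      also have "\<dots> \<le> B + (norm k)\<^sup>2 * (C0 * B)"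
        unfolding norm_mult norm_power
        by (intro add_mono mult_left_mono integral_op_norm_le(1)[OF L K(1) \<tau>] bounded_densityD(2)[OF \<tau> t]) auto
      also have "\<dots> \<le> C * B" using C0 B by (simp add: C_def distrib_right)
      finally show "norm (g2 t) \<le> C * B" .
    qed
    have w1: "has_weak_deriv L 1 (integral_op L K \<tau>) (integral_op L K' \<tau>)"
      by (rule integral_op_weak_deriv[OF L K(1) K' \<tau>])
         (use surface_green_weak(1)[OF L k] in \<open>auto simp: K_def K'_def\<close>)
    have w2: "has_weak_deriv L 2 (integral_op L K \<tau>) g2"
      unfolding has_weak_deriv_def
    proof (intro conjI allI impI)
      show "square_integrable L g2" by (rule bounded_density_square_integrable[OF g2b])
      fix \<phi> assume \<phi>: "smooth \<phi> \<and> periodic L \<phi>"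
      obtain B1 where B1: "bounded_density L (vderiv (vderiv \<phi>)) B1" using \<phi> smooth_vderiv smooth_bounded_density by metis
      obtain B2 where B2: "bounded_density L \<phi> B2" using \<phi> smooth_bounded_density by blast
      have i1: "integrable (lebesgue_on {0..L}) (\<lambda>t. \<tau> t * \<phi> t)"
        by (rule integrable_mult_smooth) (use \<phi> bounded_density_square_integrable[OF \<tau>] L2_imp_L1 in auto)
      have i2: "integrable (lebesgue_on {0..L}) (\<lambda>t. integral_op L K \<tau> t * \<phi> t)"
        by (rule integrable_mult_smooth)
           (use \<phi> bounded_density_square_integrable[OF integral_op_bounded_density[OF L K(1) \<tau>]] L2_imp_L1 in auto)
      \<comment> \<open>Two integrations by parts; the jump of the slope leaves the value
        \<open>\<phi> t\<close>.\<close>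
      have per: "(LINT s|lebesgue_on {0..L}. K s t * vderiv (vderiv \<phi>) s) =
          \<phi> t - k\<^sup>2 * (LINT s|lebesgue_on {0..L}. K s t * \<phi> s)" for t
        unfolding K_def using surface_green_weak(1)[OF L k, of "vderiv \<phi>" t] surface_green_weak(2)[OF L k, of \<phi> t] \<phi>
        by (simp add: smooth_vderiv periodic_vderiv mult.assoc)
      have "(LINT t|lebesgue_on {0..L}. integral_op L K \<tau> t * vderiv (vderiv \<phi>) t) =
        (LINT t|lebesgue_on {0..L}. \<tau> t * \<phi> t - k\<^sup>2 * (\<tau> t * (LINT s|lebesgue_on {0..L}. K s t * \<phi> s)))"
        unfolding integral_op_fubini(1)[OF L K(1) \<tau> B1] per by (simp add: right_diff_distrib mult_ac)
      also have "\<dots> = (LINT t|lebesgue_on {0..L}. \<tau> t * \<phi> t) - k\<^sup>2 * (LINT t|lebesgue_on {0..L}. integral_op L K \<tau> t * \<phi> t)"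
        using integral_op_fubini[OF L K(1) \<tau> B2] i1 by simp
      also have "\<dots> = (LINT t|lebesgue_on {0..L}. g2 t * \<phi> t)"
        unfolding g2_def left_diff_distrib using i1 i2 by (simp add: mult.assoc)
      finally show "(LINT t|lebesgue_on {0..L}. integral_op L K \<tau> t * (vderiv ^^ 2) \<phi> t) =
        (- 1)\<^sup>2 * (LINT t|lebesgue_on {0..L}. g2 t * \<phi> t)" by (simp add: eval_nat_numeral)
    qed
    have "periodic L (integral_op L K \<tau>)"
      using period_part(3)[OF L] by (simp add: periodic_def integral_op_def K_def diff_add_eq[symmetric])
    moreover have "continuous_on UNIV (integral_op L K \<tau>)" by (rule integral_op_continuous[OF K(1) \<tau> _ K(3)]) (use K(2) in auto)
    moreover have "norm (integral_op L K \<tau> t) \<le> C * B" "norm (integral_op L K' \<tau> t) \<le> C * B" for t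
    proof -
      have "C0 \<le> C" "C1 \<le> C" using C0 by (auto simp: C_def)
      then have "C0 * B \<le> C * B" "C1 * B \<le> C * B" using B by (auto intro: mult_right_mono)
      then show "norm (integral_op L K \<tau> t) \<le> C * B" "norm (integral_op L K' \<tau> t) \<le> C * B"
        using integral_op_norm_le(1)[OF L K(1) \<tau>, of t] integral_op_norm_le(1)[OF L K' \<tau>, of t] by linarith+
    qed
    ultimately show ?thesis
      using H2I[OF L _ _ w1 w2, of "C * B"] bounded_densityD(2)[OF g2b] by (simp add: G mult.assoc)
  qed
  moreover have "0 \<le> sqrt (3 * L) * C" using C0 L by (simp add: C_def)
  ultimately show ?thesis using that by blast
qed

section \<open>Geometry of the curve\<close>

locale closed_curve =
  fixes \<gamma> :: "real \<Rightarrow> complex" and L :: real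
  assumes curve: "smooth_closed_curve \<gamma> L"
begin

definition "\<gamma>d n = (vderiv ^^ n) \<gamma>"
abbreviation "T \<equiv> vderiv \<gamma>"

lemma L: "L > 0" and smooth_gamma: "smooth \<gamma>" and periodic_gamma: "periodic L \<gamma>"
  and inj_gamma: "inj_on \<gamma> {0..<L}" and norm_T: "norm (T s) = 1"
  using curve by (auto simp: smooth_closed_curve_def)

lemma smooth_d: "smooth (\<gamma>d n)"
  unfolding \<gamma>d_def using smooth_gamma by (induction n) (auto intro: smooth_vderiv)

lemma \<gamma>d_simps: "\<gamma>d 0 = \<gamma>" "\<gamma>d (Suc 0) = T" "vderiv (\<gamma>d n) = \<gamma>d (Suc n)"
  by (auto simp: \<gamma>d_def)

lemma has_vderiv_d: "(\<gamma>d n has_vector_derivative \<gamma>d (Suc n) t) (at t)"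
  using smooth_has_vderiv[OF smooth_d[of n]] by (simp add: \<gamma>d_simps)

lemma has_vderiv_gamma: "(\<gamma> has_vector_derivative T t) (at t)"
  and has_vderiv_T: "(T has_vector_derivative \<gamma>d 2 t) (at t)"
  using has_vderiv_d[of 0 t] has_vderiv_d[of 1 t] by (auto simp: \<gamma>d_simps numeral_2_eq_2)

lemma continuous_d: "continuous_on A (\<gamma>d n)"
  by (rule smooth_continuous_on[OF smooth_d])

lemma periodic_d: "periodic L (\<gamma>d n)"
proof (induction n)
  case (Suc n)
  show ?case using periodic_vderiv[OF smooth_d Suc] by (simp add: \<gamma>d_simps)
qed (simp add: \<gamma>d_def periodic_gamma)

lemma d_shift: "\<gamma>d n (t + of_int m * L) = \<gamma>d n t"
  using shift_of_int[of "\<gamma>d n"] periodic_d by (simp add: periodic_def)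

text \<open>Keeping the parameter difference within half a period stays away from \<open>L\<close>,
  where the chord vanishes again although \<open>u\<close> does not.\<close>

lemma reduce:
  obtains m :: int and u where "s = t + u + of_int m * L" "\<bar>u\<bar> \<le> L / 2"
proof
  define m where "m = \<lfloor>(s - t) / L + 1 / 2\<rfloor>"
  show "s = t + (s - t - of_int m * L) + of_int m * L" by simp
  have "of_int m \<le> (s - t) / L + 1 / 2" "(s - t) / L + 1 / 2 < of_int m + 1"
    unfolding m_def using floor_correct[of "(s - t) / L + 1 / 2"] by auto
  then have "(of_int m - 1 / 2) \<le> (s - t) / L" "(s - t) / L < of_int m + 1 / 2" by auto
  then have "(of_int m - 1 / 2) * L \<le> s - t" "s - t < (of_int m + 1 / 2) * L"
    using L by (simp_all add: pos_le_divide_eq pos_divide_less_eq)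
  then have "of_int m * L - L / 2 \<le> s - t" "s - t < of_int m * L + L / 2"
    by (simp_all add: algebra_simps)
  then show "\<bar>s - t - of_int m * L\<bar> \<le> L / 2" unfolding abs_le_iff by simp
qed

lemma d_bounded: obtains C where "C > 0" "\<And>t. norm (\<gamma>d n t) \<le> C"
proof -
  obtain C where C: "C > 0" "\<And>t. t \<in> {-L/2..L/2} \<Longrightarrow> norm (\<gamma>d n t) \<le> C"
    using continuous_bounded_Icc[OF continuous_d] by metis
  have "norm (\<gamma>d n t) \<le> C" for t
  proof -
    obtain m u where "t = 0 + u + of_int m * L" "\<bar>u\<bar> \<le> L / 2" using reduce by metis
    moreover from this have "u \<in> {-L/2..L/2}" unfolding atLeastAtMost_iff by linarith
    ultimately show ?thesis using C(2)[of u] d_shift[of n u m] by simp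
  qed
  with C(1) that show ?thesis by blast
qed

lemma gamma_eq_iff: "\<gamma> s = \<gamma> t \<longleftrightarrow> (\<exists>m::int. s = t + of_int m * L)"
proof
  have sh: "\<gamma> (period_part L x) = \<gamma> x" for x
    using d_shift[of 0 "period_part L x" "\<lfloor>x / L\<rfloor>"] by (simp add: \<gamma>d_simps period_part_def mult.commute)
  assume "\<gamma> s = \<gamma> t"
  then have "\<gamma> (period_part L s) = \<gamma> (period_part L t)" by (simp add: sh)
  then have "period_part L s = period_part L t"
    using inj_gamma period_part(1,2)[OF L] by (simp add: inj_on_def)
  then have "s = t + of_int (\<lfloor>s / L\<rfloor> - \<lfloor>t / L\<rfloor>) * L" by (simp add: period_part_def algebra_simps)
  then show "\<exists>m::int. s = t + of_int m * L" by blast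
next
  assume "\<exists>m::int. s = t + of_int m * L"
  then show "\<gamma> s = \<gamma> t" using d_shift[of 0] by (auto simp: \<gamma>d_simps)
qed

text \<open>\<open>w 0\<close> is the second-order Taylor remainder of the curve divided by the
  square of \<open>u\<close>, in integral form; \<open>w j\<close> is its \<open>j\<close>-th
  derivative in \<open>u\<close>. The integral form is smooth across \<open>u = 0\<close>.\<close>

definition w :: "nat \<Rightarrow> real \<Rightarrow> real \<Rightarrow> complex" where
  "w j t u = integral {0..1} (\<lambda>\<theta>. complex_of_real ((1 - \<theta>) * \<theta> ^ j) * \<gamma>d (2 + j) (t + \<theta> * u))"

lemma w_continuous: "continuous_on UNIV (\<lambda>(t, u). w j t u)"
proof -
  have "continuous_on UNIV (\<lambda>x. integral (cbox 0 1) (\<lambda>\<theta>. complex_of_real ((1 - \<theta>) * \<theta> ^ j) * \<gamma>d (2 + j) (fst x + \<theta> * snd x)))"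
    by (rule integral_continuous_on_param)
       (auto simp: case_prod_unfold intro!: continuous_intros continuous_on_compose2[OF continuous_d[of UNIV]])
  then show ?thesis by (simp add: w_def case_prod_unfold)
qed

lemma w_deriv: "(w j t has_vector_derivative w (Suc j) t u) (at u)"
proof -
  have c: "continuous_on A (\<lambda>\<theta>. complex_of_real ((1 - \<theta>) * \<theta> ^ j) * \<gamma>d (2 + j) (t + \<theta> * x))" for A x
    by (auto intro!: continuous_intros continuous_on_compose2[OF continuous_d[of UNIV]])
  have "((\<lambda>u. integral (cbox 0 1) (\<lambda>\<theta>. complex_of_real ((1 - \<theta>) * \<theta> ^ j) * \<gamma>d (2 + j) (t + \<theta> * u)))
    has_vector_derivative integral (cbox 0 1) (\<lambda>\<theta>. complex_of_real ((1 - \<theta>) * \<theta> ^ Suc j) * \<gamma>d (2 + Suc j) (t + \<theta> * u))) (at u within UNIV)"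
  proof (rule leibniz_rule_vector_derivative)
    fix x \<theta> :: real
    have "(\<gamma>d (2 + j) \<circ> (\<lambda>x. t + \<theta> * x) has_vector_derivative \<theta> *\<^sub>R \<gamma>d (Suc (2 + j)) (t + \<theta> * x)) (at x)"
      by (rule vector_diff_chain_at) (auto intro!: derivative_eq_intros has_vderiv_d)
    then have "((\<lambda>x. \<gamma>d (2 + j) (t + \<theta> * x)) has_vector_derivative \<theta> *\<^sub>R \<gamma>d (2 + Suc j) (t + \<theta> * x)) (at x)"
      by (simp add: o_def)
    from has_vector_derivative_mult_right[OF this, of "complex_of_real ((1 - \<theta>) * \<theta> ^ j)"]
    show "((\<lambda>x. complex_of_real ((1 - \<theta>) * \<theta> ^ j) * \<gamma>d (2 + j) (t + \<theta> * x)) has_vector_derivative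
      complex_of_real ((1 - \<theta>) * \<theta> ^ Suc j) * \<gamma>d (2 + Suc j) (t + \<theta> * x)) (at x within UNIV)"
      by (simp add: scaleR_conv_of_real mult_ac)
    show "(\<lambda>\<theta>. complex_of_real ((1 - \<theta>) * \<theta> ^ j) * \<gamma>d (2 + j) (t + \<theta> * x)) integrable_on cbox 0 1"
      by (rule integrable_continuous[OF c])
  next
    show "continuous_on (UNIV \<times> cbox 0 1) (\<lambda>(u, \<theta>). complex_of_real ((1 - \<theta>) * \<theta> ^ Suc j) * \<gamma>d (2 + Suc j) (t + \<theta> * u))"
      unfolding case_prod_unfold
      by (auto intro!: continuous_intros continuous_on_compose2[OF continuous_d[of UNIV]])
  qed auto
  then show ?thesis by (simp add: w_def[abs_def])
qed

lemma taylor: "\<gamma> (t + u) = \<gamma> t + u * T t + u\<^sup>2 * w 0 t u"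
proof -
  \<comment> \<open>The function of \<open>\<theta>\<close> is chosen so that the first-order terms
    cancel in its derivative and the integrand of \<open>w 0\<close> remains.\<close>
  have d: "((\<lambda>\<theta>. complex_of_real ((1 - \<theta>) * u) * T (t + \<theta> * u) + \<gamma> (t + \<theta> * u)) has_vector_derivative
      complex_of_real (u\<^sup>2) * (complex_of_real (1 - \<theta>) * \<gamma>d 2 (t + \<theta> * u))) (at \<theta>)" for \<theta>
  proof -
    have "(T \<circ> (\<lambda>\<theta>. t + \<theta> * u) has_vector_derivative u *\<^sub>R \<gamma>d 2 (t + \<theta> * u)) (at \<theta>)"
      by (rule vector_diff_chain_at) (auto intro!: derivative_eq_intros has_vderiv_T)
    moreover have "(\<gamma> \<circ> (\<lambda>\<theta>. t + \<theta> * u) has_vector_derivative u *\<^sub>R T (t + \<theta> * u)) (at \<theta>)"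
      by (rule vector_diff_chain_at) (auto intro!: derivative_eq_intros has_vderiv_gamma)
    moreover have "((\<lambda>\<theta>. complex_of_real ((1 - \<theta>) * u)) has_vector_derivative complex_of_real (- u)) (at \<theta>)"
      by (intro has_vector_derivative_of_real) (auto intro!: derivative_eq_intros)
    ultimately have "((\<lambda>\<theta>. complex_of_real ((1 - \<theta>) * u) * T (t + \<theta> * u) + \<gamma> (t + \<theta> * u)) has_vector_derivative
       (complex_of_real ((1 - \<theta>) * u) * (u *\<^sub>R \<gamma>d 2 (t + \<theta> * u)) + complex_of_real (- u) * T (t + \<theta> * u)) + u *\<^sub>R T (t + \<theta> * u)) (at \<theta>)"
      unfolding o_def by (intro has_vector_derivative_add has_vector_derivative_mult)
    then show ?thesis by (simp add: scaleR_conv_of_real power2_eq_square mult_ac)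
  qed
  have "((\<lambda>\<theta>. complex_of_real (u\<^sup>2) * (complex_of_real (1 - \<theta>) * \<gamma>d 2 (t + \<theta> * u))) has_integral
      (complex_of_real ((1 - 1) * u) * T (t + 1 * u) + \<gamma> (t + 1 * u)) - (complex_of_real ((1 - 0) * u) * T (t + 0 * u) + \<gamma> (t + 0 * u))) {0..1}"
    by (rule fundamental_theorem_of_calculus) (use has_vector_derivative_at_within[OF d] in auto)
  from integral_unique[OF this]
  have "integral {0..1} (\<lambda>\<theta>. complex_of_real (u\<^sup>2) * (complex_of_real (1 - \<theta>) * \<gamma>d 2 (t + \<theta> * u))) = \<gamma> (t + u) - u * T t - \<gamma> t"
    by (simp only:) simp
  then have "complex_of_real (u\<^sup>2) * w 0 t u = \<gamma> (t + u) - u * T t - \<gamma> t"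
    by (simp add: w_def)
  then show ?thesis by (simp add: algebra_simps)
qed

text \<open>The chord divided by \<open>u\<close>, continued smoothly to the unit tangent at
  \<open>u = 0\<close>.\<close>

definition h :: "real \<Rightarrow> real \<Rightarrow> complex" where "h t u = T t + u * w 0 t u"

lemma chord_eq: "\<gamma> (t + u) - \<gamma> t = u * h t u"
  by (simp add: taylor h_def power2_eq_square algebra_simps)

lemma h_continuous: "continuous_on UNIV (\<lambda>(t, u). h t u)"
  using w_continuous[of 0] unfolding h_def case_prod_unfold \<gamma>d_simps(2)[symmetric]
  by (auto intro!: continuous_intros continuous_on_compose2[OF continuous_d[of UNIV]])

lemma h_nonzero: assumes "\<bar>u\<bar> < L" shows "h t u \<noteq> 0"
proof (cases "u = 0")
  case True
  then show ?thesis using norm_T[of t] by (auto simp: h_def)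
next
  case False
  have "\<gamma> (t + u) \<noteq> \<gamma> t"
  proof
    assume "\<gamma> (t + u) = \<gamma> t"
    then obtain m :: int where "u = of_int m * L" by (auto simp: gamma_eq_iff)
    moreover from this False have "\<bar>m\<bar> \<ge> 1" by auto
    then have "\<bar>of_int m\<bar> \<ge> (1::real)" by linarith
    then have "\<bar>of_int m * L\<bar> \<ge> L" using L by (simp add: abs_mult)
    ultimately show False using assms by simp
  qed
  then show ?thesis using chord_eq[of t u] by auto
qed

lemma w_shift: "w j (t + of_int m * L) u = w j t u"
proof -
  have "t + of_int m * L + \<theta> * u = (t + \<theta> * u) + of_int m * L" for \<theta> by simp
  then show ?thesis by (simp only: w_def d_shift)
qed

lemma h_shift: "h (t + of_int m * L) u = h t u"
  using d_shift[of 1 t m] by (simp add: h_def w_shift \<gamma>d_simps)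

text \<open>\<open>h\<close> is continuous and free of zeros for differences below \<open>L\<close>,
  by injectivity of the curve. Periodicity in \<open>t\<close> confines the matter to a compact
  square, where the norm attains a positive minimum.\<close>

lemma chord_arc:
  obtains c where "c > 0" "\<And>t u. \<bar>u\<bar> \<le> L / 2 \<Longrightarrow> c \<le> norm (h t u)"
proof -
  let ?S = "{-L/2..L/2} \<times> {-L/2..L/2}"
  have "compact ?S" by (intro compact_Times compact_Icc)
  moreover have "?S \<noteq> {}" using L by auto
  moreover have "continuous_on ?S (\<lambda>x. norm (case x of (t, u) \<Rightarrow> h t u))"
    by (intro continuous_intros continuous_on_subset[OF h_continuous]) auto
  ultimately obtain z where z: "z \<in> ?S" "\<And>x. x \<in> ?S \<Longrightarrow> norm (case z of (t, u) \<Rightarrow> h t u) \<le> norm (case x of (t, u) \<Rightarrow> h t u)"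
    using continuous_attains_inf by metis
  define c where "c = norm (case z of (t, u) \<Rightarrow> h t u)"
  have "c > 0" using z(1) h_nonzero L by (auto simp: c_def split: prod.splits)
  moreover have "c \<le> norm (h t u)" if u: "\<bar>u\<bar> \<le> L / 2" for t u
  proof -
    obtain m v where mv: "t = 0 + v + of_int m * L" "\<bar>v\<bar> \<le> L / 2" using reduce by metis
    then have "h t u = h v u" by (simp add: h_shift)
    moreover have "(v, u) \<in> ?S" unfolding mem_Times_iff atLeastAtMost_iff fst_conv snd_conv using u mv by linarith
    ultimately show ?thesis using z(2)[of "(v, u)"] by (simp add: c_def)
  qed
  ultimately show ?thesis using that by blast
qed

lemma w_bounded: obtains C where "C > 0" "\<And>t u. norm (w j t u) \<le> C"
proof -
  obtain C where C: "C > 0" "\<And>t. norm (\<gamma>d (2 + j) t) \<le> C" using d_bounded[of "2 + j"] by metis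
  have "norm (w j t u) \<le> C * (1 - 0)" for t u
    unfolding w_def
  proof (rule integral_bound)
    show "continuous_on {0..1} (\<lambda>\<theta>. complex_of_real ((1 - \<theta>) * \<theta> ^ j) * \<gamma>d (2 + j) (t + \<theta> * u))"
      by (auto intro!: continuous_intros continuous_on_compose2[OF continuous_d[of UNIV]])
    fix \<theta> :: real assume \<theta>: "\<theta> \<in> {0..1}"
    then have "\<bar>(1 - \<theta>) * \<theta> ^ j\<bar> \<le> 1" by (auto simp: abs_mult power_le_one intro!: mult_le_one)
    then have "norm (complex_of_real ((1 - \<theta>) * \<theta> ^ j)) \<le> 1" by (simp only: norm_of_real)
    then have "norm (complex_of_real ((1 - \<theta>) * \<theta> ^ j)) * norm (\<gamma>d (2 + j) (t + \<theta> * u)) \<le> 1 * C"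
      by (intro mult_mono C(2)) auto
    then show "norm (complex_of_real ((1 - \<theta>) * \<theta> ^ j) * \<gamma>d (2 + j) (t + \<theta> * u)) \<le> C" by (simp add: norm_mult)
  qed auto
  with C(1) that show ?thesis by (metis mult.right_neutral diff_zero)
qed

section \<open>Chord length against arc length\<close>

definition r :: "real \<Rightarrow> real \<Rightarrow> real" where "r s t = norm (\<gamma> s - \<gamma> t)"

lemma r_sym: "r s t = r t s" by (simp add: r_def norm_minus_commute)

lemma inner_T_normal: "T s \<bullet> normal \<gamma> s = 0"
  by (simp add: normal_def inner_complex_def)

lemma norm_normal: "norm (normal \<gamma> s) = 1" by (simp add: normal_def norm_mult norm_T)

lemma r_lower: obtains c where "c > 0" "\<And>t u. \<bar>u\<bar> \<le> L / 2 \<Longrightarrow> c * \<bar>u\<bar> \<le> r (t + u) t"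
proof -
  obtain c where c: "c > 0" "\<And>t u. \<bar>u\<bar> \<le> L / 2 \<Longrightarrow> c \<le> norm (h t u)" using chord_arc by metis
  have "c * \<bar>u\<bar> \<le> r (t + u) t" if "\<bar>u\<bar> \<le> L / 2" for t u
    using mult_right_mono[OF c(2)[OF that, of t], of "\<bar>u\<bar>"] by (simp add: r_def chord_eq norm_mult mult.commute)
  with c(1) that show ?thesis by blast
qed

lemma lipschitz_d: obtains C where "C > 0" "\<And>s t. norm (\<gamma>d n s - \<gamma>d n t) \<le> C * \<bar>s - t\<bar>"
proof -
  obtain C where C: "C > 0" "\<And>t. norm (\<gamma>d (Suc n) t) \<le> C" using d_bounded[of "Suc n"] by metis
  have "norm (\<gamma>d n s - \<gamma>d n t) \<le> C * norm (s - t)" for s t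
  proof (rule differentiable_bound[of UNIV _ "\<lambda>t x. x *\<^sub>R \<gamma>d (Suc n) t"])
    fix t
    show "(\<gamma>d n has_derivative (\<lambda>x. x *\<^sub>R \<gamma>d (Suc n) t)) (at t within UNIV)"
      using has_vderiv_d[of n t] by (simp add: has_vector_derivative_def)
    show "onorm (\<lambda>x. x *\<^sub>R \<gamma>d (Suc n) t) \<le> C"
    proof (rule onorm_le)
      fix x :: real
      show "norm (x *\<^sub>R \<gamma>d (Suc n) t) \<le> C * norm x"
        using mult_left_mono[OF C(2)[of t], of "\<bar>x\<bar>"] by (simp add: mult.commute)
    qed
  qed auto
  with C(1) that show ?thesis by simp
qed

text \<open>The first-order term of the chord is tangential and so orthogonal to the normal; only
  the quadratic remainder survives. The lower bound on the chord converts powers of \<open>u\<close>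
  into powers of \<open>r\<close>.\<close>

lemma geometric_bounds:
  obtains C where "C > 0" "\<And>s t. norm (\<gamma>d n s - \<gamma>d n t) \<le> C * r s t"
    "\<And>s t. \<bar>(\<gamma> s - \<gamma> t) \<bullet> normal \<gamma> t\<bar> \<le> C * (r s t)\<^sup>2"
proof -
  obtain c where c: "c > 0" "\<And>t u. \<bar>u\<bar> \<le> L / 2 \<Longrightarrow> c * \<bar>u\<bar> \<le> r (t + u) t" using r_lower by metis
  obtain C1 where C1: "C1 > 0" "\<And>s t. norm (\<gamma>d n s - \<gamma>d n t) \<le> C1 * \<bar>s - t\<bar>" using lipschitz_d by metis
  obtain C2 where C2: "C2 > 0" "\<And>t u. norm (w 0 t u) \<le> C2" using w_bounded by metis
  define C where "C = C1 / c + C2 / c\<^sup>2"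
  have Cle: "C1 / c \<le> C" "C2 / c\<^sup>2 \<le> C" "C > 0" using C1 C2 c by (auto simp: C_def add_pos_pos)
  have "norm (\<gamma>d n s - \<gamma>d n t) \<le> C * r s t \<and> \<bar>(\<gamma> s - \<gamma> t) \<bullet> normal \<gamma> t\<bar> \<le> C * (r s t)\<^sup>2" for s t
  proof -
    obtain m u where s: "s = t + u + of_int m * L" and u: "\<bar>u\<bar> \<le> L / 2" using reduce by metis
    have g: "\<gamma>d i s = \<gamma>d i (t + u)" for i unfolding s by (rule d_shift)
    from g[of 0] have g0: "\<gamma> s = \<gamma> (t + u)" by (simp add: \<gamma>d_simps)
    then have r: "r s t = r (t + u) t" by (simp add: r_def)
    have u_le: "\<bar>u\<bar> \<le> r s t / c" using c(2)[OF u, of t] c(1) by (simp add: r pos_le_divide_eq mult.commute)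
    have r0: "0 \<le> r s t" by (simp add: r_def)
    have "norm (\<gamma>d n s - \<gamma>d n t) \<le> C1 * \<bar>u\<bar>" using C1(2)[of "t + u" t] by (simp add: g)
    also have "\<dots> \<le> C1 * (r s t / c)" using u_le C1 by (intro mult_left_mono) auto
    also have "\<dots> \<le> C * r s t" using mult_right_mono[OF Cle(1) r0] by simp
    finally have 1: "norm (\<gamma>d n s - \<gamma>d n t) \<le> C * r s t" .
    have "\<gamma> s - \<gamma> t = u *\<^sub>R T t + u\<^sup>2 *\<^sub>R w 0 t u" unfolding g0 taylor by (simp add: scaleR_conv_of_real)
    then have "(\<gamma> s - \<gamma> t) \<bullet> normal \<gamma> t = u\<^sup>2 * (w 0 t u \<bullet> normal \<gamma> t)"
      by (simp add: inner_add_left inner_T_normal)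
    then have "\<bar>(\<gamma> s - \<gamma> t) \<bullet> normal \<gamma> t\<bar> \<le> u\<^sup>2 * C2"
      using Cauchy_Schwarz_ineq2[of "w 0 t u" "normal \<gamma> t"] C2(2)[of t u] by (auto simp: abs_mult norm_normal intro!: mult_left_mono)
    also have "u\<^sup>2 \<le> (r s t / c)\<^sup>2" using power_mono[OF u_le, of 2] by simp
    then have "u\<^sup>2 * C2 \<le> (r s t / c)\<^sup>2 * C2" using C2 by (intro mult_right_mono) auto
    also have "\<dots> = (C2 / c\<^sup>2) * (r s t)\<^sup>2" by (simp add: power_divide)
    also have "\<dots> \<le> C * (r s t)\<^sup>2" using Cle by (intro mult_right_mono) auto
    finally show ?thesis using 1 by simp
  qed
  with Cle(3) that show ?thesis by blast
qed

section \<open>Weakly singular integrals along the curve\<close>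

lemma abs_powr_has_integral:
  fixes a :: real assumes "a \<ge> 0"
  shows "((\<lambda>x. \<bar>x\<bar> powr (- 1 / 2)) has_integral (4 * sqrt a)) {- a..a}"
proof -
  have "((\<lambda>x. x powr (- 1 / 2)) has_integral (a powr (- 1 / 2 + 1) / (- 1 / 2 + 1))) {0..a}"
    by (rule has_integral_powr_from_0) (use assms in auto)
  then have 1: "((\<lambda>x. x powr (- 1 / 2)) has_integral (2 * sqrt a)) {0..a}"
    using assms by (simp add: powr_half_sqrt mult.commute)
  have p: "((\<lambda>x. \<bar>x\<bar> powr (- 1 / 2)) has_integral (2 * sqrt a)) {0..a}"
    by (rule has_integral_eq[OF _ 1]) auto
  then have "((\<lambda>x. \<bar>- x\<bar> powr (- 1 / 2)) has_integral (2 * sqrt a)) {- a..- 0}"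
    by (subst has_integral_reflect_real)
  then have n: "((\<lambda>x. \<bar>x\<bar> powr (- 1 / 2)) has_integral (2 * sqrt a)) {- a..0}" by simp
  show ?thesis using has_integral_combine[OF _ _ n p] assms by simp
qed

text \<open>The exponent \<open>-1/2\<close> is one convenient value between \<open>-1\<close> and
  \<open>0\<close>: integrable, yet strong enough to absorb a logarithm. The comparison with arc
  length holds on the window centred at \<open>s\<close>; periodicity carries the bound to
  \<open>{0..L}\<close>.\<close>

lemma weakly_singular_integral:
  obtains C where "C > 0" "\<And>s. integrable (lebesgue_on {0..L}) (\<lambda>t. r s t powr (- 1 / 2))"
    "\<And>s. (LINT t|lebesgue_on {0..L}. r s t powr (- 1 / 2)) \<le> C"
    "\<And>s. integrable (lebesgue_on {s - L/2..s - L/2 + L}) (\<lambda>t. r s t powr (- 1 / 2))"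
proof -
  obtain c where c: "c > 0" "\<And>t u. \<bar>u\<bar> \<le> L / 2 \<Longrightarrow> c * \<bar>u\<bar> \<le> r (t + u) t" using r_lower by metis
  define b where "b = (\<lambda>x::real. c powr (- 1 / 2) * \<bar>x\<bar> powr (- 1 / 2))"
  define C where "C = c powr (- 1 / 2) * (4 * sqrt (L / 2))"
  have "(b has_integral C) {- (L/2)..L/2}"
    unfolding b_def C_def by (intro has_integral_mult_right abs_powr_has_integral) (use L in auto)
  then have "((b \<circ> (+) (- s)) has_integral C) {- (L/2) + s..L/2 + s}" for s
    by (subst has_integral_shift_Icc_real) simp
  then have bi: "((\<lambda>t. b (t - s)) has_integral C) {s - L/2..s - L/2 + L}" for s
    by (simp add: o_def)
  have ba: "(\<lambda>t. b (t - s)) absolutely_integrable_on {s - L/2..s - L/2 + L}" for s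
    by (rule nonnegative_absolutely_integrable_1) (use bi[of s] in \<open>auto simp: b_def integrable_on_def\<close>)
  then have bint: "integrable (lebesgue_on {s - L/2..s - L/2 + L}) (\<lambda>t. b (t - s))" for s
    using integrable_lebesgue_on_iff_absolutely_integrable by blast
  have m: "(\<lambda>t. r s t powr (- 1 / 2)) \<in> borel_measurable (lebesgue_on A)" for s A
  proof (rule borel_measurable_lebesgue_on_borel)
    have [measurable]: "\<gamma> \<in> borel_measurable borel"
      by (rule borel_measurable_continuous_onI) (rule smooth_continuous_on[OF smooth_gamma])
    show "(\<lambda>t. r s t powr (- 1 / 2)) \<in> borel_measurable borel" unfolding r_def by measurable
  qed
  have le: "r s t powr (- 1 / 2) \<le> b (t - s)" if "t \<in> {s - L/2..s - L/2 + L}" for s t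
  \<comment> \<open>At \<open>t = s\<close> both sides are \<open>0\<close>, because
    \<open>0 powr p = 0\<close>.\<close>
  proof (cases "t = s")
    case False
    have "\<bar>t - s\<bar> \<le> L / 2" using that unfolding atLeastAtMost_iff abs_le_iff by simp
    then have l: "c * \<bar>t - s\<bar> \<le> r s t" using c(2)[of "t - s" s] by (simp add: r_sym)
    have "r s t powr (- 1 / 2) \<le> (c * \<bar>t - s\<bar>) powr (- 1 / 2)"
      by (rule powr_mono2') (use False c l in auto)
    also have "\<dots> = b (t - s)" using c by (simp add: b_def powr_mult)
    finally show ?thesis .
  qed (simp add: r_def b_def)
  have ri: "integrable (lebesgue_on {s - L/2..s - L/2 + L}) (\<lambda>t. r s t powr (- 1 / 2))" for s
  proof (rule Bochner_Integration.integrable_bound[OF bint m], rule AE_I2)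
    fix t assume "t \<in> space (lebesgue_on {s - L/2..s - L/2 + L})"
    then show "norm (r s t powr (- 1 / 2)) \<le> norm (b (t - s))"
      using order_trans[OF le[of t s] abs_ge_self] by simp
  qed
  have per: "r s (t + L) powr (- 1 / 2) = r s t powr (- 1 / 2)" for s t
    using periodic_gamma by (simp add: r_def periodic_def)
  have sh: "integrable (lebesgue_on {0..L}) (\<lambda>t. r s t powr (- 1 / 2))"
    "(LINT t|lebesgue_on {0..L}. r s t powr (- 1 / 2)) = (LINT t|lebesgue_on {s - L/2..s - L/2 + L}. r s t powr (- 1 / 2))" for s
    using periodic_integral_shift[where f = "\<lambda>t. r s t powr (- 1 / 2)" and b = 0, OF L per ri] by simp_all
  have "(LINT t|lebesgue_on {0..L}. r s t powr (- 1 / 2)) \<le> C" for s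
  proof -
    have "(LINT t|lebesgue_on {s - L/2..s - L/2 + L}. r s t powr (- 1 / 2)) \<le> (LINT t|lebesgue_on {s - L/2..s - L/2 + L}. b (t - s))"
      by (rule Bochner_Integration.integral_mono[OF ri bint]) (use le in auto)
    also have "\<dots> = C" using lebesgue_integral_eq_integral[OF bint[of s]] bi[of s] by (simp add: integral_unique)
    finally show ?thesis using sh(2)[of s] by (simp only:)
  qed
  moreover have "C > 0" using c L by (simp add: C_def)
  ultimately show ?thesis using that sh(1) ri by blast
qed

lemma countable_gamma: "countable {t. \<gamma> t = \<gamma> s}"
proof -
  have "{t. \<gamma> t = \<gamma> s} = range (\<lambda>m::int. s + of_int m * L)" by (auto simp: gamma_eq_iff)
  then show ?thesis by simp
qed

lemma AE_gamma_ne: "AE t in lebesgue_on {a..b}. \<gamma> s \<noteq> \<gamma> t"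
  using AE_lebesgue_on_notin_countable[OF countable_gamma[of s], of "{a..b}"]
  by (auto elim: eventually_mono)

text \<open>A bound off the diagonal is enough: for each \<open>s\<close> the excluded parameters
  are translates of \<open>s\<close> by whole periods, a countable set.\<close>

lemma weakly_singular_kernel:
  fixes K :: "real \<Rightarrow> real \<Rightarrow> complex"
  assumes m: "(\<lambda>x. K (fst x) (snd x)) \<in> borel_measurable (borel \<Otimes>\<^sub>M borel)"
    and K: "\<And>s t. \<gamma> s \<noteq> \<gamma> t \<Longrightarrow> norm (K s t) \<le> D * r s t powr (- 1 / 2)"
  obtains C where "bounded_kernel L K C"
proof -
  obtain C where C: "C > 0" "\<And>s. integrable (lebesgue_on {0..L}) (\<lambda>t. r s t powr (- 1 / 2))"
    "\<And>s. (LINT t|lebesgue_on {0..L}. r s t powr (- 1 / 2)) \<le> C" using weakly_singular_integral by metis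
  have "integrable (lebesgue_on {0..L}) (K s) \<and> (LINT t|lebesgue_on {0..L}. norm (K s t)) \<le> \<bar>D\<bar> * C" for s
  proof -
    have le: "AE t in lebesgue_on {0..L}. norm (K s t) \<le> \<bar>D\<bar> * r s t powr (- 1 / 2)"
      using AE_gamma_ne[of s 0 L]
    proof eventually_elim
      case (elim t)
      then show ?case by (intro order_trans[OF K mult_right_mono]) auto
    qed
    have i: "integrable (lebesgue_on {0..L}) (\<lambda>t. \<bar>D\<bar> * r s t powr (- 1 / 2))" using C(2) by simp
    have 1: "integrable (lebesgue_on {0..L}) (K s)"
    proof (rule Bochner_Integration.integrable_bound[OF i])
      have "(\<lambda>t. K (fst (s, t)) (snd (s, t))) \<in> borel_measurable borel"
        by (rule measurable_compose[OF _ m]) measurable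
      then show "K s \<in> borel_measurable (lebesgue_on {0..L})" by (intro borel_measurable_lebesgue_on_borel) simp
    qed (use le in \<open>auto elim: eventually_mono\<close>)
    have "(LINT t|lebesgue_on {0..L}. norm (K s t)) \<le> (LINT t|lebesgue_on {0..L}. \<bar>D\<bar> * r s t powr (- 1 / 2))"
      by (rule integral_mono_AE) (use 1 i le in auto)
    also have "\<dots> \<le> \<bar>D\<bar> * C" using C(3)[of s] by (simp add: mult_left_mono)
    finally show ?thesis using 1 by simp
  qed
  then show ?thesis using that m by (auto simp: bounded_kernel_def case_prod_unfold)
qed

end

section \<open>The Helmholtz Green's function as a function of the squared distance\<close>

definition entire_coeffs :: "(nat \<Rightarrow> complex) \<Rightarrow> bool" where
  "entire_coeffs c \<longleftrightarrow> (\<forall>z. summable (\<lambda>n. c n * z ^ n))"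

definition pseries :: "(nat \<Rightarrow> complex) \<Rightarrow> real \<Rightarrow> complex" where
  "pseries c x = (\<Sum>n. c n * complex_of_real x ^ n)"

lemma entire_diffs: "entire_coeffs c \<Longrightarrow> entire_coeffs (diffs c)"
  unfolding entire_coeffs_def using termdiff_converges_all by blast

lemma pseries_deriv:
  assumes "entire_coeffs c" shows "(pseries c has_vector_derivative pseries (diffs c) x) (at x)"
proof -
  have "((\<lambda>z. \<Sum>n. c n * z ^ n) has_field_derivative (\<Sum>n. diffs c n * complex_of_real x ^ n)) (at (complex_of_real x))"
    by (rule termdiffs_strong_converges_everywhere) (use assms in \<open>auto simp: entire_coeffs_def\<close>)
  from has_vector_derivative_real_field[OF this] show ?thesis unfolding pseries_def[abs_def] .
qed

lemma pseries_continuous: "entire_coeffs c \<Longrightarrow> continuous_on A (pseries c)"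
  by (meson pseries_deriv continuous_at_imp_continuous_on has_vector_derivative_continuous)

lemma entire_Suc:
  assumes "entire_coeffs c" shows "entire_coeffs (\<lambda>n. c (Suc n))"
  unfolding entire_coeffs_def
proof
  fix z :: complex
  show "summable (\<lambda>n. c (Suc n) * z ^ n)"
  proof (cases "z = 0")
    case False
    have "summable (\<lambda>n. c (Suc n) * z ^ Suc n)"
      using assms unfolding entire_coeffs_def by (subst summable_Suc_iff) blast
    from summable_mult[OF this, of "inverse z"] False show ?thesis by (simp add: mult_ac)
  next
    case True
    show ?thesis unfolding True by (rule summable_finite[of "{0}"]) auto
  qed
qed

text \<open>Splits off the constant term, so that division by the argument leaves a pole with
  explicit coefficient and another entire series.\<close>

lemma pseries_Suc:
  assumes "entire_coeffs c" shows "pseries c x = c 0 + x * pseries (\<lambda>n. c (Suc n)) x"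
proof -
  have s: "summable (\<lambda>n. c n * complex_of_real x ^ n)" "summable (\<lambda>n. c (Suc n) * complex_of_real x ^ n)"
    using assms entire_Suc[OF assms] by (auto simp: entire_coeffs_def)
  have "pseries c x = (\<Sum>n. c (Suc n) * complex_of_real x ^ Suc n) + c 0"
    unfolding pseries_def using suminf_split_head[OF s(1)] by simp
  also have "(\<Sum>n. c (Suc n) * complex_of_real x ^ Suc n) = (\<Sum>n. x * (c (Suc n) * complex_of_real x ^ n))"
    by (simp add: mult_ac)
  also have "\<dots> = x * pseries (\<lambda>n. c (Suc n)) x" unfolding pseries_def by (rule suminf_mult[OF s(2)])
  finally show ?thesis by simp
qed

lemma pseries_add:
  assumes "entire_coeffs c" "entire_coeffs d"
  shows "entire_coeffs (\<lambda>n. c n + d n)" "pseries (\<lambda>n. c n + d n) x = pseries c x + pseries d x"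
  using assms by (auto simp: entire_coeffs_def pseries_def distrib_right summable_add suminf_add)

lemma pseries_cmult:
  assumes "entire_coeffs c"
  shows "entire_coeffs (\<lambda>n. a * c n)" "pseries (\<lambda>n. a * c n) x = a * pseries c x"
  using assms by (auto simp: entire_coeffs_def pseries_def mult.assoc summable_mult suminf_mult)

lemma factorial_bound_entire:
  assumes "\<And>n. norm (c n) \<le> q ^ n / fact n" shows "entire_coeffs c"
  unfolding entire_coeffs_def
proof
  fix z :: complex
  have q: "q \<ge> 0" using assms[of 1] norm_ge_zero[of "c 1"] by (simp del: norm_ge_zero)
  have "summable (\<lambda>n. inverse (fact n) * (q * norm z) ^ n)" by (rule summable_exp)
  then show "summable (\<lambda>n. c n * z ^ n)"
  proof (rule summable_comparison_test')
    fix n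
    have "norm (c n) * norm z ^ n \<le> q ^ n / fact n * norm z ^ n"
      using assms by (intro mult_right_mono) auto
    then show "norm (c n * z ^ n) \<le> inverse (fact n) * (q * norm z) ^ n"
      by (simp add: norm_mult norm_power field_simps)
  qed
qed

text \<open>The Bessel function of \<open>k * r\<close> expanded in powers of the squared distance.
  The primed sequence does the same for the series with harmonic numbers in
  \<open>bessel_Y0\<close>.\<close>

definition bessel_coeff :: "real \<Rightarrow> nat \<Rightarrow> real" where
  "bessel_coeff k n = (- 1) ^ n / (fact n)\<^sup>2 * (k\<^sup>2 / 4) ^ n"

definition bessel_coeff' :: "real \<Rightarrow> nat \<Rightarrow> real" where
  "bessel_coeff' k n = (- 1) ^ (n + 1) * harm n / (fact n)\<^sup>2 * (k\<^sup>2 / 4) ^ n"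

text \<open>The constant comes from \<open>i/4 * i * 2/pi = - 1/(2 pi)\<close>, halved because the
  logarithm is taken of the squared distance.\<close>

definition log_coeff :: "real \<Rightarrow> nat \<Rightarrow> complex" where
  "log_coeff k n = - 1 / (4 * pi) * complex_of_real (bessel_coeff k n)"

text \<open>What remains of the Green's function after the logarithm of the squared distance is
  split off: the term with \<open>bessel_J0\<close>, the constant part of the logarithm and the
  harmonic series.\<close>

definition reg_coeff :: "real \<Rightarrow> nat \<Rightarrow> complex" where
  "reg_coeff k n = (\<i> / 4 - (ln (k / 2) + euler_mascheroni) / (2 * pi)) * complex_of_real (bessel_coeff k n)
    + - 1 / (2 * pi) * complex_of_real (bessel_coeff' k n)"

lemma entire_bessel: "entire_coeffs (\<lambda>n. complex_of_real (bessel_coeff k n))"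
  "entire_coeffs (\<lambda>n. complex_of_real (bessel_coeff' k n))"
proof -
  have f1: "(1::real) \<le> fact n" for n by (simp add: fact_ge_1)
  show "entire_coeffs (\<lambda>n. complex_of_real (bessel_coeff k n))"
  proof (rule factorial_bound_entire)
    fix n
    have "1 / (fact n)\<^sup>2 \<le> 1 / (fact n :: real)" using f1[of n] by (intro divide_left_mono) (auto simp: power2_eq_square)
    then have "1 / (fact n)\<^sup>2 * (k\<^sup>2 / 4) ^ n \<le> 1 / fact n * (k\<^sup>2 / 4) ^ n" by (intro mult_right_mono) auto
    then show "norm (complex_of_real (bessel_coeff k n)) \<le> (k\<^sup>2 / 4) ^ n / fact n"
      unfolding norm_of_real by (simp add: bessel_coeff_def abs_mult power_abs)
  qed
  \<comment> \<open>A crude bound that gives up one of the two factorials in the denominator; one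
    factorial suffices for convergence everywhere.\<close>
  have h: "harm n \<le> (fact n :: real)" for n
  proof (induction n)
    case (Suc n)
    show ?case
    proof (cases "n = 0")
      case True
      then show ?thesis by (simp add: harm_def)
    next
      case False
      have "inverse (real (Suc n)) \<le> 1" by (simp add: inverse_le_1_iff)
      also have "1 \<le> real n * fact n" using mult_mono[of 1 "real n" 1 "fact n"] f1[of n] False by simp
      finally have "harm n + inverse (real (Suc n)) \<le> fact n + real n * fact n" using Suc by (intro add_mono)
      then show ?thesis by (simp add: harm_Suc algebra_simps)
    qed
  qed (simp add: harm_def)
  show "entire_coeffs (\<lambda>n. complex_of_real (bessel_coeff' k n))"
  proof (rule factorial_bound_entire)
    fix n
    have "harm n / (fact n)\<^sup>2 \<le> fact n / ((fact n)\<^sup>2 :: real)" by (intro divide_right_mono h) auto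
    also have "\<dots> = 1 / fact n" by (simp add: power2_eq_square)
    finally have "harm n / (fact n)\<^sup>2 * (k\<^sup>2 / 4) ^ n \<le> 1 / fact n * (k\<^sup>2 / 4) ^ n" by (intro mult_right_mono) auto
    then show "norm (complex_of_real (bessel_coeff' k n)) \<le> (k\<^sup>2 / 4) ^ n / fact n"
      unfolding norm_of_real by (simp add: bessel_coeff'_def abs_mult power_abs harm_nonneg)
  qed
qed

lemma entire_log: "entire_coeffs (log_coeff k)" and entire_reg: "entire_coeffs (reg_coeff k)"
  unfolding log_coeff_def[abs_def] reg_coeff_def[abs_def]
  by (intro pseries_cmult pseries_add entire_bessel)+

text \<open>The argument of these functions is the squared distance \<open>|x - y|\<^sup>2\<close>.\<close>

definition \<Phi>0 :: "real \<Rightarrow> real \<Rightarrow> complex" where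
  "\<Phi>0 k x = pseries (log_coeff k) x * ln x + pseries (reg_coeff k) x"

definition \<Phi>1 :: "real \<Rightarrow> real \<Rightarrow> complex" where
  "\<Phi>1 k x = pseries (diffs (log_coeff k)) x * ln x + pseries (log_coeff k) x / x + pseries (diffs (reg_coeff k)) x"

definition \<Phi>2 :: "real \<Rightarrow> real \<Rightarrow> complex" where
  "\<Phi>2 k x = pseries (diffs (diffs (log_coeff k))) x * ln x + 2 * pseries (diffs (log_coeff k)) x / x
    - pseries (log_coeff k) x / x\<^sup>2 + pseries (diffs (diffs (reg_coeff k))) x"

lemma ln_deriv_complex: "x > 0 \<Longrightarrow> ((\<lambda>x. complex_of_real (ln x)) has_vector_derivative complex_of_real (1 / x)) (at x)"
  by (intro has_vector_derivative_of_real) (auto intro!: derivative_eq_intros simp: has_real_derivative_iff_has_vector_derivative[symmetric])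

lemma inverse_deriv_complex: "x \<noteq> 0 \<Longrightarrow> ((\<lambda>x. complex_of_real (1 / x)) has_vector_derivative complex_of_real (- 1 / x\<^sup>2)) (at x)"
  by (intro has_vector_derivative_of_real)
     (auto intro!: derivative_eq_intros simp: has_real_derivative_iff_has_vector_derivative[symmetric] power2_eq_square)

lemma \<Phi>_deriv:
  assumes "x > 0"
  shows "(\<Phi>0 k has_vector_derivative \<Phi>1 k x) (at x)" "(\<Phi>1 k has_vector_derivative \<Phi>2 k x) (at x)"
proof -
  note p = pseries_deriv[OF entire_log[of k], of x] pseries_deriv[OF entire_diffs[OF entire_log[of k]], of x]
    pseries_deriv[OF entire_reg[of k], of x] pseries_deriv[OF entire_diffs[OF entire_reg[of k]], of x]
  show "(\<Phi>0 k has_vector_derivative \<Phi>1 k x) (at x)"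
    unfolding \<Phi>0_def[abs_def]
    by (rule has_vector_derivative_eq_rhs[OF has_vector_derivative_add[OF has_vector_derivative_mult[OF p(1) ln_deriv_complex[OF assms]] p(3)]])
       (simp add: \<Phi>1_def)
  have eq: "\<Phi>1 k = (\<lambda>x. pseries (diffs (log_coeff k)) x * complex_of_real (ln x) + pseries (log_coeff k) x * complex_of_real (1 / x) + pseries (diffs (reg_coeff k)) x)"
    by (simp add: \<Phi>1_def[abs_def])
  have nz: "x \<noteq> 0" using assms by simp
  show "(\<Phi>1 k has_vector_derivative \<Phi>2 k x) (at x)"
    unfolding eq
    by (rule has_vector_derivative_eq_rhs[OF has_vector_derivative_add[OF has_vector_derivative_add[OF
          has_vector_derivative_mult[OF p(2) ln_deriv_complex[OF assms]]
          has_vector_derivative_mult[OF p(1) inverse_deriv_complex[OF nz]]] p(4)]])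
       (simp add: \<Phi>2_def)
qed

text \<open>As a function of the squared distance the Green's function is one entire series times a
  logarithm plus another entire series. Along a line the squared distance is a quadratic polynomial,
  so directional derivatives become one-dimensional calculus.\<close>

lemma green_eq:
  assumes k: "k > 0" and "x \<noteq> y"
  shows "green k x y = \<Phi>0 k ((cmod (x - y))\<^sup>2)"
proof -
  define r where "r = cmod (x - y)"
  have r: "r > 0" using assms by (simp add: r_def)
  have pw: "(k * r / 2) ^ (2 * m) = (k\<^sup>2 / 4) ^ m * (r\<^sup>2) ^ m" for m
  proof -
    have "(k * r / 2)\<^sup>2 = k\<^sup>2 / 4 * r\<^sup>2" by (simp add: power2_eq_square)
    then show ?thesis by (simp only: power_mult power_mult_distrib)
  qed
  have s: "summable (\<lambda>n. bessel_coeff k n * (r\<^sup>2) ^ n)" "summable (\<lambda>n. bessel_coeff' k n * (r\<^sup>2) ^ n)"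
  proof -
    have "summable (\<lambda>n. complex_of_real (bessel_coeff k n * (r\<^sup>2) ^ n))" "summable (\<lambda>n. complex_of_real (bessel_coeff' k n * (r\<^sup>2) ^ n))"
      using entire_bessel[of k] unfolding entire_coeffs_def by (auto dest: spec[of _ "complex_of_real (r\<^sup>2)"])
    then show "summable (\<lambda>n. bessel_coeff k n * (r\<^sup>2) ^ n)" "summable (\<lambda>n. bessel_coeff' k n * (r\<^sup>2) ^ n)"
      by (simp_all only: summable_of_real_iff)
  qed
  have J: "complex_of_real (bessel_J0 (k * r)) = pseries (\<lambda>n. complex_of_real (bessel_coeff k n)) (r\<^sup>2)"
  proof -
    have "bessel_J0 (k * r) = (\<Sum>n. bessel_coeff k n * (r\<^sup>2) ^ n)"
      unfolding bessel_J0_def pw by (simp add: bessel_coeff_def mult.assoc)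
    then show ?thesis using suminf_of_real[OF s(1), where ?'a = complex] by (simp add: pseries_def)
  qed
  define E where "E = (\<Sum>m. (- 1) ^ (m + 1) * harm m / (fact m)\<^sup>2 * (k * r / 2) ^ (2 * m))"
  have E: "complex_of_real E = pseries (\<lambda>n. complex_of_real (bessel_coeff' k n)) (r\<^sup>2)"
  proof -
    have "E = (\<Sum>n. bessel_coeff' k n * (r\<^sup>2) ^ n)"
      unfolding E_def pw by (simp add: bessel_coeff'_def mult.assoc)
    then show ?thesis using suminf_of_real[OF s(2), where ?'a = complex] by (simp add: pseries_def)
  qed
  have l: "ln (k * r / 2) = ln (k / 2) + ln (r\<^sup>2) / 2"
    using k r by (simp add: ln_mult ln_div ln_realpow)
  have A: "pseries (log_coeff k) (r\<^sup>2) = - 1 / (4 * pi) * complex_of_real (bessel_J0 (k * r))"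
    unfolding log_coeff_def[abs_def] pseries_cmult(2)[OF entire_bessel(1)] J ..
  have B: "pseries (reg_coeff k) (r\<^sup>2) = (\<i> / 4 - (ln (k / 2) + euler_mascheroni) / (2 * pi)) * complex_of_real (bessel_J0 (k * r)) + - 1 / (2 * pi) * complex_of_real E"
    unfolding reg_coeff_def[abs_def] pseries_add(2)[OF pseries_cmult(1)[OF entire_bessel(1)] pseries_cmult(1)[OF entire_bessel(2)]]
      pseries_cmult(2)[OF entire_bessel(1)] pseries_cmult(2)[OF entire_bessel(2)] J E ..
  have "green k x y = \<i> / 4 * (complex_of_real (bessel_J0 (k * r)) + \<i> * complex_of_real
    (2 / pi * ((ln (k / 2) + ln (r\<^sup>2) / 2 + euler_mascheroni) * bessel_J0 (k * r) + E)))"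
    unfolding green_def hankel_H0_def bessel_Y0_def r_def[symmetric] E_def[symmetric] l ..
  also have "\<dots> = \<Phi>0 k (r\<^sup>2)"
    unfolding \<Phi>0_def A B by (simp add: field_simps)
  finally show ?thesis by (simp add: r_def)
qed

section \<open>Directional derivatives of the Green's function\<close>

lemma dir_derivI:
  assumes "((\<lambda>t::real. H (x + t *\<^sub>R v)) has_vector_derivative D) (at 0)" "\<And>z. z \<noteq> y \<Longrightarrow> F z = H z" "x \<noteq> y"
  shows "dir_deriv v F x = D"
proof -
  \<comment> \<open>The formula fails at \<open>y\<close> only, and a line through \<open>x\<close>
    stays away from \<open>y\<close> for small \<open>t\<close>; the value of \<open>F\<close> at
    \<open>y\<close> has no influence.\<close>
  have "open {t::real. x + t *\<^sub>R v \<noteq> y}"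
    by (rule open_Collect_neq) (intro continuous_intros)+
  then have "((\<lambda>t::real. F (x + t *\<^sub>R v)) has_vector_derivative D) (at 0)"
    by (rule has_vector_derivative_transform_within_open[OF assms(1)]) (use assms(2,3) in auto)
  then show ?thesis unfolding dir_deriv_def by (rule vector_derivative_at)
qed

lemma norm2_line_deriv:
  fixes d v :: complex
  shows "((\<lambda>t. (norm (d + t *\<^sub>R v))\<^sup>2) has_vector_derivative 2 * (d \<bullet> v)) (at 0)"
proof -
  have eq: "(\<lambda>t. (norm (d + t *\<^sub>R v))\<^sup>2) = (\<lambda>t. (norm d)\<^sup>2 + 2 * t * (d \<bullet> v) + t\<^sup>2 * (norm v)\<^sup>2)"
    by (rule ext, simp only: power2_norm_eq_inner inner_add_left inner_add_right inner_scaleR_left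
        inner_scaleR_right inner_commute[of v d], algebra)
  show ?thesis unfolding eq has_real_derivative_iff_has_vector_derivative[symmetric]
    by (auto intro!: derivative_eq_intros)
qed

lemma radial_deriv:
  fixes d v :: complex
  assumes "\<And>x. x > 0 \<Longrightarrow> (P has_vector_derivative P' x) (at x)" "d \<noteq> 0"
  shows "((\<lambda>t. P ((norm (d + t *\<^sub>R v))\<^sup>2)) has_vector_derivative (2 * (d \<bullet> v)) *\<^sub>R P' ((norm d)\<^sup>2)) (at 0)"
proof -
  have "(P \<circ> (\<lambda>t. (norm (d + t *\<^sub>R v))\<^sup>2) has_vector_derivative (2 * (d \<bullet> v)) *\<^sub>R P' ((norm d)\<^sup>2)) (at 0)"
    by (rule vector_diff_chain_at[OF norm2_line_deriv]) (use assms in auto)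
  then show ?thesis by (simp add: o_def)
qed

lemma inner_line_deriv:
  fixes d v w :: complex
  shows "((\<lambda>t. complex_of_real ((d + t *\<^sub>R v) \<bullet> w)) has_vector_derivative complex_of_real (v \<bullet> w)) (at 0)"
  by (intro has_vector_derivative_of_real)
     (auto simp: inner_add_left has_real_derivative_iff_has_vector_derivative[symmetric] intro!: derivative_eq_intros)

lemma dir_deriv_green:
  assumes k: "k > 0" and xy: "x \<noteq> y"
  shows "dir_deriv v (\<lambda>x. green k x y) x = 2 * ((x - y) \<bullet> v) * \<Phi>1 k ((cmod (x - y))\<^sup>2)"
    "dir_deriv v (\<lambda>y. green k x y) y = - 2 * ((x - y) \<bullet> v) * \<Phi>1 k ((cmod (x - y))\<^sup>2)"
proof -
  have d: "x - y \<noteq> 0" "y - x \<noteq> 0" using xy by auto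
  show "dir_deriv v (\<lambda>x. green k x y) x = 2 * ((x - y) \<bullet> v) * \<Phi>1 k ((cmod (x - y))\<^sup>2)"
    by (rule dir_derivI[where H = "\<lambda>x. \<Phi>0 k ((cmod (x - y))\<^sup>2)" and y = y])
       (use radial_deriv[OF \<Phi>_deriv(1) d(1), of k v] xy green_eq[OF k] in \<open>auto simp: algebra_simps scaleR_conv_of_real\<close>)
  show "dir_deriv v (\<lambda>y. green k x y) y = - 2 * ((x - y) \<bullet> v) * \<Phi>1 k ((cmod (x - y))\<^sup>2)"
    by (rule dir_derivI[where H = "\<lambda>y. \<Phi>0 k ((cmod (y - x))\<^sup>2)" and y = x])
       (use radial_deriv[OF \<Phi>_deriv(1) d(2), of k v] xy green_eq[OF k] in
         \<open>auto simp: algebra_simps scaleR_conv_of_real norm_minus_commute\<close>)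
qed

lemma dir_deriv_inner_deriv:
  fixes d v w :: complex
  assumes "d \<noteq> 0"
  shows "((\<lambda>t. 2 * complex_of_real ((d + t *\<^sub>R v) \<bullet> w) * \<Phi>1 k ((norm (d + t *\<^sub>R v))\<^sup>2)) has_vector_derivative
    2 * (v \<bullet> w) * \<Phi>1 k ((norm d)\<^sup>2) + 4 * (d \<bullet> v) * (d \<bullet> w) * \<Phi>2 k ((norm d)\<^sup>2)) (at 0)"
  by (rule has_vector_derivative_eq_rhs[OF has_vector_derivative_mult[OF
        has_vector_derivative_mult_right[OF inner_line_deriv] radial_deriv[OF \<Phi>_deriv(2) assms]]])
     (auto simp: scaleR_conv_of_real mult_ac)

lemma dir_deriv_green2:
  assumes k: "k > 0" and xy: "x \<noteq> y"
  shows "dir_deriv v (dir_deriv v (\<lambda>x. green k x y)) x =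
      2 * (v \<bullet> v) * \<Phi>1 k ((cmod (x - y))\<^sup>2) + 4 * ((x - y) \<bullet> v) * ((x - y) \<bullet> v) * \<Phi>2 k ((cmod (x - y))\<^sup>2)"
    "dir_deriv v (\<lambda>x. dir_deriv w (\<lambda>y. green k x y) y) x =
      - (2 * (v \<bullet> w) * \<Phi>1 k ((cmod (x - y))\<^sup>2) + 4 * ((x - y) \<bullet> v) * ((x - y) \<bullet> w) * \<Phi>2 k ((cmod (x - y))\<^sup>2))"
proof -
  have d: "x - y \<noteq> 0" using xy by auto
  have sh: "x + t *\<^sub>R v - y = x - y + t *\<^sub>R v" for t by simp
  show "dir_deriv v (dir_deriv v (\<lambda>x. green k x y)) x =
      2 * (v \<bullet> v) * \<Phi>1 k ((cmod (x - y))\<^sup>2) + 4 * ((x - y) \<bullet> v) * ((x - y) \<bullet> v) * \<Phi>2 k ((cmod (x - y))\<^sup>2)"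
    by (rule dir_derivI[where H = "\<lambda>x. 2 * complex_of_real ((x - y) \<bullet> v) * \<Phi>1 k ((cmod (x - y))\<^sup>2)" and y = y])
       (use dir_deriv_inner_deriv[OF d, of v v k] dir_deriv_green(1)[OF k] xy in \<open>auto simp: sh\<close>)
  show "dir_deriv v (\<lambda>x. dir_deriv w (\<lambda>y. green k x y) y) x =
      - (2 * (v \<bullet> w) * \<Phi>1 k ((cmod (x - y))\<^sup>2) + 4 * ((x - y) \<bullet> v) * ((x - y) \<bullet> w) * \<Phi>2 k ((cmod (x - y))\<^sup>2))"
    by (rule dir_derivI[where H = "\<lambda>x. - (2 * complex_of_real ((x - y) \<bullet> w) * \<Phi>1 k ((cmod (x - y))\<^sup>2))" and y = y])
       (use has_vector_derivative_minus[OF dir_deriv_inner_deriv[OF d, of v w k]] dir_deriv_green(2)[OF k] xy in \<open>auto simp: sh\<close>)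
qed

section \<open>Orders of vanishing on the diagonal\<close>

context closed_curve
begin

text \<open>Kernel estimates become bookkeeping of exponents: products add orders, division by the
  squared distance costs \<open>2\<close>. The diagonal is excluded, since the kernels carry
  arbitrary default values there.\<close>

definition Ord :: "real \<Rightarrow> (real \<Rightarrow> real \<Rightarrow> 'b::real_normed_vector) \<Rightarrow> bool" where
  "Ord p F \<longleftrightarrow> (\<exists>C. \<forall>s t. \<gamma> s \<noteq> \<gamma> t \<longrightarrow> norm (F s t) \<le> C * r s t powr p)"

lemma r_pos: "\<gamma> s \<noteq> \<gamma> t \<Longrightarrow> 0 < r s t" by (simp add: r_def)

lemma r_nonneg [simp]: "0 \<le> r s t" by (simp add: r_def)

lemma OrdI: "(\<And>s t. \<gamma> s \<noteq> \<gamma> t \<Longrightarrow> norm (F s t) \<le> C * r s t powr p) \<Longrightarrow> Ord p F"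
  unfolding Ord_def by blast

lemma OrdE:
  assumes "Ord p F"
  obtains C where "C \<ge> 0" "\<And>s t. \<gamma> s \<noteq> \<gamma> t \<Longrightarrow> norm (F s t) \<le> C * r s t powr p"
proof -
  obtain C where C: "\<And>s t. \<gamma> s \<noteq> \<gamma> t \<Longrightarrow> norm (F s t) \<le> C * r s t powr p" using assms by (auto simp: Ord_def)
  have "norm (F s t) \<le> \<bar>C\<bar> * r s t powr p" if "\<gamma> s \<noteq> \<gamma> t" for s t
    by (rule order_trans[OF C[OF that] mult_right_mono]) auto
  then show ?thesis using that[of "\<bar>C\<bar>"] by simp
qed

lemma r_bounded: obtains R where "R \<ge> 1" "\<And>s t. r s t \<le> R"
proof -
  obtain C where C: "C > 0" "\<And>t. norm (\<gamma>d 0 t) \<le> C" using d_bounded[of 0] by metis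
  have "r s t \<le> 2 * C + 1" for s t
    using norm_triangle_ineq4[of "\<gamma> s" "\<gamma> t"] C(2)[of s] C(2)[of t] by (simp add: r_def \<gamma>d_simps)
  then show ?thesis using that[of "2 * C + 1"] C(1) by simp
qed

lemma Ord_cong: "(\<And>s t. \<gamma> s \<noteq> \<gamma> t \<Longrightarrow> F s t = G s t) \<Longrightarrow> Ord p G \<Longrightarrow> Ord p F"
  unfolding Ord_def by metis

text \<open>The curve is bounded, so surplus powers of the chord are absorbed into the
  constant.\<close>

lemma Ord_mono:
  assumes "Ord p F" "q \<le> p" shows "Ord q F"
proof -
  obtain C where C: "C \<ge> 0" "\<And>s t. \<gamma> s \<noteq> \<gamma> t \<Longrightarrow> norm (F s t) \<le> C * r s t powr p" using OrdE[OF assms(1)] by metis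
  obtain R where R: "R \<ge> 1" "\<And>s t. r s t \<le> R" using r_bounded by metis
  show ?thesis
  proof (rule OrdI)
    fix s t assume ne: "\<gamma> s \<noteq> \<gamma> t"
    have "r s t powr p = r s t powr (p - q) * r s t powr q" by (simp flip: powr_add)
    also have "\<dots> \<le> R powr (p - q) * r s t powr q"
      using R(2)[of s t] r_pos[OF ne] assms(2) by (intro mult_right_mono powr_mono2) auto
    finally have "C * r s t powr p \<le> C * (R powr (p - q) * r s t powr q)" using C(1) by (rule mult_left_mono)
    then show "norm (F s t) \<le> (C * R powr (p - q)) * r s t powr q" using C(2)[OF ne] by (simp add: mult.assoc)
  qed
qed

lemma Ord_add:
  assumes "Ord p F" "Ord p G" shows "Ord p (\<lambda>s t. F s t + G s t)"
proof -
  obtain C where C: "\<And>s t. \<gamma> s \<noteq> \<gamma> t \<Longrightarrow> norm (F s t) \<le> C * r s t powr p" using OrdE[OF assms(1)] by metis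
  obtain D where D: "\<And>s t. \<gamma> s \<noteq> \<gamma> t \<Longrightarrow> norm (G s t) \<le> D * r s t powr p" using OrdE[OF assms(2)] by metis
  show ?thesis
  proof (rule OrdI)
    fix s t assume ne: "\<gamma> s \<noteq> \<gamma> t"
    show "norm (F s t + G s t) \<le> (C + D) * r s t powr p"
      using norm_triangle_le[OF add_mono[OF C[OF ne] D[OF ne]]] by (simp add: distrib_right)
  qed
qed

lemma Ord_minus: "Ord p F \<Longrightarrow> Ord p (\<lambda>s t. - F s t)"
  by (simp add: Ord_def)

lemma Ord_diff: "Ord p F \<Longrightarrow> Ord p G \<Longrightarrow> Ord p (\<lambda>s t. F s t - G s t)"
  using Ord_add[OF _ Ord_minus, of p F G] by simp

lemma Ord_bilinear:
  assumes F: "Ord p F" and G: "Ord q G" and le: "\<And>s t. norm (H s t) \<le> norm (F s t) * norm (G s t)"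
  shows "Ord (p + q) H"
proof -
  obtain C where C: "C \<ge> 0" "\<And>s t. \<gamma> s \<noteq> \<gamma> t \<Longrightarrow> norm (F s t) \<le> C * r s t powr p" using OrdE[OF F] by metis
  obtain D where D: "D \<ge> 0" "\<And>s t. \<gamma> s \<noteq> \<gamma> t \<Longrightarrow> norm (G s t) \<le> D * r s t powr q" using OrdE[OF G] by metis
  show ?thesis
  proof (rule OrdI)
    fix s t assume ne: "\<gamma> s \<noteq> \<gamma> t"
    have "norm (H s t) \<le> (C * r s t powr p) * (D * r s t powr q)"
      by (rule order_trans[OF le mult_mono[OF C(2)[OF ne] D(2)[OF ne]]]) (use C in auto)
    then show "norm (H s t) \<le> (C * D) * r s t powr (p + q)" by (simp add: powr_add mult_ac)
  qed
qed

lemma Ord_mult: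
  fixes F G :: "real \<Rightarrow> real \<Rightarrow> 'b::real_normed_algebra"
  assumes "Ord p F" "Ord q G" "m = p + q" shows "Ord m (\<lambda>s t. F s t * G s t)"
  unfolding assms(3) by (rule Ord_bilinear[OF assms(1,2)]) (rule norm_mult_ineq)

lemma Ord_inner:
  fixes F G :: "real \<Rightarrow> real \<Rightarrow> complex"
  assumes "Ord p F" "Ord q G" "m = p + q" shows "Ord m (\<lambda>s t. F s t \<bullet> G s t)"
  unfolding assms(3) by (rule Ord_bilinear[OF assms(1,2)]) (simp add: Cauchy_Schwarz_ineq2)

lemma Ord_of_real: "Ord p F \<Longrightarrow> Ord p (\<lambda>s t. complex_of_real (F s t))"
  by (simp add: Ord_def)

lemma Ord_0: "(\<And>s t. norm (F s t) \<le> C) \<Longrightarrow> Ord 0 F"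
  by (rule OrdI[of _ C]) (simp add: r_def)

lemma Ord_const: "Ord 0 (\<lambda>s t. c)" by (rule Ord_0[of _ "norm c"]) simp

lemma Ord_cmult:
  fixes F :: "real \<Rightarrow> real \<Rightarrow> 'b::real_normed_algebra"
  shows "Ord p F \<Longrightarrow> Ord p (\<lambda>s t. c * F s t)"
  using Ord_mult[OF Ord_const, of p F p c] by simp

definition "\<rho> s t = (r s t)\<^sup>2"

lemma \<rho>_pos: "\<gamma> s \<noteq> \<gamma> t \<Longrightarrow> 0 < \<rho> s t" by (simp add: \<rho>_def r_def)

lemma Ord_div_\<rho>:
  fixes F :: "real \<Rightarrow> real \<Rightarrow> 'b::real_normed_field"
  assumes "Ord p F" "m = p - 2" shows "Ord m (\<lambda>s t. F s t / of_real (\<rho> s t))"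
proof -
  have "Ord (- 2) (\<lambda>s t. 1 / of_real (\<rho> s t) :: 'b)"
    by (rule OrdI[of _ 1]) (simp add: norm_divide powr_minus \<rho>_def divide_inverse norm_inverse norm_power)
  from Ord_mult[OF assms(1) this, of m] assms(2) show ?thesis by simp
qed

lemma Ord_d: "Ord 1 (\<lambda>s t. \<gamma> s - \<gamma> t)"
  by (rule OrdI[of _ 1]) (simp add: r_def)

lemma Ord_\<gamma>d: "Ord 0 (\<lambda>s t. \<gamma>d n s)" "Ord 0 (\<lambda>s t. \<gamma>d n t)"
  using d_bounded[of n] Ord_0 by metis+

lemma Ord_T: "Ord 0 (\<lambda>s t. T s)" by (rule Ord_0[of _ 1]) (simp add: norm_T)

lemma Ord_normal: "Ord 0 (\<lambda>s t. normal \<gamma> s)" "Ord 0 (\<lambda>s t. normal \<gamma> t)"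
  by (rule Ord_0[of _ 1], simp add: norm_normal)+

lemma Ord_T_diff: "Ord 1 (\<lambda>s t. T s - T t)"
proof -
  obtain C where "\<And>s t. norm (\<gamma>d 1 s - \<gamma>d 1 t) \<le> C * r s t" using geometric_bounds[of 1] by metis
  then show ?thesis by (intro OrdI[of _ C]) (simp add: \<gamma>d_simps r_pos)
qed

lemma Ord_normal_diff: "Ord 1 (\<lambda>s t. normal \<gamma> s - normal \<gamma> t)"
proof -
  have "normal \<gamma> s - normal \<gamma> t = - \<i> * (T s - T t)" for s t by (simp add: normal_def algebra_simps)
  then show ?thesis using Ord_cmult[OF Ord_T_diff, of "- \<i>"] by simp
qed

lemma Ord_d_normal: "Ord 2 (\<lambda>s t. (\<gamma> s - \<gamma> t) \<bullet> normal \<gamma> t)" "Ord 2 (\<lambda>s t. (\<gamma> s - \<gamma> t) \<bullet> normal \<gamma> s)"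
proof -
  obtain C where C: "\<And>s t. \<bar>(\<gamma> s - \<gamma> t) \<bullet> normal \<gamma> t\<bar> \<le> C * (r s t)\<^sup>2" using geometric_bounds[of 0] by metis
  then show "Ord 2 (\<lambda>s t. (\<gamma> s - \<gamma> t) \<bullet> normal \<gamma> t)"
    by (intro OrdI[of _ C]) (simp add: r_pos)
  have "\<bar>(\<gamma> s - \<gamma> t) \<bullet> normal \<gamma> s\<bar> \<le> C * (r s t)\<^sup>2" for s t
    using C[of t s] by (simp add: r_sym[of t s] inner_diff_left abs_minus_commute)
  then show "Ord 2 (\<lambda>s t. (\<gamma> s - \<gamma> t) \<bullet> normal \<gamma> s)"
    by (intro OrdI[of _ C]) (simp add: r_pos)
qed

text \<open>For short chords \<open>ln x \<le> x\<close> is applied to the chord raised to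
  \<open>-1/2\<close>, which gives the constant \<open>4\<close>. For long chords the logarithm is
  bounded by the diameter bound \<open>R\<close>, and a constant is itself of order
  \<open>-1/2\<close>.\<close>

lemma Ord_ln: "Ord (- 1 / 2) (\<lambda>s t. ln (\<rho> s t))"
proof -
  obtain R where R: "R \<ge> 1" "\<And>s t. r s t \<le> R" using r_bounded by metis
  show ?thesis
  proof (rule OrdI)
    fix s t assume ne: "\<gamma> s \<noteq> \<gamma> t"
    have p: "r s t > 0" using r_pos[OF ne] .
    have l: "ln (\<rho> s t) = 2 * ln (r s t)" unfolding \<rho>_def using p by (simp add: ln_realpow)
    have pp: "r s t powr (- 1 / 2) > 0" using p by simp
    have "\<bar>ln (\<rho> s t)\<bar> \<le> 4 * r s t powr (- 1 / 2) + 2 * (R * R powr (1 / 2)) * r s t powr (- 1 / 2)"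
    proof (cases "r s t \<le> 1")
      case True
      have "ln (r s t powr (- 1 / 2)) \<le> r s t powr (- 1 / 2)" using ln_bound[OF pp] .
      then have "- ln (r s t) / 2 \<le> r s t powr (- 1 / 2)" using p by (simp add: ln_powr)
      then have "\<bar>ln (\<rho> s t)\<bar> \<le> 4 * r s t powr (- 1 / 2)" using True p by (simp add: l)
      moreover have "0 \<le> 2 * (R * R powr (1 / 2)) * r s t powr (- 1 / 2)" using R by simp
      ultimately show ?thesis by linarith
    next
      case False
      have "ln (r s t) \<le> R" using ln_bound[OF p] R(2)[of s t] by linarith
      moreover have "1 \<le> R powr (1 / 2) * r s t powr (- 1 / 2)"
      proof -
        have "1 = r s t powr (1 / 2) * r s t powr (- 1 / 2)" using p by (simp flip: powr_add)
        also have "\<dots> \<le> R powr (1 / 2) * r s t powr (- 1 / 2)" using p R(2) by (intro mult_right_mono powr_mono2) auto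
        finally show ?thesis .
      qed
      then have "R * 1 \<le> R * (R powr (1 / 2) * r s t powr (- 1 / 2))" using R(1) by (intro mult_left_mono) auto
      moreover have "ln (r s t) \<ge> 0" using False by simp
      ultimately have "\<bar>ln (\<rho> s t)\<bar> \<le> 2 * (R * R powr (1 / 2)) * r s t powr (- 1 / 2)" by (simp add: l mult_ac)
      then show ?thesis using pp by linarith
    qed
    then show "norm (ln (\<rho> s t)) \<le> (4 + 2 * (R * R powr (1 / 2))) * r s t powr (- 1 / 2)" by (simp only: distrib_right real_norm_def)
  qed
qed

lemma Ord_pseries:
  assumes "entire_coeffs c" shows "Ord 0 (\<lambda>s t. pseries c (\<rho> s t))"
proof -
  obtain R where R: "R \<ge> 1" "\<And>s t. r s t \<le> R" using r_bounded by metis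
  obtain C where C: "\<And>x. x \<in> {0..R\<^sup>2} \<Longrightarrow> norm (pseries c x) \<le> C"
    using continuous_bounded_Icc[OF pseries_continuous[OF assms]] by metis
  have "\<rho> s t \<in> {0..R\<^sup>2}" for s t using R power_mono[OF R(2), of s t 2] by (simp add: \<rho>_def r_def)
  then show ?thesis by (intro Ord_0[of _ C] C)
qed

lemmas entire_intros = entire_log entire_reg entire_diffs entire_Suc

text \<open>Each derivative in the squared distance costs two orders in the chord. The second claim
  isolates the pole of \<open>\<Phi>1\<close>: the remaining terms of the logarithmic series lose
  the division, and only a logarithm is left.\<close>

lemma Ord_\<Phi>:
  shows "Ord (- 1 / 2) (\<lambda>s t. \<Phi>0 k (\<rho> s t))"
    "Ord (- 1 / 2) (\<lambda>s t. \<Phi>1 k (\<rho> s t) - log_coeff k 0 / \<rho> s t)"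
    "Ord (- 2) (\<lambda>s t. \<Phi>1 k (\<rho> s t))" "Ord (- 4) (\<lambda>s t. \<Phi>2 k (\<rho> s t))"
proof -
  have ln: "Ord (- 1 / 2) (\<lambda>s t. complex_of_real (ln (\<rho> s t)))" by (rule Ord_of_real[OF Ord_ln])
  have pln: "Ord (- 1 / 2) (\<lambda>s t. pseries c (\<rho> s t) * complex_of_real (ln (\<rho> s t)))" if "entire_coeffs c" for c
    by (rule Ord_mult[OF Ord_pseries[OF that] ln]) simp
  have reg: "Ord (- 1 / 2) (\<lambda>s t. pseries c (\<rho> s t))" if "entire_coeffs c" for c
    by (rule Ord_mono[OF Ord_pseries[OF that]]) simp
  show "Ord (- 1 / 2) (\<lambda>s t. \<Phi>0 k (\<rho> s t))"
    unfolding \<Phi>0_def by (intro Ord_add pln reg entire_intros)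
  show 1: "Ord (- 1 / 2) (\<lambda>s t. \<Phi>1 k (\<rho> s t) - log_coeff k 0 / \<rho> s t)"
  proof (rule Ord_cong)
    fix s t assume ne: "\<gamma> s \<noteq> \<gamma> t"
    show "\<Phi>1 k (\<rho> s t) - log_coeff k 0 / \<rho> s t = pseries (diffs (log_coeff k)) (\<rho> s t) * ln (\<rho> s t)
      + pseries (\<lambda>n. log_coeff k (Suc n)) (\<rho> s t) + pseries (diffs (reg_coeff k)) (\<rho> s t)"
      unfolding \<Phi>1_def using pseries_Suc[OF entire_log, of k "\<rho> s t"] \<rho>_pos[OF ne] by (simp add: add_divide_distrib)
  qed (intro Ord_add pln reg entire_intros)
  have "Ord (- 2) (\<lambda>s t. (\<Phi>1 k (\<rho> s t) - log_coeff k 0 / \<rho> s t) + log_coeff k 0 / \<rho> s t)"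
    by (intro Ord_add Ord_mono[OF 1] Ord_div_\<rho>[OF Ord_const]) auto
  then show "Ord (- 2) (\<lambda>s t. \<Phi>1 k (\<rho> s t))" by simp
  have "Ord (- 4) (\<lambda>s t. pseries (diffs (diffs (log_coeff k))) (\<rho> s t) * ln (\<rho> s t)
    + (2 * pseries (diffs (log_coeff k)) (\<rho> s t)) / complex_of_real (\<rho> s t)
    - pseries (log_coeff k) (\<rho> s t) / complex_of_real (\<rho> s t) / complex_of_real (\<rho> s t)
    + pseries (diffs (diffs (reg_coeff k))) (\<rho> s t))"
    by (intro Ord_add Ord_diff Ord_div_\<rho>[where p = "-2" and m = "-4"]
        Ord_mono[OF Ord_div_\<rho>[OF Ord_cmult[OF Ord_pseries] refl], of _ "-4"]
        Ord_mono[OF pln] Ord_mono[OF reg] entire_intros)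
       (auto intro!: Ord_div_\<rho>[OF Ord_pseries] entire_intros)
  then show "Ord (- 4) (\<lambda>s t. \<Phi>2 k (\<rho> s t))"
    unfolding \<Phi>2_def by (simp add: power2_eq_square)
qed

section \<open>The kernels of the layer potentials\<close>

lemma measurable_curve [measurable]:
  "\<gamma> \<in> borel_measurable borel" "T \<in> borel_measurable borel" "\<gamma>d n \<in> borel_measurable borel"
  "normal \<gamma> \<in> borel_measurable borel"
proof -
  show g: "\<gamma>d n \<in> borel_measurable borel" for n by (rule borel_measurable_continuous_onI[OF continuous_d])
  show "\<gamma> \<in> borel_measurable borel" "T \<in> borel_measurable borel" using g[of 0] g[of 1] by (simp_all add: \<gamma>d_simps)
  then show "normal \<gamma> \<in> borel_measurable borel" unfolding normal_def[abs_def] by measurable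
qed

lemma measurable_\<rho> [measurable]: "(\<lambda>x. \<rho> (fst x) (snd x)) \<in> borel_measurable (borel \<Otimes>\<^sub>M borel)"
  unfolding \<rho>_def r_def by measurable

lemma measurable_pseries: "entire_coeffs c \<Longrightarrow> pseries c \<in> borel_measurable borel"
  by (rule borel_measurable_continuous_onI[OF pseries_continuous])

lemma measurable_\<Phi> [measurable]: "\<Phi>0 k \<in> borel_measurable borel" "\<Phi>1 k \<in> borel_measurable borel" "\<Phi>2 k \<in> borel_measurable borel"
proof -
  note [measurable] = measurable_pseries[OF entire_log[of k]] measurable_pseries[OF entire_reg[of k]]
    measurable_pseries[OF entire_diffs[OF entire_log[of k]]] measurable_pseries[OF entire_diffs[OF entire_reg[of k]]]
    measurable_pseries[OF entire_diffs[OF entire_diffs[OF entire_log[of k]]]]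
    measurable_pseries[OF entire_diffs[OF entire_diffs[OF entire_reg[of k]]]]
  show "\<Phi>0 k \<in> borel_measurable borel" unfolding \<Phi>0_def[abs_def] by measurable
  show "\<Phi>1 k \<in> borel_measurable borel" unfolding \<Phi>1_def[abs_def] by measurable
  show "\<Phi>2 k \<in> borel_measurable borel" unfolding \<Phi>2_def[abs_def] by measurable
qed

lemma Ord_bounded_kernel:
  fixes K :: "real \<Rightarrow> real \<Rightarrow> complex"
  assumes "(\<lambda>x. K (fst x) (snd x)) \<in> borel_measurable (borel \<Otimes>\<^sub>M borel)" "Ord p K" "- 1 / 2 \<le> p"
  obtains C where "bounded_kernel L K C"
proof -
  obtain D where "\<And>s t. \<gamma> s \<noteq> \<gamma> t \<Longrightarrow> norm (K s t) \<le> D * r s t powr (- 1 / 2)"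
    using OrdE[OF Ord_mono[OF assms(2,3)]] by metis
  then show ?thesis using weakly_singular_kernel[OF assms(1)] that by blast
qed

definition kernel_S :: "real \<Rightarrow> real \<Rightarrow> real \<Rightarrow> complex" where
  "kernel_S k s t = \<Phi>0 k (\<rho> s t)"

definition kernel_S' :: "real \<Rightarrow> real \<Rightarrow> real \<Rightarrow> complex" where
  "kernel_S' k s t = 2 * ((\<gamma> s - \<gamma> t) \<bullet> normal \<gamma> s) * \<Phi>1 k (\<rho> s t)"

definition kernel_S'' :: "real \<Rightarrow> real \<Rightarrow> real \<Rightarrow> complex" where
  "kernel_S'' k s t = 2 * \<Phi>1 k (\<rho> s t) + 4 * ((\<gamma> s - \<gamma> t) \<bullet> normal \<gamma> s) * ((\<gamma> s - \<gamma> t) \<bullet> normal \<gamma> s) * \<Phi>2 k (\<rho> s t)"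

text \<open>In \<open>\<D>' + \<S>''\<close> the hypersingular parts cancel: the kernel is bounded.\<close>

definition kernel_sum :: "real \<Rightarrow> real \<Rightarrow> real \<Rightarrow> complex" where
  "kernel_sum k s t = ((normal \<gamma> s - normal \<gamma> t) \<bullet> (normal \<gamma> s - normal \<gamma> t)) * \<Phi>1 k (\<rho> s t)
    + 4 * ((\<gamma> s - \<gamma> t) \<bullet> normal \<gamma> s) * ((\<gamma> s - \<gamma> t) \<bullet> (normal \<gamma> s - normal \<gamma> t)) * \<Phi>2 k (\<rho> s t)"

lemma layer_kernels:
  assumes k: "k > 0" and ne: "\<gamma> s \<noteq> \<gamma> t"
  shows "green k (\<gamma> s) (\<gamma> t) = kernel_S k s t"
    "dir_deriv (normal \<gamma> s) (\<lambda>x. green k x (\<gamma> t)) (\<gamma> s) = kernel_S' k s t"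
    "dir_deriv (normal \<gamma> s) (dir_deriv (normal \<gamma> s) (\<lambda>x. green k x (\<gamma> t))) (\<gamma> s) = kernel_S'' k s t"
    "dir_deriv (normal \<gamma> s) (\<lambda>x. dir_deriv (normal \<gamma> t) (\<lambda>y. green k x y) (\<gamma> t)) (\<gamma> s) = kernel_sum k s t - kernel_S'' k s t"
    "dir_deriv (normal \<gamma> t) (\<lambda>y. green k (\<gamma> s) y) (\<gamma> t) = - 2 * ((\<gamma> s - \<gamma> t) \<bullet> normal \<gamma> t) * \<Phi>1 k (\<rho> s t)"
proof -
  have nn: "normal \<gamma> u \<bullet> normal \<gamma> u = 1" for u using norm_normal[of u] by (simp add: norm_eq_1)
  \<comment> \<open>This identity merges the two \<open>\<Phi>1\<close> terms of opposite sign, one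
    from \<open>\<D>'\<close> and one from \<open>\<S>''\<close>, into a quadratically small
    factor.\<close>
  have diff: "(normal \<gamma> s - normal \<gamma> t) \<bullet> (normal \<gamma> s - normal \<gamma> t) = 2 - 2 * (normal \<gamma> s \<bullet> normal \<gamma> t)"
    by (simp add: inner_diff_left inner_diff_right nn inner_commute[of "normal \<gamma> t"])
  show "green k (\<gamma> s) (\<gamma> t) = kernel_S k s t"
    using green_eq[OF k ne] by (simp add: kernel_S_def \<rho>_def r_def)
  show "dir_deriv (normal \<gamma> s) (\<lambda>x. green k x (\<gamma> t)) (\<gamma> s) = kernel_S' k s t"
    using dir_deriv_green(1)[OF k ne] by (simp add: kernel_S'_def \<rho>_def r_def)
  show "dir_deriv (normal \<gamma> s) (dir_deriv (normal \<gamma> s) (\<lambda>x. green k x (\<gamma> t))) (\<gamma> s) = kernel_S'' k s t"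
    using dir_deriv_green2(1)[OF k ne] by (simp add: kernel_S''_def \<rho>_def r_def nn)
  show "dir_deriv (normal \<gamma> s) (\<lambda>x. dir_deriv (normal \<gamma> t) (\<lambda>y. green k x y) (\<gamma> t)) (\<gamma> s) = kernel_sum k s t - kernel_S'' k s t"
    unfolding dir_deriv_green2(2)[OF k ne] kernel_sum_def kernel_S''_def diff \<rho>_def r_def
    by (simp add: inner_diff_right algebra_simps)
  show "dir_deriv (normal \<gamma> t) (\<lambda>y. green k (\<gamma> s) y) (\<gamma> t) = - 2 * ((\<gamma> s - \<gamma> t) \<bullet> normal \<gamma> t) * \<Phi>1 k (\<rho> s t)"
    using dir_deriv_green(2)[OF k ne] by (simp add: \<rho>_def r_def)
qed

text \<open>A chord paired with a normal counts \<open>2\<close>, a difference of normals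
  \<open>1\<close>, and \<open>\<Phi>1\<close>, \<open>\<Phi>2\<close> count \<open>-2\<close>,
  \<open>-4\<close>. The last claim says that the hypersingularity of \<open>\<S>''\<close> is a
  pure multiple of the inverse squared distance, since its \<open>\<Phi>2\<close> term has order
  \<open>0\<close>.\<close>

lemma Ord_kernels:
  "Ord (- 1 / 2) (kernel_S k)" "Ord 0 (kernel_S' k)" "Ord 0 (kernel_sum k)"
  "Ord (- 1 / 2) (\<lambda>s t. kernel_S'' k s t - 2 * log_coeff k 0 / \<rho> s t)"
proof -
  show "Ord (- 1 / 2) (kernel_S k)" unfolding kernel_S_def[abs_def] by (rule Ord_\<Phi>)
  show "Ord 0 (kernel_S' k)" unfolding kernel_S'_def[abs_def]
    by (rule Ord_mult[OF Ord_of_real[OF Ord_cmult[OF Ord_d_normal(2)]] Ord_\<Phi>(3)]) simp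
  have nd: "Ord 2 (\<lambda>s t. complex_of_real ((normal \<gamma> s - normal \<gamma> t) \<bullet> (normal \<gamma> s - normal \<gamma> t)))"
    by (rule Ord_of_real[OF Ord_inner[OF Ord_normal_diff Ord_normal_diff]]) simp
  have dd: "Ord 2 (\<lambda>s t. (\<gamma> s - \<gamma> t) \<bullet> (normal \<gamma> s - normal \<gamma> t))"
    by (rule Ord_inner[OF Ord_d Ord_normal_diff]) simp
  note 4 = Ord_cmult[OF Ord_d_normal(2), of 4]
  show "Ord 0 (kernel_sum k)" unfolding kernel_sum_def[abs_def]
    by (rule Ord_add[OF Ord_mult[OF nd Ord_\<Phi>(3)] Ord_mult[OF Ord_of_real[OF Ord_mult[OF 4 dd refl]] Ord_\<Phi>(4)]]) auto
  have "Ord 0 (\<lambda>s t. complex_of_real (4 * ((\<gamma> s - \<gamma> t) \<bullet> normal \<gamma> s) * ((\<gamma> s - \<gamma> t) \<bullet> normal \<gamma> s)) * \<Phi>2 k (\<rho> s t))"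
    by (rule Ord_mult[OF Ord_of_real[OF Ord_mult[OF 4 Ord_d_normal(2) refl]] Ord_\<Phi>(4)]) simp
  then have "Ord (- 1 / 2) (\<lambda>s t. 2 * (\<Phi>1 k (\<rho> s t) - log_coeff k 0 / \<rho> s t)
     + complex_of_real (4 * ((\<gamma> s - \<gamma> t) \<bullet> normal \<gamma> s) * ((\<gamma> s - \<gamma> t) \<bullet> normal \<gamma> s)) * \<Phi>2 k (\<rho> s t))"
    by (intro Ord_add Ord_cmult Ord_\<Phi>(2) Ord_mono[of 0 _ "- 1 / 2"]) auto
  then show "Ord (- 1 / 2) (\<lambda>s t. kernel_S'' k s t - 2 * log_coeff k 0 / \<rho> s t)"
    unfolding kernel_S''_def by (simp add: algebra_simps)
qed

lemma kernels_measurable [measurable]: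
  "(\<lambda>x. kernel_S k (fst x) (snd x)) \<in> borel_measurable (borel \<Otimes>\<^sub>M borel)"
  "(\<lambda>x. kernel_S' k (fst x) (snd x)) \<in> borel_measurable (borel \<Otimes>\<^sub>M borel)"
  "(\<lambda>x. kernel_S'' k (fst x) (snd x)) \<in> borel_measurable (borel \<Otimes>\<^sub>M borel)"
  "(\<lambda>x. kernel_sum k (fst x) (snd x)) \<in> borel_measurable (borel \<Otimes>\<^sub>M borel)"
  unfolding kernel_S_def kernel_S'_def kernel_S''_def kernel_sum_def by measurable

end

section \<open>The double layer potential\<close>

lemma has_vector_derivative_quotient:
  fixes f g :: "real \<Rightarrow> complex"
  assumes f: "(f has_vector_derivative f') (at x)" and g: "(g has_vector_derivative g') (at x)" and nz: "g x \<noteq> 0"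
  shows "((\<lambda>x. f x / g x) has_vector_derivative (f' * g x - f x * g') / (g x)\<^sup>2) (at x)"
proof -
  have "(inverse has_field_derivative - (inverse (g x) ^ Suc (Suc 0))) (at (g x))"
    by (rule DERIV_inverse[OF nz])
  from has_vector_derivative_mult[OF f field_vector_diff_chain_at[OF g this]]
  show ?thesis
    using nz by (simp add: o_def divide_inverse[symmetric] has_vector_derivative_eq_rhs field_simps power2_eq_square)
qed

text \<open>In contrast to \<open>period_part\<close>, the diagonal lies in the middle of the
  period, and the unavoidable jump is moved to the antipodal parameter, where the kernels are
  smooth.\<close>

definition centered_part :: "real \<Rightarrow> real \<Rightarrow> real" where
  "centered_part L x = period_part L (x + L / 2) - L / 2"

lemma centered_part:
  assumes L: "L > 0"
  shows "\<bar>centered_part L x\<bar> \<le> L / 2" "centered_part L (x + L) = centered_part L x"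
    "- (L / 2) \<le> x \<Longrightarrow> x < L / 2 \<Longrightarrow> centered_part L x = x"
    "\<exists>m::int. x = centered_part L x + of_int m * L"
proof -
  show "\<bar>centered_part L x\<bar> \<le> L / 2"
    using period_part(1,2)[OF L, of "x + L / 2"] unfolding centered_part_def by linarith
  show "centered_part L (x + L) = centered_part L x"
    using period_part(3)[OF L, of "x + L / 2"] by (simp add: centered_part_def add.commute add.left_commute)
  show "- (L / 2) \<le> x \<Longrightarrow> x < L / 2 \<Longrightarrow> centered_part L x = x"
    using period_part(4)[OF L, of "x + L / 2"] by (simp add: centered_part_def)
  show "\<exists>m::int. x = centered_part L x + of_int m * L"
    by (rule exI[of _ "\<lfloor>(x + L / 2) / L\<rfloor>"]) (simp add: centered_part_def period_part_def)
qed

context closed_curve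
begin

section \<open>Derivatives of the entire and logarithmic parts of the double layer kernel\<close>

definition "\<alpha>0 s t = (\<gamma> s - \<gamma> t) \<bullet> normal \<gamma> t"
definition "\<alpha>1 s t = T s \<bullet> normal \<gamma> t"
definition "\<alpha>2 s t = \<gamma>d 2 s \<bullet> normal \<gamma> t"
definition "\<rho>1 s t = 2 * ((\<gamma> s - \<gamma> t) \<bullet> T s)"
definition "\<rho>2 s t = 2 + 2 * ((\<gamma> s - \<gamma> t) \<bullet> \<gamma>d 2 s)"

lemma d_deriv: "((\<lambda>s. \<gamma> s - \<gamma> t) has_vector_derivative T s) (at s)"
  using has_vector_derivative_diff[OF has_vderiv_gamma has_vector_derivative_const] by simp

lemma \<alpha>_deriv:
  "((\<lambda>s. complex_of_real (\<alpha>0 s t)) has_vector_derivative complex_of_real (\<alpha>1 s t)) (at s)"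
  "((\<lambda>s. complex_of_real (\<alpha>1 s t)) has_vector_derivative complex_of_real (\<alpha>2 s t)) (at s)"
  unfolding \<alpha>0_def \<alpha>1_def \<alpha>2_def
  by (intro bounded_linear.has_vector_derivative[OF bounded_linear_of_real]
      bounded_linear.has_vector_derivative[OF bounded_linear_inner_left] d_deriv has_vderiv_T)+

lemma \<rho>_eq: "\<rho> s t = (\<gamma> s - \<gamma> t) \<bullet> (\<gamma> s - \<gamma> t)"
  by (simp add: \<rho>_def r_def power2_norm_eq_inner)

lemma \<rho>_deriv: "((\<lambda>s. \<rho> s t) has_real_derivative \<rho>1 s t) (at s)" "((\<lambda>s. \<rho>1 s t) has_real_derivative \<rho>2 s t) (at s)"
proof -
  note ip = bounded_bilinear.has_vector_derivative[OF bounded_bilinear_inner]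
  show "((\<lambda>s. \<rho> s t) has_real_derivative \<rho>1 s t) (at s)"
    unfolding \<rho>_eq has_real_derivative_iff_has_vector_derivative
    by (rule has_vector_derivative_eq_rhs[OF ip[OF d_deriv d_deriv]]) (simp add: \<rho>1_def inner_commute)
  have T: "T s \<bullet> T s = 1" using norm_T[of s] by (simp add: norm_eq_1)
  have "((\<lambda>s. (\<gamma> s - \<gamma> t) \<bullet> T s) has_vector_derivative (\<gamma> s - \<gamma> t) \<bullet> \<gamma>d 2 s + T s \<bullet> T s) (at s)"
    by (rule ip[OF d_deriv has_vderiv_T])
  then show "((\<lambda>s. \<rho>1 s t) has_real_derivative \<rho>2 s t) (at s)"
    unfolding \<rho>1_def \<rho>2_def has_real_derivative_iff_has_vector_derivative[symmetric]
    by (auto intro!: derivative_eq_intros simp: T)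
qed

lemma complex_\<rho>_deriv:
  "((\<lambda>s. complex_of_real (\<rho>1 s t)) has_vector_derivative complex_of_real (\<rho>2 s t)) (at s)"
  "\<gamma> s \<noteq> \<gamma> t \<Longrightarrow> ((\<lambda>s. complex_of_real (ln (\<rho> s t))) has_vector_derivative complex_of_real (\<rho>1 s t / \<rho> s t)) (at s)"
  "\<gamma> s \<noteq> \<gamma> t \<Longrightarrow> ((\<lambda>s. complex_of_real (\<rho>1 s t / \<rho> s t)) has_vector_derivative
     complex_of_real (\<rho>2 s t / \<rho> s t - (\<rho>1 s t)\<^sup>2 / (\<rho> s t)\<^sup>2)) (at s)"
proof -
  show "((\<lambda>s. complex_of_real (\<rho>1 s t)) has_vector_derivative complex_of_real (\<rho>2 s t)) (at s)"
    by (rule has_vector_derivative_of_real[OF \<rho>_deriv(2)])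
  assume "\<gamma> s \<noteq> \<gamma> t"
  then have p: "\<rho> s t > 0" by (rule \<rho>_pos)
  show "((\<lambda>s. complex_of_real (ln (\<rho> s t))) has_vector_derivative complex_of_real (\<rho>1 s t / \<rho> s t)) (at s)"
    by (rule has_vector_derivative_of_real, rule DERIV_cong[OF DERIV_chain2[OF DERIV_ln_divide[OF p] \<rho>_deriv(1)]]) simp
  show "((\<lambda>s. complex_of_real (\<rho>1 s t / \<rho> s t)) has_vector_derivative
     complex_of_real (\<rho>2 s t / \<rho> s t - (\<rho>1 s t)\<^sup>2 / (\<rho> s t)\<^sup>2)) (at s)"
    by (rule has_vector_derivative_of_real, rule DERIV_cong[OF DERIV_divide[OF \<rho>_deriv(2,1)]])
       (use p in \<open>auto simp: field_simps power2_eq_square\<close>)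
qed

lemma pseries_\<rho>_deriv:
  assumes "entire_coeffs c"
  shows "((\<lambda>s. pseries c (\<rho> s t)) has_vector_derivative complex_of_real (\<rho>1 s t) * pseries (diffs c) (\<rho> s t)) (at s)"
proof -
  have "(pseries c \<circ> (\<lambda>s. \<rho> s t) has_vector_derivative \<rho>1 s t *\<^sub>R pseries (diffs c) (\<rho> s t)) (at s)"
    by (rule vector_diff_chain_at[OF _ pseries_deriv[OF assms]])
       (use \<rho>_deriv in \<open>simp add: has_real_derivative_iff_has_vector_derivative\<close>)
  then show ?thesis by (simp add: o_def scaleR_conv_of_real)
qed

definition "E0 c s t = complex_of_real (\<alpha>0 s t) * pseries c (\<rho> s t)"
definition "E1 c s t = complex_of_real (\<alpha>1 s t) * pseries c (\<rho> s t)
  + complex_of_real (\<alpha>0 s t) * (complex_of_real (\<rho>1 s t) * pseries (diffs c) (\<rho> s t))"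
definition "E2 c s t = complex_of_real (\<alpha>2 s t) * pseries c (\<rho> s t)
  + 2 * (complex_of_real (\<alpha>1 s t) * (complex_of_real (\<rho>1 s t) * pseries (diffs c) (\<rho> s t)))
  + complex_of_real (\<alpha>0 s t) * (complex_of_real (\<rho>2 s t) * pseries (diffs c) (\<rho> s t)
  + complex_of_real (\<rho>1 s t) * (complex_of_real (\<rho>1 s t) * pseries (diffs (diffs c)) (\<rho> s t)))"

lemma E_deriv:
  assumes "entire_coeffs c"
  shows "((\<lambda>s. E0 c s t) has_vector_derivative E1 c s t) (at s)" "((\<lambda>s. E1 c s t) has_vector_derivative E2 c s t) (at s)"
proof -
  note p0 = pseries_\<rho>_deriv[OF assms] and p1 = pseries_\<rho>_deriv[OF entire_diffs[OF assms]]
  show "((\<lambda>s. E0 c s t) has_vector_derivative E1 c s t) (at s)"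
    unfolding E0_def
    by (rule has_vector_derivative_eq_rhs[OF has_vector_derivative_mult[OF \<alpha>_deriv(1) p0]]) (simp add: E1_def)
  show "((\<lambda>s. E1 c s t) has_vector_derivative E2 c s t) (at s)"
    unfolding E1_def
    by (rule has_vector_derivative_eq_rhs[OF has_vector_derivative_add[OF has_vector_derivative_mult[OF \<alpha>_deriv(2) p0]
          has_vector_derivative_mult[OF \<alpha>_deriv(1) has_vector_derivative_mult[OF complex_\<rho>_deriv(1) p1]]]])
       (simp add: E2_def algebra_simps)
qed

text \<open>\<open>Lg1\<close> and \<open>Lg2\<close> are derivatives in \<open>s\<close> off the
  diagonal; on it they take the values given by \<open>ln 0 = 0\<close> and
  \<open>x / 0 = 0\<close>.\<close>

definition "Lg0 c s t = E0 c s t * ln (\<rho> s t)"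
definition "Lg1 c s t = E1 c s t * ln (\<rho> s t) + E0 c s t * complex_of_real (\<rho>1 s t / \<rho> s t)"
definition "Lg2 c s t = E2 c s t * ln (\<rho> s t) + 2 * (E1 c s t * complex_of_real (\<rho>1 s t / \<rho> s t))
  + E0 c s t * complex_of_real (\<rho>2 s t / \<rho> s t - (\<rho>1 s t)\<^sup>2 / (\<rho> s t)\<^sup>2)"

lemma Lg_deriv:
  assumes "entire_coeffs c" "\<gamma> s \<noteq> \<gamma> t"
  shows "((\<lambda>s. Lg0 c s t) has_vector_derivative Lg1 c s t) (at s)" "((\<lambda>s. Lg1 c s t) has_vector_derivative Lg2 c s t) (at s)"
proof -
  note d = E_deriv[OF assms(1)] complex_\<rho>_deriv(2,3)[OF assms(2)]
  show "((\<lambda>s. Lg0 c s t) has_vector_derivative Lg1 c s t) (at s)"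
    unfolding Lg0_def
    by (rule has_vector_derivative_eq_rhs[OF has_vector_derivative_mult[OF d(1) d(3)]]) (simp add: Lg1_def)
  show "((\<lambda>s. Lg1 c s t) has_vector_derivative Lg2 c s t) (at s)"
    unfolding Lg1_def
    by (rule has_vector_derivative_eq_rhs[OF has_vector_derivative_add[OF has_vector_derivative_mult[OF d(2) d(3)]
          has_vector_derivative_mult[OF d(1) d(4)]]])
       (simp add: Lg2_def algebra_simps)
qed

lemma Ord_\<alpha>\<rho>:
  "Ord 2 (\<lambda>s t. complex_of_real (\<alpha>0 s t))" "Ord 1 (\<lambda>s t. complex_of_real (\<alpha>1 s t))" "Ord 0 (\<lambda>s t. complex_of_real (\<alpha>2 s t))"
  "Ord 1 (\<lambda>s t. complex_of_real (\<rho>1 s t))" "Ord 0 (\<lambda>s t. complex_of_real (\<rho>2 s t))"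
proof -
  show "Ord 2 (\<lambda>s t. complex_of_real (\<alpha>0 s t))" unfolding \<alpha>0_def by (rule Ord_of_real[OF Ord_d_normal(1)])
  \<comment> \<open>The tangent at \<open>t\<close> is orthogonal to the normal at \<open>t\<close>;
    subtracting it gains one order.\<close>
  have "\<alpha>1 s t = (T s - T t) \<bullet> normal \<gamma> t" for s t by (simp add: \<alpha>1_def inner_diff_left inner_T_normal)
  then show "Ord 1 (\<lambda>s t. complex_of_real (\<alpha>1 s t))"
    using Ord_of_real[OF Ord_inner[OF Ord_T_diff Ord_normal(2), of 1]] by simp
  show "Ord 0 (\<lambda>s t. complex_of_real (\<alpha>2 s t))" unfolding \<alpha>2_def
    by (rule Ord_of_real[OF Ord_inner[OF Ord_\<gamma>d(1) Ord_normal(2)]]) simp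
  show "Ord 1 (\<lambda>s t. complex_of_real (\<rho>1 s t))" unfolding \<rho>1_def
    by (rule Ord_of_real[OF Ord_cmult[OF Ord_inner[OF Ord_d Ord_T]]]) simp
  have "Ord 0 (\<lambda>s t. 2 * ((\<gamma> s - \<gamma> t) \<bullet> \<gamma>d 2 s))"
    by (rule Ord_mono[OF Ord_cmult[OF Ord_inner[OF Ord_d Ord_\<gamma>d(1) refl]]]) simp
  then show "Ord 0 (\<lambda>s t. complex_of_real (\<rho>2 s t))" unfolding \<rho>2_def
    by (intro Ord_of_real Ord_add Ord_const)
qed

lemma Ord_E:
  assumes c: "entire_coeffs c"
  shows "Ord 2 (E0 c)" "Ord 1 (E1 c)" "Ord 0 (E2 c)"
proof -
  note p = Ord_pseries[OF c] Ord_pseries[OF entire_diffs[OF c]] Ord_pseries[OF entire_diffs[OF entire_diffs[OF c]]]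
  show "Ord 2 (E0 c)" unfolding E0_def[abs_def] by (rule Ord_mult[OF Ord_\<alpha>\<rho>(1) p(1)]) simp
  show "Ord 1 (E1 c)" unfolding E1_def[abs_def]
    by (rule Ord_add[OF Ord_mult[OF Ord_\<alpha>\<rho>(2) p(1)] Ord_mono[OF Ord_mult[OF Ord_\<alpha>\<rho>(1) Ord_mult[OF Ord_\<alpha>\<rho>(4) p(2) refl] refl]]]) auto
  have "Ord 0 (\<lambda>s t. complex_of_real (\<rho>1 s t) * (complex_of_real (\<rho>1 s t) * pseries (diffs (diffs c)) (\<rho> s t)))"
    by (rule Ord_mono[OF Ord_mult[OF Ord_\<alpha>\<rho>(4) Ord_mult[OF Ord_\<alpha>\<rho>(4) p(3) refl] refl]]) simp
  then have "Ord 0 (\<lambda>s t. complex_of_real (\<alpha>0 s t) * (complex_of_real (\<rho>2 s t) * pseries (diffs c) (\<rho> s t)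
  + complex_of_real (\<rho>1 s t) * (complex_of_real (\<rho>1 s t) * pseries (diffs (diffs c)) (\<rho> s t))))"
    by (intro Ord_mult[OF Ord_mono[OF Ord_\<alpha>\<rho>(1), of 0] Ord_add] Ord_mult[OF Ord_\<alpha>\<rho>(5) p(2)]) auto
  moreover have "Ord 0 (\<lambda>s t. 2 * (complex_of_real (\<alpha>1 s t) * (complex_of_real (\<rho>1 s t) * pseries (diffs c) (\<rho> s t))))"
    by (rule Ord_mono[OF Ord_cmult[OF Ord_mult[OF Ord_\<alpha>\<rho>(2) Ord_mult[OF Ord_\<alpha>\<rho>(4) p(2) refl] refl]]]) simp
  moreover have "Ord 0 (\<lambda>s t. complex_of_real (\<alpha>2 s t) * pseries c (\<rho> s t))"
    by (rule Ord_mult[OF Ord_\<alpha>\<rho>(3) p(1)]) simp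
  ultimately show "Ord 0 (E2 c)" unfolding E2_def[abs_def] by (intro Ord_add)
qed

text \<open>The numerator vanishes to second order, so two derivatives leave a logarithm at worst.
  This is the reason why the wave-number dependent part of the double layer potential gains two
  derivatives.\<close>

lemma Ord_Lg:
  assumes c: "entire_coeffs c"
  shows "Ord (3/2) (Lg0 c)" "Ord (1/2) (Lg1 c)" "Ord (- 1/2) (Lg2 c)"
proof -
  note E = Ord_E[OF c]
  have ln: "Ord (- 1 / 2) (\<lambda>s t. complex_of_real (ln (\<rho> s t)))" by (rule Ord_of_real[OF Ord_ln])
  have q1: "Ord (- 1) (\<lambda>s t. complex_of_real (\<rho>1 s t / \<rho> s t))"
    using Ord_div_\<rho>[OF Ord_\<alpha>\<rho>(4), of "-1"] by simp
  have q2: "Ord (- 2) (\<lambda>s t. complex_of_real (\<rho>2 s t / \<rho> s t - (\<rho>1 s t)\<^sup>2 / (\<rho> s t)\<^sup>2))"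
  proof -
    have "Ord (- 2) (\<lambda>s t. complex_of_real (\<rho>2 s t) / complex_of_real (\<rho> s t) - complex_of_real (\<rho>1 s t / \<rho> s t) * complex_of_real (\<rho>1 s t / \<rho> s t))"
      by (rule Ord_diff[OF Ord_div_\<rho>[OF Ord_\<alpha>\<rho>(5)] Ord_mult[OF q1 q1]]) auto
    then show ?thesis by (simp add: power2_eq_square)
  qed
  show "Ord (3/2) (Lg0 c)" unfolding Lg0_def[abs_def] by (rule Ord_mult[OF E(1) ln]) simp
  show "Ord (1/2) (Lg1 c)" unfolding Lg1_def[abs_def]
    by (rule Ord_add[OF Ord_mult[OF E(2) ln] Ord_mono[OF Ord_mult[OF E(1) q1 refl]]]) auto
  show "Ord (- 1/2) (Lg2 c)" unfolding Lg2_def[abs_def]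
    by (rule Ord_add[OF Ord_add[OF Ord_mult[OF E(3) ln] Ord_mono[OF Ord_cmult[OF Ord_mult[OF E(2) q1 refl]]]]
          Ord_mono[OF Ord_mult[OF E(1) q2 refl]]]) auto
qed

text \<open>A positive order forces the limit zero at the diagonal, which is then the prescribed
  value.\<close>

lemma Ord_isCont:
  fixes F :: "real \<Rightarrow> real \<Rightarrow> complex"
  assumes F: "Ord p F" and p: "p > 0" and z: "\<And>s t. \<gamma> s = \<gamma> t \<Longrightarrow> F s t = 0" and st: "\<gamma> s = \<gamma> t"
  shows "isCont (\<lambda>s. F s t) s"
proof -
  obtain C where C: "C \<ge> 0" "\<And>s t. \<gamma> s \<noteq> \<gamma> t \<Longrightarrow> norm (F s t) \<le> C * r s t powr p" using OrdE[OF F] by metis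
  have le: "norm (F x t) \<le> C * r x t powr p" for x
    using C(2)[of x t] z[of x t] C(1) by (cases "\<gamma> x = \<gamma> t") auto
  have "isCont (\<lambda>x. r x t) s" unfolding r_def
    using has_vector_derivative_continuous[OF has_vderiv_gamma[of s]] by (intro continuous_intros)
  then have "(\<lambda>x. r x t) \<midarrow>s\<rightarrow> 0" using st by (simp add: isCont_def r_def)
  then have "(\<lambda>x. r x t powr p) \<midarrow>s\<rightarrow> 0 powr p" using p by (intro tendsto_powr') (auto intro: always_eventually)
  then have "(\<lambda>x. C * r x t powr p) \<midarrow>s\<rightarrow> 0" by (intro tendsto_mult_right_zero) simp
  then have "(\<lambda>x. F x t) \<midarrow>s\<rightarrow> 0" by (rule Lim_null_comparison[rotated]) (simp add: le always_eventually)
  then show ?thesis using z[OF st] by (simp add: isCont_def)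
qed

lemma Lg_isCont:
  assumes c: "entire_coeffs c"
  shows "isCont (\<lambda>s. Lg0 c s t) s" "isCont (\<lambda>s. Lg1 c s t) s"
proof -
  \<comment> \<open>On the diagonal \<open>ln 0 = 0\<close> removes the logarithmic terms, and
    \<open>\<alpha>0 = 0\<close> removes the other one.\<close>
  have z: "Lg0 c s t = 0" "Lg1 c s t = 0" if "\<gamma> s = \<gamma> t" for s t
    using that by (simp_all add: Lg0_def Lg1_def E0_def \<alpha>0_def \<rho>_def r_def)
  show "isCont (\<lambda>s. Lg0 c s t) s"
  proof (cases "\<gamma> s = \<gamma> t")
    case True
    show ?thesis by (rule Ord_isCont[OF Ord_Lg(1)[OF c] _ z(1) True]) auto
  next
    case False
    then show ?thesis using Lg_deriv(1)[OF c] has_vector_derivative_continuous by blast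
  qed
  show "isCont (\<lambda>s. Lg1 c s t) s"
  proof (cases "\<gamma> s = \<gamma> t")
    case True
    show ?thesis by (rule Ord_isCont[OF Ord_Lg(2)[OF c] _ z(2) True]) auto
  next
    case False
    then show ?thesis using Lg_deriv(2)[OF c] has_vector_derivative_continuous by blast
  qed
qed

text \<open>With \<open>\<gamma> (t + u) - \<gamma> t = u h\<close> and \<open>h = T t + u w\<close>, the Laplace kernel is
  \<open>Im (T t / (u h)) = Im (1 / u - w / h)\<close>, and \<open>1 / u\<close> is real: the singularity disappears.\<close>

definition "h1 t u = w 0 t u + complex_of_real u * w 1 t u"
definition "h2 t u = 2 * w 1 t u + complex_of_real u * w 2 t u"

lemma h_deriv:
  "(h t has_vector_derivative h1 t u) (at u)" "(h1 t has_vector_derivative h2 t u) (at u)"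
proof -
  have u: "((\<lambda>u. complex_of_real u) has_vector_derivative 1) (at u)"
    using has_vector_derivative_of_real[OF DERIV_ident] by simp
  have w: "(w 0 t has_vector_derivative w 1 t u) (at u)" "(w 1 t has_vector_derivative w 2 t u) (at u)"
    using w_deriv[of 0 t u] w_deriv[of 1 t u] by (simp_all add: numeral_2_eq_2)
  show "(h t has_vector_derivative h1 t u) (at u)"
    unfolding h_def[abs_def]
    by (rule has_vector_derivative_eq_rhs[OF has_vector_derivative_add[OF has_vector_derivative_const has_vector_derivative_mult[OF u w(1)]]])
       (simp add: h1_def)
  show "(h1 t has_vector_derivative h2 t u) (at u)"
    unfolding h1_def[abs_def]
    by (rule has_vector_derivative_eq_rhs[OF has_vector_derivative_add[OF w(1) has_vector_derivative_mult[OF u w(2)]]])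
       (simp add: h2_def)
qed

text \<open>The complex form of the Laplace kernel without its real pole. \<open>V1\<close> and
  \<open>V2\<close> are its derivatives by the quotient rule, valid as long as \<open>h\<close> has
  no zero, that is for differences below \<open>L\<close>.\<close>

definition "V0 t u = w 0 t u / h t u"
definition "V1 t u = (w 1 t u * h t u - w 0 t u * h1 t u) / (h t u)\<^sup>2"
definition "V2 t u = ((w 2 t u * h t u - w 0 t u * h2 t u) * (h t u)\<^sup>2
  - (w 1 t u * h t u - w 0 t u * h1 t u) * (2 * h t u * h1 t u)) / ((h t u)\<^sup>2)\<^sup>2"

lemma V_deriv:
  assumes "\<bar>u\<bar> < L"
  shows "(V0 t has_vector_derivative V1 t u) (at u)" "(V1 t has_vector_derivative V2 t u) (at u)"
proof -
  have w: "(w 0 t has_vector_derivative w 1 t u) (at u)" "(w 1 t has_vector_derivative w 2 t u) (at u)"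
    using w_deriv[of 0 t u] w_deriv[of 1 t u] by (simp_all add: numeral_2_eq_2)
  note hn = h_nonzero[OF assms, of t]
  show "(V0 t has_vector_derivative V1 t u) (at u)"
    unfolding V0_def[abs_def] V1_def by (rule has_vector_derivative_quotient[OF w(1) h_deriv(1) hn])
  have n: "((\<lambda>u. w 1 t u * h t u - w 0 t u * h1 t u) has_vector_derivative w 2 t u * h t u - w 0 t u * h2 t u) (at u)"
    by (rule has_vector_derivative_eq_rhs[OF has_vector_derivative_diff[OF has_vector_derivative_mult[OF w(2) h_deriv(1)]
          has_vector_derivative_mult[OF w(1) h_deriv(2)]]]) (simp add: algebra_simps)
  have d: "((\<lambda>u. (h t u)\<^sup>2) has_vector_derivative 2 * h t u * h1 t u) (at u)"
    unfolding power2_eq_square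
    by (rule has_vector_derivative_eq_rhs[OF has_vector_derivative_mult[OF h_deriv(1) h_deriv(1)]]) (simp add: algebra_simps)
  show "(V1 t has_vector_derivative V2 t u) (at u)"
    unfolding V1_def[abs_def] V2_def by (rule has_vector_derivative_quotient[OF n d]) (use hn in simp)
qed

lemma V_shift: "V0 (t + of_int m * L) u = V0 t u" "V1 (t + of_int m * L) u = V1 t u" "V2 (t + of_int m * L) u = V2 t u"
  by (simp_all add: V0_def V1_def V2_def h1_def h2_def h_shift w_shift)

lemma wh_cont:
  "continuous_on A (\<lambda>x. w j (fst x) (snd x))" "continuous_on A (\<lambda>x. h (fst x) (snd x))"
  using w_continuous[of j] h_continuous continuous_on_subset[OF _ subset_UNIV]
  by (auto simp: case_prod_unfold)

lemma V_bounded: obtains C where "C > 0" "\<And>t u. \<bar>u\<bar> \<le> L / 2 \<Longrightarrow> norm (V0 t u) \<le> C"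
  "\<And>t u. \<bar>u\<bar> \<le> L / 2 \<Longrightarrow> norm (V1 t u) \<le> C" "\<And>t u. \<bar>u\<bar> \<le> L / 2 \<Longrightarrow> norm (V2 t u) \<le> C"
proof -
  let ?S = "{-L/2..L/2} \<times> {-L/2..L/2}"
  have S: "compact ?S" by (intro compact_Times compact_Icc)
  have nz: "h (fst x) (snd x) \<noteq> 0" if "x \<in> ?S" for x
    using that L by (intro h_nonzero) (auto simp: mem_Times_iff abs_if)
  have b: "\<exists>C>0. \<forall>x\<in>?S. norm (F (fst x) (snd x)) \<le> C" if "continuous_on ?S (\<lambda>x. F (fst x) (snd x))"
    for F :: "real \<Rightarrow> real \<Rightarrow> complex"
    using compact_imp_bounded[OF compact_continuous_image[OF that S]] unfolding bounded_pos by auto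
  have cV: "continuous_on ?S (\<lambda>x. V0 (fst x) (snd x))" "continuous_on ?S (\<lambda>x. V1 (fst x) (snd x))" "continuous_on ?S (\<lambda>x. V2 (fst x) (snd x))"
  proof -
    have c1: "continuous_on ?S (\<lambda>x. h1 (fst x) (snd x))" "continuous_on ?S (\<lambda>x. h2 (fst x) (snd x))"
      unfolding h1_def h2_def by (intro continuous_on_add continuous_on_mult continuous_on_of_real continuous_on_const
          continuous_on_snd continuous_on_id wh_cont)+
    have n1: "\<forall>x\<in>?S. h (fst x) (snd x) \<noteq> 0" "\<forall>x\<in>?S. (h (fst x) (snd x))\<^sup>2 \<noteq> 0" "\<forall>x\<in>?S. ((h (fst x) (snd x))\<^sup>2)\<^sup>2 \<noteq> 0"
      using nz by (simp_all only: power_eq_0_iff) blast+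
    show "continuous_on ?S (\<lambda>x. V0 (fst x) (snd x))"
      unfolding V0_def by (rule continuous_on_divide[OF wh_cont n1(1)])
    show "continuous_on ?S (\<lambda>x. V1 (fst x) (snd x))"
      unfolding V1_def by (rule continuous_on_divide[OF _ _ n1(2)])
        (intro continuous_on_diff continuous_on_mult continuous_on_power wh_cont c1)+
    show "continuous_on ?S (\<lambda>x. V2 (fst x) (snd x))"
      unfolding V2_def by (rule continuous_on_divide[OF _ _ n1(3)])
        (intro continuous_on_diff continuous_on_mult continuous_on_power continuous_on_const wh_cont c1)+
  qed
  from b[OF cV(1)] b[OF cV(2)] b[OF cV(3)]
  obtain C0 C1 C2 where C: "C0 > 0" "C1 > 0" "C2 > 0"
    "\<And>x. x \<in> ?S \<Longrightarrow> norm (V0 (fst x) (snd x)) \<le> C0" "\<And>x. x \<in> ?S \<Longrightarrow> norm (V1 (fst x) (snd x)) \<le> C1"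
    "\<And>x. x \<in> ?S \<Longrightarrow> norm (V2 (fst x) (snd x)) \<le> C2" by blast
  have "norm (V0 t u) \<le> C0 \<and> norm (V1 t u) \<le> C1 \<and> norm (V2 t u) \<le> C2" if u: "\<bar>u\<bar> \<le> L / 2" for t u
  proof -
    obtain m v where mv: "t = 0 + v + of_int m * L" "\<bar>v\<bar> \<le> L / 2" using reduce by metis
    have "(v, u) \<in> ?S" unfolding mem_Times_iff atLeastAtMost_iff fst_conv snd_conv using u mv by linarith
    then show ?thesis using C(4)[of "(v, u)"] C(5)[of "(v, u)"] C(6)[of "(v, u)"] by (simp add: mv V_shift)
  qed
  moreover have "C0 \<le> C0 + C1 + C2" "C1 \<le> C0 + C1 + C2" "C2 \<le> C0 + C1 + C2" "0 < C0 + C1 + C2"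
    using C(1-3) by auto
  ultimately show ?thesis using that[of "C0 + C1 + C2"] order_trans by blast
qed

lemma V0_eq:
  assumes "\<bar>u\<bar> < L" "u \<noteq> 0"
  shows "- Im (V0 t u) = \<alpha>0 (t + u) t / \<rho> (t + u) t"
proof -
  have hn: "h t u \<noteq> 0" by (rule h_nonzero[OF assms(1)])
  have d: "\<gamma> (t + u) - \<gamma> t = u * h t u" by (rule chord_eq)
  have "T t / (u * h t u) = 1 / u - V0 t u"
    using hn assms(2) by (simp add: V0_def h_def field_simps)
  then have "- Im (V0 t u) = Im (T t / (\<gamma> (t + u) - \<gamma> t))" by (simp add: d)
  \<comment> \<open>The normal is the tangent times \<open>- \<i>\<close>, so pairing the chord with
    it equals the imaginary part of the tangent times the conjugate chord.\<close>
  also have "\<dots> = \<alpha>0 (t + u) t / \<rho> (t + u) t"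
    by (simp add: \<alpha>0_def \<rho>_def r_def Im_divide normal_def inner_complex_def cmod_power2 mult.commute)
  finally show ?thesis .
qed

text \<open>The series left in \<open>\<Phi>1\<close> once the pole and the logarithm are removed:
  the logarithmic series divided by its argument, plus the derivative of the regular series.\<close>

definition "diff_coeff k n = log_coeff k (Suc n) + diffs (reg_coeff k) n"

text \<open>The pole of \<open>\<Phi>1\<close> times the numerator is the Laplace kernel, here
  replaced by its extension \<open>V0\<close> across the diagonal; the other two terms collect the
  entire and logarithmic remainders.\<close>

definition kernel_D :: "real \<Rightarrow> real \<Rightarrow> real \<Rightarrow> complex" where
  "kernel_D k s t = - 2 * (log_coeff k 0 * complex_of_real (- Im (V0 t (centered_part L (s - t))))
    + E0 (diff_coeff k) s t + Lg0 (diffs (log_coeff k)) s t)"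
definition kernel_D1 :: "real \<Rightarrow> real \<Rightarrow> real \<Rightarrow> complex" where
  "kernel_D1 k s t = - 2 * (log_coeff k 0 * complex_of_real (- Im (V1 t (centered_part L (s - t))))
    + E1 (diff_coeff k) s t + Lg1 (diffs (log_coeff k)) s t)"
definition kernel_D2 :: "real \<Rightarrow> real \<Rightarrow> real \<Rightarrow> complex" where
  "kernel_D2 k s t = - 2 * (log_coeff k 0 * complex_of_real (- Im (V2 t (centered_part L (s - t))))
    + E2 (diff_coeff k) s t + Lg2 (diffs (log_coeff k)) s t)"

lemma entire_diff_coeff: "entire_coeffs (diff_coeff k)"
  unfolding diff_coeff_def[abs_def] by (intro pseries_add entire_intros)

lemma kernel_D_eq:
  assumes "\<gamma> s \<noteq> \<gamma> t"
  shows "kernel_D k s t = - 2 * \<alpha>0 s t * \<Phi>1 k (\<rho> s t)"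
proof -
  define u where "u = centered_part L (s - t)"
  obtain m :: int where m: "s - t = u + of_int m * L" unfolding u_def using centered_part(4)[OF L] by metis
  then have s: "s = t + u + of_int m * L" by simp
  have "\<bar>u\<bar> < L" unfolding u_def using centered_part(1)[OF L, of "s - t"] L by linarith
  moreover have "u \<noteq> 0" using assms s gamma_eq_iff[of s t] by auto
  ultimately have "- Im (V0 t u) = \<alpha>0 (t + u) t / \<rho> (t + u) t" by (rule V0_eq)
  also have "\<dots> = \<alpha>0 s t / \<rho> s t" using d_shift[of 0 "t + u" m] by (simp add: s \<alpha>0_def \<rho>_def r_def \<gamma>d_simps)
  finally have V: "- Im (V0 t u) = \<alpha>0 s t / \<rho> s t" .
  have p: "pseries (diff_coeff k) x = pseries (\<lambda>n. log_coeff k (Suc n)) x + pseries (diffs (reg_coeff k)) x" for x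
    unfolding diff_coeff_def[abs_def] by (intro pseries_add entire_intros)
  show ?thesis
    unfolding kernel_D_def u_def[symmetric] V E0_def Lg0_def \<Phi>1_def p pseries_Suc[OF entire_log, of k "\<rho> s t"]
    using \<rho>_pos[OF assms] by (simp add: field_simps)
qed

lemma Ord_kernel_D: "Ord 0 (kernel_D k)" "Ord 0 (kernel_D1 k)" "Ord (- 1 / 2) (kernel_D2 k)"
proof -
  obtain C where C: "\<And>t u. \<bar>u\<bar> \<le> L / 2 \<Longrightarrow> norm (V0 t u) \<le> C"
    "\<And>t u. \<bar>u\<bar> \<le> L / 2 \<Longrightarrow> norm (V1 t u) \<le> C" "\<And>t u. \<bar>u\<bar> \<le> L / 2 \<Longrightarrow> norm (V2 t u) \<le> C" using V_bounded by metis
  have b: "Ord 0 (\<lambda>s t. log_coeff k 0 * complex_of_real (- Im (F t (centered_part L (s - t)))))"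
    if "\<And>t u. \<bar>u\<bar> \<le> L / 2 \<Longrightarrow> norm (F t u) \<le> C" for F :: "real \<Rightarrow> real \<Rightarrow> complex"
  proof (intro Ord_cmult Ord_of_real Ord_0[of _ C])
    fix s t
    show "norm (- Im (F t (centered_part L (s - t)))) \<le> C"
      using order_trans[OF abs_Im_le_cmod that[OF centered_part(1)[OF L], of t "s - t"]] by simp
  qed
  note E = Ord_E[OF entire_diff_coeff[of k]] and Lg = Ord_Lg[OF entire_diffs[OF entire_log[of k]]]
  show "Ord 0 (kernel_D k)" unfolding kernel_D_def[abs_def]
    by (intro Ord_cmult Ord_add b C Ord_mono[OF E(1)] Ord_mono[OF Lg(1)]) auto
  show "Ord 0 (kernel_D1 k)" unfolding kernel_D1_def[abs_def]
    by (intro Ord_cmult Ord_add b C Ord_mono[OF E(2)] Ord_mono[OF Lg(2)]) auto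
  show "Ord (- 1 / 2) (kernel_D2 k)" unfolding kernel_D2_def[abs_def]
    using Lg(3) by (intro Ord_cmult Ord_add Ord_mono[OF b] C Ord_mono[OF E(3)]) auto
qed

lemma measurable_wh [measurable]:
  "(\<lambda>x. w j (fst x) (snd x)) \<in> borel_measurable (borel \<Otimes>\<^sub>M borel)"
  "(\<lambda>x. h (fst x) (snd x)) \<in> borel_measurable (borel \<Otimes>\<^sub>M borel)"
  unfolding borel_prod by (rule borel_measurable_continuous_onI[OF wh_cont(1)] borel_measurable_continuous_onI[OF wh_cont(2)])+

lemma measurable_kernel_D [measurable]:
  "(\<lambda>x. kernel_D k (fst x) (snd x)) \<in> borel_measurable (borel \<Otimes>\<^sub>M borel)"
  "(\<lambda>x. kernel_D1 k (fst x) (snd x)) \<in> borel_measurable (borel \<Otimes>\<^sub>M borel)"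
  "(\<lambda>x. kernel_D2 k (fst x) (snd x)) \<in> borel_measurable (borel \<Otimes>\<^sub>M borel)"
proof -
  have [measurable]: "centered_part L \<in> borel_measurable borel"
    unfolding centered_part_def period_part_def by measurable
  have "(\<lambda>x. (snd x, centered_part L (fst x - snd x))) \<in> borel \<Otimes>\<^sub>M borel \<rightarrow>\<^sub>M (borel \<Otimes>\<^sub>M borel :: (real \<times> real) measure)"
    by measurable
  note sw = measurable_compose[OF this]
  have os: "(\<lambda>x. complex_of_real (snd x)) \<in> borel_measurable (borel \<Otimes>\<^sub>M borel :: (real \<times> real) measure)"
    unfolding borel_prod by (intro borel_measurable_continuous_onI continuous_intros)
  have V: "(\<lambda>x. V0 (fst x) (snd x)) \<in> borel_measurable (borel \<Otimes>\<^sub>M borel)" "(\<lambda>x. V1 (fst x) (snd x)) \<in> borel_measurable (borel \<Otimes>\<^sub>M borel)"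
    "(\<lambda>x. V2 (fst x) (snd x)) \<in> borel_measurable (borel \<Otimes>\<^sub>M borel)"
    unfolding V0_def V1_def V2_def h1_def h2_def
    by (intro borel_measurable_divide borel_measurable_diff borel_measurable_add borel_measurable_times
        borel_measurable_power borel_measurable_const os measurable_wh)+
  note [measurable] = sw[OF V(1), simplified] sw[OF V(2), simplified] sw[OF V(3), simplified]
  have E: "(\<lambda>x. E0 c (fst x) (snd x)) \<in> borel_measurable (borel \<Otimes>\<^sub>M borel)" "(\<lambda>x. E1 c (fst x) (snd x)) \<in> borel_measurable (borel \<Otimes>\<^sub>M borel)"
    "(\<lambda>x. E2 c (fst x) (snd x)) \<in> borel_measurable (borel \<Otimes>\<^sub>M borel)" if "entire_coeffs c" for c
  proof -
    note [measurable] = measurable_pseries[OF that] measurable_pseries[OF entire_diffs[OF that]]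
      measurable_pseries[OF entire_diffs[OF entire_diffs[OF that]]]
    show "(\<lambda>x. E0 c (fst x) (snd x)) \<in> borel_measurable (borel \<Otimes>\<^sub>M borel)" "(\<lambda>x. E1 c (fst x) (snd x)) \<in> borel_measurable (borel \<Otimes>\<^sub>M borel)"
      "(\<lambda>x. E2 c (fst x) (snd x)) \<in> borel_measurable (borel \<Otimes>\<^sub>M borel)"
      unfolding E0_def E1_def E2_def \<alpha>0_def \<alpha>1_def \<alpha>2_def \<rho>1_def \<rho>2_def by measurable
  qed
  note [measurable] = E[OF entire_diff_coeff[of k]] E[OF entire_diffs[OF entire_log[of k]]]
  show "(\<lambda>x. kernel_D k (fst x) (snd x)) \<in> borel_measurable (borel \<Otimes>\<^sub>M borel)"
    unfolding kernel_D_def Lg0_def by measurable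
  show "(\<lambda>x. kernel_D1 k (fst x) (snd x)) \<in> borel_measurable (borel \<Otimes>\<^sub>M borel)"
    unfolding kernel_D1_def Lg1_def \<rho>1_def by measurable
  show "(\<lambda>x. kernel_D2 k (fst x) (snd x)) \<in> borel_measurable (borel \<Otimes>\<^sub>M borel)"
    unfolding kernel_D2_def Lg2_def \<rho>1_def \<rho>2_def by measurable
qed

end

context closed_curve
begin

section \<open>Weak differentiation of the double layer kernel\<close>

lemma kernel_integrable_first:
  fixes K :: "real \<Rightarrow> real \<Rightarrow> complex"
  assumes m: "(\<lambda>x. K (fst x) (snd x)) \<in> borel_measurable (borel \<Otimes>\<^sub>M borel)" and K: "Ord (- 1 / 2) K"
  shows "integrable (lebesgue_on {t - L / 2..t - L / 2 + L}) (\<lambda>s. K s t)"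
    "(\<lambda>s. K s t) \<in> borel_measurable (lebesgue_on A)"
proof -
  have "(\<lambda>s. K (fst (s, t)) (snd (s, t))) \<in> borel_measurable borel"
    by (rule measurable_compose[OF _ m]) measurable
  then show m1: "(\<lambda>s. K s t) \<in> borel_measurable (lebesgue_on A)" for A
    by (intro borel_measurable_lebesgue_on_borel) simp
  obtain C where C: "C \<ge> 0" "\<And>s t. \<gamma> s \<noteq> \<gamma> t \<Longrightarrow> norm (K s t) \<le> C * r s t powr (- 1 / 2)" using OrdE[OF K] by metis
  have ri: "integrable (lebesgue_on {t - L / 2..t - L / 2 + L}) (\<lambda>s. r t s powr (- 1 / 2))"
    using weakly_singular_integral by metis
  show "integrable (lebesgue_on {t - L / 2..t - L / 2 + L}) (\<lambda>s. K s t)"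
  proof (rule Bochner_Integration.integrable_bound[OF _ m1])
    show "integrable (lebesgue_on {t - L / 2..t - L / 2 + L}) (\<lambda>s. C * r t s powr (- 1 / 2))"
      using ri by simp
    show "AE s in lebesgue_on {t - L / 2..t - L / 2 + L}. norm (K s t) \<le> norm (C * r t s powr (- 1 / 2))"
      using AE_gamma_ne[of t "t - L / 2" "t - L / 2 + L"]
    proof eventually_elim
      case (elim s)
      then show ?case using C(2)[of s t] C(1) by (simp add: r_sym[of s t] abs_mult)
    qed
  qed
qed

lemma curve_periodic: "\<gamma> (s + L) = \<gamma> s" "T (s + L) = T s" "\<gamma>d n (s + L) = \<gamma>d n s" "normal \<gamma> (s + L) = normal \<gamma> s"
  using periodic_d[of n] periodic_d[of 0] periodic_d[of 1] by (simp_all add: periodic_def \<gamma>d_simps normal_def)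

lemma kernel_D_periodic:
  "kernel_D k (s + L) t = kernel_D k s t" "kernel_D1 k (s + L) t = kernel_D1 k s t" "kernel_D2 k (s + L) t = kernel_D2 k s t"
proof -
  have c: "centered_part L (s + L - t) = centered_part L (s - t)"
    using centered_part(2)[OF L, of "s - t"] by (simp add: algebra_simps)
  show "kernel_D k (s + L) t = kernel_D k s t" "kernel_D1 k (s + L) t = kernel_D1 k s t" "kernel_D2 k (s + L) t = kernel_D2 k s t"
    by (simp_all add: kernel_D_def kernel_D1_def kernel_D2_def c E0_def E1_def E2_def Lg0_def Lg1_def Lg2_def
        \<alpha>0_def \<alpha>1_def \<alpha>2_def \<rho>_def r_def \<rho>1_def \<rho>2_def curve_periodic)
qed

text \<open>The parameters \<open>t + L / 2\<close> and \<open>t - L / 2\<close> name the same point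
  of the curve, so integration by parts leaves no end terms. Only imaginary parts agree: the real
  part of \<open>V0\<close> contains \<open>1 / u\<close>, which is not periodic. The slopes agree
  because the two functions coincide on a neighbourhood of \<open>u = L / 2\<close>.\<close>

lemma V_ends: "Im (V0 t (L / 2)) = Im (V0 t (- (L / 2)))" "Im (V1 t (L / 2)) = Im (V1 t (- (L / 2)))"
proof -
  have e: "- Im (V0 t u) = - Im (V0 t (u - L))" if "0 < u" "u < L" for u
  proof -
    have "\<alpha>0 (t + u) t / \<rho> (t + u) t = \<alpha>0 (t + (u - L)) t / \<rho> (t + (u - L)) t"
      using curve_periodic(1)[of "t + (u - L)"] by (simp add: \<alpha>0_def \<rho>_def r_def)
    then show ?thesis using V0_eq[of u t] V0_eq[of "u - L" t] that by simp
  qed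
  show "Im (V0 t (L / 2)) = Im (V0 t (- (L / 2)))" using e[of "L / 2"] L by simp
  have im: "((\<lambda>u. Im (F u)) has_vector_derivative Im F') (at x)" if "(F has_vector_derivative F') (at x)" for F F' x
    using that by (rule bounded_linear.has_vector_derivative[OF bounded_linear_Im])
  have d1: "((\<lambda>u. Im (V0 t u)) has_vector_derivative Im (V1 t (L / 2))) (at (L / 2))"
    by (rule im[OF V_deriv(1)]) (use L in simp)
  have "(V0 t \<circ> (\<lambda>u. u - L) has_vector_derivative 1 *\<^sub>R V1 t (- (L / 2))) (at (L / 2))"
    by (rule vector_diff_chain_at) (use V_deriv(1)[of "- (L / 2)" t] L in \<open>auto intro!: derivative_eq_intros\<close>)
  from im[OF this] have "((\<lambda>u. Im (V0 t (u - L))) has_vector_derivative Im (V1 t (- (L / 2)))) (at (L / 2))"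
    by (simp add: o_def)
  then have d2: "((\<lambda>u. Im (V0 t u)) has_vector_derivative Im (V1 t (- (L / 2)))) (at (L / 2))"
    by (rule has_vector_derivative_transform_within_open[of _ _ _ "{0<..<L}"]) (use e L in auto)
  show "Im (V1 t (L / 2)) = Im (V1 t (- (L / 2)))" using vector_derivative_unique_at[OF d1 d2] .
qed

text \<open>The window is centred at \<open>t\<close>. Both differentiated functions are continuous
  across the diagonal, so \<open>t\<close> is merely an exceptional point, and the end terms cancel
  by periodicity.\<close>

lemma kernel_D_weak:
  assumes \<phi>: "smooth \<phi>" "periodic L \<phi>"
  shows "(LINT s|lebesgue_on {0..L}. kernel_D k s t * vderiv \<phi> s) = - (LINT s|lebesgue_on {0..L}. kernel_D1 k s t * \<phi> s)"
    "(LINT s|lebesgue_on {0..L}. kernel_D1 k s t * vderiv \<phi> s) = - (LINT s|lebesgue_on {0..L}. kernel_D2 k s t * \<phi> s)"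
proof -
  have c: "centered_part L (s - t) = s - t" if "s \<in> {t - L / 2<..<t - L / 2 + L}" for s
    using that by (intro centered_part(3)[OF L]) auto
  have ne: "\<gamma> s \<noteq> \<gamma> t" if "s \<in> {t - L / 2<..<t - L / 2 + L} - {t}" for s
  proof -
    have "h t (s - t) \<noteq> 0" using that L by (intro h_nonzero) auto
    then show ?thesis using chord_eq[of t "s - t"] that by auto
  qed
  have dV: "((\<lambda>s. complex_of_real (- Im (F (s - t)))) has_vector_derivative complex_of_real (- Im F')) (at s)"
    if "(F has_vector_derivative F') (at (s - t))" for F F' s
  proof -
    have "(F \<circ> (\<lambda>s. s - t) has_vector_derivative 1 *\<^sub>R F') (at s)"
      by (rule vector_diff_chain_at) (use that in \<open>auto intro!: derivative_eq_intros\<close>)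
    from bounded_linear.has_vector_derivative[OF bounded_linear_Im this]
    have "((\<lambda>s. - Im (F (s - t))) has_vector_derivative - Im F') (at s)"
      by (intro has_vector_derivative_minus) (simp add: o_def)
    then show ?thesis by (rule bounded_linear.has_vector_derivative[OF bounded_linear_of_real])
  qed
  note E = E_deriv[OF entire_diff_coeff[of k]] and Lg = Lg_deriv[OF entire_diffs[OF entire_log[of k]]]
  note Lc = Lg_isCont[OF entire_diffs[OF entire_log[of k]]]
  \<comment> \<open>With \<open>s - t\<close> in place of \<open>centered_part\<close>, the function
    is continuous up to the right end, where \<open>centered_part\<close> has already jumped
    back.\<close>
  define F0 where "F0 = (\<lambda>s. - 2 * (log_coeff k 0 * complex_of_real (- Im (V0 t (s - t)))
    + E0 (diff_coeff k) s t + Lg0 (diffs (log_coeff k)) s t))"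
  define F1 where "F1 = (\<lambda>s. - 2 * (log_coeff k 0 * complex_of_real (- Im (V1 t (s - t)))
    + E1 (diff_coeff k) s t + Lg1 (diffs (log_coeff k)) s t))"
  have eq: "F0 s = kernel_D k s t" "F1 s = kernel_D1 k s t" if "s \<in> {t - L / 2<..<t - L / 2 + L}" for s
    using c[OF that] by (simp_all add: F0_def F1_def kernel_D_def kernel_D1_def)
  have sm: "\<bar>s - t\<bar> < L" if "s \<in> {t - L / 2..t - L / 2 + L}" for s using that L by auto
  have d0: "(F0 has_vector_derivative kernel_D1 k s t) (at s)" and d1: "(F1 has_vector_derivative kernel_D2 k s t) (at s)"
    if s: "s \<in> {t - L / 2<..<t - L / 2 + L} - {t}" for s
  proof -
    have sl: "\<bar>s - t\<bar> < L" using s by (intro sm) auto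
    have cs: "centered_part L (s - t) = s - t" using s by (intro c) auto
    show "(F0 has_vector_derivative kernel_D1 k s t) (at s)"
      unfolding F0_def kernel_D1_def cs
      by (intro has_vector_derivative_mult_right has_vector_derivative_add dV V_deriv E Lg sl ne s)
    show "(F1 has_vector_derivative kernel_D2 k s t) (at s)"
      unfolding F1_def kernel_D2_def cs
      by (intro has_vector_derivative_mult_right has_vector_derivative_add dV V_deriv E Lg sl ne s)
  qed
  have cF: "continuous_on {t - L / 2..t - L / 2 + L} F0" "continuous_on {t - L / 2..t - L / 2 + L} F1"
    unfolding F0_def F1_def
    by (intro continuous_at_imp_continuous_on ballI continuous_mult continuous_const continuous_add Lc
        has_vector_derivative_continuous[OF E(1)] has_vector_derivative_continuous[OF E(2)]
        has_vector_derivative_continuous[OF dV[OF V_deriv(1)[OF sm]]]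
        has_vector_derivative_continuous[OF dV[OF V_deriv(2)[OF sm]]]; assumption)+
  have ends: "F0 (t - L / 2 + L) = F0 (t - L / 2)" "F1 (t - L / 2 + L) = F1 (t - L / 2)"
  proof -
    have "E0 c (s + L) t = E0 c s t" "E1 c (s + L) t = E1 c s t" "Lg0 c (s + L) t = Lg0 c s t" "Lg1 c (s + L) t = Lg1 c s t" for c s
      by (simp_all add: E0_def E1_def Lg0_def Lg1_def \<alpha>0_def \<alpha>1_def \<rho>_def r_def \<rho>1_def curve_periodic)
    moreover have "t - L / 2 + L - t = L / 2" "t - L / 2 - t = - (L / 2)" by simp_all
    ultimately show "F0 (t - L / 2 + L) = F0 (t - L / 2)" "F1 (t - L / 2 + L) = F1 (t - L / 2)"
      by (simp_all only: F0_def F1_def V_ends)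
  qed
  have o: "Ord (- 1 / 2) (kernel_D1 k)" by (rule Ord_mono[OF Ord_kernel_D(2)]) simp
  have o0: "Ord (- 1 / 2) (kernel_D k)" by (rule Ord_mono[OF Ord_kernel_D(1)]) simp
  note i1 = kernel_integrable_first[OF measurable_kernel_D(2) o] and i2 = kernel_integrable_first[OF measurable_kernel_D(3) Ord_kernel_D(3)]
    and i0 = kernel_integrable_first[OF measurable_kernel_D(1) o0]
  have "(LINT s|lebesgue_on {0..L}. kernel_D k s t * vderiv \<phi> s) =
    (F0 (t - L / 2 + L) - F0 (t - L / 2)) * \<phi> (t - L / 2) - (LINT s|lebesgue_on {0..L}. kernel_D1 k s t * \<phi> s)"
    by (rule periodic_integration_by_parts[OF L _ _ _ cF(1) _ _ _ _ \<phi>, where S = "{t}"])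
       (use kernel_D_periodic eq d0 i0(2) i1 in auto)
  then show "(LINT s|lebesgue_on {0..L}. kernel_D k s t * vderiv \<phi> s) = - (LINT s|lebesgue_on {0..L}. kernel_D1 k s t * \<phi> s)"
    unfolding ends by simp
  have "(LINT s|lebesgue_on {0..L}. kernel_D1 k s t * vderiv \<phi> s) =
    (F1 (t - L / 2 + L) - F1 (t - L / 2)) * \<phi> (t - L / 2) - (LINT s|lebesgue_on {0..L}. kernel_D2 k s t * \<phi> s)"
    by (rule periodic_integration_by_parts[OF L _ _ _ cF(2) _ _ _ _ \<phi>, where S = "{t}"])
       (use kernel_D_periodic eq d1 i1(2) i2 in auto)
  then show "(LINT s|lebesgue_on {0..L}. kernel_D1 k s t * vderiv \<phi> s) = - (LINT s|lebesgue_on {0..L}. kernel_D2 k s t * \<phi> s)"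
    unfolding ends by simp
qed

lemma double_layer_H2:
  obtains C where "C \<ge> 0" "\<And>\<sigma> B. bounded_density L \<sigma> B \<Longrightarrow>
    integral_op L (kernel_D k) \<sigma> \<in> H2 L \<and> H2_norm L (integral_op L (kernel_D k) \<sigma>) \<le> C * B"
proof -
  obtain C0 where K0: "bounded_kernel L (kernel_D k) C0"
    using Ord_bounded_kernel[OF measurable_kernel_D(1) Ord_kernel_D(1)] by auto
  obtain C1 where K1: "bounded_kernel L (kernel_D1 k) C1"
    using Ord_bounded_kernel[OF measurable_kernel_D(2) Ord_kernel_D(2)] by auto
  obtain C2 where K2: "bounded_kernel L (kernel_D2 k) C2"
    using Ord_bounded_kernel[OF measurable_kernel_D(3) Ord_kernel_D(3)] by auto
  have C: "C0 \<ge> 0" "C1 \<ge> 0" "C2 \<ge> 0" using bounded_kernelD(4) K0 K1 K2 by auto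
  obtain D where D: "\<And>s t. \<gamma> s \<noteq> \<gamma> t \<Longrightarrow> norm (kernel_D k s t) \<le> D * r s t powr 0" using OrdE[OF Ord_kernel_D(1)] by metis
  have bd: "AE t in lebesgue_on {0..L}. norm (kernel_D k s t) \<le> D" for s
    using AE_gamma_ne[of s 0 L]
  proof eventually_elim
    case (elim t)
    then show ?case using D[of s t] r_pos[of s t] by simp
  qed
  have cont: "AE t in lebesgue_on {0..L}. isCont (\<lambda>s. kernel_D k s t) s" for s
    using AE_gamma_ne[of s 0 L]
  proof eventually_elim
    case (elim t)
    \<comment> \<open>Continuity is read off from the form with \<open>\<Phi>1\<close>, since the
      defining formula contains the discontinuous \<open>centered_part\<close>.\<close>
    have "isCont (\<lambda>s. \<rho> s t) s" using \<rho>_deriv(1) DERIV_isCont by blast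
    moreover have "isCont (\<Phi>1 k) (\<rho> s t)"
      using \<Phi>_deriv(2)[OF \<rho>_pos[OF elim]] has_vector_derivative_continuous by blast
    ultimately have "isCont (\<lambda>s. \<Phi>1 k (\<rho> s t)) s" by (rule isCont_o2)
    moreover have "isCont (\<lambda>s. complex_of_real (\<alpha>0 s t)) s" using \<alpha>_deriv(1) has_vector_derivative_continuous by blast
    ultimately have "isCont (\<lambda>s. - 2 * complex_of_real (\<alpha>0 s t) * \<Phi>1 k (\<rho> s t)) s" by (intro continuous_mult continuous_const)
    moreover have "eventually (\<lambda>s. kernel_D k s t = - 2 * complex_of_real (\<alpha>0 s t) * \<Phi>1 k (\<rho> s t)) (nhds s)"
    proof -
      have "open {s. \<gamma> s \<noteq> \<gamma> t}"
        by (rule open_Collect_neq) (auto intro: smooth_continuous_on smooth_gamma continuous_on_const)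
      then show ?thesis using elim kernel_D_eq by (auto simp: eventually_nhds)
    qed
    ultimately show ?case using isCont_cong by fastforce
  qed
  define C where "C = C0 + C1 + C2"
  have le: "C0 \<le> C" "C1 \<le> C" "C2 \<le> C" "C \<ge> 0" using C by (auto simp: C_def)
  have "integral_op L (kernel_D k) \<sigma> \<in> H2 L \<and> H2_norm L (integral_op L (kernel_D k) \<sigma>) \<le> sqrt (3 * L) * C * B"
    if \<sigma>: "bounded_density L \<sigma> B" for \<sigma> B
  proof -
    have B: "B \<ge> 0" using bounded_densityD(2)[OF \<sigma>, of 0] L norm_ge_zero[of "\<sigma> 0"] by (simp del: norm_ge_zero)
    have w1: "has_weak_deriv L 1 (integral_op L (kernel_D k) \<sigma>) (integral_op L (kernel_D1 k) \<sigma>)"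
      by (rule integral_op_weak_deriv[OF L K0 K1 \<sigma>]) (simp add: kernel_D_weak)
    have w2: "has_weak_deriv L 2 (integral_op L (kernel_D k) \<sigma>) (integral_op L (kernel_D2 k) \<sigma>)"
      by (rule integral_op_weak_deriv[OF L K0 K2 \<sigma>])
         (simp add: kernel_D_weak smooth_vderiv periodic_vderiv eval_nat_numeral)
    have "norm (integral_op L (kernel_D k) \<sigma> s) \<le> C * B" "norm (integral_op L (kernel_D1 k) \<sigma> s) \<le> C * B"
      "norm (integral_op L (kernel_D2 k) \<sigma> s) \<le> C * B" for s
      using integral_op_norm_le(1)[OF L K0 \<sigma>, of s] integral_op_norm_le(1)[OF L K1 \<sigma>, of s]
        integral_op_norm_le(1)[OF L K2 \<sigma>, of s] mult_right_mono[OF le(1) B] mult_right_mono[OF le(2) B] mult_right_mono[OF le(3) B]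
      by linarith+
    moreover have "periodic L (integral_op L (kernel_D k) \<sigma>)" by (simp add: periodic_def integral_op_def kernel_D_periodic)
    moreover have "continuous_on UNIV (integral_op L (kernel_D k) \<sigma>)" by (rule integral_op_continuous[OF K0 \<sigma> bd cont])
    ultimately show ?thesis using H2I[OF L _ _ w1 w2, of "C * B"] by (simp add: mult.assoc)
  qed
  moreover have "0 \<le> sqrt (3 * L) * C" using le L by simp
  ultimately show ?thesis using that by blast
qed

end

section \<open>Regularity of \<open>H\<^sup>2\<close> functions\<close>

lemma AE_lebesgue_on_negligible:
  assumes "AE t in lebesgue_on {a..b::real}. P t"
  shows "negligible {t \<in> {a..b}. \<not> P t}"
proof -
  have "AE t in lebesgue. t \<in> {a..b} \<longrightarrow> P t"
    using assms by (subst (asm) AE_restrict_space_iff) auto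
  then have "negligible {t. \<not> (t \<in> {a..b} \<longrightarrow> P t)}"
    by (simp add: negligible_iff_null_sets eventually_ae_filter) (metis (no_types, lifting) null_sets_completion_subset)
  then show ?thesis by (rule negligible_subset) auto
qed

text \<open>The first weak derivative agrees almost everywhere with an antiderivative
  \<open>p\<close> of a square integrable function, which is Hoelder continuous with exponent
  \<open>1/2\<close>. Integrating once more gives a Taylor remainder of order \<open>3/2\<close>.
  Expanding at either end of the interval serves both signs of the increment, and
  \<open>p 0 = p L\<close> joins the periods.\<close>

lemma H2_derivative:
  assumes L: "L > 0" and f: "f \<in> H2 L"
  shows "\<exists>(p :: real \<Rightarrow> complex) C. 0 \<le> C \<and> p 0 = p L \<and> (\<forall>x y z. 0 \<le> x \<and> x \<le> y \<and> y \<le> L \<and> (z = x \<or> z = y) \<longrightarrow>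
    norm (f y - f x - (y - x) * p z) \<le> C * (y - x) * sqrt (y - x))"
proof -
  obtain g1 g2 where g: "has_weak_deriv L 1 f g1" "has_weak_deriv L 2 f g2"
    and c: "continuous_on {0..L} f" "periodic L f" using H2D[OF f] by blast
  have si: "square_integrable L g1" "square_integrable L g2" using g by (simp_all add: has_weak_deriv_def)
  have gi: "integrable (lebesgue_on {0..L}) g1" "integrable (lebesgue_on {0..L}) g2" using si L2_imp_L1 by auto
  have g1H: "g1 integrable_on {0..L}" "g2 integrable_on {0..L}"
    using integrable_on_subinterval_lebesgue(2)[OF gi(1), of 0 L] integrable_on_subinterval_lebesgue(2)[OF gi(2), of 0 L] by simp_all
  \<comment> \<open>Testing the first-order identity with \<open>vderiv \<phi>\<close> shows that
    \<open>g2\<close> is the weak derivative of \<open>g1\<close>.\<close>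
  have W: "(LINT t|lebesgue_on {0..L}. g1 t * vderiv \<phi> t) = - (LINT t|lebesgue_on {0..L}. g2 t * \<phi> t)"
    if \<phi>: "smooth \<phi>" "periodic L \<phi>" for \<phi>
  proof -
    have "(LINT t|lebesgue_on {0..L}. f t * vderiv (vderiv \<phi>) t) = - (LINT t|lebesgue_on {0..L}. g1 t * vderiv \<phi> t)"
      using g(1) smooth_vderiv[OF \<phi>(1)] periodic_vderiv[OF \<phi>] by (auto simp: has_weak_deriv_def)
    moreover have "(LINT t|lebesgue_on {0..L}. f t * vderiv (vderiv \<phi>) t) = (LINT t|lebesgue_on {0..L}. g2 t * \<phi> t)"
      using g(2) \<phi> by (auto simp: has_weak_deriv_def eval_nat_numeral)
    ultimately show ?thesis by simp
  qed
  obtain c0 where c0: "AE t in lebesgue_on {0..L}. g1 t = c0 + integral {0..t} g2" "integral {0..L} g2 = 0"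
    by (rule weak_deriv_imp_antiderivative[OF L gi W])
  define p where "p = (\<lambda>t. c0 + integral {0..t} g2)"
  have pc: "continuous_on {0..L} p" unfolding p_def
    by (intro continuous_intros indefinite_integral_continuous_1 g1H)
  have p0: "p 0 = p L" using c0(2) by (simp add: p_def)
  define C where "C = (LINT t|lebesgue_on {0..L}. (cmod (g2 t))\<^sup>2) + 1"
  have C: "C \<ge> 0" unfolding C_def by (intro add_nonneg_nonneg Bochner_Integration.integral_nonneg) auto
  have hol: "norm (p y - p x) \<le> C * sqrt (y - x)" if "0 \<le> x" "x \<le> y" "y \<le> L" for x y
    using square_integrable_holder[OF si(2) that] integral_diff_Icc[OF g1H(2) that] by (simp add: p_def C_def)
  have fd: "f y - f x = integral {x..y} p" if xy: "0 \<le> x" "x \<le> y" "y \<le> L" for x y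
  proof -
    have "f y - f x = integral {0..y} g1 - integral {0..x} g1"
      using H2_antiderivative[OF L c(1) g(1), of y] H2_antiderivative[OF L c(1) g(1), of x] xy by simp
    also have "\<dots> = integral {x..y} g1" by (rule integral_diff_Icc[OF g1H(1) xy])
    also have "\<dots> = integral {x..y} p"
      by (rule integral_spike[OF AE_lebesgue_on_negligible[OF c0(1)]]) (use xy in \<open>auto simp: p_def\<close>)
    finally show ?thesis .
  qed
  have est: "norm (f y - f x - (y - x) * p z) \<le> C * (y - x) * sqrt (y - x)"
    if xy: "0 \<le> x" "x \<le> y" "y \<le> L" and z: "z = x \<or> z = y" for x y z
  proof -
    have pci: "continuous_on {x..y} p" by (rule continuous_on_subset[OF pc]) (use xy in auto)
    have "f y - f x - (y - x) * p z = integral {x..y} p - integral {x..y} (\<lambda>t. p z)"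
      using fd[OF xy] xy by (simp add: scaleR_conv_of_real)
    also have "\<dots> = integral {x..y} (\<lambda>t. p t - p z)"
      by (rule integral_diff[symmetric]) (auto intro: integrable_continuous_interval pci)
    also have "norm \<dots> \<le> (C * sqrt (y - x)) * (y - x)"
    proof (rule integral_bound[OF xy(2)])
      show "continuous_on {x..y} (\<lambda>t. p t - p z)" by (intro continuous_intros pci)
      fix t assume t: "t \<in> {x..y}"
      have "norm (p t - p z) \<le> C * sqrt \<bar>t - z\<bar>"
        using hol[of t z] hol[of z t] t xy z by (cases "t \<le> z") (auto simp: norm_minus_commute abs_if)
      also have "\<dots> \<le> C * sqrt (y - x)" using t z C by (intro mult_left_mono) auto
      finally show "norm (p t - p z) \<le> C * sqrt (y - x)" .
    qed
    finally show ?thesis by (simp add: mult_ac)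
  qed
  show ?thesis
  proof (intro exI conjI allI impI)
    show "0 \<le> C" "p 0 = p L" by (rule C, rule p0)
    show "norm (f y - f x - (y - x) * p z) \<le> C * (y - x) * sqrt (y - x)"
      if "0 \<le> x \<and> x \<le> y \<and> y \<le> L \<and> (z = x \<or> z = y)" for x y z
      using that by (intro est) blast+
  qed
qed

lemma H2_bounded:
  assumes L: "L > 0" and f: "f \<in> H2 L"
  obtains B where "B \<ge> 0" "\<And>t. norm (f t) \<le> B"
proof -
  have c: "continuous_on {0..L} f" and p: "periodic L f" using H2D[OF f] by blast+
  obtain B where B: "B > 0" "\<And>t. t \<in> {0..L} \<Longrightarrow> norm (f t) \<le> B" using continuous_bounded_Icc[OF c] by metis
  have "norm (f t) \<le> B" for t
  proof -
    have "f t = f (period_part L t)"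
      using shift_of_int[of f L "period_part L t" "\<lfloor>t / L\<rfloor>"] p by (simp add: periodic_def period_part_def mult.commute)
    then show ?thesis using B(2)[of "period_part L t"] period_part(1,2)[OF L, of t] by simp
  qed
  then show ?thesis using that[of B] B(1) by simp
qed

text \<open>The remainder divided by the square of \<open>u\<close> is of size \<open>|u|\<close> to
  the power \<open>-1/2\<close>, hence integrable: exactly the regularity that the finite part of a
  double pole calls for.\<close>

lemma H2_taylor:
  assumes L: "L > 0" and f: "f \<in> H2 L"
  shows "\<exists>(p :: complex) C. 0 \<le> C \<and>
    (\<forall>u. \<bar>u\<bar> \<le> L / 2 \<longrightarrow> norm (f (s + u) - f s - u * p) \<le> C * (\<bar>u\<bar> * sqrt \<bar>u\<bar>))"
proof -
  obtain q :: "real \<Rightarrow> complex" and C where q: "C \<ge> 0" "q 0 = q L"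
    and q': "\<forall>x y z. 0 \<le> x \<and> x \<le> y \<and> y \<le> L \<and> (z = x \<or> z = y) \<longrightarrow>
      norm (f y - f x - (y - x) * q z) \<le> C * (y - x) * sqrt (y - x)"
    using H2_derivative[OF L f] by blast
  have q34: "norm (f y - f x - (y - x) * q x) \<le> C * (y - x) * sqrt (y - x)"
    "norm (f y - f x - (y - x) * q y) \<le> C * (y - x) * sqrt (y - x)" if "0 \<le> x" "x \<le> y" "y \<le> L" for x y
    using q' that by blast+
  obtain B where B: "B \<ge> 0" "\<And>t. norm (f t) \<le> B" using H2_bounded[OF L f] by metis
  have per: "f (t + L) = f t" for t using H2D[OF f] by (metis periodic_def)
  define z where "z = period_part L s"
  have z: "0 \<le> z" "z < L" unfolding z_def by (rule period_part[OF L])+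
  have fz: "f (s + u) = f (z + u)" for u
    using shift_of_int[where f = f and t = "z + u" and n = "\<lfloor>s / L\<rfloor>", OF per] by (simp add: z_def period_part_def algebra_simps)
  from fz[of 0] have fz0: "f s = f z" by simp
  define p where "p = q z"
  \<comment> \<open>Within this radius the increment stays inside one period. At
    \<open>z = 0\<close> negative increments are expanded from the other end \<open>L\<close>, where
    \<open>p\<close> has the same value.\<close>
  define \<delta> where "\<delta> = (if z = 0 then L / 2 else min z (L - z))"
  have \<delta>: "\<delta> > 0" using z L by (auto simp: \<delta>_def)
  have small: "norm (f (s + u) - f s - u * p) \<le> C * (\<bar>u\<bar> * sqrt \<bar>u\<bar>)" if u: "\<bar>u\<bar> \<le> \<delta>" for u
  proof (cases "u \<ge> 0")
    case True
    have "z + u \<le> L" using u True L by (auto simp: \<delta>_def min_def split: if_splits)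
    then show ?thesis using q34(1)[of z "z + u"] z True by (simp add: fz fz0 p_def mult.assoc)
  next
    case False
    show ?thesis
    proof (cases "z = 0")
      case True
      have "f (s + u) = f (L + u)" using per[of u] by (simp add: fz True add.commute)
      moreover have "f s = f L" using per[of 0] by (simp add: fz0 True)
      moreover have "norm (f (L + u) - f L - u * p) = norm (f L - f (L + u) - (L - (L + u)) * q L)"
        using q(2) by (subst norm_minus_cancel[symmetric]) (simp add: p_def True algebra_simps)
      moreover have "0 \<le> L + u" using u True L by (simp add: \<delta>_def)
      ultimately show ?thesis using q34(2)[of "L + u" L] False by (simp add: mult.assoc)
    next
      case zp: False
      have "0 \<le> z + u" using u zp False by (auto simp: \<delta>_def min_def split: if_splits)
      moreover have "norm (f (z + u) - f z - u * p) = norm (f z - f (z + u) - (z - (z + u)) * q z)"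
        by (subst norm_minus_cancel[symmetric]) (simp add: p_def algebra_simps)
      ultimately show ?thesis using q34(2)[of "z + u" z] z False by (simp add: fz fz0 mult.assoc)
    qed
  qed
  \<comment> \<open>For larger increments the left side is bounded, and the second summand makes the
    right side at least as large.\<close>
  define D where "D = C + (2 * B + L * norm p) / (\<delta> * sqrt \<delta>)"
  have D: "C \<le> D" "(2 * B + L * norm p) / (\<delta> * sqrt \<delta>) \<le> D" "0 \<le> D"
    using q(1) B(1) L \<delta> by (auto simp: D_def)
  have "norm (f (s + u) - f s - u * p) \<le> D * (\<bar>u\<bar> * sqrt \<bar>u\<bar>)" if u: "\<bar>u\<bar> \<le> L / 2" for u
  proof (cases "\<bar>u\<bar> \<le> \<delta>")
    case True
    from small[OF this] mult_right_mono[OF D(1), of "\<bar>u\<bar> * sqrt \<bar>u\<bar>"] show ?thesis by simp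
  next
    case False
    have "norm (f (s + u) - f s - u * p) \<le> norm (f (s + u)) + norm (f s) + norm (u * p)"
      by (meson norm_triangle_ineq4 order_trans add_right_mono)
    also have "\<dots> \<le> B + B + L * norm p"
      using u L by (intro add_mono B) (auto simp: norm_mult intro!: mult_right_mono)
    also have "\<dots> = (2 * B + L * norm p) / (\<delta> * sqrt \<delta>) * (\<delta> * sqrt \<delta>)" using \<delta> by simp
    also have "\<dots> \<le> D * (\<bar>u\<bar> * sqrt \<bar>u\<bar>)"
      using D False \<delta> by (intro mult_mono) auto
    finally show ?thesis .
  qed
  with D(3) show ?thesis by blast
qed

section \<open>Finite part integrals\<close>

text \<open>Needed to evaluate the \<open>THE\<close> in \<open>finite_part_integral\<close>. The
  functions \<open>1 / \<epsilon>\<close>, \<open>ln \<epsilon>\<close> and \<open>1\<close> grow at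
  different rates, so their coefficients in the difference of two expansions vanish one after the
  other.\<close>

lemma has_finite_part_unique:
  assumes "has_finite_part I C" "has_finite_part I D" shows "C = D"
proof -
  obtain a b a' b' where l: "((\<lambda>\<epsilon>. I \<epsilon> - a / of_real \<epsilon> - b * of_real (ln \<epsilon>)) \<longlongrightarrow> C) (at_right 0)"
    "((\<lambda>\<epsilon>. I \<epsilon> - a' / of_real \<epsilon> - b' * of_real (ln \<epsilon>)) \<longlongrightarrow> D) (at_right 0)"
    using assms by (auto simp: has_finite_part_def)
  define x where "x = a' - a"
  define y where "y = b' - b"
  have d: "((\<lambda>\<epsilon>. x / of_real \<epsilon> + y * of_real (ln \<epsilon>)) \<longlongrightarrow> C - D) (at_right 0)"
    using tendsto_diff[OF l] by (simp add: x_def y_def diff_divide_distrib left_diff_distrib algebra_simps)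
  have e0: "((\<lambda>\<epsilon>. complex_of_real \<epsilon>) \<longlongrightarrow> 0) (at_right 0)"
    by (rule tendsto_eq_intros | simp)+
  have "((\<lambda>\<epsilon>::real. \<epsilon> * ln \<epsilon>) \<longlongrightarrow> 0) (at_right 0)" by real_asymp
  from tendsto_of_real[OF this, where ?'a = complex]
  have el: "((\<lambda>\<epsilon>. complex_of_real (\<epsilon> * ln \<epsilon>)) \<longlongrightarrow> 0) (at_right 0)" by (simp only: of_real_0)
  have pos: "eventually (\<lambda>\<epsilon>::real. \<epsilon> > 0) (at_right 0)" by (rule eventually_at_right_less)
  \<comment> \<open>Multiplication by \<open>\<epsilon>\<close> isolates the coefficient of the
    pole.\<close>
  have "((\<lambda>\<epsilon>. complex_of_real \<epsilon> * (x / of_real \<epsilon> + y * of_real (ln \<epsilon>)) - y * complex_of_real (\<epsilon> * ln \<epsilon>)) \<longlongrightarrow> 0 * (C - D) - y * 0) (at_right 0)"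
    by (intro tendsto_intros e0 el d)
  moreover have "eventually (\<lambda>\<epsilon>. complex_of_real \<epsilon> * (x / of_real \<epsilon> + y * of_real (ln \<epsilon>)) - y * complex_of_real (\<epsilon> * ln \<epsilon>) = x) (at_right 0)"
    using pos by eventually_elim (simp add: field_simps)
  ultimately have "((\<lambda>\<epsilon>::real. x) \<longlongrightarrow> 0 * (C - D) - y * 0) (at_right 0)" by (rule Lim_transform_eventually)
  from tendsto_unique[OF trivial_limit_at_right_real tendsto_const this] have x: "x = 0" by simp
  have "((\<lambda>\<epsilon>::real. 1 / ln \<epsilon>) \<longlongrightarrow> 0) (at_right 0)" by real_asymp
  from tendsto_of_real[OF this, where ?'a = complex]
  have il: "((\<lambda>\<epsilon>. complex_of_real (1 / ln \<epsilon>)) \<longlongrightarrow> 0) (at_right 0)" by (simp only: of_real_0)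
  \<comment> \<open>With the pole gone, division by the logarithm isolates its coefficient.\<close>
  have "((\<lambda>\<epsilon>. complex_of_real (1 / ln \<epsilon>) * (x / of_real \<epsilon> + y * of_real (ln \<epsilon>))) \<longlongrightarrow> 0 * (C - D)) (at_right 0)"
    by (intro tendsto_intros il d)
  moreover have "eventually (\<lambda>\<epsilon>. complex_of_real (1 / ln \<epsilon>) * (x / of_real \<epsilon> + y * of_real (ln \<epsilon>)) = y) (at_right 0)"
  proof -
    have "eventually (\<lambda>\<epsilon>::real. \<epsilon> < 1) (at_right 0)" by (rule eventually_at_right_real[THEN eventually_mono, of 0 1]) auto
    with pos show ?thesis
    proof eventually_elim
      case (elim \<epsilon>)
      then have "ln \<epsilon> \<noteq> 0" by simp
      then show ?case by (simp add: x)
    qed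
  qed
  ultimately have "((\<lambda>\<epsilon>::real. y) \<longlongrightarrow> 0 * (C - D)) (at_right 0)" by (rule Lim_transform_eventually)
  from tendsto_unique[OF trivial_limit_at_right_real tendsto_const this] have y: "y = 0" by simp
  have "((\<lambda>\<epsilon>::real. 0::complex) \<longlongrightarrow> C - D) (at_right 0)" using d by (simp add: x y)
  from tendsto_unique[OF trivial_limit_at_right_real tendsto_const this] show ?thesis by simp
qed

lemma cutoff_integral_tendsto:
  fixes g :: "real \<Rightarrow> complex"
  assumes g: "integrable M g" and q[measurable]: "q \<in> borel_measurable M" and pos: "AE t in M. 0 < q t"
  shows "((\<lambda>\<epsilon>. LINT t|M. (if \<epsilon> < q t then g t else 0)) \<longlongrightarrow> (LINT t|M. g t)) (at_right (0::real))"
proof (rule tendsto_at_right_sequentially[of 0 1])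
  fix e :: "nat \<Rightarrow> real" assume e: "e \<longlonglongrightarrow> 0"
  have [measurable]: "g \<in> borel_measurable M" using g by simp
  show "(\<lambda>n. LINT t|M. (if e n < q t then g t else 0)) \<longlonglongrightarrow> (LINT t|M. g t)"
  proof (rule integral_dominated_convergence[where w = "\<lambda>t. norm (g t)"])
    show "AE t in M. (\<lambda>n. if e n < q t then g t else 0) \<longlonglongrightarrow> g t"
      using pos
    proof eventually_elim
      case (elim t)
      have "eventually (\<lambda>n. e n < q t) sequentially" using order_tendstoD(2)[OF e elim] .
      then have "eventually (\<lambda>n. g t = (if e n < q t then g t else 0)) sequentially" by (rule eventually_mono) simp
      then show ?case by (rule Lim_transform_eventually[OF tendsto_const])
    qed
  qed (use g in auto)
qed simp

lemma integral_lebesgue_on_cut: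
  fixes f :: "real \<Rightarrow> complex"
  assumes "{t \<in> {a..b}. P t} \<in> sets lebesgue"
  shows "(LINT t|lebesgue_on {t \<in> {a..b}. P t}. f t) = (LINT t|lebesgue_on {a..b}. (if P t then f t else 0))"
proof -
  have "(LINT t|lebesgue_on {t \<in> {a..b}. P t}. f t) = (LINT t|lebesgue. indicator {t \<in> {a..b}. P t} t *\<^sub>R f t)"
    by (rule integral_restrict_space) (use assms in simp)
  also have "\<dots> = (LINT t|lebesgue. indicator {a..b} t *\<^sub>R (if P t then f t else 0))"
    by (rule Bochner_Integration.integral_cong) (auto simp: indicator_def)
  also have "\<dots> = (LINT t|lebesgue_on {a..b}. (if P t then f t else 0))"
    by (rule integral_restrict_space[symmetric]) auto
  finally show ?thesis .
qed

text \<open>The antiderivative is \<open>- A / (t - s) + p ln |t - s|\<close>. The cutoff is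
  symmetric about \<open>s\<close>, so the logarithms cancel and \<open>p\<close> drops out of the
  value.\<close>

lemma principal_integral:
  fixes A p :: complex and a e s :: real
  assumes a: "0 < a" and e: "0 < e" "e \<le> a"
  shows "((\<lambda>t. if e < \<bar>t - s\<bar> then (A + (t - s) * p) / complex_of_real ((t - s)\<^sup>2) else 0) has_integral
    (2 * A / e - 2 * A / a)) {s - a..s + a}"
proof -
  let ?f = "\<lambda>t. (A + (t - s) * p) / complex_of_real ((t - s)\<^sup>2)"
  define F where "F = (\<lambda>t. - A * complex_of_real (1 / (t - s)) + p * complex_of_real (ln \<bar>t - s\<bar>))"
  have dF: "(F has_vector_derivative ?f t) (at t)" if t: "t \<noteq> s" for t
  proof -
    have d1: "((\<lambda>t. 1 / (t - s)) has_real_derivative - 1 / (t - s)\<^sup>2) (at t)"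
      using t by (auto intro!: derivative_eq_intros simp: power2_eq_square)
    have d2: "((\<lambda>t. ln \<bar>t - s\<bar>) has_real_derivative 1 / (t - s)) (at t)"
    proof (cases "t > s")
      case True
      have "((\<lambda>t. ln (t - s)) has_real_derivative 1 / (t - s)) (at t)"
        using True by (auto intro!: derivative_eq_intros)
      then show ?thesis
        by (rule has_field_derivative_transform_within_open[of _ _ _ "{s<..}"]) (use True in auto)
    next
      case False
      have "((\<lambda>t. ln (s - t)) has_real_derivative 1 / (t - s)) (at t)"
        using False t by (auto intro!: derivative_eq_intros simp: field_simps)
      then show ?thesis
        by (rule has_field_derivative_transform_within_open[of _ _ _ "{..<s}"]) (use False t in auto)
    qed
    have "(F has_vector_derivative - A * complex_of_real (- 1 / (t - s)\<^sup>2) + p * complex_of_real (1 / (t - s))) (at t)"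
      unfolding F_def
      by (rule has_vector_derivative_add[OF has_vector_derivative_mult_right[OF has_vector_derivative_of_real[OF d1]]
            has_vector_derivative_mult_right[OF has_vector_derivative_of_real[OF d2]]])
    moreover have "- A * complex_of_real (- 1 / v\<^sup>2) + p * complex_of_real (1 / v) = (A + v * p) / complex_of_real (v\<^sup>2)"
      if "v \<noteq> 0" for v :: real
      using that by (simp add: add_divide_distrib power2_eq_square)
    from this[of "t - s"] have "- A * complex_of_real (- 1 / (t - s)\<^sup>2) + p * complex_of_real (1 / (t - s)) = ?f t"
      using t by simp
    ultimately show ?thesis by simp
  qed
  let ?g = "\<lambda>t. if e < \<bar>t - s\<bar> then ?f t else 0"
  have 1: "(?g has_integral F (s - e) - F (s - a)) {s - a..s - e}"
  proof (rule has_integral_spike_finite)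
    show "(?f has_integral F (s - e) - F (s - a)) {s - a..s - e}"
    proof (rule fundamental_theorem_of_calculus)
      fix t assume "t \<in> {s - a..s - e}"
      then have "t \<noteq> s" using e by auto
      then show "(F has_vector_derivative ?f t) (at t within {s - a..s - e})"
        by (rule has_vector_derivative_at_within[OF dF])
    qed (use e in simp)
    fix t assume "t \<in> {s - a..s - e} - {s - e}"
    then have "e < \<bar>t - s\<bar>" by auto
    then show "?g t = ?f t" by (simp only: if_True)
  qed simp
  have 2: "(?g has_integral 0) {s - e..s + e}"
  proof (rule has_integral_is_0)
    fix t assume "t \<in> {s - e..s + e}"
    then have "\<not> e < \<bar>t - s\<bar>" by auto
    then show "?g t = 0" by (simp only: if_False)
  qed
  have 3: "(?g has_integral F (s + a) - F (s + e)) {s + e..s + a}"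
  proof (rule has_integral_spike_finite)
    show "(?f has_integral F (s + a) - F (s + e)) {s + e..s + a}"
    proof (rule fundamental_theorem_of_calculus)
      fix t assume "t \<in> {s + e..s + a}"
      then have "t \<noteq> s" using e by auto
      then show "(F has_vector_derivative ?f t) (at t within {s + e..s + a})"
        by (rule has_vector_derivative_at_within[OF dF])
    qed (use e in simp)
    fix t assume "t \<in> {s + e..s + a} - {s + e}"
    then have "e < \<bar>t - s\<bar>" by auto
    then show "?g t = ?f t" by (simp only: if_True)
  qed simp
  have "(?g has_integral (F (s - e) - F (s - a)) + 0 + (F (s + a) - F (s + e))) {s - a..s + a}"
    by (rule has_integral_combine[OF _ _ has_integral_combine[OF _ _ 1 2] 3]) (use e in auto)
  moreover have "(F (s - e) - F (s - a)) + 0 + (F (s + a) - F (s + e)) = 2 * A / e - 2 * A / a"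
    using a e by (simp add: F_def)
  ultimately show ?thesis by simp
qed

section \<open>The hypersingular operators\<close>

lemma has_finite_part_cong:
  assumes "\<And>\<epsilon>. \<epsilon> > 0 \<Longrightarrow> I \<epsilon> = J \<epsilon>"
  shows "has_finite_part I C \<longleftrightarrow> has_finite_part J C"
proof -
  have "eventually (\<lambda>\<epsilon>. I \<epsilon> - a / of_real \<epsilon> - b * of_real (ln \<epsilon>) = J \<epsilon> - a / of_real \<epsilon> - b * of_real (ln \<epsilon>)) (at_right 0)" for a b
    using eventually_at_right_less[of "0::real"] by eventually_elim (simp add: assms)
  from tendsto_cong[OF this] show ?thesis by (simp add: has_finite_part_def)
qed

lemma has_finite_part_diff:
  assumes "(J \<longlongrightarrow> D) (at_right 0)" "has_finite_part I C"
  shows "has_finite_part (\<lambda>\<epsilon>. J \<epsilon> - I \<epsilon>) (D - C)"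
proof -
  obtain a b where l: "((\<lambda>\<epsilon>. I \<epsilon> - a / of_real \<epsilon> - b * of_real (ln \<epsilon>)) \<longlongrightarrow> C) (at_right 0)"
    using assms(2) by (auto simp: has_finite_part_def)
  have "((\<lambda>\<epsilon>. (J \<epsilon> - I \<epsilon>) - (- a) / of_real \<epsilon> - (- b) * of_real (ln \<epsilon>)) \<longlongrightarrow> D - C) (at_right 0)"
    using tendsto_diff[OF assms(1) l] by (simp add: algebra_simps)
  then show ?thesis unfolding has_finite_part_def by blast
qed

lemma integral_indicator_Icc_le:
  fixes x y :: real assumes "x \<le> y"
  shows "(LINT t|lebesgue_on {a..b}. indicat_real {x..y} t) \<le> y - x"
proof -
  have "(LINT t|lebesgue_on {a..b}. indicat_real {x..y} t) = (LINT t|lebesgue. indicat_real {a..b} t *\<^sub>R indicat_real {x..y} t)"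
    by (rule integral_restrict_space) auto
  also have "\<dots> \<le> (LINT t|lebesgue. indicat_real {x..y} t)"
  proof (rule integral_mono_AE')
    show "integrable lebesgue (indicat_real {x..y})" by (rule integrable_real_indicator) (auto simp: emeasure_lborel_Icc_eq)
  qed (auto simp: indicator_def)
  also have "\<dots> = y - x" using assms by simp
  finally show ?thesis .
qed

context closed_curve
begin

section \<open>Agreement of chord and arc length to second order\<close>

lemma r_le: "r (t + u) t \<le> \<bar>u\<bar>"
proof -
  have "norm (\<gamma> (t + u) - \<gamma> t) \<le> 1 * norm (t + u - t)"
  proof (rule differentiable_bound[of UNIV _ "\<lambda>t x. x *\<^sub>R T t"])
    fix t
    show "(\<gamma> has_derivative (\<lambda>x. x *\<^sub>R T t)) (at t within UNIV)"
      using has_vderiv_gamma[of t] by (simp add: has_vector_derivative_def)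
    show "onorm (\<lambda>x. x *\<^sub>R T t) \<le> 1" by (rule onorm_le) (simp add: norm_T)
  qed auto
  then show ?thesis by (simp add: r_def)
qed

lemma inner_T_d2: "T t \<bullet> \<gamma>d 2 t = 0"
proof -
  have "((\<lambda>s. T s \<bullet> T s) has_vector_derivative T t \<bullet> \<gamma>d 2 t + \<gamma>d 2 t \<bullet> T t) (at t)"
    by (rule bounded_bilinear.has_vector_derivative[OF bounded_bilinear_inner has_vderiv_T has_vderiv_T])
  moreover have "(\<lambda>s. T s \<bullet> T s) = (\<lambda>s. 1)" using norm_T by (simp add: norm_eq_1)
  ultimately have "((\<lambda>s. 1::real) has_vector_derivative T t \<bullet> \<gamma>d 2 t + \<gamma>d 2 t \<bullet> T t) (at t)" by simp
  from vector_derivative_unique_at[OF this has_vector_derivative_const]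
  show ?thesis by (simp add: inner_commute)
qed

lemma w_zero: "w 0 t 0 = (1 / 2) *\<^sub>R \<gamma>d 2 t"
proof -
  have "((\<lambda>\<theta>. (1 - \<theta>) *\<^sub>R \<gamma>d 2 t) has_integral (1 - 1\<^sup>2 / 2) *\<^sub>R \<gamma>d 2 t - (0 - 0\<^sup>2 / 2) *\<^sub>R \<gamma>d 2 t) {0..1}"
  proof (rule fundamental_theorem_of_calculus)
    fix x :: real
    have "((\<lambda>\<theta>. \<theta> - \<theta>\<^sup>2 / 2) has_real_derivative (1 - x)) (at x within {0..1})"
      by (auto intro!: derivative_eq_intros)
    from has_vector_derivative_scaleR[OF this has_vector_derivative_const]
    show "((\<lambda>\<theta>. (\<theta> - \<theta>\<^sup>2 / 2) *\<^sub>R \<gamma>d 2 t) has_vector_derivative (1 - x) *\<^sub>R \<gamma>d 2 t) (at x within {0..1})" by simp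
  qed simp
  then have "integral {0..1} (\<lambda>\<theta>. (1 - \<theta>) *\<^sub>R \<gamma>d 2 t) = (1 / 2) *\<^sub>R \<gamma>d 2 t" by (simp add: integral_unique)
  then show ?thesis by (simp add: w_def scaleR_conv_of_real)
qed

text \<open>The linear term in the expansion of the squared norm of \<open>h\<close> is
  \<open>2 u\<close> times the tangential component of \<open>w 0\<close>. At \<open>u = 0\<close>
  that component is half of \<open>T t \<bullet> \<gamma>d 2 t\<close>, which vanishes by unit
  speed, so the whole deviation is quadratic.\<close>

lemma chord_expansion: obtains D where "D \<ge> 0" "\<And>t u. \<bar>(norm (h t u))\<^sup>2 - 1\<bar> \<le> D * u\<^sup>2"
proof -
  obtain C0 where C0: "C0 > 0" "\<And>t u. norm (w 0 t u) \<le> C0" using w_bounded[of 0] by metis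
  obtain C1 where C1: "C1 > 0" "\<And>t u. norm (w 1 t u) \<le> C1" using w_bounded[of 1] by metis
  have lip: "norm (w 0 t u - w 0 t 0) \<le> C1 * norm (u - 0)" for t u
  proof (rule differentiable_bound[of UNIV _ "\<lambda>u x. x *\<^sub>R w 1 t u"])
    fix u
    show "(w 0 t has_derivative (\<lambda>x. x *\<^sub>R w 1 t u)) (at u within UNIV)"
      using w_deriv[of 0 t u] by (simp add: has_vector_derivative_def)
    show "onorm (\<lambda>x. x *\<^sub>R w 1 t u) \<le> C1"
    proof (rule onorm_le)
      fix x :: real
      show "norm (x *\<^sub>R w 1 t u) \<le> C1 * norm x"
        using mult_left_mono[OF C1(2)[of t u], of "\<bar>x\<bar>"] by (simp add: mult.commute)
    qed
  qed auto
  have "\<bar>(norm (h t u))\<^sup>2 - 1\<bar> \<le> (2 * C1 + C0\<^sup>2) * u\<^sup>2" for t u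
  proof -
    have expand: "(x + u *\<^sub>R y) \<bullet> (x + u *\<^sub>R y) = x \<bullet> x + 2 * (u * (x \<bullet> y)) + u\<^sup>2 * (y \<bullet> y)" for x y :: complex
      by (simp add: inner_add_left inner_add_right inner_commute[of y x] power2_eq_square algebra_simps)
    have TT: "T t \<bullet> T t = 1" using norm_T[of t] by (simp add: norm_eq_1)
    have Tw: "T t \<bullet> w 0 t u = T t \<bullet> (w 0 t u - w 0 t 0)" by (simp add: inner_diff_right w_zero inner_T_d2)
    have "h t u = T t + u *\<^sub>R w 0 t u" by (simp add: h_def scaleR_conv_of_real)
    then have "(norm (h t u))\<^sup>2 = (T t + u *\<^sub>R w 0 t u) \<bullet> (T t + u *\<^sub>R w 0 t u)"
      by (simp only: power2_norm_eq_inner)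
    also have "\<dots> = T t \<bullet> T t + 2 * (u * (T t \<bullet> w 0 t u)) + u\<^sup>2 * (w 0 t u \<bullet> w 0 t u)"
      by (rule expand)
    also have "\<dots> = 1 + 2 * (u * (T t \<bullet> w 0 t u)) + u\<^sup>2 * (norm (w 0 t u))\<^sup>2"
      by (simp only: TT power2_norm_eq_inner)
    finally have "\<bar>(norm (h t u))\<^sup>2 - 1\<bar> = \<bar>2 * (u * (T t \<bullet> w 0 t u)) + u\<^sup>2 * (norm (w 0 t u))\<^sup>2\<bar>" by simp
    also have "\<dots> \<le> 2 * (\<bar>u\<bar> * \<bar>T t \<bullet> w 0 t u\<bar>) + u\<^sup>2 * (norm (w 0 t u))\<^sup>2"
      using abs_triangle_ineq[of "2 * (u * (T t \<bullet> w 0 t u))" "u\<^sup>2 * (norm (w 0 t u))\<^sup>2"] unfolding abs_mult by simp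
    also have "\<dots> \<le> 2 * (\<bar>u\<bar> * (C1 * \<bar>u\<bar>)) + u\<^sup>2 * C0\<^sup>2"
    proof (intro add_mono mult_left_mono power_mono C0(2))
      have "\<bar>T t \<bullet> w 0 t u\<bar> \<le> norm (T t) * norm (w 0 t u - w 0 t 0)" unfolding Tw by (rule Cauchy_Schwarz_ineq2)
      then show "\<bar>T t \<bullet> w 0 t u\<bar> \<le> C1 * \<bar>u\<bar>" using lip[of t u] by (simp add: norm_T)
    qed auto
    also have "\<dots> = 2 * C1 * (\<bar>u\<bar> * \<bar>u\<bar>) + C0\<^sup>2 * u\<^sup>2" by simp
    also have "\<bar>u\<bar> * \<bar>u\<bar> = u\<^sup>2" by (simp only: abs_mult_self_eq power2_eq_square)
    also have "2 * C1 * u\<^sup>2 + C0\<^sup>2 * u\<^sup>2 = (2 * C1 + C0\<^sup>2) * u\<^sup>2" by (simp only: distrib_right)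
    finally show ?thesis .
  qed
  moreover have "2 * C1 + C0\<^sup>2 \<ge> 0" using C1 by simp
  ultimately show ?thesis using that by blast
qed

text \<open>Two consequences used for the finite part: replacing the inverse squared chord by the
  inverse square of the arc length costs a bounded function, and cutoffs by chord and by arc length
  differ on a set of width of third order.\<close>

lemma distance_expansion:
  obtains D where "D \<ge> 0" "\<And>t u. 0 < \<bar>u\<bar> \<Longrightarrow> \<bar>u\<bar> \<le> L / 2 \<Longrightarrow> \<bar>1 / \<rho> (t + u) t - 1 / u\<^sup>2\<bar> \<le> D"
    "\<And>t u. \<bar>u\<bar> - r (t + u) t \<le> D * \<bar>u\<bar> ^ 3"
proof -
  obtain D where D: "D \<ge> 0" "\<And>t u. \<bar>(norm (h t u))\<^sup>2 - 1\<bar> \<le> D * u\<^sup>2" using chord_expansion by metis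
  obtain c where c: "c > 0" "\<And>t u. \<bar>u\<bar> \<le> L / 2 \<Longrightarrow> c \<le> norm (h t u)" using chord_arc by metis
  have r: "r (t + u) t = \<bar>u\<bar> * norm (h t u)" for t u by (simp add: r_def chord_eq norm_mult)
  have 1: "\<bar>1 / \<rho> (t + u) t - 1 / u\<^sup>2\<bar> \<le> D / c\<^sup>2" if u: "0 < \<bar>u\<bar>" "\<bar>u\<bar> \<le> L / 2" for t u
  proof -
    have hp: "norm (h t u) > 0" using c(1) c(2)[OF u(2), of t] by linarith
    have "1 / \<rho> (t + u) t - 1 / u\<^sup>2 = (1 - (norm (h t u))\<^sup>2) / (u\<^sup>2 * (norm (h t u))\<^sup>2)"
      using hp u by (simp add: \<rho>_def r power_mult_distrib field_simps)
    then have "\<bar>1 / \<rho> (t + u) t - 1 / u\<^sup>2\<bar> = \<bar>(norm (h t u))\<^sup>2 - 1\<bar> / (u\<^sup>2 * (norm (h t u))\<^sup>2)"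
      by (simp add: abs_divide abs_mult abs_minus_commute)
    also have "\<dots> \<le> (D * u\<^sup>2) / (u\<^sup>2 * c\<^sup>2)"
    proof (rule frac_le)
      show "u\<^sup>2 * c\<^sup>2 \<le> u\<^sup>2 * (norm (h t u))\<^sup>2" using c(1) c(2)[OF u(2), of t] by (intro mult_left_mono power_mono) auto
    qed (use D u c in auto)
    also have "\<dots> = D / c\<^sup>2" using u by simp
    finally show ?thesis .
  qed
  have 2: "\<bar>u\<bar> - r (t + u) t \<le> D * \<bar>u\<bar> ^ 3" for t u
  proof -
    have "1 - norm (h t u) \<le> \<bar>(norm (h t u))\<^sup>2 - 1\<bar>"
    proof (cases "norm (h t u) \<le> 1")
      case True
      then have "norm (h t u) * norm (h t u) \<le> 1 * norm (h t u)" by (intro mult_right_mono) auto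
      then show ?thesis by (simp add: power2_eq_square)
    next
      case False
      then show ?thesis using abs_ge_zero[of "(norm (h t u))\<^sup>2 - 1"] by linarith
    qed
    also have "\<dots> \<le> D * u\<^sup>2" by (rule D)
    finally have "\<bar>u\<bar> * (1 - norm (h t u)) \<le> \<bar>u\<bar> * (D * u\<^sup>2)" by (rule mult_left_mono) simp
    moreover have "\<bar>u\<bar> * (D * u\<^sup>2) = D * \<bar>u\<bar> ^ 3"
    proof -
      have "\<bar>u\<bar> ^ 3 = \<bar>u\<bar> * u\<^sup>2" by (simp add: power3_eq_cube power2_eq_square flip: abs_mult)
      then show ?thesis by simp
    qed
    ultimately have "\<bar>u\<bar> - \<bar>u\<bar> * norm (h t u) \<le> D * \<bar>u\<bar> ^ 3" by (simp only: right_diff_distrib mult_1_right)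
    then show ?thesis by (simp only: r)
  qed
  have m: "D \<le> D + D / c\<^sup>2" "D / c\<^sup>2 \<le> D + D / c\<^sup>2" "0 \<le> D + D / c\<^sup>2" using D by auto
  have "\<bar>u\<bar> - r (t + u) t \<le> (D + D / c\<^sup>2) * \<bar>u\<bar> ^ 3" for t u
    by (rule order_trans[OF 2 mult_right_mono[OF m(1)]]) simp
  moreover have "\<bar>1 / \<rho> (t + u) t - 1 / u\<^sup>2\<bar> \<le> D + D / c\<^sup>2" if "0 < \<bar>u\<bar>" "\<bar>u\<bar> \<le> L / 2" for t u
    using 1[OF that, of t] m by linarith
  ultimately show ?thesis using that m(3) by blast
qed

lemma r_measurable: "(\<lambda>t. r s t) \<in> borel_measurable borel"
  unfolding r_def by measurable

text \<open>The integrand is split into an explicit model with a double pole in the arc length,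
  built from the first-order Taylor polynomial of the density, and an integrable rest. The model is
  integrated in closed form with a symmetric cutoff in arc length. Since the prescribed cutoff is by
  chord, a discrepancy appears on two short intervals and is shown to vanish.\<close>

lemma kernel_S''_finite_part:
  assumes \<sigma>: "\<sigma> \<in> H2 L"
  shows "\<And>\<epsilon>. \<epsilon> > 0 \<Longrightarrow> integrable (lebesgue_on {0..L}) (\<lambda>t. if \<epsilon> < r s t then kernel_S'' k s t * \<sigma> t else 0)"
    "\<exists>C. has_finite_part (\<lambda>\<epsilon>. LINT t|lebesgue_on {0..L}. (if \<epsilon> < r s t then kernel_S'' k s t * \<sigma> t else 0)) C"
proof -
  let ?N = "lebesgue_on {s - L / 2..s - L / 2 + L}"
  interpret finite_measure ?N by (rule finite_measure_Icc)
  obtain p :: complex and C1 where p: "C1 \<ge> 0" "\<And>u. \<bar>u\<bar> \<le> L / 2 \<Longrightarrow> norm (\<sigma> (s + u) - \<sigma> s - u * p) \<le> C1 * (\<bar>u\<bar> * sqrt \<bar>u\<bar>)"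
    using H2_taylor[OF L \<sigma>, of s] by blast
  obtain B where B: "B \<ge> 0" "\<And>t. norm (\<sigma> t) \<le> B" using H2_bounded[OF L \<sigma>] by metis
  obtain D where D: "D \<ge> 0" "\<And>t u. 0 < \<bar>u\<bar> \<Longrightarrow> \<bar>u\<bar> \<le> L / 2 \<Longrightarrow> \<bar>1 / \<rho> (t + u) t - 1 / u\<^sup>2\<bar> \<le> D"
    "\<And>t u. \<bar>u\<bar> - r (t + u) t \<le> D * \<bar>u\<bar> ^ 3" using distance_expansion by metis
  obtain c where c: "c > 0" "\<And>t u. \<bar>u\<bar> \<le> L / 2 \<Longrightarrow> c * \<bar>u\<bar> \<le> r (t + u) t" using r_lower by metis
  obtain CW where CW: "CW \<ge> 0" "\<And>s t. \<gamma> s \<noteq> \<gamma> t \<Longrightarrow> norm (kernel_S'' k s t - 2 * log_coeff k 0 / \<rho> s t) \<le> CW * r s t powr (- 1 / 2)"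
    using OrdE[OF Ord_kernels(4)] by metis
  have per: "\<sigma> (t + L) = \<sigma> t" for t using H2D[OF \<sigma>] by (metis periodic_def)
  have \<sigma>c: "continuous_on UNIV \<sigma>" using H2D[OF \<sigma>] by blast
  have [measurable]: "\<sigma> \<in> borel_measurable borel" by (rule borel_measurable_continuous_onI[OF \<sigma>c])
  have [measurable]: "(\<lambda>t. kernel_S'' k s t) \<in> borel_measurable borel"
  proof -
    have "(\<lambda>t. kernel_S'' k (fst (s, t)) (snd (s, t))) \<in> borel_measurable borel"
      by (rule measurable_compose[OF _ kernels_measurable(3)]) measurable
    then show ?thesis by simp
  qed
  note [measurable] = r_measurable[of s]
  define a0 where "a0 = log_coeff k 0"
  \<comment> \<open>The model integrand: the Taylor polynomial of the density over the squared arc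
    length. By the order of \<open>kernel_S''\<close> its coefficient is
    \<open>2 * a0\<close>.\<close>
  define P where "P = (\<lambda>t. (\<sigma> s + (t - s) * p) / complex_of_real ((t - s)\<^sup>2))"
  define G where "G = (\<lambda>t. kernel_S'' k s t * \<sigma> t - 2 * a0 * P t)"
  have [measurable]: "P \<in> borel_measurable borel" unfolding P_def by measurable
  have [measurable]: "G \<in> borel_measurable borel" unfolding G_def by measurable
  have I: "\<bar>t - s\<bar> \<le> L / 2" if "t \<in> {s - L / 2..s - L / 2 + L}" for t
    using that unfolding atLeastAtMost_iff by linarith
  have Gb: "norm (G t) \<le> 2 * norm a0 * (B * D) + (CW * B + 2 * norm a0 * C1) * r s t powr (- 1 / 2)"
    if t: "t \<in> {s - L / 2..s - L / 2 + L}" and ne: "\<gamma> s \<noteq> \<gamma> t" for t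
  proof -
    define u where "u = t - s"
    have u: "\<bar>u\<bar> \<le> L / 2" "t = s + u" using I[OF t] by (auto simp: u_def)
    have u0: "u \<noteq> 0" using ne u(2) by auto
    have rr: "r s t = r (s + u) s" "\<rho> s t = \<rho> (s + u) s" by (simp_all add: u(2) \<rho>_def r_sym)
    define X where "X = complex_of_real (1 / \<rho> s t)"
    define Y where "Y = complex_of_real (1 / u\<^sup>2)"
    have Pt: "P t = (\<sigma> s + u * p) * Y" by (simp add: P_def u_def Y_def)
    have ut: "\<sigma> (s + u) = \<sigma> t" by (simp add: u_def)
    \<comment> \<open>Three errors: the kernel against its pole, chord against arc length in the
      pole, and the density against its Taylor polynomial.\<close>
    have "G t = (kernel_S'' k s t - 2 * a0 * X) * \<sigma> t + 2 * a0 * (\<sigma> t * (X - Y) + (\<sigma> t - \<sigma> s - u * p) * Y)"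
      unfolding G_def Pt by (simp add: algebra_simps)
    also have "norm \<dots> \<le> norm ((kernel_S'' k s t - 2 * a0 * X) * \<sigma> t) + norm (2 * a0) * (norm (\<sigma> t * (X - Y))
        + norm ((\<sigma> t - \<sigma> s - u * p) * Y))"
      by (rule order_trans[OF norm_triangle_ineq add_left_mono])
         (simp only: norm_mult[of "2 * a0"], intro mult_left_mono norm_triangle_ineq norm_ge_zero)
    also have "\<dots> \<le> (CW * r s t powr (- 1 / 2)) * B + norm (2 * a0) * (B * D + C1 * r s t powr (- 1 / 2))"
    proof (intro add_mono mult_left_mono)
      have "2 * a0 * X = 2 * log_coeff k 0 / \<rho> s t" by (simp add: X_def a0_def)
      then show "norm ((kernel_S'' k s t - 2 * a0 * X) * \<sigma> t) \<le> (CW * r s t powr (- 1 / 2)) * B"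
        using CW(2)[OF ne] CW(1) unfolding norm_mult by (intro mult_mono B) auto
      have "X - Y = complex_of_real (1 / \<rho> s t - 1 / u\<^sup>2)" by (simp add: X_def Y_def)
      moreover have "\<bar>1 / \<rho> s t - 1 / u\<^sup>2\<bar> \<le> D" unfolding rr by (rule D(2)) (use u0 u in auto)
      ultimately have "norm (X - Y) \<le> D" by (simp only: norm_of_real)
      then show "norm (\<sigma> t * (X - Y)) \<le> B * D" unfolding norm_mult by (intro mult_mono B) auto
      have "norm Y = 1 / u\<^sup>2" by (simp only: Y_def norm_of_real abs_divide abs_one abs_power2)
      then have "norm ((\<sigma> t - \<sigma> s - u * p) * Y) \<le> C1 * (\<bar>u\<bar> * sqrt \<bar>u\<bar>) * (1 / u\<^sup>2)"
        unfolding norm_mult using p(2)[OF u(1)] by (intro mult_mono) (auto simp: ut p)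
      also have "\<dots> = C1 * (\<bar>u\<bar> * sqrt \<bar>u\<bar>) / u\<^sup>2" by simp
      also have "\<dots> = C1 * \<bar>u\<bar> powr (- 1 / 2)"
      proof -
        have "sqrt \<bar>u\<bar> * (\<bar>u\<bar> * sqrt \<bar>u\<bar>) = \<bar>u\<bar> * (sqrt \<bar>u\<bar> * sqrt \<bar>u\<bar>)" by (simp only: mult_ac)
        also have "\<dots> = u\<^sup>2" by (simp add: power2_eq_square)
        finally have "sqrt \<bar>u\<bar> * (\<bar>u\<bar> * sqrt \<bar>u\<bar>) = u\<^sup>2" .
        then have "\<bar>u\<bar> * sqrt \<bar>u\<bar> / u\<^sup>2 = 1 / sqrt \<bar>u\<bar>" using u0 by (simp add: field_simps)
        then have "\<bar>u\<bar> * sqrt \<bar>u\<bar> / u\<^sup>2 = \<bar>u\<bar> powr (- (1 / 2))" by (simp add: powr_minus_divide powr_half_sqrt)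
        then show ?thesis by (simp only: times_divide_eq_right[symmetric]) simp
      qed
      \<comment> \<open>The chord is at most the arc length, and the exponent is negative.\<close>
      also have "\<dots> \<le> C1 * r s t powr (- 1 / 2)"
        using r_le[of s u] r_pos[OF ne] p(1) by (intro mult_left_mono powr_mono2') (auto simp: rr)
      finally show "norm ((\<sigma> t - \<sigma> s - u * p) * Y) \<le> C1 * r s t powr (- 1 / 2)" .
    qed simp
    also have "\<dots> = 2 * norm a0 * (B * D) + (CW * B + 2 * norm a0 * C1) * r s t powr (- 1 / 2)"
      by (simp add: norm_mult algebra_simps)
    finally show ?thesis .
  qed
  have ri: "integrable ?N (\<lambda>t. r s t powr (- 1 / 2))" using weakly_singular_integral by metis
  have Gi: "integrable ?N G"
  proof (rule Bochner_Integration.integrable_bound)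
    show "integrable ?N (\<lambda>t. 2 * norm a0 * (B * D) + (CW * B + 2 * norm a0 * C1) * r s t powr (- 1 / 2))"
      using ri by simp
    show "G \<in> borel_measurable ?N" by (rule borel_measurable_lebesgue_on_borel) measurable
    show "AE t in ?N. norm (G t) \<le> norm (2 * norm a0 * (B * D) + (CW * B + 2 * norm a0 * C1) * r s t powr (- 1 / 2))"
      using AE_gamma_ne[of s "s - L / 2" "s - L / 2 + L"] AE_space
    proof eventually_elim
      case (elim t)
      from elim(2) have "t \<in> {s - L / 2..s - L / 2 + L}" by simp
      from order_trans[OF Gb[OF this elim(1)] abs_ge_self] show ?case unfolding real_norm_def .
    qed
  qed
  define Bm where "Bm = norm (\<sigma> s) + L * norm p"
  have Bm: "Bm \<ge> 0" using L by (simp add: Bm_def)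
  have Pb: "norm (P t) \<le> Bm / \<epsilon>\<^sup>2" if t: "t \<in> {s - L / 2..s - L / 2 + L}" "\<epsilon> < \<bar>t - s\<bar>" "\<epsilon> > 0" for t \<epsilon>
  proof -
    have "norm (\<sigma> s + (t - s) * p) \<le> norm (\<sigma> s) + \<bar>t - s\<bar> * norm p"
      by (rule order_trans[OF norm_triangle_ineq]) (simp only: norm_mult norm_of_real)
    also have "\<dots> \<le> Bm" unfolding Bm_def using I[OF t(1)] L by (intro add_left_mono mult_right_mono) auto
    finally have n: "norm (\<sigma> s + (t - s) * p) \<le> Bm" .
    have "\<epsilon>\<^sup>2 \<le> (t - s)\<^sup>2" using t by (simp add: abs_le_square_iff[symmetric])
    then have "norm (\<sigma> s + (t - s) * p) / (t - s)\<^sup>2 \<le> Bm / \<epsilon>\<^sup>2" using n t(3) Bm by (intro frac_le) auto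
    then show ?thesis by (simp only: P_def norm_divide norm_of_real abs_power2)
  qed
  have Pi: "integrable ?N (\<lambda>t. if \<epsilon> < \<bar>t - s\<bar> \<and> Q t then P t else 0)"
    if \<epsilon>: "\<epsilon> > 0" and [measurable]: "Measurable.pred borel Q" for \<epsilon> and Q :: "real \<Rightarrow> bool"
  proof (rule integrable_const_bound)
    show "AE t in ?N. norm (if \<epsilon> < \<bar>t - s\<bar> \<and> Q t then P t else 0) \<le> Bm / \<epsilon>\<^sup>2"
      using Pb \<epsilon> Bm by (intro AE_I2) auto
    show "(\<lambda>t. if \<epsilon> < \<bar>t - s\<bar> \<and> Q t then P t else 0) \<in> borel_measurable ?N"
      by (rule borel_measurable_lebesgue_on_borel) measurable
  qed
  have r_le': "r s t \<le> \<bar>t - s\<bar>" for t using r_le[of s "t - s"] by (simp add: r_sym)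
  \<comment> \<open>The contribution of the points that the arc length cutoff keeps and the chord
    cutoff discards.\<close>
  define Err where "Err = (\<lambda>\<epsilon>. LINT t|?N. (if \<epsilon> < \<bar>t - s\<bar> \<and> r s t \<le> \<epsilon> then P t else 0))"
  \<comment> \<open>On those points the arc length is at most \<open>\<epsilon> / c\<close>, so it
    exceeds \<open>\<epsilon>\<close> by at most \<open>D * (\<epsilon> / c) ^ 3\<close>. The model
    is of size \<open>\<epsilon> ^ (-2)\<close> there, and the product is of first order in
    \<open>\<epsilon>\<close>.\<close>
  define E where "E = D / c ^ 3"
  have E: "E \<ge> 0" using D c by (simp add: E_def)
  have ErrB: "norm (Err \<epsilon>) \<le> 2 * Bm * E * \<epsilon>" if \<epsilon>: "\<epsilon> > 0" for \<epsilon>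
  proof -
    have i: "integrable ?N (\<lambda>t. if \<epsilon> < \<bar>t - s\<bar> \<and> r s t \<le> \<epsilon> then P t else 0)" by (rule Pi[OF \<epsilon>]) measurable
    have ii: "integrable ?N (indicat_real {x..y})" for x y
      by (rule integrable_const_bound[of _ 1], simp, rule borel_measurable_lebesgue_on_borel) simp
    let ?X = "indicat_real {s - \<epsilon> - E * \<epsilon> ^ 3..s - \<epsilon>}" and ?Y = "indicat_real {s + \<epsilon>..s + \<epsilon> + E * \<epsilon> ^ 3}"
    have le: "norm (if \<epsilon> < \<bar>t - s\<bar> \<and> r s t \<le> \<epsilon> then P t else 0) \<le> Bm / \<epsilon>\<^sup>2 * (?X t + ?Y t)"
      if t: "t \<in> {s - L / 2..s - L / 2 + L}" for t
    proof (cases "\<epsilon> < \<bar>t - s\<bar> \<and> r s t \<le> \<epsilon>")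
      case True
      have "c * \<bar>t - s\<bar> \<le> r s t" using c(2)[OF I[OF t], of s] by (simp add: r_sym)
      then have "\<bar>t - s\<bar> \<le> \<epsilon> / c" using True c(1) by (simp add: pos_le_divide_eq mult.commute)
      then have "\<bar>t - s\<bar> ^ 3 \<le> (\<epsilon> / c) ^ 3" by (intro power_mono) auto
      then have "D * \<bar>t - s\<bar> ^ 3 \<le> D * (\<epsilon> / c) ^ 3" using D(1) by (rule mult_left_mono)
      also have "\<dots> = E * \<epsilon> ^ 3" by (simp add: E_def power_divide)
      finally have "D * \<bar>t - s\<bar> ^ 3 \<le> E * \<epsilon> ^ 3" .
      moreover have "\<bar>t - s\<bar> - r s t \<le> D * \<bar>t - s\<bar> ^ 3" using D(3)[of "t - s" s] by (simp add: r_sym)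
      ultimately have "\<bar>t - s\<bar> \<le> \<epsilon> + E * \<epsilon> ^ 3" using True by linarith
      then have "t \<in> {s - \<epsilon> - E * \<epsilon> ^ 3..s - \<epsilon>} \<or> t \<in> {s + \<epsilon>..s + \<epsilon> + E * \<epsilon> ^ 3}"
        using True unfolding atLeastAtMost_iff by linarith
      then have "1 \<le> ?X t + ?Y t" by (auto simp: indicator_def)
      then have "Bm / \<epsilon>\<^sup>2 * 1 \<le> Bm / \<epsilon>\<^sup>2 * (?X t + ?Y t)" using Bm by (intro mult_left_mono) auto
      then show ?thesis using Pb[OF t _ \<epsilon>] True by simp
    next
      case False
      then have "(if \<epsilon> < \<bar>t - s\<bar> \<and> r s t \<le> \<epsilon> then P t else 0) = 0" by (rule if_not_P)
      then show ?thesis using Bm by simp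
    qed
    have "norm (Err \<epsilon>) \<le> (LINT t|?N. norm (if \<epsilon> < \<bar>t - s\<bar> \<and> r s t \<le> \<epsilon> then P t else 0))"
      unfolding Err_def by (rule integral_norm_bound)
    also have "\<dots> \<le> (LINT t|?N. Bm / \<epsilon>\<^sup>2 * (?X t + ?Y t))"
    proof (rule Bochner_Integration.integral_mono)
      show "integrable ?N (\<lambda>t. norm (if \<epsilon> < \<bar>t - s\<bar> \<and> r s t \<le> \<epsilon> then P t else 0))" by (rule integrable_norm[OF i])
      show "integrable ?N (\<lambda>t. Bm / \<epsilon>\<^sup>2 * (?X t + ?Y t))"
        by (intro integrable_mult_right Bochner_Integration.integrable_add ii)
    qed (use le in simp)
    also have "\<dots> = Bm / \<epsilon>\<^sup>2 * ((LINT t|?N. ?X t) + (LINT t|?N. ?Y t))"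
      by (simp only: integral_mult_right_zero Bochner_Integration.integral_add[OF ii ii])
    also have "\<dots> \<le> Bm / \<epsilon>\<^sup>2 * (E * \<epsilon> ^ 3 + E * \<epsilon> ^ 3)"
      using integral_indicator_Icc_le[of "s - \<epsilon> - E * \<epsilon> ^ 3" "s - \<epsilon>" "s - L / 2" "s - L / 2 + L"]
        integral_indicator_Icc_le[of "s + \<epsilon>" "s + \<epsilon> + E * \<epsilon> ^ 3" "s - L / 2" "s - L / 2 + L"] E \<epsilon> Bm
      by (intro mult_left_mono add_mono) auto
    also have "\<dots> = 2 * Bm * E * \<epsilon>" using \<epsilon> by (simp add: power3_eq_cube power2_eq_square)
    finally show ?thesis .
  qed
  have Err0: "(Err \<longlongrightarrow> 0) (at_right 0)"
  proof (rule Lim_null_comparison)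
    show "eventually (\<lambda>\<epsilon>. norm (Err \<epsilon>) \<le> 2 * Bm * E * \<epsilon>) (at_right 0)"
      using eventually_at_right_less[of "0::real"] by eventually_elim (rule ErrB)
    show "((\<lambda>\<epsilon>. 2 * Bm * E * \<epsilon>) \<longlongrightarrow> 0) (at_right 0)"
      by (rule tendsto_eq_intros | simp)+
  qed
  have main: "(LINT t|?N. (if \<epsilon> < \<bar>t - s\<bar> then P t else 0)) = 2 * \<sigma> s / \<epsilon> - 2 * \<sigma> s / complex_of_real (L / 2)"
    if \<epsilon>: "0 < \<epsilon>" "\<epsilon> \<le> L / 2" for \<epsilon>
  proof -
    have i: "integrable ?N (\<lambda>t. if \<epsilon> < \<bar>t - s\<bar> then P t else 0)" using Pi[OF \<epsilon>(1), of "\<lambda>_. True"] by simp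
    have "((\<lambda>t. if \<epsilon> < \<bar>t - s\<bar> then P t else 0) has_integral (2 * \<sigma> s / \<epsilon> - 2 * \<sigma> s / complex_of_real (L / 2))) {s - L / 2..s - L / 2 + L}"
    proof -
      have e: "s - L / 2 + L = s + L / 2" by simp
      show ?thesis unfolding P_def e using principal_integral[of "L / 2" \<epsilon> s "\<sigma> s" p] \<epsilon> L by simp
    qed
    then show ?thesis using lebesgue_integral_eq_integral[OF i] by (simp add: integral_unique)
  qed
  \<comment> \<open>Since the chord never exceeds the arc length, the chord cutoff of
    \<open>P\<close> is the arc length cutoff minus the discrepancy.\<close>
  have dec: "(if \<epsilon> < r s t then kernel_S'' k s t * \<sigma> t else 0) = (if \<epsilon> < r s t then G t else 0)
    + 2 * a0 * ((if \<epsilon> < \<bar>t - s\<bar> then P t else 0) - (if \<epsilon> < \<bar>t - s\<bar> \<and> r s t \<le> \<epsilon> then P t else 0))" for \<epsilon> t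
    using r_le'[of t] by (auto simp: G_def)
  have Gci: "integrable ?N (\<lambda>t. if \<epsilon> < r s t then G t else 0)" for \<epsilon>
  proof (rule Bochner_Integration.integrable_bound[OF Gi])
    show "(\<lambda>t. if \<epsilon> < r s t then G t else 0) \<in> borel_measurable ?N"
      by (rule borel_measurable_lebesgue_on_borel) measurable
  qed auto
  have P1: "integrable ?N (\<lambda>t. if \<epsilon> < \<bar>t - s\<bar> then P t else 0)" "integrable ?N (\<lambda>t. if \<epsilon> < \<bar>t - s\<bar> \<and> r s t \<le> \<epsilon> then P t else 0)"
    if "\<epsilon> > 0" for \<epsilon>
  proof -
    show "integrable ?N (\<lambda>t. if \<epsilon> < \<bar>t - s\<bar> then P t else 0)" using Pi[OF that, of "\<lambda>_. True"] by simp
    show "integrable ?N (\<lambda>t. if \<epsilon> < \<bar>t - s\<bar> \<and> r s t \<le> \<epsilon> then P t else 0)" by (rule Pi[OF that]) measurable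
  qed
  have Ni: "integrable ?N (\<lambda>t. if \<epsilon> < r s t then kernel_S'' k s t * \<sigma> t else 0)" if "\<epsilon> > 0" for \<epsilon>
    unfolding dec using Gci P1[OF that] by (intro Bochner_Integration.integrable_add integrable_mult_right Bochner_Integration.integrable_diff)
  have per': "(if \<epsilon> < r s (t + L) then kernel_S'' k s (t + L) * \<sigma> (t + L) else 0) = (if \<epsilon> < r s t then kernel_S'' k s t * \<sigma> t else 0)" for \<epsilon> t
    by (simp add: per kernel_S''_def r_def \<rho>_def curve_periodic)
  note sh = periodic_integral_shift[where b = 0 and a = "s - L / 2", OF L per' Ni]
  show "integrable (lebesgue_on {0..L}) (\<lambda>t. if \<epsilon> < r s t then kernel_S'' k s t * \<sigma> t else 0)" if "\<epsilon> > 0" for \<epsilon>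
    using sh(1)[OF that] by simp
  define J where "J = (\<lambda>\<epsilon>. LINT t|lebesgue_on {0..L}. (if \<epsilon> < r s t then kernel_S'' k s t * \<sigma> t else 0))"
  define Q where "Q = (LINT t|?N. G t) + 2 * a0 * (- (2 * \<sigma> s / complex_of_real (L / 2)) - 0)"
  have cutG: "((\<lambda>\<epsilon>. LINT t|?N. (if \<epsilon> < r s t then G t else 0)) \<longlongrightarrow> (LINT t|?N. G t)) (at_right 0)"
  proof (rule cutoff_integral_tendsto[OF Gi])
    show "(\<lambda>t. r s t) \<in> borel_measurable ?N" by (rule borel_measurable_lebesgue_on_borel[OF r_measurable])
    show "AE t in ?N. 0 < r s t"
      using AE_gamma_ne[of s "s - L / 2" "s - L / 2 + L"] by eventually_elim (rule r_pos)
  qed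
  have "((\<lambda>\<epsilon>. (LINT t|?N. (if \<epsilon> < r s t then G t else 0)) + 2 * a0 * (- (2 * \<sigma> s / complex_of_real (L / 2)) - Err \<epsilon>)) \<longlongrightarrow> Q) (at_right 0)"
    unfolding Q_def
    by (rule tendsto_add[OF cutG tendsto_mult[OF tendsto_const tendsto_diff[OF tendsto_const Err0]]])
  \<comment> \<open>The only divergent term is \<open>4 * a0 * \<sigma> s / \<epsilon>\<close>; the
    logarithm enters with coefficient \<open>0\<close> because the linear term of the model is odd
    about \<open>s\<close>.\<close>
  moreover have "eventually (\<lambda>\<epsilon>. (LINT t|?N. (if \<epsilon> < r s t then G t else 0)) + 2 * a0 * (- (2 * \<sigma> s / complex_of_real (L / 2)) - Err \<epsilon>)
    = J \<epsilon> - (4 * a0 * \<sigma> s) / of_real \<epsilon> - 0 * of_real (ln \<epsilon>)) (at_right 0)"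
  proof -
    have "eventually (\<lambda>\<epsilon>. \<epsilon> \<in> {0<..<L / 2}) (at_right 0)" by (rule eventually_at_right_real) (use L in simp)
    then show ?thesis
    proof eventually_elim
      case (elim \<epsilon>)
      then have \<epsilon>: "0 < \<epsilon>" "\<epsilon> \<le> L / 2" by auto
      have "J \<epsilon> = (LINT t|?N. (if \<epsilon> < r s t then kernel_S'' k s t * \<sigma> t else 0))"
        unfolding J_def using sh(2)[OF \<epsilon>(1)] by simp
      also have "\<dots> = (LINT t|?N. (if \<epsilon> < r s t then G t else 0)) + 2 * a0 * ((LINT t|?N. (if \<epsilon> < \<bar>t - s\<bar> then P t else 0)) - Err \<epsilon>)"
        unfolding dec Err_def
        by (subst Bochner_Integration.integral_add)
           (use Gci P1[OF \<epsilon>(1)] in \<open>auto intro!: integrable_mult_right Bochner_Integration.integrable_diff simp: Bochner_Integration.integral_diff\<close>)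
      finally show ?case unfolding main[OF \<epsilon>] by (simp add: algebra_simps)
    qed
  qed
  ultimately have "((\<lambda>\<epsilon>. J \<epsilon> - (4 * a0 * \<sigma> s) / of_real \<epsilon> - 0 * of_real (ln \<epsilon>)) \<longlongrightarrow> Q) (at_right 0)"
    by (rule Lim_transform_eventually)
  then have "has_finite_part J Q" unfolding has_finite_part_def by blast
  then show "\<exists>C. has_finite_part (\<lambda>\<epsilon>. LINT t|lebesgue_on {0..L}. (if \<epsilon> < r s t then kernel_S'' k s t * \<sigma> t else 0)) C"
    unfolding J_def by blast
qed

lemma cut_measurable: "{t \<in> {0..L}. \<epsilon> < r s t} \<in> sets lebesgue"
proof -
  have "{t. \<epsilon> < r s t} \<in> sets borel" using r_measurable[of s] by measurable
  then have "{0..L} \<inter> {t. \<epsilon> < r s t} \<in> sets borel" by (intro sets.Int) auto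
  then have "{0..L} \<inter> {t. \<epsilon> < r s t} \<in> sets lebesgue" by (intro sets_completionI_sets) simp
  then show ?thesis by (simp add: Int_def)
qed

text \<open>The kernel of \<open>\<D>'\<close> is \<open>kernel_sum\<close> minus
  \<open>kernel_S''\<close>. The cut integral of the first converges in the ordinary sense and the
  second has a finite part \<open>C\<close>; hence \<open>\<D>'\<close> has a finite part too, and
  \<open>C\<close> cancels in the sum.\<close>

lemma layer_D'_plus_S'':
  assumes k: "k > 0" and \<sigma>: "\<sigma> \<in> H2 L"
  shows "layer_D' \<gamma> L k \<sigma> s + layer_S'' \<gamma> L k \<sigma> s = integral_op L (kernel_sum k) \<sigma> s"
proof -
  let ?M = "lebesgue_on {0..L}"
  define I where "I = (\<lambda>\<epsilon>. LINT t|?M. (if \<epsilon> < r s t then kernel_S'' k s t * \<sigma> t else 0))"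
  define J where "J = (\<lambda>\<epsilon>. LINT t|?M. (if \<epsilon> < r s t then kernel_sum k s t * \<sigma> t else 0))"
  have Ii: "integrable ?M (\<lambda>t. if \<epsilon> < r s t then kernel_S'' k s t * \<sigma> t else 0)" if "\<epsilon> > 0" for \<epsilon>
    using kernel_S''_finite_part(1)[OF \<sigma> that] .
  obtain C where C: "has_finite_part I C" unfolding I_def using kernel_S''_finite_part(2)[OF \<sigma>] by blast
  obtain C1 where K: "bounded_kernel L (kernel_sum k) C1"
    using Ord_bounded_kernel[OF kernels_measurable(4) Ord_kernels(3)] by auto
  have \<sigma>c: "continuous_on {0..L} \<sigma>" using H2D[OF \<sigma>] by blast
  obtain B where "bounded_density L \<sigma> B" using H2_bounded[OF L \<sigma>] continuous_bounded_density[OF \<sigma>c] by metis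
  note Ki = integral_op_integrable[OF K this, of s]
  have rm: "(\<lambda>t. r s t) \<in> borel_measurable ?M" by (rule borel_measurable_lebesgue_on_borel[OF r_measurable])
  have Ji: "integrable ?M (\<lambda>t. if \<epsilon> < r s t then kernel_sum k s t * \<sigma> t else 0)" for \<epsilon>
  proof (rule Bochner_Integration.integrable_bound[OF Ki])
    note [measurable] = rm borel_measurable_integrable[OF Ki]
    show "(\<lambda>t. if \<epsilon> < r s t then kernel_sum k s t * \<sigma> t else 0) \<in> borel_measurable ?M" by measurable
  qed auto
  have J: "(J \<longlongrightarrow> integral_op L (kernel_sum k) \<sigma> s) (at_right 0)"
    unfolding J_def integral_op_def
  proof (rule cutoff_integral_tendsto[OF Ki rm])
    show "AE t in ?M. 0 < r s t" using AE_gamma_ne[of s 0 L] by eventually_elim (rule r_pos)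
  qed
  \<comment> \<open>For \<open>\<epsilon> > 0\<close> the domain of integration avoids the diagonal,
    so the kernel formulas hold at every remaining point.\<close>
  have cut: "(LINT t|lebesgue_on {t \<in> {0..L}. \<epsilon> < dist (\<gamma> s) (\<gamma> t)}. f t) = (LINT t|?M. (if \<epsilon> < r s t then g t else 0))"
    if \<epsilon>: "\<epsilon> > 0" and fg: "\<And>t. \<gamma> s \<noteq> \<gamma> t \<Longrightarrow> f t = g t" for f g :: "real \<Rightarrow> complex" and \<epsilon>
  proof -
    have d: "dist (\<gamma> s) (\<gamma> t) = r s t" for t by (simp add: r_def dist_norm)
    have "(LINT t|lebesgue_on {t \<in> {0..L}. \<epsilon> < r s t}. f t) = (LINT t|?M. (if \<epsilon> < r s t then f t else 0))"
      by (rule integral_lebesgue_on_cut[OF cut_measurable])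
    also have "(\<lambda>t. if \<epsilon> < r s t then f t else 0) = (\<lambda>t. if \<epsilon> < r s t then g t else 0)"
    proof
      fix t
      have "\<gamma> s \<noteq> \<gamma> t" if "\<epsilon> < r s t" using that \<epsilon> by (auto simp: r_def)
      then show "(if \<epsilon> < r s t then f t else 0) = (if \<epsilon> < r s t then g t else 0)" using fg by auto
    qed
    finally show ?thesis by (simp only: d)
  qed
  have the: "finite_part_integral \<gamma> L s f = X"
    if "\<And>\<epsilon>. \<epsilon> > 0 \<Longrightarrow> (LINT t|lebesgue_on {t \<in> {0..L}. \<epsilon> < dist (\<gamma> s) (\<gamma> t)}. f t) = Y \<epsilon>" "has_finite_part Y X" for f X Y
    unfolding finite_part_integral_def
  proof (rule the_equality)
    show "has_finite_part (\<lambda>\<epsilon>. LINT t|lebesgue_on {t \<in> {0..L}. \<epsilon> < dist (\<gamma> s) (\<gamma> t)}. f t) X"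
      using has_finite_part_cong[OF that(1)] that(2) by simp
    then show "Z = X" if "has_finite_part (\<lambda>\<epsilon>. LINT t|lebesgue_on {t \<in> {0..L}. \<epsilon> < dist (\<gamma> s) (\<gamma> t)}. f t) Z" for Z
      using has_finite_part_unique that by blast
  qed
  have S: "layer_S'' \<gamma> L k \<sigma> s = C"
    unfolding layer_S''_def
    by (rule the[OF _ C]) (simp only: I_def, rule cut, simp_all add: layer_kernels(3)[OF k])
  have D: "layer_D' \<gamma> L k \<sigma> s = integral_op L (kernel_sum k) \<sigma> s - C"
    unfolding layer_D'_def
  proof (rule the[OF _ has_finite_part_diff[OF J C]])
    fix \<epsilon> :: real assume \<epsilon>: "\<epsilon> > 0"
    have "(LINT t|lebesgue_on {t \<in> {0..L}. \<epsilon> < dist (\<gamma> s) (\<gamma> t)}.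
        dir_deriv (normal \<gamma> s) (\<lambda>x. dir_deriv (normal \<gamma> t) (\<lambda>y. green k x y) (\<gamma> t)) (\<gamma> s) * \<sigma> t) =
      (LINT t|?M. (if \<epsilon> < r s t then (kernel_sum k s t - kernel_S'' k s t) * \<sigma> t else 0))"
      by (rule cut[OF \<epsilon>]) (simp add: layer_kernels(4)[OF k])
    also have "\<dots> = (LINT t|?M. (if \<epsilon> < r s t then kernel_sum k s t * \<sigma> t else 0) - (if \<epsilon> < r s t then kernel_S'' k s t * \<sigma> t else 0))"
      by (rule Bochner_Integration.integral_cong) (auto simp: left_diff_distrib)
    also have "\<dots> = J \<epsilon> - I \<epsilon>" unfolding I_def J_def by (rule Bochner_Integration.integral_diff[OF Ji Ii[OF \<epsilon>]])
    finally show "(LINT t|lebesgue_on {t \<in> {0..L}. \<epsilon> < dist (\<gamma> s) (\<gamma> t)}.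
        dir_deriv (normal \<gamma> s) (\<lambda>x. dir_deriv (normal \<gamma> t) (\<lambda>y. green k x y) (\<gamma> t)) (\<gamma> s) * \<sigma> t) = J \<epsilon> - I \<epsilon>" .
  qed
  show ?thesis by (simp add: S D)
qed

end

section \<open>Combinations of layer potentials\<close>

lemma has_weak_deriv_combination:
  assumes f: "continuous_on {0..L} f" "has_weak_deriv L m f f'" and g: "continuous_on {0..L} g" "has_weak_deriv L m g g'"
  shows "has_weak_deriv L m (\<lambda>x. a * f x + b * g x) (\<lambda>x. a * f' x + b * g' x)"
    "(LINT t|lebesgue_on {0..L}. (cmod (a * f' t + b * g' t))\<^sup>2) \<le>
      2 * (cmod a)\<^sup>2 * (LINT t|lebesgue_on {0..L}. (cmod (f' t))\<^sup>2) + 2 * (cmod b)\<^sup>2 * (LINT t|lebesgue_on {0..L}. (cmod (g' t))\<^sup>2)"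
proof -
  let ?M = "lebesgue_on {0..L}"
  have sq: "square_integrable L f'" "square_integrable L g'" using f g by (auto simp: has_weak_deriv_def)
  then have [measurable]: "f' \<in> borel_measurable ?M" "g' \<in> borel_measurable ?M"
    and si: "integrable ?M (\<lambda>t. (cmod (f' t))\<^sup>2)" "integrable ?M (\<lambda>t. (cmod (g' t))\<^sup>2)"
    by (auto simp: square_integrable_def)
  have i: "integrable ?M (\<lambda>t. 2 * (cmod a)\<^sup>2 * (cmod (f' t))\<^sup>2 + 2 * (cmod b)\<^sup>2 * (cmod (g' t))\<^sup>2)"
    by (intro Bochner_Integration.integrable_add integrable_mult_right si)
  have le: "(cmod (a * f' t + b * g' t))\<^sup>2 \<le> 2 * (cmod a)\<^sup>2 * (cmod (f' t))\<^sup>2 + 2 * (cmod b)\<^sup>2 * (cmod (g' t))\<^sup>2" for t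
  proof -
    have "(cmod (a * f' t + b * g' t))\<^sup>2 \<le> (cmod (a * f' t) + cmod (b * g' t))\<^sup>2"
      by (rule power_mono[OF norm_triangle_ineq]) simp
    also have "\<dots> \<le> 2 * (cmod (a * f' t))\<^sup>2 + 2 * (cmod (b * g' t))\<^sup>2"
      using zero_le_power2[of "cmod (a * f' t) - cmod (b * g' t)"] unfolding power2_sum power2_diff by linarith
    finally show ?thesis by (simp only: norm_mult power_mult_distrib mult.assoc)
  qed
  have ci: "integrable ?M (\<lambda>t. (cmod (a * f' t + b * g' t))\<^sup>2)"
    by (rule Bochner_Integration.integrable_bound[OF i]) (measurable, rule AE_I2, use le in \<open>simp add: abs_of_nonneg\<close>)
  show "(LINT t|?M. (cmod (a * f' t + b * g' t))\<^sup>2) \<le>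
      2 * (cmod a)\<^sup>2 * (LINT t|?M. (cmod (f' t))\<^sup>2) + 2 * (cmod b)\<^sup>2 * (LINT t|?M. (cmod (g' t))\<^sup>2)"
    using Bochner_Integration.integral_mono[OF ci i le] si by simp
  show "has_weak_deriv L m (\<lambda>x. a * f x + b * g x) (\<lambda>x. a * f' x + b * g' x)"
    unfolding has_weak_deriv_def
  proof (intro conjI allI impI)
    show "square_integrable L (\<lambda>x. a * f' x + b * g' x)"
      using ci by (simp add: square_integrable_def)
    fix \<phi> assume \<phi>: "smooth \<phi> \<and> periodic L \<phi>"
    have sm: "smooth ((vderiv ^^ m) \<phi>)" using \<phi> by (induction m) (auto intro: smooth_vderiv)
    note fi = integrable_mult_smooth[OF continuous_imp_integrable_lebesgue_on[OF f(1)] sm]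
      and gi = integrable_mult_smooth[OF continuous_imp_integrable_lebesgue_on[OF g(1)] sm]
      and fi' = integrable_mult_smooth[OF L2_imp_L1[OF sq(1)] conjunct1[OF \<phi>]]
      and gi' = integrable_mult_smooth[OF L2_imp_L1[OF sq(2)] conjunct1[OF \<phi>]]
    have "(LINT t|?M. (a * f t + b * g t) * (vderiv ^^ m) \<phi> t)
        = a * (LINT t|?M. f t * (vderiv ^^ m) \<phi> t) + b * (LINT t|?M. g t * (vderiv ^^ m) \<phi> t)"
      using fi gi by (simp add: distrib_right mult.assoc)
    also have "\<dots> = a * ((- 1) ^ m * (LINT t|?M. f' t * \<phi> t)) + b * ((- 1) ^ m * (LINT t|?M. g' t * \<phi> t))"
      using f(2) g(2) \<phi> by (simp add: has_weak_deriv_def)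
    also have "\<dots> = (- 1) ^ m * (a * (LINT t|?M. f' t * \<phi> t) + b * (LINT t|?M. g' t * \<phi> t))"
      by (simp add: algebra_simps)
    also have "a * (LINT t|?M. f' t * \<phi> t) + b * (LINT t|?M. g' t * \<phi> t) = (LINT t|?M. (a * f' t + b * g' t) * \<phi> t)"
      using fi' gi' by (simp add: distrib_right mult.assoc)
    finally show "(LINT t|?M. (a * f t + b * g t) * (vderiv ^^ m) \<phi> t) = (- 1) ^ m * (LINT t|?M. (a * f' t + b * g' t) * \<phi> t)" .
  qed
qed

text \<open>The factor \<open>2\<close> replaces the sharp triangle inequality: it follows from
  squaring termwise, without Minkowski, and is good enough for bounding operators.\<close>

lemma H2_combination:
  assumes L: "L > 0" and f: "f \<in> H2 L" and g: "g \<in> H2 L"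
  shows "(\<lambda>x. a * f x + b * g x) \<in> H2 L"
    "H2_norm L (\<lambda>x. a * f x + b * g x) \<le> 2 * (cmod a * H2_norm L f + cmod b * H2_norm L g)"
proof -
  obtain f1 f2 where f': "has_weak_deriv L 1 f f1" "has_weak_deriv L 2 f f2" "continuous_on UNIV f" "periodic L f"
    using H2D[OF f] by metis
  obtain g1 g2 where g': "has_weak_deriv L 1 g g1" "has_weak_deriv L 2 g g2" "continuous_on UNIV g" "periodic L g"
    using H2D[OF g] by metis
  have fc: "continuous_on {0..L} f" and gc: "continuous_on {0..L} g" using f'(3) g'(3) continuous_on_subset by blast+
  let ?c = "\<lambda>f g x. a * f x + b * g x"
  have cc: "continuous_on A (?c f g)" for A
    using f'(3) g'(3) continuous_on_subset by (intro continuous_intros) blast+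
  note w = has_weak_deriv_combination(1)[OF fc _ gc, of _ _ _ a b]
  note w0 = w[OF has_weak_deriv_0[OF fc] has_weak_deriv_0[OF gc]] and w1 = w[OF f'(1) g'(1)] and w2 = w[OF f'(2) g'(2)]
  show "(\<lambda>x. a * f x + b * g x) \<in> H2 L"
    unfolding H2_def
  proof (intro CollectI conjI allI impI)
    show "periodic L (?c f g)" using f'(4) g'(4) by (simp add: periodic_def)
    fix m :: nat assume "m \<le> 2"
    then have "m = 0 \<or> m = 1 \<or> m = 2" by auto
    then show "\<exists>h. has_weak_deriv L m (?c f g) h" using w0 w1 w2 by blast
  qed (rule cc)
  define I where "I = (\<lambda>h :: real \<Rightarrow> complex. LINT t|lebesgue_on {0..L}. (cmod (h t))\<^sup>2)"
  have Inn: "I h \<ge> 0" for h unfolding I_def by (intro Bochner_Integration.integral_nonneg) auto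
  have N: "(H2_norm L f)\<^sup>2 = I f + I f1 + I f2" "(H2_norm L g)\<^sup>2 = I g + I g1 + I g2"
    using H2_norm_eq[OF L fc f'(1,2)] H2_norm_eq[OF L gc g'(1,2)] Inn by (simp_all add: I_def)
  have le: "I (?c F G) \<le> 2 * (cmod a)\<^sup>2 * I F + 2 * (cmod b)\<^sup>2 * I G"
    if "has_weak_deriv L m f F" "has_weak_deriv L m g G" for m F G
    unfolding I_def by (rule has_weak_deriv_combination(2)[OF fc that(1) gc that(2)])
  have nn: "H2_norm L f \<ge> 0" "H2_norm L g \<ge> 0"
    using H2_norm_eq[OF L fc f'(1,2)] H2_norm_eq[OF L gc g'(1,2)] Inn by (simp_all add: I_def)
  have "(H2_norm L (?c f g))\<^sup>2 = I (?c f g) + I (?c f1 g1) + I (?c f2 g2)"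
    using H2_norm_eq[OF L cc w1 w2] Inn by (simp add: I_def)
  also have "\<dots> \<le> (2 * (cmod a)\<^sup>2 * I f + 2 * (cmod b)\<^sup>2 * I g) + (2 * (cmod a)\<^sup>2 * I f1 + 2 * (cmod b)\<^sup>2 * I g1)
      + (2 * (cmod a)\<^sup>2 * I f2 + 2 * (cmod b)\<^sup>2 * I g2)"
    by (intro add_mono le[OF has_weak_deriv_0[OF fc] has_weak_deriv_0[OF gc]] le[OF f'(1) g'(1)] le[OF f'(2) g'(2)])
  also have "\<dots> = 2 * (cmod a * H2_norm L f)\<^sup>2 + 2 * (cmod b * H2_norm L g)\<^sup>2"
    unfolding power_mult_distrib N by (simp add: algebra_simps)
  also have "\<dots> \<le> (2 * (cmod a * H2_norm L f + cmod b * H2_norm L g))\<^sup>2"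
  proof -
    have "0 \<le> cmod a * H2_norm L f" "0 \<le> cmod b * H2_norm L g" using nn by auto
    moreover have "2 * x\<^sup>2 + 2 * y\<^sup>2 \<le> (2 * (x + y))\<^sup>2" if "0 \<le> x" "0 \<le> y" for x y :: real
    proof -
      have "(2 * (x + y))\<^sup>2 - (2 * x\<^sup>2 + 2 * y\<^sup>2) = 2 * x\<^sup>2 + 2 * y\<^sup>2 + 8 * (x * y)"
        by (simp add: power2_eq_square algebra_simps)
      moreover have "0 \<le> 2 * x\<^sup>2 + 2 * y\<^sup>2 + 8 * (x * y)" using that by simp
      ultimately show ?thesis by linarith
    qed
    ultimately show ?thesis by blast
  qed
  finally show "H2_norm L (?c f g) \<le> 2 * (cmod a * H2_norm L f + cmod b * H2_norm L g)"
    by (rule power2_le_imp_le) (use nn in simp)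
qed

lemma bounded_density_combination:
  assumes "bounded_density L f A" "bounded_density L g B"
  shows "bounded_density L (\<lambda>x. a * f x + b * g x) (cmod a * A + cmod b * B)"
  unfolding bounded_density_def
proof (intro conjI ballI)
  note [measurable] = bounded_densityD(1)[OF assms(1)] bounded_densityD(1)[OF assms(2)]
  show "(\<lambda>x. a * f x + b * g x) \<in> borel_measurable (lebesgue_on {0..L})" by measurable
  fix t assume t: "t \<in> {0..L}"
  have "cmod (a * f t + b * g t) \<le> cmod (a * f t) + cmod (b * g t)" by (rule norm_triangle_ineq)
  also have "\<dots> \<le> cmod a * A + cmod b * B"
    unfolding norm_mult by (intro add_mono mult_left_mono bounded_densityD(2)[OF assms(1) t] bounded_densityD(2)[OF assms(2) t]) auto
  finally show "cmod (a * f t + b * g t) \<le> cmod a * A + cmod b * B" .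
qed

lemma integral_op_combination:
  assumes K: "bounded_kernel L K C" and f: "bounded_density L f A" and g: "bounded_density L g B"
  shows "integral_op L K (\<lambda>x. a * f x + b * g x) = (\<lambda>s. a * integral_op L K f s + b * integral_op L K g s)"
proof
  fix s
  have "(\<lambda>t. K s t * (a * f t + b * g t)) = (\<lambda>t. a * (K s t * f t) + b * (K s t * g t))"
    by (simp add: fun_eq_iff algebra_simps)
  then show "integral_op L K (\<lambda>x. a * f x + b * g x) s = a * integral_op L K f s + b * integral_op L K g s"
    using integral_op_integrable[OF K f, of s] integral_op_integrable[OF K g, of s] by (simp add: integral_op_def)
qed

lemma integral_op_mult_kernel: "integral_op L (\<lambda>s t. a s * K s t) f s = a s * integral_op L K f s"
  by (simp add: integral_op_def mult.assoc)

lemma surface_green_kernel: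
  assumes L: "L > 0" and k: "Im k > 0"
  obtains C where "bounded_kernel L (surface_green L k) C"
proof -
  have "continuous_on UNIV (green_profile L k)"
    using green_profile_deriv(1)[OF L k] by (auto intro!: continuous_at_imp_continuous_on has_vector_derivative_continuous)
  from periodic_kernel[OF L this] obtain C
    where "bounded_kernel L (\<lambda>s t. green_profile L k (period_part L (s - t))) C" by blast
  moreover have "surface_green L k = (\<lambda>s t. green_profile L k (period_part L (s - t)))"
    by (intro ext surface_green_eq[OF L k])
  ultimately show ?thesis using that by simp
qed

lemma surface_green_op_eq: "surface_green_op L k = integral_op L (surface_green L k)"
  by (intro ext) (simp add: surface_green_op_def integral_op_def)

lemma H2_bounded_density:
  assumes L: "L > 0" and \<sigma>: "\<sigma> \<in> H2 L"
  obtains B where "bounded_density L \<sigma> B"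
proof -
  obtain B where "\<And>t. norm (\<sigma> t) \<le> B" using H2_bounded[OF L \<sigma>] by metis
  moreover have "continuous_on {0..L} \<sigma>" using H2D[OF \<sigma>] by blast
  ultimately have "bounded_density L \<sigma> B" by (intro continuous_bounded_density) auto
  then show ?thesis by (rule that)
qed

context closed_curve
begin

section \<open>Layer potentials as integral operators, and the compact part\<close>

lemma curvature_bounded:
  "(\<lambda>s. complex_of_real (curvature \<gamma> s)) \<in> borel_measurable borel"
  "\<exists>C. \<forall>s. norm (complex_of_real (curvature \<gamma> s)) \<le> C"
proof -
  have "vderiv (normal \<gamma>) s = - \<i> * \<gamma>d 2 s" for s
    unfolding normal_def[abs_def]
    by (rule fun_cong[OF vderiv_eqI]) (rule has_vector_derivative_mult_right[OF has_vderiv_T])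
  then have eq: "curvature \<gamma> = (\<lambda>s. T s \<bullet> (- \<i> * \<gamma>d 2 s))" by (intro ext) (simp add: curvature_def)
  have "continuous_on UNIV (\<lambda>s. T s \<bullet> (- \<i> * \<gamma>d 2 s))"
    using continuous_d[of UNIV 1] continuous_d[of UNIV 2] by (intro continuous_intros) (simp_all add: \<gamma>d_simps)
  then show "(\<lambda>s. complex_of_real (curvature \<gamma> s)) \<in> borel_measurable borel"
    unfolding eq by (intro borel_measurable_continuous_onI continuous_on_of_real)
  obtain C where C: "\<And>t. norm (\<gamma>d 2 t) \<le> C" using d_bounded[of 2] by metis
  have "norm (complex_of_real (curvature \<gamma> s)) \<le> C" for s
  proof -
    have "\<bar>T s \<bullet> (- \<i> * \<gamma>d 2 s)\<bar> \<le> norm (T s) * norm (- \<i> * \<gamma>d 2 s)" by (rule Cauchy_Schwarz_ineq2)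
    also have "\<dots> = norm (\<gamma>d 2 s)" by (simp add: norm_T norm_mult)
    finally show ?thesis using C[of s] by (simp add: eq)
  qed
  then show "\<exists>C. \<forall>s. norm (complex_of_real (curvature \<gamma> s)) \<le> C" by blast
qed

text \<open>The directional derivatives are known off the diagonal only, so even the measurability
  of \<open>F\<close> has to be derived; integrability is transferred across the null set of
  excluded parameters.\<close>

lemma integral_op_eqI:
  assumes K: "bounded_kernel L K C" and \<sigma>: "bounded_density L \<sigma> B" and eq: "\<And>t. \<gamma> s \<noteq> \<gamma> t \<Longrightarrow> F t = K s t"
  shows "(LINT t|lebesgue_on {0..L}. F t * \<sigma> t) = integral_op L K \<sigma> s"
proof -
  let ?M = "lebesgue_on {0..L}" and ?S = "{t. \<gamma> t = \<gamma> s}"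
  have i: "integrable ?M (\<lambda>t. K s t * \<sigma> t)" by (rule integral_op_integrable[OF K \<sigma>])
  have "(\<lambda>t. F t * \<sigma> t) absolutely_integrable_on {0..L}"
  proof (rule absolutely_integrable_spike[where S = ?S])
    show "(\<lambda>t. K s t * \<sigma> t) absolutely_integrable_on {0..L}" using i by (simp add: integrable_lebesgue_on_iff_absolutely_integrable)
    show "negligible ?S" 
      unfolding negligible_iff_null_sets by (intro null_sets_completionI countable_imp_null_set_lborel countable_gamma)
    fix t assume "t \<in> {0..L} - ?S"
    then have "\<gamma> s \<noteq> \<gamma> t" by auto
    then show "F t * \<sigma> t = K s t * \<sigma> t" by (simp add: eq)
  qed
  then have i': "integrable ?M (\<lambda>t. F t * \<sigma> t)" by (simp add: integrable_lebesgue_on_iff_absolutely_integrable)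
  have ae: "AE t in ?M. F t * \<sigma> t = K s t * \<sigma> t"
    using AE_gamma_ne[of s 0 L] by eventually_elim (simp add: eq)
  show ?thesis
    unfolding integral_op_def
    by (rule integral_cong_AE[OF borel_measurable_integrable[OF i'] borel_measurable_integrable[OF i] ae])
qed

lemma layer_potentials_eq_integral_op:
  assumes k: "k > 0" and \<sigma>: "bounded_density L \<sigma> B"
  shows "layer_S \<gamma> L k \<sigma> = integral_op L (kernel_S k) \<sigma>"
    "layer_S' \<gamma> L k \<sigma> = integral_op L (kernel_S' k) \<sigma>"
    "layer_D \<gamma> L k \<sigma> = integral_op L (kernel_D k) \<sigma>"
proof -
  obtain C0 where K0: "bounded_kernel L (kernel_S k) C0"
    using Ord_bounded_kernel[OF kernels_measurable(1) Ord_kernels(1)] by auto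
  obtain C1 where K1: "bounded_kernel L (kernel_S' k) C1"
    using Ord_bounded_kernel[OF kernels_measurable(2) Ord_kernels(2)] by auto
  obtain C2 where K2: "bounded_kernel L (kernel_D k) C2"
    using Ord_bounded_kernel[OF measurable_kernel_D(1) Ord_kernel_D(1)] by auto
  show "layer_S \<gamma> L k \<sigma> = integral_op L (kernel_S k) \<sigma>"
    unfolding layer_S_def[abs_def] by (intro ext integral_op_eqI[OF K0 \<sigma>] layer_kernels(1)[OF k])
  show "layer_S' \<gamma> L k \<sigma> = integral_op L (kernel_S' k) \<sigma>"
    unfolding layer_S'_def[abs_def] by (intro ext integral_op_eqI[OF K1 \<sigma>] layer_kernels(2)[OF k])
  show "layer_D \<gamma> L k \<sigma> = integral_op L (kernel_D k) \<sigma>"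
    unfolding layer_D_def[abs_def]
    by (intro ext integral_op_eqI[OF K2 \<sigma>]) (simp add: layer_kernels(5)[OF k] kernel_D_eq \<alpha>0_def)
qed

lemma layer_combination_compact:
  fixes a b d k\<Gamma> :: complex and e :: "real \<Rightarrow> complex"
  assumes k: "k > 0" and k\<Gamma>: "Im k\<Gamma> > 0" and e: "e \<in> borel_measurable borel" "\<And>s. norm (e s) \<le> E"
  shows "\<exists>K. compact_operator_on (H2 L) (H2_norm L) K \<and> (\<forall>\<sigma>\<in>H2 L. \<forall>s. K \<sigma> s = a * integral_op L (kernel_D k) \<sigma> s
      + b * surface_green_op L k\<Gamma> (integral_op L (kernel_D k) \<sigma>) s
      + surface_green_op L k\<Gamma> (integral_op L (kernel_sum k) \<sigma>) s
      + d * surface_green_op L k\<Gamma> (integral_op L (kernel_S k) \<sigma>) s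
      + surface_green_op L k\<Gamma> (\<lambda>t. e t * integral_op L (kernel_S' k) \<sigma> t) s)"
proof -
  obtain C0 where K0: "bounded_kernel L (kernel_S k) C0"
    using Ord_bounded_kernel[OF kernels_measurable(1) Ord_kernels(1)] by auto
  obtain C1 where K1': "bounded_kernel L (kernel_S' k) C1"
    using Ord_bounded_kernel[OF kernels_measurable(2) Ord_kernels(2)] by auto
  obtain C2 where K2: "bounded_kernel L (kernel_D k) C2"
    using Ord_bounded_kernel[OF measurable_kernel_D(1) Ord_kernel_D(1)] by auto
  obtain C3 where K3: "bounded_kernel L (kernel_sum k) C3"
    using Ord_bounded_kernel[OF kernels_measurable(4) Ord_kernels(3)] by auto
  obtain CK where KG: "bounded_kernel L (surface_green L k\<Gamma>) CK" using surface_green_kernel[OF L k\<Gamma>] by metis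
  define K1 where "K1 = (\<lambda>s t. e s * kernel_S' k s t)"
  have K1: "bounded_kernel L K1 (E * C1)" unfolding K1_def by (rule bounded_kernel_mult[OF K1' e])
  have eK: "e t * integral_op L (kernel_S' k) \<sigma> t = integral_op L K1 \<sigma> t" for \<sigma> t
    by (simp add: K1_def integral_op_mult_kernel)
  note ib = integral_op_bounded_density[OF L] and comb = bounded_density_combination
  \<comment> \<open>All densities fed to the surface Green's operator are gathered into one, so that
    a single application of its bound suffices. The factors \<open>1\<close> fit the terms to the
    binary combination lemmas.\<close>
  define M where "M = (\<lambda>\<sigma> t. b * integral_op L (kernel_D k) \<sigma> t + 1 * (1 * integral_op L (kernel_sum k) \<sigma> t +
      1 * (d * integral_op L (kernel_S k) \<sigma> t + 1 * integral_op L K1 \<sigma> t)))"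
  define K where "K = (\<lambda>\<sigma> s. a * integral_op L (kernel_D k) \<sigma> s + 1 * surface_green_op L k\<Gamma> (M \<sigma>) s)"
  have K_eq: "K \<sigma> = (\<lambda>s. a * integral_op L (kernel_D k) \<sigma> s + 1 * surface_green_op L k\<Gamma> (M \<sigma>) s)" for \<sigma>
    by (simp only: K_def)
  define CM where "CM = cmod b * C2 + (C3 + (cmod d * C0 + E * C1))"
  have M: "bounded_density L (M \<sigma>) (CM * B)" if "bounded_density L \<sigma> B" for \<sigma> B
  proof -
    note i = ib[OF K2 that] ib[OF K3 that] ib[OF K0 that] ib[OF K1 that]
    have "bounded_density L (M \<sigma>) (cmod b * (C2 * B) + cmod 1 * (cmod 1 * (C3 * B) + cmod 1 * (cmod d * (C0 * B) + cmod 1 * (E * C1 * B))))"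
      unfolding M_def by (rule comb[OF i(1) comb[OF i(2) comb[OF i(3,4)]]])
    then show ?thesis by (simp add: CM_def algebra_simps)
  qed
  have Mlin: "M (\<lambda>x. p * f x + q * g x) = (\<lambda>x. p * M f x + q * M g x)"
    if "bounded_density L f B" "bounded_density L g B'" for f g :: "real \<Rightarrow> complex" and B B' p q
    unfolding M_def integral_op_combination[OF K0 that] integral_op_combination[OF K1 that]
      integral_op_combination[OF K2 that] integral_op_combination[OF K3 that]
    by (simp add: fun_eq_iff algebra_simps)
  obtain CD where CD: "CD \<ge> 0" "\<And>\<sigma> B. bounded_density L \<sigma> B \<Longrightarrow>
      integral_op L (kernel_D k) \<sigma> \<in> H2 L \<and> H2_norm L (integral_op L (kernel_D k) \<sigma>) \<le> CD * B"
    using double_layer_H2[of k] by blast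
  obtain CG where CG: "CG \<ge> 0" "\<And>\<sigma> B. bounded_density L \<sigma> B \<Longrightarrow>
      surface_green_op L k\<Gamma> \<sigma> \<in> H2 L \<and> H2_norm L (surface_green_op L k\<Gamma> \<sigma>) \<le> CG * B"
    using surface_green_H2[OF L k\<Gamma>] by blast
  have "compact_operator_on (H2 L) (H2_norm L) K"
  proof (rule compact_operator_onI[OF L])
    fix f :: "real \<Rightarrow> complex" and B assume f: "continuous_on {0..L} f" and B: "\<And>t. t \<in> {0..L} \<Longrightarrow> norm (f t) \<le> B"
    have fb: "bounded_density L f B" by (rule continuous_bounded_density[OF f B])
    note D = CD(2)[OF fb] and G = CG(2)[OF M[OF fb]]
    have "H2_norm L (K f) \<le> 2 * (cmod a * H2_norm L (integral_op L (kernel_D k) f) + cmod 1 * H2_norm L (surface_green_op L k\<Gamma> (M f)))"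
      unfolding K_eq by (rule H2_combination(2)[OF L]) (use D G in auto)
    also have "\<dots> \<le> 2 * (cmod a * (CD * B) + cmod 1 * (CG * (CM * B)))"
      by (intro mult_left_mono add_mono) (use D G in auto)
    also have "\<dots> = (2 * (cmod a * CD + CG * CM)) * B" by (simp add: algebra_simps)
    finally show "K f \<in> H2 L \<and> H2_norm L (K f) \<le> (2 * (cmod a * CD + CG * CM)) * B"
      using H2_combination(1)[OF L, of "integral_op L (kernel_D k) f" "surface_green_op L k\<Gamma> (M f)" a 1] D G
      unfolding K_eq by blast
  next
    fix f g :: "real \<Rightarrow> complex" and p q assume f: "continuous_on {0..L} f" and g: "continuous_on {0..L} g"
    obtain A where A: "bounded_density L f A"
      using continuous_bounded_Icc[OF f] continuous_bounded_density[OF f] by metis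
    obtain B where B: "bounded_density L g B"
      using continuous_bounded_Icc[OF g] continuous_bounded_density[OF g] by metis
    show "K (\<lambda>x. p * f x + q * g x) = (\<lambda>x. p * K f x + q * K g x)"
      unfolding K_eq Mlin[OF A B] surface_green_op_eq integral_op_combination[OF K2 A B] integral_op_combination[OF KG M[OF A] M[OF B]]
      by (simp add: fun_eq_iff algebra_simps)
  qed
  moreover have "K \<sigma> s = a * integral_op L (kernel_D k) \<sigma> s
      + b * surface_green_op L k\<Gamma> (integral_op L (kernel_D k) \<sigma>) s
      + surface_green_op L k\<Gamma> (integral_op L (kernel_sum k) \<sigma>) s
      + d * surface_green_op L k\<Gamma> (integral_op L (kernel_S k) \<sigma>) s
      + surface_green_op L k\<Gamma> (\<lambda>t. e t * integral_op L (kernel_S' k) \<sigma> t) s" if \<sigma>H: "\<sigma> \<in> H2 L" for \<sigma> s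
  proof -
    obtain B where \<sigma>: "bounded_density L \<sigma> B" using H2_bounded_density[OF L \<sigma>H] by metis
    note i = ib[OF K2 \<sigma>] ib[OF K3 \<sigma>] ib[OF K0 \<sigma>] ib[OF K1 \<sigma>]
    have "surface_green_op L k\<Gamma> (M \<sigma>) s = b * integral_op L (surface_green L k\<Gamma>) (integral_op L (kernel_D k) \<sigma>) s
      + 1 * (1 * integral_op L (surface_green L k\<Gamma>) (integral_op L (kernel_sum k) \<sigma>) s
      + 1 * (d * integral_op L (surface_green L k\<Gamma>) (integral_op L (kernel_S k) \<sigma>) s
      + 1 * integral_op L (surface_green L k\<Gamma>) (integral_op L K1 \<sigma>) s))"
      unfolding M_def surface_green_op_eq
        integral_op_combination[OF KG i(1) comb[OF i(2) comb[OF i(3,4)]]]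
        integral_op_combination[OF KG i(2) comb[OF i(3,4)]] integral_op_combination[OF KG i(3,4)] ..
    then show ?thesis unfolding K_eq eK surface_green_op_eq by (simp add: add.assoc)
  qed
  ultimately show ?thesis by blast
qed

end

theorem mainTheorem4:
  fixes \<gamma> :: "real \<Rightarrow> complex" and L k :: real and c\<^sub>1 c\<^sub>2 k\<Gamma> :: complex
  assumes "smooth_closed_curve \<gamma> L"
    and "k > 0"
    and "c\<^sub>1 \<noteq> 0"
    and "k\<Gamma>\<^sup>2 = (1 + c\<^sub>1 * c\<^sub>2) / c\<^sub>1\<^sup>2" and "Im k\<Gamma> > 0"
  shows "fredholm_second_kind_on (H2 L) (H2_norm L) (\<lambda>\<sigma> s.
      - c\<^sub>1 / 2 * \<sigma> s
      + c\<^sub>1 * layer_D \<gamma> L k \<sigma> s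
      - 1 / c\<^sub>1 * surface_green_op L k\<Gamma> (layer_D \<gamma> L k \<sigma>) s
      + surface_green_op L k\<Gamma> (\<lambda>t. layer_D' \<gamma> L k \<sigma> t + layer_S'' \<gamma> L k \<sigma> t) s
      + ((of_real k)\<^sup>2 - c\<^sub>2 / c\<^sub>1) * surface_green_op L k\<Gamma> (layer_S \<gamma> L k \<sigma>) s
      + surface_green_op L k\<Gamma>
          (\<lambda>t. (of_real (curvature \<gamma> t) - 1 / c\<^sub>1) * layer_S' \<gamma> L k \<sigma> t) s)"
proof -
  interpret closed_curve \<gamma> L by unfold_locales (rule assms)
  define e where "e = (\<lambda>t. complex_of_real (curvature \<gamma> t) - 1 / c\<^sub>1)"
  note [measurable] = curvature_bounded(1)
  obtain C where C: "\<And>s. norm (complex_of_real (curvature \<gamma> s)) \<le> C" using curvature_bounded(2) by blast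
  have e: "e \<in> borel_measurable borel" "\<And>s. norm (e s) \<le> C + norm (1 / c\<^sub>1)"
  proof -
    show "e \<in> borel_measurable borel" unfolding e_def by measurable
    show "norm (e s) \<le> C + norm (1 / c\<^sub>1)" for s
      unfolding e_def by (rule order_trans[OF norm_triangle_ineq4 add_right_mono[OF C]])
  qed
  obtain K where K: "compact_operator_on (H2 L) (H2_norm L) K"
    and K_eq: "\<And>\<sigma> s. \<sigma> \<in> H2 L \<Longrightarrow> K \<sigma> s = c\<^sub>1 * integral_op L (kernel_D k) \<sigma> s
      + (- 1 / c\<^sub>1) * surface_green_op L k\<Gamma> (integral_op L (kernel_D k) \<sigma>) s
      + surface_green_op L k\<Gamma> (integral_op L (kernel_sum k) \<sigma>) s
      + ((of_real k)\<^sup>2 - c\<^sub>2 / c\<^sub>1) * surface_green_op L k\<Gamma> (integral_op L (kernel_S k) \<sigma>) s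
      + surface_green_op L k\<Gamma> (\<lambda>t. e t * integral_op L (kernel_S' k) \<sigma> t) s"
    using layer_combination_compact[OF assms(2,5) e, of c\<^sub>1 "- 1 / c\<^sub>1" "(of_real k)\<^sup>2 - c\<^sub>2 / c\<^sub>1"] by blast
  show ?thesis
    unfolding fredholm_second_kind_on_def
  \<comment> \<open>The scalar is the coefficient of the identity. The equation for \<open>K\<close>
    is demanded on \<open>H2\<close> only, which is where the finite parts have been
    evaluated.\<close>
  proof (intro exI[of _ "- c\<^sub>1 / 2"] exI[of _ K] conjI ballI ext K)
    show "- c\<^sub>1 / 2 \<noteq> 0" using assms(3) by simp
    fix \<sigma> s assume \<sigma>: "\<sigma> \<in> H2 L"
    obtain B where "bounded_density L \<sigma> B" using H2_bounded_density[OF L \<sigma>] by metis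
    note eqs = layer_potentials_eq_integral_op[OF assms(2) this] layer_D'_plus_S''[OF assms(2) \<sigma>]
    have op: "(\<lambda>t. integral_op L (kernel_sum k) \<sigma> t) = integral_op L (kernel_sum k) \<sigma>" ..
    show "- c\<^sub>1 / 2 * \<sigma> s
      + c\<^sub>1 * layer_D \<gamma> L k \<sigma> s
      - 1 / c\<^sub>1 * surface_green_op L k\<Gamma> (layer_D \<gamma> L k \<sigma>) s
      + surface_green_op L k\<Gamma> (\<lambda>t. layer_D' \<gamma> L k \<sigma> t + layer_S'' \<gamma> L k \<sigma> t) s
      + ((of_real k)\<^sup>2 - c\<^sub>2 / c\<^sub>1) * surface_green_op L k\<Gamma> (layer_S \<gamma> L k \<sigma>) s
      + surface_green_op L k\<Gamma>
          (\<lambda>t. (of_real (curvature \<gamma> t) - 1 / c\<^sub>1) * layer_S' \<gamma> L k \<sigma> t) s = - c\<^sub>1 / 2 * \<sigma> s + K \<sigma> s"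
      unfolding eqs K_eq[OF \<sigma>] e_def by simp
  qed
qed

end
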